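(* Let $\delta\ge 1$ be an integer, $0<\lambda\le 1$, $\mathfrak p,\mathfrak q,\mathfrak r\ge1$, $q\ge 2$ a prime power, and $\boldsymbol\gamma=(\gamma_v)_{v\subset\mathbb N}$ an indexed set of non-negative real numbers. There is a constant $C_{\delta,s,q,\boldsymbol\gamma}>0$ (depending only on $\delta,s,q,\boldsymbol\gamma$ and the fixed bijection $\varphi$) such that for any function $f:[0,1)^s\to\mathbb R$ whose partial mixed derivatives up to order $\delta$ in each variable exist and are continuous, and any digital $(t,\delta+1,\beta,n\times m,s)$-net $\{\boldsymbol x_0,\dots,\boldsymbol x_{q^m-1}\}$ over $\mathbb F_q$ with $0<\beta\le1$, the quantities $I_s(f)=\int_{[0,1]^s}f(\boldsymbol x)\,d\boldsymbol x$ and $Q_{q^m,s}(f)=q^{-m}\sum_{h=0}^{q^m-1}f(\boldsymbol x_h)$ satisfy (the bounds being vacuous if $N_{\delta,\lambda,\boldsymbol\gamma}(f)=\infty$): for $0<\lambda<1$, $$|I_s(f)-Q_{q^m,s}(f)|\le q^{-(\delta+\lambda)\lfloor(\beta n-t)/(\delta+1)\rfloor}\,C_{\delta,s,q,\boldsymbol\gamma}\,N_{\delta,\lambda,\boldsymbol\gamma}(f)\sum_{\emptyset\ne u\subseteq\{1,\dots,s\}}\gamma_u\,C_{|u|,q,\delta+\lambda}\,(\beta n-t+\delta+1)^{|u|(\delta+1)-1},$$ and for $\lambda=1$, $$|I_s(f)-Q_{q^m,s}(f)|\le q^{-(\beta n-t)}\,C_{\delta,s,q,\boldsymbol\gamma}\,N_{\delta,\lambda,\boldsymbol\gamma}(f)\sum_{\emptyset\ne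 u\subseteq\{1,\dots,s\}}\gamma_u\,C'_{|u|,q,\delta+1}\,(\beta n-t+\delta+1)^{|u|(\delta+1)},$$ where $C_{|u|,q,\delta+\lambda}=q^{|u|(\delta+1)}\left((q-q^{\lambda})^{-1}+(1-q^{(1-\delta-\lambda)/(\delta+1)})^{-|u|(\delta+1)}\right)$ and $C'_{|u|,q,\delta+1}=q^{|u|(\delta+1)}\left(q^{-1}+(1-q^{1/(\delta+1)-1})^{-|u|(\delta+1)}\right)$.
   Context: $\mathbb N=\{1,2,\dots\}$, $\mathcal S=\{1,\dots,s\}$. $\mathbb F_q$ is the field with $q$ elements and $\varphi:\{0,\dots,q-1\}\to\mathbb F_q$ a fixed bijection with $\varphi(0)=0$. Digital nets. Let $C_1,\dots,C_s\in\mathbb F_q^{n\times m}$. For $0\le h<q^m$ with $h=h_0+\cdots+h_{m-1}q^{m-1}$ in base $q$ let $\vec h=(\varphi(h_0),\dots,\varphi(h_{m-1}))^\top$, $C_j\vec h=(y_{j,1}(h),\dots,y_{j,n}(h))^\top$, $x_{h,j}=\sum_{i=1}^n\varphi^{-1}(y_{j,i}(h))q^{-i}$ and $\boldsymbol x_h=(x_{h,1},\dots,x_{h,s})$. The point set $\{\boldsymbol x_0,\dots,\boldsymbol x_{q^m-1}\}$ is the digital net with generating matrices $C_1,\dots,C_s$. Let $\alpha\ge1$ be an integer, $0<\beta\le\alpha m/n$ real and $0\le t\le\beta n$ an integer, and let $c_{j,i}$ be the $i$-th row of $C_j$. The net is a digital $(t,\alpha,\beta,n\times m,s)$-net over $\mathbb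 F_q$ if for all $1\le i_{j,\nu_j}<\cdots<i_{j,1}\le n$, $0\le\nu_j\le m$, $j=1,\dots,s$, with $\sum_{j=1}^s\sum_{l=1}^{\min(\nu_j,\alpha)}i_{j,l}\le\beta n-t$, the vectors $c_{1,i_{1,\nu_1}},\dots,c_{1,i_{1,1}},\dots,c_{s,i_{s,\nu_s}},\dots,c_{s,i_{s,1}}$ are linearly independent over $\mathbb F_q$. Variation. For a function $g:[0,1)^d\to\mathbb R$ and a box $J=\prod_{j=1}^d[x_j,y_j)$, $x_j<y_j$, with all vertices in $[0,1)^d$, let $\Delta(g,J)=\sum_{v\subseteq\{1,\dots,d\}}(-1)^{|v|}g(\boldsymbol z_v)$, where $\boldsymbol z_v$ has $j$-th coordinate $y_j$ if $j\in v$ and $x_j$ otherwise. The generalized Vitali variation is $$V^{(d)}_{\lambda,\mathfrak p}(g)=\sup_{\mathcal P}\left(\sum_{J\in\mathcal P}\mathrm{Vol}(J)\left|\frac{\Delta(g,J)}{\mathrm{Vol}(J)^\lambda}\right|^{\mathfrak p}\right)^{1/\mathfrak p},$$ the supremum being over all finite partitions $\mathcal P$ of $[0,1)^d$ into subintervals (boxes), where boxes having a vertex outside $[0,1)^d$ are omitted from the sum. For a function $g$ of variables indexed by a finite set $u$ and $w\subseteq u$, let $g_w$ be the function of $\boldsymbol x_w=(x_j)_{j\in w}$ obtained by integrating $g$ over $[0,1)$ in all variables $x_j$, $j\in u\setminus w$ (existence of these integrals is part of the requirement that the variation be finite); let $V^{(|w|)}_{\lambda,\mathfrak p}(g_w;w)$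 be its generalized Vitali variation if $w\ne\emptyset$, and $|g_\emptyset|$ if $w=\emptyset$. The generalized Hardy and Krause variation (all weights $1$) is $V^{(|u|)}_{\lambda,\mathfrak p,\mathfrak q,\boldsymbol 1}(g)=\left(\sum_{w\subseteq u}V^{(|w|)}_{\lambda,\mathfrak p}(g_w;w)^{\mathfrak q}\right)^{1/\mathfrak q}$. The functional $N$. For $\boldsymbol\tau\in\{0,\dots,\delta\}^s$ let $f^{(\boldsymbol\tau)}=\frac{\partial^{\tau_1+\cdots+\tau_s}f}{\partial x_1^{\tau_1}\cdots\partial x_s^{\tau_s}}$ (one-sided at $0$), $u(\boldsymbol\tau)=\{j:\tau_j=\delta\}$, $v(\boldsymbol\tau)=\{j:\tau_j>0\}$. Then $$N_{\delta,\lambda,\boldsymbol\gamma}(f)=\left(\sum_{\boldsymbol\tau\in\{0,\dots,\delta\}^s}\gamma_{v(\boldsymbol\tau)}^{-1}\left[V^{(|u(\boldsymbol\tau)|)}_{\lambda,\mathfrak p,\mathfrak q,\boldsymbol 1}\bigl(f^{(\boldsymbol\tau)}(\cdot,\boldsymbol 0_{\mathcal S\setminus u(\boldsymbol\tau)})\bigr)\right]^{\mathfrak r}\right)^{1/\mathfrak r},$$ where $f^{(\boldsymbol\tau)}(\cdot,\boldsymbol 0_{\mathcal S\setminus u(\boldsymbol\tau)})$ is the function of the variables $x_j$, $j\in u(\boldsymbol\tau)$, with all other variables set to $0$, and for $u(\boldsymbol\tau)=\emptyset$ the bracket is $|f^{(\boldsymbol\tau)}(\boldsymbol 0)|$. If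 $\gamma_{v(\boldsymbol\tau)}=0$ the bracket is assumed to be $0$ and $0/0:=0$ (so $N=\infty$ otherwise). *)

theory Defs
  imports "HOL-Analysis.Analysis" "Jordan_Normal_Form.VS_Connect"
begin

text \<open>
  A function of variables \<open>x\<^sub>j\<close>, \<open>j \<in> u\<close>, for a finite \<open>u\<close>, is represented by a map
  \<open>g :: (nat \<Rightarrow> real) \<Rightarrow> real\<close> of which only the values on \<open>cube u\<close> matter.
  For \<open>u = {}\<close> the cube consists of the single point \<open>\<lambda>_. undefined\<close>.
\<close>

definition cube :: "nat set \<Rightarrow> (nat \<Rightarrow> real) set" where
  "cube u = (\<Pi>\<^sub>E j\<in>u. {0..<1})"

abbreviation lebesgue_on_vars :: "nat set \<Rightarrow> (nat \<Rightarrow> real) measure" where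
  "lebesgue_on_vars u \<equiv> \<Pi>\<^sub>M j\<in>u. lborel"


section \<open>Digital nets\<close>

text \<open>
  The finite field is the type \<open>'a\<close>, so \<open>q = CARD('a)\<close>. Matrix and vector entries are indexed
  from \<open>0\<close>, hence the shifts by one below.
\<close>

definition digit_vec :: "(nat \<Rightarrow> 'a::{field,finite}) \<Rightarrow> nat \<Rightarrow> nat \<Rightarrow> 'a vec" where
  "digit_vec \<phi> m h = Matrix.vec m (\<lambda>k. \<phi> (h div CARD('a) ^ k mod CARD('a)))"

definition net_point ::
    "(nat \<Rightarrow> 'a::{field,finite}) \<Rightarrow> nat \<Rightarrow> nat \<Rightarrow> nat \<Rightarrow> (nat \<Rightarrow> 'a mat) \<Rightarrow> nat \<Rightarrow> nat \<Rightarrow> real" where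
  "net_point \<phi> n m s C h = (\<lambda>j\<in>{1..s}.
     \<Sum>i=1..n. real (inv_into {0..<CARD('a)} \<phi> (vec_index (C j *\<^sub>v digit_vec \<phi> m h) (i - 1)))
               / real CARD('a) ^ i)"

text \<open>
  Linear independence is that of a family: repeated vectors make the family dependent.
\<close>

definition lin_indpt_family :: "nat \<Rightarrow> 'i set \<Rightarrow> ('i \<Rightarrow> 'a::field vec) \<Rightarrow> bool" where
  "lin_indpt_family m I c \<longleftrightarrow>
     inj_on c I \<and> \<not> LinearCombinations.module.lin_dep class_ring (module_vec TYPE('a) m) (c ` I)"

definition digital_net ::
    "nat \<Rightarrow> nat \<Rightarrow> real \<Rightarrow> nat \<Rightarrow> nat \<Rightarrow> nat \<Rightarrow> (nat \<Rightarrow> 'a::{field,finite} mat) \<Rightarrow> bool" where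
  "digital_net t \<alpha> \<beta> n m s C \<longleftrightarrow>
     1 \<le> \<alpha> \<and> 1 \<le> n \<and> 1 \<le> m \<and> 1 \<le> s \<and>
     0 < \<beta> \<and> \<beta> \<le> real \<alpha> * real m / real n \<and> real t \<le> \<beta> * real n \<and>
     (\<forall>j\<in>{1..s}. C j \<in> carrier_mat n m) \<and>
     (\<forall>(\<nu> :: nat \<Rightarrow> nat) (i :: nat \<Rightarrow> nat \<Rightarrow> nat).
        (\<forall>j\<in>{1..s}. \<nu> j \<le> m \<and>
           (\<forall>l\<in>{1..\<nu> j}. 1 \<le> i j l \<and> i j l \<le> n) \<and>
           (\<forall>l\<in>{1..<\<nu> j}. i j (Suc l) < i j l)) \<and>
        real (\<Sum>j=1..s. \<Sum>l=1..min (\<nu> j) \<alpha>. i j l) \<le> \<beta> * real n - real t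
        \<longrightarrow> lin_indpt_family m (SIGMA j:{1..s}. {1..\<nu> j}) (\<lambda>(j, l). row (C j) (i j l - 1)))"


section \<open>Generalized variation\<close>

text \<open>
  A box \<open>\<Prod>\<^sub>j [x\<^sub>j, y\<^sub>j)\<close> is represented by the pair \<open>(x, y)\<close> of its extreme corners.
\<close>

definition box_set :: "nat set \<Rightarrow> (nat \<Rightarrow> real) \<times> (nat \<Rightarrow> real) \<Rightarrow> (nat \<Rightarrow> real) set" where
  "box_set u = (\<lambda>(x, y). \<Pi>\<^sub>E j\<in>u. {x j..<y j})"

definition vertex :: "nat set \<Rightarrow> (nat \<Rightarrow> real) \<times> (nat \<Rightarrow> real) \<Rightarrow> nat set \<Rightarrow> nat \<Rightarrow> real" where
  "vertex u = (\<lambda>(x, y) v. \<lambda>j\<in>u. if j \<in> v then y j else x j)"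

definition box_vol :: "nat set \<Rightarrow> (nat \<Rightarrow> real) \<times> (nat \<Rightarrow> real) \<Rightarrow> real" where
  "box_vol u = (\<lambda>(x, y). \<Prod>j\<in>u. y j - x j)"

definition box_diff ::
    "nat set \<Rightarrow> ((nat \<Rightarrow> real) \<Rightarrow> real) \<Rightarrow> (nat \<Rightarrow> real) \<times> (nat \<Rightarrow> real) \<Rightarrow> real" where
  "box_diff u g J = (\<Sum>v\<in>Pow u. (-1) ^ card v * g (vertex u J v))"

definition box_partition :: "nat set \<Rightarrow> ((nat \<Rightarrow> real) \<times> (nat \<Rightarrow> real)) set \<Rightarrow> bool" where
  "box_partition u P \<longleftrightarrow>
     finite P \<and> (\<forall>(x, y)\<in>P. \<forall>j\<in>u. x j < y j) \<and>
     disjoint_family_on (box_set u) P \<and> (\<Union>J\<in>P. box_set u J) = cube u"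

definition vitali_variation ::
    "real \<Rightarrow> real \<Rightarrow> nat set \<Rightarrow> ((nat \<Rightarrow> real) \<Rightarrow> real) \<Rightarrow> ennreal" where
  "vitali_variation lam p u g =
     (SUP P\<in>{P. box_partition u P}.
        ennreal ((\<Sum>J\<in>{J\<in>P. \<forall>v\<in>Pow u. vertex u J v \<in> cube u}.
                    box_vol u J * \<bar>box_diff u g J / box_vol u J powr lam\<bar> powr p) powr (1 / p)))"

text \<open>The map \<open>x \<mapsto> x\<^sup>a\<close> on \<open>[0, \<infinity>]\<close>, for exponents \<open>a > 0\<close> only.\<close>

definition ennpowr :: "ennreal \<Rightarrow> real \<Rightarrow> ennreal" where
  "ennpowr x a = (if x = \<infinity> then \<infinity> else ennreal (enn2real x powr a))"

text \<open>The function \<open>g\<^sub>w\<close>, and the existence of the integrals defining it.\<close>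

definition marginal ::
    "nat set \<Rightarrow> nat set \<Rightarrow> ((nat \<Rightarrow> real) \<Rightarrow> real) \<Rightarrow> (nat \<Rightarrow> real) \<Rightarrow> real" where
  "marginal u w g x = (LINT y:cube (u - w)|lebesgue_on_vars (u - w). g (merge w (u - w) (x, y)))"

definition marginal_exists :: "nat set \<Rightarrow> nat set \<Rightarrow> ((nat \<Rightarrow> real) \<Rightarrow> real) \<Rightarrow> bool" where
  "marginal_exists u w g \<longleftrightarrow>
     (\<forall>x\<in>cube w. set_integrable (lebesgue_on_vars (u - w)) (cube (u - w))
                    (\<lambda>y. g (merge w (u - w) (x, y))))"

text \<open>
  A missing integral makes the variation infinite. For \<open>u = {}\<close> the only term is
  \<open>w = {}\<close>, and the variation is the absolute value of \<open>g\<close> at the only point of \<open>cube {}\<close>.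
\<close>

definition hk_variation ::
    "real \<Rightarrow> real \<Rightarrow> real \<Rightarrow> nat set \<Rightarrow> ((nat \<Rightarrow> real) \<Rightarrow> real) \<Rightarrow> ennreal" where
  "hk_variation lam p q u g =
     ennpowr (\<Sum>w\<in>Pow u. ennpowr
        (if \<not> marginal_exists u w g then \<infinity>
         else if w = {} then ennreal \<bar>marginal u {} g (\<lambda>_. undefined)\<bar>
         else vitali_variation lam p w (marginal u w g)) q) (1 / q)"


section \<open>Mixed partial derivatives and the functional \<open>N\<close>\<close>

text \<open>
  Differentiation within \<open>[0, 1)\<close> is one-sided at \<open>0\<close> and two-sided elsewhere.
\<close>

definition partial_deriv ::
    "nat \<Rightarrow> ((nat \<Rightarrow> real) \<Rightarrow> real) \<Rightarrow> (nat \<Rightarrow> real) \<Rightarrow> real" where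
  "partial_deriv j f x = vector_derivative (\<lambda>z. f (x(j := z))) (at (x j) within {0..<1})"

text \<open>
  All partial derivatives obtained by differentiating, in any order, at most \<open>\<delta>\<close> times with respect
  to each of the variables \<open>x\<^sub>1, \<dots>, x\<^sub>s\<close> exist and are continuous on the cube.
\<close>

definition smooth_mixed :: "nat \<Rightarrow> nat \<Rightarrow> ((nat \<Rightarrow> real) \<Rightarrow> real) \<Rightarrow> bool" where
  "smooth_mixed \<delta> s f \<longleftrightarrow>
     (\<forall>js. set js \<subseteq> {1..s} \<and> (\<forall>j. count_list js j \<le> \<delta>) \<longrightarrow>
        continuous_on (cube {1..s}) (foldr partial_deriv js f) \<and>
        (\<forall>j\<in>{1..s}. count_list js j < \<delta> \<longrightarrow>
           (\<forall>x\<in>cube {1..s}. (\<lambda>z. foldr partial_deriv js f (x(j := z)))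
                                differentiable (at (x j) within {0..<1}))))"

text \<open>\<open>\<partial>\<^sub>1\<close> is applied last; the order is immaterial for functions satisfying \<open>smooth_mixed\<close>.\<close>

definition mixed_deriv ::
    "nat \<Rightarrow> (nat \<Rightarrow> nat) \<Rightarrow> ((nat \<Rightarrow> real) \<Rightarrow> real) \<Rightarrow> (nat \<Rightarrow> real) \<Rightarrow> real" where
  "mixed_deriv s \<tau> = foldr (\<lambda>j. partial_deriv j ^^ \<tau> j) [1..<Suc s]"

definition anchored ::
    "nat \<Rightarrow> nat set \<Rightarrow> ((nat \<Rightarrow> real) \<Rightarrow> real) \<Rightarrow> (nat \<Rightarrow> real) \<Rightarrow> real" where
  "anchored s u g x = g (\<lambda>j\<in>{1..s}. if j \<in> u then x j else 0)"

text \<open>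
  In \<^typ>\<open>ennreal\<close> one has \<open>0 / 0 = 0\<close> and \<open>x / 0 = \<infinity>\<close> for \<open>x > 0\<close>, which is the convention
  for vanishing weights.
\<close>

definition N_functional ::
    "nat \<Rightarrow> real \<Rightarrow> real \<Rightarrow> real \<Rightarrow> real \<Rightarrow> (nat set \<Rightarrow> real) \<Rightarrow> nat
       \<Rightarrow> ((nat \<Rightarrow> real) \<Rightarrow> real) \<Rightarrow> ennreal" where
  "N_functional \<delta> lam p q r \<gamma> s f =
     ennpowr (\<Sum>\<tau>\<in>({1..s} \<rightarrow>\<^sub>E {0..\<delta>}).
        let u = {j\<in>{1..s}. \<tau> j = \<delta>}; v = {j\<in>{1..s}. \<tau> j > 0}
        in ennpowr (hk_variation lam p q u (anchored s u (mixed_deriv s \<tau> f))) r / ennreal (\<gamma> v))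
     (1 / r)"


section \<open>Integral, quadrature rule and the explicit constants\<close>

text \<open>Integration over \<open>[0,1)\<^sup>s\<close>, which differs from \<open>[0,1]\<^sup>s\<close> by a null set.\<close>

definition I_int :: "nat \<Rightarrow> ((nat \<Rightarrow> real) \<Rightarrow> real) \<Rightarrow> real" where
  "I_int s f = (LINT x:cube {1..s}|lebesgue_on_vars {1..s}. f x)"

definition Q_qmc ::
    "(nat \<Rightarrow> 'a::{field,finite}) \<Rightarrow> nat \<Rightarrow> nat \<Rightarrow> nat \<Rightarrow> (nat \<Rightarrow> 'a mat)
       \<Rightarrow> ((nat \<Rightarrow> real) \<Rightarrow> real) \<Rightarrow> real" where
  "Q_qmc \<phi> n m s C f =
     (\<Sum>h<CARD('a) ^ m. f (net_point \<phi> n m s C h)) / real CARD('a) ^ m"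

definition const_lt1 :: "nat \<Rightarrow> nat \<Rightarrow> nat \<Rightarrow> real \<Rightarrow> real" where
  "const_lt1 d q \<delta> lam = real q ^ (d * (\<delta> + 1)) *
     (1 / (real q - real q powr lam)
      + 1 / (1 - real q powr ((1 - real \<delta> - lam) / (real \<delta> + 1))) ^ (d * (\<delta> + 1)))"

definition const_eq1 :: "nat \<Rightarrow> nat \<Rightarrow> nat \<Rightarrow> real" where
  "const_eq1 d q \<delta> = real q ^ (d * (\<delta> + 1)) *
     (1 / real q + 1 / (1 - real q powr (1 / (real \<delta> + 1) - 1)) ^ (d * (\<delta> + 1)))"

end

theory Submission
  imports Defs "HOL-Probability.Probability"
begin

text \<open>
  Fix a nontrivial additive character of the field. Averaging a finite Walsh expansion over the net
  kills every character outside the dual net, so the quadrature error is at most the sum of the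
  absolute Walsh coefficients over the nonzero dual elements.

  A Walsh coefficient is estimated by inserting the Taylor expansion of \<open>f\<close> anchored at \<open>0\<close>. Let
  \<open>a\<^sub>1 > a\<^sub>2 > \<dots>\<close> be the positions of the nonzero digits in one coordinate. Integrating the Walsh
  function \<open>\<delta>\<close> times gains a factor of order \<open>q\<^sup>-\<^sup>a\<close> for each of \<open>a\<^sub>1, \<dots>, a\<^sub>\<delta>\<close> and leaves a kernel
  with mean zero on the cells of level \<open>a\<^sub>\<delta>\<^sub>+\<^sub>1 - 1\<close>, against which the variation with exponent
  \<open>\<lambda>\<close> of the derivative gains the further factor \<open>q\<close> to the power \<open>-\<lambda> a\<^sub>\<delta>\<^sub>+\<^sub>1\<close>. As the \<open>a\<^sub>l\<close> decrease,
  the product is at most a constant times \<open>q\<close> to the power \<open>-\<theta> (a\<^sub>1 + \<dots> + a\<^sub>\<delta>\<^sub>+\<^sub>1)\<close> with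
  \<open>\<theta> = (\<delta> + \<lambda>) / (\<delta> + 1)\<close>.

  With \<open>T = \<beta> n - t\<close>, the independence of the rows forces the sum of all leading positions of a nonzero
  dual element to be at least \<open>T - (\<delta> + 1)\<^sup>2\<close>, and it bounds the number of dual elements with prescribed
  leading digits. The remaining sum over the leading positions is geometric.
\<close>

section \<open>Additive characters of a finite field\<close>

text \<open>The integrand is only continuous on the half-open cube and may be unbounded near its
  upper faces, so neither its integrability nor the convergence of its Walsh series is available at
  the outset. Integrability is recovered from the Taylor terms, and all Walsh expansions are
  truncated at a level \<open>N\<close>, with error bounds uniform in \<open>N\<close>.

  The anchoring at 0 is what produces the weights. A Taylor term with \<open>\<tau> j = 0\<close>
  integrates to zero against a Walsh function that is nontrivial in coordinate j, so a dual element
  that is nonzero exactly in the coordinates v meets only weights of sets containing v.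

  The constant must be the same for all \<open>lam\<close> and all three exponents. This is why
  crude bounds such as 4^(1 - lam) \<le> 4 and g^(1/r) \<le> 1 + g occur. A single estimate, with
  decay q^(-\<theta> T) and geometric ratio \<rho> = q^(1/(\<delta>+1) - \<theta>), covers
  \<open>lam < 1\<close> and \<open>lam = 1\<close> together; the two cases differ only in how it is
  weakened at the end.\<close>

lemma exists_maximal_additive_subgroup:
  "\<exists>H :: 'a::{field,finite} set. 0 \<in> H \<and> (\<forall>x\<in>H. \<forall>y\<in>H. x - y \<in> H) \<and> H \<noteq> UNIV \<and>
     (\<forall>H'. 0 \<in> H' \<and> (\<forall>x\<in>H'. \<forall>y\<in>H'. x - y \<in> H') \<and> H \<subset> H' \<longrightarrow> H' = UNIV)"
proof -
  define F where "F = {H :: 'a set. 0 \<in> H \<and> (\<forall>x\<in>H. \<forall>y\<in>H. x - y \<in> H) \<and> H \<noteq> UNIV}"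
  have "(1 :: 'a) \<notin> {0}" by simp
  then have "{0 :: 'a} \<noteq> UNIV" by (metis UNIV_I)
  then have "{0} \<in> F" unfolding F_def by simp
  moreover have "finite F" by simp
  ultimately obtain H where "H \<in> F" and H: "\<forall>H'\<in>F. H \<subseteq> H' \<longrightarrow> H = H'"
    using finite_has_maximal2[of F "{0}"] by meson
  moreover have "H' = UNIV" if "0 \<in> H'" "\<forall>x\<in>H'. \<forall>y\<in>H'. x - y \<in> H'" "H \<subset> H'" for H'
  proof (rule ccontr)
    assume "H' \<noteq> UNIV"
    with that have "H' \<in> F" unfolding F_def by blast
    with H that(3) show False by blast
  qed
  ultimately show ?thesis unfolding F_def by (intro exI[of _ H]) auto
qed

text \<open>
  A maximal proper additive subgroup \<open>H\<close> has prime index \<open>p\<close>, the characteristic, so every \<open>x\<close> lies in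
  \<open>c g + H\<close> for a fixed \<open>g \<notin> H\<close> and some \<open>c\<close> unique modulo \<open>p\<close>; the character is \<open>x \<mapsto> exp (2 \<pi> i c / p)\<close>.
\<close>

lemma exists_additive_character:
  "\<exists>\<psi> :: 'a::{field,finite} \<Rightarrow> complex.
     (\<forall>x y. \<psi> (x + y) = \<psi> x * \<psi> y) \<and> (\<forall>x. cmod (\<psi> x) = 1) \<and> (\<exists>x. \<psi> x \<noteq> 1)"
proof -
  obtain H :: "'a set" where H0: "0 \<in> H" and Hd: "\<And>x y. x \<in> H \<Longrightarrow> y \<in> H \<Longrightarrow> x - y \<in> H"
    and HU: "H \<noteq> UNIV"
    and Hmax: "\<And>H'. 0 \<in> H' \<Longrightarrow> (\<And>x y. x \<in> H' \<Longrightarrow> y \<in> H' \<Longrightarrow> x - y \<in> H') \<Longrightarrow> H \<subset> H' \<Longrightarrow> H' = UNIV"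
    using exists_maximal_additive_subgroup[where 'a='a] by metis
  have Hm: "- x \<in> H" if "x \<in> H" for x using Hd[OF H0 that] by simp
  have Ha: "x + y \<in> H" if "x \<in> H" "y \<in> H" for x y using Hd[OF that(1) Hm[OF that(2)]] by simp
  have Hnat: "of_nat n * x \<in> H" if "x \<in> H" for n x
    by (induction n) (auto simp: H0 algebra_simps intro: Ha that)
  have Hint: "of_int n * x \<in> H" if "x \<in> H" for n x
    by (cases n rule: int_cases2) (auto intro: Hnat Hm that)
  obtain g where g: "g \<notin> H" using HU by blast
  let ?p = "int (CHAR('a))"
  have p: "prime CHAR('a)" using finite_imp_CHAR_pos[where 'a='a] by (intro prime_CHAR_semidom) auto
  \<comment> \<open>The multiples of \<open>g\<close> meet \<open>H\<close> exactly in the multiples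
    of p: for n prime to p, a Bezout combination of n and p would put \<open>g\<close> itself into
    \<open>H\<close>, since p annihilates the field.\<close>
  have dvd0: "of_int n * g \<in> H \<longleftrightarrow> ?p dvd n" for n
  proof
    assume n: "of_int n * g \<in> H"
    show "?p dvd n"
    proof (rule ccontr)
      assume "\<not> ?p dvd n"
      then have "coprime n ?p" using p by (metis coprime_commute prime_imp_coprime prime_nat_int_transfer)
      then obtain c d where cd: "c * n + d * ?p = 1" using bezout_int[of n ?p] by (auto simp: coprime_iff_gcd_eq_1)
      then have "of_int (c * n + d * ?p) = (1 :: 'a)" by (simp only: of_int_1)
      then have "of_int c * of_int n = (1 :: 'a)" by simp
      then have "of_int c * (of_int n * g) = g" by (simp only: mult.assoc[symmetric] mult_1)
      then show False using Hint[OF n, of c] g by (simp only:)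
    qed
  next
    assume "?p dvd n"
    then obtain d where "n = ?p * d" by (elim dvdE)
    then show "of_int n * g \<in> H" using H0 by simp
  qed
  \<comment> \<open>The subgroup H + Zg. It is strictly larger than \<open>H\<close>, so by
    maximality every x has an integer coefficient \<open>c x\<close>.\<close>
  let ?H' = "{x. \<exists>i::int. x - of_int i * g \<in> H}"
  have "?H' = UNIV"
  proof (rule Hmax)
    show "0 \<in> ?H'" using H0 by (auto intro!: exI[of _ 0])
    show "x - y \<in> ?H'" if "x \<in> ?H'" "y \<in> ?H'" for x y
    proof -
      from that obtain i j where "x - of_int i * g \<in> H" "y - of_int j * g \<in> H" by blast
      from Hd[OF this] have "x - y - of_int (i - j) * g \<in> H" by (simp add: algebra_simps)
      then show ?thesis by blast
    qed
    have "H \<subseteq> ?H'" by (auto intro!: exI[of _ 0])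
    moreover have "g \<in> ?H'" using H0 by (auto intro!: exI[of _ 1])
    ultimately show "H \<subset> ?H'" using g by blast
  qed
  then have "\<forall>x. \<exists>i::int. x - of_int i * g \<in> H" by blast
  then obtain c where c: "\<And>x. x - of_int (c x) * g \<in> H" by metis
  define \<psi> :: "'a \<Rightarrow> complex" where "\<psi> x = cis (2 * pi * of_int (c x) / of_int ?p)" for x
  \<comment> \<open>Coefficients are determined only modulo p, which is all that the exponential
    sees.\<close>
  have cis_eq: "cis (2 * pi * of_int i / of_int ?p) = cis (2 * pi * of_int j / of_int ?p)"
    if "?p dvd i - j" for i j :: int
  proof -
    from that obtain d where "i - j = ?p * d" by (elim dvdE)
    then have d: "i = j + ?p * d" by linarith
    have "2 * pi * of_int i / of_int ?p = 2 * pi * of_int j / of_int ?p + 2 * pi * of_int d"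
      using prime_gt_0_nat[OF p] by (simp add: d field_simps)
    then show ?thesis using cis_multiple_2pi[of "of_int d"] by (simp add: cis_mult[symmetric])
  qed
  have "\<psi> (x + y) = \<psi> x * \<psi> y" for x y
  proof -
    have "x + y - of_int (c (x + y)) * g - (x - of_int (c x) * g + (y - of_int (c y) * g)) \<in> H"
      using Hd[OF c[of "x + y"] Ha[OF c[of x] c[of y]]] .
    then have "of_int (c x + c y - c (x + y)) * g \<in> H" by (simp add: algebra_simps)
    then have "?p dvd c x + c y - c (x + y)" using dvd0 by blast
    then have "?p dvd c (x + y) - (c x + c y)" by (simp add: dvd_diff_commute)
    from cis_eq[OF this] show ?thesis unfolding \<psi>_def by (simp add: cis_mult add_divide_distrib distrib_left)
  qed
  moreover have "cmod (\<psi> x) = 1" for x unfolding \<psi>_def by simp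
  moreover have "\<psi> g \<noteq> 1"
  proof
    assume "\<psi> g = 1"
    then have "cos (2 * pi * of_int (c g) / of_int ?p) = 1" unfolding \<psi>_def by (simp add: complex_eq_iff)
    then obtain k :: int where "2 * pi * of_int (c g) / of_int ?p = of_int k * 2 * pi" using cos_one_2pi_int by blast
    then have "(of_int (c g)::real) = of_int (k * ?p)" using prime_gt_0_nat[OF p] by (simp add: field_simps)
    then have "c g = k * ?p" using of_int_eq_iff by blast
    \<comment> \<open>The coefficient of \<open>g\<close> itself is 1 modulo p, whereas
      \<open>\<psi> g = 1\<close> would make it 0 modulo p.\<close>
    moreover have "?p dvd 1 - c g"
    proof -
      have "of_int (1 - c g) * g \<in> H" using c[of g] by (simp add: algebra_simps)
      then show ?thesis using dvd0 by blast
    qed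
    ultimately have "?p dvd (1 - c g) + c g" by (intro dvd_add) auto
    then show False using p by (auto dest: prime_gt_1_nat)
  qed
  ultimately show ?thesis by blast
qed

locale additive_character =
  fixes \<psi> :: "'a::{field,finite} \<Rightarrow> complex"
  assumes add: "\<psi> (x + y) = \<psi> x * \<psi> y" and norm_eq_1: "cmod (\<psi> x) = 1" and nontrivial: "\<exists>x. \<psi> x \<noteq> 1"
begin

lemma zero [simp]: "\<psi> 0 = 1"
  using add[of 0 0] norm_eq_1[of 0] by force

lemma sum: "\<psi> (\<Sum>i\<in>I. f i) = (\<Prod>i\<in>I. \<psi> (f i))"
  by (induction I rule: infinite_finite_induct) (auto simp: add)

text \<open>Translating the summation variable by some y with \<open>\<psi> y \<noteq> 1\<close>
  multiplies the sum by \<open>\<psi> y\<close>.\<close>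

lemma sum_eq_0: "(\<Sum>x\<in>UNIV. \<psi> x) = 0"
proof -
  obtain y where y: "\<psi> y \<noteq> 1" using nontrivial by blast
  have "(\<Sum>x\<in>UNIV. \<psi> x) = (\<Sum>x\<in>UNIV. \<psi> (y + x))"
    by (rule sum.reindex_bij_witness[of _ "\<lambda>x. y + x" "\<lambda>x. x - y"]) auto
  also have "\<dots> = \<psi> y * (\<Sum>x\<in>UNIV. \<psi> x)" by (simp add: add sum_distrib_left)
  finally have "(\<Sum>x\<in>UNIV. \<psi> x) = \<psi> y * (\<Sum>x\<in>UNIV. \<psi> x)" .
  then show ?thesis using y by simp
qed

text \<open>For nonzero e, multiplication by e permutes the field.\<close>

lemma sum_mult: "(\<Sum>x\<in>UNIV. \<psi> (x * e)) = (if e = 0 then of_nat CARD('a) else 0)"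
proof (cases "e = 0")
  case False
  have "(\<Sum>x\<in>UNIV. \<psi> (x * e)) = (\<Sum>x\<in>UNIV. \<psi> x)"
    by (rule sum.reindex_bij_witness[of _ "\<lambda>x. x / e" "\<lambda>x. x * e"]) (use False in auto)
  then show ?thesis using False by (simp add: sum_eq_0)
qed auto

text \<open>The sum factors over the coordinates. This orthogonality is used twice: over the points
  of the net it detects dual elements, and over the frequencies it produces indicators of
  cells.\<close>

lemma sum_PiE: "finite I \<Longrightarrow> (\<Sum>x\<in>I \<rightarrow>\<^sub>E UNIV. \<psi> (\<Sum>i\<in>I. x i * e i)) =
   (if \<forall>i\<in>I. e i = 0 then of_nat CARD('a) ^ card I else 0)"
proof -
  assume I: "finite I"
  have "(\<Sum>x\<in>I \<rightarrow>\<^sub>E UNIV. \<psi> (\<Sum>i\<in>I. x i * e i)) = (\<Sum>x\<in>I \<rightarrow>\<^sub>E UNIV. \<Prod>i\<in>I. \<psi> (x i * e i))"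
    by (simp add: sum)
  also have "\<dots> = (\<Prod>i\<in>I. \<Sum>x\<in>UNIV. \<psi> (x * e i))"
    by (rule prod_sum_PiE[symmetric]) (use I in auto)
  finally show ?thesis using I by (auto simp: sum_mult)
qed

end

section \<open>Digits and Walsh functions\<close>

text \<open>The space is exactly [0,1), so products of this measure live on \<open>cube\<close> and
  integrals need no indicator of the domain. As it is a probability measure, a bound for the
  integrand is a bound for the integral.\<close>

definition unit_lborel :: "real measure" where
  "unit_lborel = restrict_space lborel {0..<1}"

lemma space_unit_lborel [simp]: "space unit_lborel = {0..<1}"
  by (simp add: unit_lborel_def space_restrict_space)

lemma borel_measurable_unit_lborel: "f \<in> borel_measurable borel \<Longrightarrow> f \<in> borel_measurable unit_lborel"
  unfolding unit_lborel_def by (rule measurable_restrict_space1) simp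

lemma prob_space_unit_lborel: "prob_space unit_lborel"
  by (rule prob_spaceI) (simp add: unit_lborel_def emeasure_restrict_space space_restrict_space)

interpretation unit_lborel: prob_space unit_lborel
  by (rule prob_space_unit_lborel)

lemma integral_unit_lborel:
  fixes f :: "real \<Rightarrow> 'b::{banach,second_countable_topology}"
  shows "integral\<^sup>L unit_lborel f = (\<integral>x. indicator {0..<1} x *\<^sub>R f x \<partial>lborel)"
  unfolding unit_lborel_def by (subst integral_restrict_space) auto

lemma integrable_unit_lborel_bounded:
  fixes f :: "real \<Rightarrow> 'b::{banach,second_countable_topology}"
  assumes "f \<in> borel_measurable unit_lborel" "\<And>x. 0 \<le> x \<Longrightarrow> x < 1 \<Longrightarrow> norm (f x) \<le> B"
  shows "integrable unit_lborel f"
  by (rule unit_lborel.integrable_const_bound[of _ B]) (use assms in auto)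

lemma norm_integral_unit_lborel_le:
  fixes f :: "real \<Rightarrow> 'b::{banach,second_countable_topology}"
  assumes "f \<in> borel_measurable unit_lborel" "\<And>x. 0 \<le> x \<Longrightarrow> x < 1 \<Longrightarrow> norm (f x) \<le> B"
  shows "norm (integral\<^sup>L unit_lborel f) \<le> B"
proof -
  have "norm (integral\<^sup>L unit_lborel f) \<le> (\<integral>x. norm (f x) \<partial>unit_lborel)"
    by (rule integral_norm_bound)
  also have "\<dots> \<le> (\<integral>x. B \<partial>unit_lborel)"
    by (rule integral_mono)
      (use assms in \<open>auto intro!: integrable_unit_lborel_bounded[where B = B]\<close>)
  finally show ?thesis using unit_lborel.prob_space by simp
qed

section \<open>Base-q digits and the cells on which they are constant\<close>

definition digit :: "nat \<Rightarrow> nat \<Rightarrow> real \<Rightarrow> nat" where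
  "digit q i x = nat (\<lfloor>real q ^ i * x\<rfloor> mod int q)"

lemma digit_measurable [measurable]: "digit q i \<in> borel \<rightarrow>\<^sub>M count_space UNIV"
  unfolding digit_def by measurable

lemma digit_less: "0 < q \<Longrightarrow> digit q i x < q"
  unfolding digit_def by (simp add: nat_less_iff)

text \<open>Dropping the last p - i digits from the number of the level-p cell of x leaves the
  number of its level-i cell.\<close>

lemma floor_mult_power_div:
  assumes "0 < q" "i \<le> p"
  shows "\<lfloor>real q ^ i * x\<rfloor> = \<lfloor>real q ^ p * x\<rfloor> div int q ^ (p - i)"
proof -
  have "real q ^ p * x / real_of_int (int q ^ (p - i)) = real q ^ i * x"
    using assms by (simp add: field_simps flip: power_add)
  then show ?thesis using floor_divide_real_eq_div[of "int q ^ (p - i)" "real q ^ p * x"] assms by simp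
qed

lemma digit_cong_cell:
  assumes "0 < q" "i \<le> p" "\<lfloor>real q ^ p * x\<rfloor> = \<lfloor>real q ^ p * y\<rfloor>"
  shows "digit q i x = digit q i y"
  using assms floor_mult_power_div[of q i p] unfolding digit_def by simp

text \<open>For i > p the shift changes \<open>q ^ i * x\<close> by an integer multiple of q, which
  the digit discards.\<close>

lemma digit_shift:
  assumes "0 < q" "p < i"
  shows "digit q i (x + of_int c / real q ^ p) = digit q i x"
proof -
  have "real q ^ i / real q ^ p = real q ^ (i - p)"
    using assms by (simp add: power_diff)
  \<comment> \<open>One factor q is split off; it is what makes the change vanish modulo q.\<close>
  also have "i - p = Suc (i - p - 1)" using assms by simp
  finally have *: "real q ^ i / real q ^ p = of_int (int q * int q ^ (i - p - 1))" by simp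
  have "real q ^ i * (x + of_int c / real q ^ p) = real q ^ i * x + real q ^ i / real q ^ p * of_int c"
    by (simp add: algebra_simps)
  then have "real q ^ i * (x + of_int c / real q ^ p) = real q ^ i * x + of_int (int q * int q ^ (i - p - 1) * c)"
    unfolding * by simp
  then have "\<lfloor>real q ^ i * (x + of_int c / real q ^ p)\<rfloor> = \<lfloor>real q ^ i * x\<rfloor> + int q * (int q ^ (i - p - 1) * c)"
    by (simp only: mult.assoc floor_add_int)
  then show ?thesis unfolding digit_def by simp
qed

lemma mem_cell_iff:
  assumes "0 < (L::real)"
  shows "x \<in> {of_int c / L..<(of_int c + 1) / L} \<longleftrightarrow> \<lfloor>L * x\<rfloor> = c"
  using assms by (simp add: floor_eq_iff field_simps)

section \<open>Periodic functions and their integrals over cells\<close>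

text \<open>Periodicity is required on the whole line, where the digits are defined too, so
  translating a cell never meets a boundary case.\<close>

definition periodic :: "real \<Rightarrow> (real \<Rightarrow> 'b) \<Rightarrow> bool" where
  "periodic h G \<longleftrightarrow> (\<forall>x. G (x + h) = G x)"

lemma periodic_int_mult:
  assumes "periodic h G"
  shows "G (x + of_int c * h) = G x"
proof (cases c rule: int_cases2)
  case (nonneg n)
  have "G (x + real n * h) = G x"
  proof (induction n)
    case (Suc n)
    have "G (x + real n * h + h) = G (x + real n * h)" using assms unfolding periodic_def by blast
    then show ?case using Suc by (simp add: algebra_simps)
  qed simp
  then show ?thesis using nonneg by simp
next
  case (nonpos n)
  have "G (x - real n * h) = G x"
  proof (induction n)
    case (Suc n)
    have "G (x - real (Suc n) * h + h) = G (x - real (Suc n) * h)" using assms unfolding periodic_def by blast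
    then show ?case using Suc by (simp add: algebra_simps)
  qed simp
  then show ?thesis using nonpos by simp
qed

lemma periodic_power:
  assumes "periodic (1 / real q ^ p) G" "a \<le> p" "0 < q"
  shows "periodic (1 / real q ^ a) G"
  unfolding periodic_def
proof
  fix x
  have "x + of_int (int q ^ (p - a)) * (1 / real q ^ p) = x + 1 / real q ^ a"
    using assms by (simp add: field_simps flip: power_add)
  then show "G (x + 1 / real q ^ a) = G x" using periodic_int_mult[OF assms(1), of x "int q ^ (p - a)"] by simp
qed

lemma integral_periodic_cell:
  fixes G :: "real \<Rightarrow> complex"
  assumes "periodic (1 / L) G"
  shows "(\<integral>x. indicator {of_int c / L..<(of_int c + 1) / L} x *\<^sub>R G x \<partial>lborel) = (\<integral>x. indicator {0..<1 / L} x *\<^sub>R G x \<partial>lborel)"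
proof -
  have "(\<integral>x. indicator {of_int c / L..<(of_int c + 1) / L} x *\<^sub>R G x \<partial>lborel) =
    (\<integral>x. indicator {of_int c / L..<(of_int c + 1) / L} (of_int c / L + 1 * x) *\<^sub>R G (of_int c / L + 1 * x) \<partial>lborel)"
    by (subst lborel_integral_real_affine[of 1 _ "of_int c / L"]) simp_all
  also have "\<dots> = (\<integral>x. indicator {0..<1 / L} x *\<^sub>R G x \<partial>lborel)"
    using periodic_int_mult[OF assms, of _ c]
    by (intro Bochner_Integration.integral_cong) (auto simp: indicator_def add_divide_distrib add.commute)
  finally show ?thesis .
qed

lemma integrable_indicator_Ico:
  fixes G :: "real \<Rightarrow> 'b::{banach,second_countable_topology}"
  assumes "G \<in> borel_measurable borel" "\<And>x. norm (G x) \<le> B"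
  shows "integrable lborel (\<lambda>x. indicator {a..<b} x *\<^sub>R G x)"
proof (rule integrableI_bounded_set_indicator[where B = B])
  show "emeasure lborel {a..<b} < \<infinity>" by (rule emeasure_bounded_finite) simp
qed (use assms in auto)

lemma norm_integral_indicator_Ico_le:
  fixes G :: "real \<Rightarrow> 'b::{banach,second_countable_topology}"
  assumes "G \<in> borel_measurable borel" "\<And>x. norm (G x) \<le> B" "a \<le> b"
  shows "norm (\<integral>x. indicator {a..<b} x *\<^sub>R G x \<partial>lborel) \<le> B * (b - a)"
proof -
  have "norm (\<integral>x. indicator {a..<b} x *\<^sub>R G x \<partial>lborel) \<le> (\<integral>x. norm (indicator {a..<b} x *\<^sub>R G x) \<partial>lborel)"
    by (rule integral_norm_bound)
  also have "\<dots> \<le> (\<integral>x. indicator {a..<b} x *\<^sub>R B \<partial>lborel)"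
  proof (rule integral_mono)
    show "integrable lborel (\<lambda>x. norm (indicator {a..<b} x *\<^sub>R G x))"
      by (intro integrable_norm integrable_indicator_Ico[OF assms(1,2)])
    show "integrable lborel (\<lambda>x. indicator {a..<b} x *\<^sub>R B)"
      by (rule integrable_indicator_Ico[where B = "\<bar>B\<bar>"]) auto
  qed (use assms(2) in \<open>auto simp: indicator_def\<close>)
  also have "\<dots> = B * (b - a)" using assms(3) by simp
  finally show ?thesis .
qed

text \<open>A cell of level a - 1 consists of q cells of level a, one for each value of the digit at
  a. By periodicity \<open>G\<close> has the same integral over each of them, so the weights enter
  only through their sum.\<close>

lemma integral_cell_digit_eq_0:
  fixes G :: "real \<Rightarrow> complex" and w :: "nat \<Rightarrow> complex"
  assumes [measurable]: "G \<in> borel_measurable borel" and B: "\<And>x. norm (G x) \<le> B"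
    and per: "periodic (1 / real q ^ a) G" and q: "0 < q" and a: "1 \<le> a" and w: "(\<Sum>d<q. w d) = 0"
  shows "(\<integral>x. indicator {of_int c / real q ^ (a - 1)..<(of_int c + 1) / real q ^ (a - 1)} x *\<^sub>R (G x * w (digit q a x)) \<partial>lborel) = 0"
proof -
  let ?I = "\<lambda>d::nat. {of_int (c * int q + int d) / real q ^ a..<(of_int (c * int q + int d) + 1) / real q ^ a}"
  have "indicator {of_int c / real q ^ (a - 1)..<(of_int c + 1) / real q ^ (a - 1)} x *\<^sub>R (G x * w (digit q a x)) =
     (\<Sum>d<q. w d * (indicator (?I d) x *\<^sub>R G x))" for x
  proof -
    have I: "x \<in> ?I d \<longleftrightarrow> \<lfloor>real q ^ a * x\<rfloor> = c * int q + int d" for d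
      by (rule mem_cell_iff) (use q in simp)
    have ind: "indicator (?I d) x = (if \<lfloor>real q ^ a * x\<rfloor> = c * int q + int d then 1 else 0 :: real)" for d
      unfolding indicator_def I by simp
    have *: "\<lfloor>real q ^ (a - 1) * x\<rfloor> = \<lfloor>real q ^ a * x\<rfloor> div int q"
      using floor_mult_power_div[of q "a - 1" a x] q a by simp
    have C: "x \<in> {of_int c / real q ^ (a - 1)..<(of_int c + 1) / real q ^ (a - 1)} \<longleftrightarrow> \<lfloor>real q ^ a * x\<rfloor> div int q = c"
      unfolding *[symmetric] by (rule mem_cell_iff) (use q in simp)
    show ?thesis
    proof (cases "\<lfloor>real q ^ a * x\<rfloor> div int q = c")
      case True
      have m: "\<lfloor>real q ^ a * x\<rfloor> = c * int q + int (digit q a x)"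
        using True q unfolding digit_def by (metis div_mult_mod_eq int_nat_eq mod_int_pos_iff of_nat_0_less_iff)
      have "(\<Sum>d<q. w d * (indicator (?I d) x *\<^sub>R G x)) = (\<Sum>d<q. if d = digit q a x then w d * G x else 0)"
        unfolding ind by (intro sum.cong refl) (auto simp: m)
      also have "\<dots> = w (digit q a x) * G x" using digit_less[OF q] by simp
      finally show ?thesis using True C by (simp only: indicator_def) simp
    next
      case False
      have "\<lfloor>real q ^ a * x\<rfloor> \<noteq> c * int q + int d" if "d < q" for d using False q that by auto
      then have "(\<Sum>d<q. w d * (indicator (?I d) x *\<^sub>R G x)) = 0"
        unfolding ind by (intro sum.neutral) auto
      then show ?thesis using False C by (simp only: indicator_def) simp
    qed
  qed
  then have "(\<integral>x. indicator {of_int c / real q ^ (a - 1)..<(of_int c + 1) / real q ^ (a - 1)} x *\<^sub>R (G x * w (digit q a x)) \<partial>lborel) =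
     (\<integral>x. (\<Sum>d<q. w d * (indicator (?I d) x *\<^sub>R G x)) \<partial>lborel)" by simp
  also have "\<dots> = (\<Sum>d<q. \<integral>x. w d * (indicator (?I d) x *\<^sub>R G x) \<partial>lborel)"
    by (rule Bochner_Integration.integral_sum, rule integrable_mult_right, rule integrable_indicator_Ico) (use B in auto)
  also have "\<dots> = (\<Sum>d<q. w d * (\<integral>x. indicator (?I d) x *\<^sub>R G x \<partial>lborel))"
    by (intro sum.cong refl integral_mult_right_zero)
  also have "\<dots> = (\<Sum>d<q. w d * (\<integral>x. indicator {0..<1 / real q ^ a} x *\<^sub>R G x \<partial>lborel))"
    by (simp only: integral_periodic_cell[OF per])
  also have "\<dots> = 0" using w by (simp flip: sum_distrib_right)
  finally show ?thesis .
qed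

section \<open>One integration of a Walsh function\<close>

definition cell_end :: "real \<Rightarrow> real \<Rightarrow> real" where
  "cell_end L y = (of_int \<lfloor>L * y\<rfloor> + 1) / L"

lemma cell_end_bounds:
  assumes "0 < L"
  shows "y < cell_end L y" "cell_end L y \<le> y + 1 / L"
  unfolding cell_end_def using assms by (auto simp: field_simps) linarith+

text \<open>The factor that replaces \<open>G\<close> when \<open>G\<close> times a Walsh function
  with leading position a is integrated from y to 1: the later cells of level a - 1 cancel, and only
  the rest of the cell of y counts.\<close>

definition cell_tail :: "nat \<Rightarrow> (nat \<Rightarrow> complex) \<Rightarrow> nat \<Rightarrow> (real \<Rightarrow> complex) \<Rightarrow> real \<Rightarrow> complex" where
  "cell_tail q w a G y =
     (\<integral>x. indicator {y..<cell_end (real q ^ (a - 1)) y} x *\<^sub>R (G x * w (digit q a x)) \<partial>lborel)"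

lemma cell_tail_measurable [measurable]:
  assumes [measurable]: "G \<in> borel_measurable borel"
  shows "cell_tail q w a G \<in> borel_measurable borel"
proof -
  \<comment> \<open>Written with a condition, the integrand is visibly measurable in x and y
    jointly, as an integral depending on a parameter requires.\<close>
  have *: "cell_tail q w a G = (\<lambda>y. \<integral>x. (if y \<le> x \<and> x < cell_end (real q ^ (a - 1)) y then G x * w (digit q a x) else 0) \<partial>lborel)"
    unfolding cell_tail_def by (intro ext Bochner_Integration.integral_cong) auto
  have [measurable]: "cell_end (real q ^ (a - 1)) \<in> borel_measurable borel"
    unfolding cell_end_def by measurable
  have [measurable]: "w \<in> borel_measurable (count_space UNIV)" by simp
  show ?thesis unfolding * by measurable
qed

text \<open>The range of integration is at most one cell of length q^(-(a-1)); this is the gain of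
  one integration.\<close>

lemma norm_cell_tail_le:
  assumes [measurable]: "G \<in> borel_measurable borel" and B: "\<And>x. norm (G x) \<le> B" and q: "0 < q"
    and w: "\<And>d. norm (w d) \<le> 1"
  shows "norm (cell_tail q w a G y) \<le> B / real q ^ (a - 1)"
proof -
  have [measurable]: "w \<in> borel_measurable (count_space UNIV)" by simp
  have "0 \<le> B" using B[of 0] norm_ge_zero order_trans by blast
  let ?e = "cell_end (real q ^ (a - 1)) y"
  have "norm (cell_tail q w a G y) \<le> B * (?e - y)"
    unfolding cell_tail_def
  proof (rule norm_integral_indicator_Ico_le)
    show "norm (G x * w (digit q a x)) \<le> B" for x
      using mult_mono[OF B[of x] w[of "digit q a x"]] \<open>0 \<le> B\<close> by (simp add: norm_mult)
    show "y \<le> ?e" using cell_end_bounds(1)[of "real q ^ (a - 1)" y] q by simp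
  qed measurable
  also have "\<dots> \<le> B * (1 / real q ^ (a - 1))"
    using cell_end_bounds(2)[of "real q ^ (a - 1)" y] q \<open>0 \<le> B\<close> by (intro mult_left_mono) auto
  finally show ?thesis by simp
qed

text \<open>A shift of y by one cell of level a - 1 moves the cell end along and leaves
  \<open>G\<close> and the digit at a unchanged. The remaining positions are at most a - 1, so this
  period is enough to treat them in the same way.\<close>

lemma periodic_cell_tail:
  assumes per: "periodic (1 / real q ^ (a - 1)) G" and q: "0 < q" and a: "1 \<le> a"
  shows "periodic (1 / real q ^ (a - 1)) (cell_tail q w a G)"
  unfolding periodic_def
proof
  fix y
  let ?L = "real q ^ (a - 1)"
  have ce: "cell_end ?L (y + 1 / ?L) = cell_end ?L y + 1 / ?L"
    unfolding cell_end_def using q by (simp add: algebra_simps add_divide_distrib)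
  have D: "digit q a (1 / ?L + x) = digit q a x" for x
    using digit_shift[of q "a - 1" a x 1] q a by (simp add: add.commute)
  have G: "G (1 / ?L + x) = G x" for x using per unfolding periodic_def by (simp add: add.commute)
  have "cell_tail q w a G (y + 1 / ?L) =
    (\<integral>x. indicator {y + 1 / ?L..<cell_end ?L y + 1 / ?L} (1 / ?L + 1 * x) *\<^sub>R (G (1 / ?L + 1 * x) * w (digit q a (1 / ?L + 1 * x))) \<partial>lborel)"
    unfolding cell_tail_def ce
    by (subst lborel_integral_real_affine[of 1 _ "1 / ?L"]) simp_all
  also have "\<dots> = cell_tail q w a G y"
    unfolding cell_tail_def mult_1 D G by (intro Bochner_Integration.integral_cong) (auto simp: indicator_def)
  finally show "cell_tail q w a G (y + 1 / ?L) = cell_tail q w a G y" .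
qed

text \<open>
  The only properties of characters needed for the decay of Walsh coefficients are that the weights
  \<open>w a\<close> are bounded by \<open>1\<close> and sum to zero over the digits, so arbitrary weights are allowed here.
\<close>

definition walsh :: "nat \<Rightarrow> (nat \<Rightarrow> nat \<Rightarrow> complex) \<Rightarrow> nat list \<Rightarrow> real \<Rightarrow> complex" where
  "walsh q w as x = (\<Prod>a\<leftarrow>as. w a (digit q a x))"

lemma walsh_simps [simp]:
  "walsh q w [] x = 1" "walsh q w (a # as) x = w a (digit q a x) * walsh q w as x"
  by (simp_all add: walsh_def)

lemma walsh_measurable [measurable]: "walsh q w as \<in> borel_measurable borel"
proof (induction as)
  case (Cons a as)
  note [measurable] = Cons
  have [measurable]: "w a \<in> borel_measurable (count_space UNIV)" by simp
  have "walsh q w (a # as) = (\<lambda>x. w a (digit q a x) * walsh q w as x)" by (simp add: fun_eq_iff)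
  then show ?case by simp
qed (simp add: walsh_def)

lemma norm_walsh_le_1: "(\<And>a d. a \<in> set as \<Longrightarrow> norm (w a d) \<le> 1) \<Longrightarrow> norm (walsh q w as x) \<le> 1"
  by (induction as) (auto simp: norm_mult intro!: mult_le_one)

lemma walsh_cong_cell:
  assumes "0 < q" "\<And>a. a \<in> set as \<Longrightarrow> a \<le> p" "\<lfloor>real q ^ p * x\<rfloor> = \<lfloor>real q ^ p * y\<rfloor>"
  shows "walsh q w as x = walsh q w as y"
proof -
  have "digit q a x = digit q a y" if "a \<in> set as" for a
    using digit_cong_cell[OF assms(1) assms(2)[OF that] assms(3)] .
  then show ?thesis unfolding walsh_def by (metis (no_types, lifting) map_cong)
qed

text \<open>The positions in \<open>as\<close> are at most a - 1, so the remaining Walsh function is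
  constant on each cell of level a - 1. In the cells to the right of that of y the digit at a
  averages to zero; what survives is the tail of the cell of y times the constant value
  there.\<close>

lemma integral_tail_eq_cell_tail:
  fixes G :: "real \<Rightarrow> complex" and w :: "nat \<Rightarrow> nat \<Rightarrow> complex"
  assumes [measurable]: "G \<in> borel_measurable borel" and B: "\<And>x. norm (G x) \<le> B"
    and per: "periodic (1 / real q ^ a) G" and q: "0 < q" and a: "1 \<le> a"
    and w: "(\<Sum>d<q. w a d) = 0" "\<And>d. norm (w a d) \<le> 1"
    and as: "\<And>b. b \<in> set as \<Longrightarrow> b \<le> a - 1" and y: "0 \<le> y" "y < 1"
  shows "(\<integral>x. indicator {y..<1} x *\<^sub>R (G x * walsh q w (a # as) x) \<partial>lborel) = cell_tail q (w a) a G y * walsh q w as y"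
proof -
  define L where "L = q ^ (a - 1)"
  have L: "0 < L" using q by (simp add: L_def)
  have Lr: "real q ^ (a - 1) = real L" by (simp add: L_def)
  have [measurable]: "w a \<in> borel_measurable (count_space UNIV)" by simp
  define H where "H x = G x * w a (digit q a x)" for x
  have [measurable]: "H \<in> borel_measurable borel" unfolding H_def by measurable
  have HB: "norm (H x) \<le> B" for x
    using mult_mono[OF B[of x] w(2)[of "digit q a x"]] order_trans[OF norm_ge_zero B[of x]] by (simp add: H_def norm_mult)
  let ?I = "\<lambda>c::int. {of_int c / real L..<(of_int c + 1) / real L}"
  \<comment> \<open>The cells of level a - 1 that lie in [0,1) entirely to the right of the cell of
    y.\<close>
  let ?C = "{\<lfloor>real L * y\<rfloor> + 1..<int L}"
  have I: "x \<in> ?I c \<longleftrightarrow> \<lfloor>real L * x\<rfloor> = c" for x c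
    by (rule mem_cell_iff) (use L in simp)
  have ind: "indicator (?I c) x = (if \<lfloor>real L * x\<rfloor> = c then 1 else 0 :: real)" for x c
    unfolding indicator_def I by simp
  have E: "x < cell_end (real L) y \<longleftrightarrow> \<lfloor>real L * x\<rfloor> \<le> \<lfloor>real L * y\<rfloor>" for x
    unfolding cell_end_def using L by (simp add: field_simps floor_le_iff)
  have R: "walsh q w as x = walsh q w as (of_int c / real L)" if "\<lfloor>real L * x\<rfloor> = c" for x c
    by (rule walsh_cong_cell[where p = "a - 1", OF q as, unfolded Lr]) (use that L in simp_all)
  have R': "walsh q w as x = walsh q w as y" if "\<lfloor>real L * x\<rfloor> = \<lfloor>real L * y\<rfloor>" for x
    by (rule walsh_cong_cell[where p = "a - 1", OF q as, unfolded Lr]) (use that L in simp_all)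
  have one: "x < 1 \<longleftrightarrow> \<lfloor>real L * x\<rfloor> < int L" for x
    using mult_less_cancel_left_pos[of "real L" x 1] L unfolding floor_less_iff by simp
  have "indicator {y..<1} x *\<^sub>R (G x * walsh q w (a # as) x) =
     walsh q w as y * (indicator {y..<cell_end (real L) y} x *\<^sub>R H x) +
     (\<Sum>c\<in>?C. walsh q w as (of_int c / real L) * (indicator (?I c) x *\<^sub>R H x))" for x
  proof -
    let ?m = "\<lfloor>real L * x\<rfloor>"
    have S: "(\<Sum>c\<in>?C. walsh q w as (of_int c / real L) * (indicator (?I c) x *\<^sub>R H x)) =
       (if ?m \<in> ?C then walsh q w as x * H x else 0)"
    proof -
      have "(\<Sum>c\<in>?C. walsh q w as (of_int c / real L) * (indicator (?I c) x *\<^sub>R H x)) = (\<Sum>c\<in>?C. if c = ?m then walsh q w as x * H x else 0)"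
        unfolding ind by (intro sum.cong refl) (auto simp: R[OF refl, symmetric])
      also have "\<dots> = (if ?m \<in> ?C then walsh q w as x * H x else 0)" by simp
      finally show ?thesis .
    qed
    have mono: "\<lfloor>real L * x\<rfloor> \<le> \<lfloor>real L * y\<rfloor>" if "x \<le> y" for x y
      using that L by (intro floor_mono mult_left_mono) auto
    \<comment> \<open>The cell of x precedes that of y, coincides with it, follows it inside [0,1),
      or lies beyond 1.\<close>
    consider "?m < \<lfloor>real L * y\<rfloor>" | "?m = \<lfloor>real L * y\<rfloor>" | "?m \<in> ?C" | "?m \<ge> int L" by force
    then show ?thesis
    proof cases
      case 1
      then have "x < y" using mono[of y x] by linarith
      then show ?thesis using 1 unfolding S by simp
    next
      case 2
      moreover have "x < 1" using 2 one[of x] one[of y] y by simp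
      ultimately show ?thesis unfolding S using E[of x] R'[of x] by (simp add: H_def indicator_def)
    next
      case 3
      then have "\<not> x \<le> y" using mono[of x y] by auto
      then have "y \<le> x" by simp
      then show ?thesis using 3 one[of x] E[of x] unfolding S by (auto simp: H_def indicator_def)
    next
      case 4
      moreover have "\<not> ?m \<le> \<lfloor>real L * y\<rfloor>" using 4 one[of y] y by simp
      ultimately show ?thesis using one[of x] E[of x] unfolding S by (auto simp: indicator_def)
    qed
  qed
  then have "(\<integral>x. indicator {y..<1} x *\<^sub>R (G x * walsh q w (a # as) x) \<partial>lborel) =
    (\<integral>x. walsh q w as y * (indicator {y..<cell_end (real L) y} x *\<^sub>R H x) +
     (\<Sum>c\<in>?C. walsh q w as (of_int c / real L) * (indicator (?I c) x *\<^sub>R H x)) \<partial>lborel)"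
    by simp
  also have "\<dots> = walsh q w as y * (\<integral>x. (indicator {y..<cell_end (real L) y} x *\<^sub>R H x) \<partial>lborel) +
     (\<Sum>c\<in>?C. walsh q w as (of_int c / real L) * (\<integral>x. indicator (?I c) x *\<^sub>R H x \<partial>lborel))"
  proof -
    have int: "integrable lborel (\<lambda>x. k * (indicator {a..<b} x *\<^sub>R H x))" for a b k
      by (rule integrable_mult_right, rule integrable_indicator_Ico) (use HB in auto)
    show ?thesis
      by (simp only: Bochner_Integration.integral_add[OF int Bochner_Integration.integrable_sum[OF int]]
          Bochner_Integration.integral_sum[OF int] integral_mult_right_zero)
  qed
  also have "(\<Sum>c\<in>?C. walsh q w as (of_int c / real L) * (\<integral>x. indicator (?I c) x *\<^sub>R H x \<partial>lborel)) = 0"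
    using integral_cell_digit_eq_0[OF assms(1) B per q a w(1)] unfolding H_def Lr by (intro sum.neutral) simp
  finally show ?thesis unfolding cell_tail_def Lr H_def by simp
qed

section \<open>Iterated integration of Walsh functions\<close>

text \<open>The truncated power from the integral form of the Taylor remainder. For y = 0 and x
  \<ge> 0 it is the monomial \<open>x ^ k / fact k\<close>, so the same kernel also describes the
  polynomial Taylor terms.\<close>

definition taylor_kernel :: "nat \<Rightarrow> real \<Rightarrow> real \<Rightarrow> real" where
  "taylor_kernel k x y = (if y \<le> x then (x - y) ^ k / fact k else 0)"

lemma taylor_kernel_measurable [measurable]:
  "(\<lambda>(x, y). taylor_kernel k x y) \<in> borel_measurable (borel \<Otimes>\<^sub>M borel)"
  unfolding taylor_kernel_def by measurable

lemma taylor_kernel_nonneg: "0 \<le> taylor_kernel k x y"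
  unfolding taylor_kernel_def by simp

lemma taylor_kernel_le_1: "x \<le> 1 \<Longrightarrow> 0 \<le> y \<Longrightarrow> taylor_kernel k x y \<le> 1"
  unfolding taylor_kernel_def using order_trans[OF power_le_one[of "x - y" k] fact_ge_1[of k, where 'a=real]]
  by (auto simp: divide_le_eq)

text \<open>By Cauchy's formula for repeated integration this is the (k+1)-fold tail integral of
  \<open>F\<close> on [y,1). Its value at 0 is the integral of \<open>F\<close> against
  \<open>x ^ k / fact k\<close>.\<close>

definition iter_tail :: "nat \<Rightarrow> (real \<Rightarrow> complex) \<Rightarrow> real \<Rightarrow> complex" where
  "iter_tail k F y = (\<integral>x. of_real (taylor_kernel k x y) * F x \<partial>unit_lborel)"

lemma iter_tail_measurable [measurable]:
  assumes "F \<in> borel_measurable borel"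
  shows "iter_tail k F \<in> borel_measurable borel"
proof -
  have [measurable]: "F \<in> borel_measurable unit_lborel" by (rule borel_measurable_unit_lborel) fact
  have [measurable]: "id \<in> borel_measurable unit_lborel" by (rule borel_measurable_unit_lborel) simp
  have "iter_tail k F = (\<lambda>y. \<integral>x. of_real (taylor_kernel k (id x) y) * F x \<partial>unit_lborel)"
    unfolding iter_tail_def by simp
  also have "\<dots> \<in> borel_measurable borel" by measurable
  finally show ?thesis .
qed

lemma iter_tail_cong:
  assumes "\<And>x. 0 \<le> x \<Longrightarrow> x < 1 \<Longrightarrow> F x = G x"
  shows "iter_tail k F y = iter_tail k G y"
  unfolding iter_tail_def using assms by (intro Bochner_Integration.integral_cong) auto

lemma norm_iter_tail_le:
  assumes "F \<in> borel_measurable borel" "\<And>x. 0 \<le> x \<Longrightarrow> x < 1 \<Longrightarrow> norm (F x) \<le> B" "0 \<le> y"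
  shows "norm (iter_tail k F y) \<le> B"
  unfolding iter_tail_def
proof (rule norm_integral_unit_lborel_le)
  have [measurable]: "F \<in> borel_measurable borel" by fact
  show "(\<lambda>x. of_real (taylor_kernel k x y) * F x) \<in> borel_measurable unit_lborel"
    by (rule borel_measurable_unit_lborel) measurable
  show "norm (of_real (taylor_kernel k x y) * F x) \<le> B" if "0 \<le> x" "x < 1" for x
    using mult_mono[OF taylor_kernel_le_1[of x y k] assms(2)[OF that]] taylor_kernel_nonneg[of k x y] that assms(3)
    by (simp add: norm_mult)
qed

lemma iter_tail_0:
  "0 \<le> y \<Longrightarrow> iter_tail 0 F y = (\<integral>x. indicator {y..<1} x *\<^sub>R F x \<partial>lborel)"
  unfolding iter_tail_def integral_unit_lborel taylor_kernel_def
  by (intro Bochner_Integration.integral_cong) (auto simp: indicator_def)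

text \<open>Integrating the kernel in z from y to x raises its degree by one; the assumptions keep
  that range inside [0,1).\<close>

lemma integral_taylor_kernel:
  assumes "0 \<le> y" "x < 1"
  shows "(\<integral>z. taylor_kernel k z y * taylor_kernel 0 x z \<partial>unit_lborel) = taylor_kernel (Suc k) x y"
proof (cases "y \<le> x")
  case True
  have "(\<integral>z. taylor_kernel k z y * taylor_kernel 0 x z \<partial>unit_lborel) = (\<integral>z. indicator {y..x} z *\<^sub>R ((z - y) ^ k / fact k) \<partial>lborel)"
    unfolding integral_unit_lborel using assms
    by (intro Bochner_Integration.integral_cong) (auto simp: indicator_def taylor_kernel_def)
  also have "\<dots> = (x - y) ^ Suc k / fact (Suc k) - (y - y) ^ Suc k / fact (Suc k)"
  proof (rule integral_FTC_Icc)
    show "((\<lambda>z. (z - y) ^ Suc k / fact (Suc k)) has_vector_derivative (z - y) ^ k / fact k) (at z within {y..x})" for z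
    proof -
      have "((\<lambda>z. (z - y) ^ Suc k / fact (Suc k)) has_real_derivative (real (Suc k) * (z - y) ^ k * 1) / fact (Suc k)) (at z within {y..x})"
        by (rule derivative_eq_intros refl | simp)+
      moreover have "real (Suc k) * (z - y) ^ k * 1 / fact (Suc k) = (z - y) ^ k / fact k"
        using mult_divide_mult_cancel_left[OF of_nat_neq_0, of k "(z - y) ^ k" "fact k :: real"] by (simp only: fact_Suc mult_1_right)
      ultimately show ?thesis by (simp only: has_real_derivative_iff_has_vector_derivative)
    qed
    show "continuous_on {y..x} (\<lambda>z. (z - y) ^ k / fact k)" by (intro continuous_intros) auto
  qed (use True in auto)
  finally show ?thesis using True by (simp add: taylor_kernel_def)
next
  case False
  have "(\<integral>z. taylor_kernel k z y * taylor_kernel 0 x z \<partial>unit_lborel) = (\<integral>z. 0 \<partial>unit_lborel)"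
    by (rule Bochner_Integration.integral_cong) (use False in \<open>auto simp: taylor_kernel_def\<close>)
  then show ?thesis using False by (simp add: taylor_kernel_def)
qed

text \<open>Fubini exchanges the two integrations, and the product of the two kernels integrates to
  the kernel of the next degree. The bound on \<open>F\<close> makes the double integral absolutely
  convergent.\<close>

lemma iter_tail_Suc:
  assumes F: "F \<in> borel_measurable borel" and B: "\<And>x. 0 \<le> x \<Longrightarrow> x < 1 \<Longrightarrow> norm (F x) \<le> B" and y: "0 \<le> y"
  shows "iter_tail (Suc k) F y = iter_tail k (iter_tail 0 F) y"
proof -
  interpret pair_prob_space unit_lborel unit_lborel ..
  have [measurable]: "F \<in> borel_measurable unit_lborel" by (rule borel_measurable_unit_lborel) fact
  have [measurable]: "id \<in> borel_measurable unit_lborel" by (rule borel_measurable_unit_lborel) simp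
  let ?f = "\<lambda>(z, x). complex_of_real (taylor_kernel k (id z) y) * (of_real (taylor_kernel 0 (id x) (id z)) * F x)"
  have int: "integrable (unit_lborel \<Otimes>\<^sub>M unit_lborel) ?f"
  proof (rule integrable_const_bound[of _ B])
    show "AE w in unit_lborel \<Otimes>\<^sub>M unit_lborel. norm (?f w) \<le> B"
    proof (rule AE_I2, clarsimp simp: space_pair_measure norm_mult)
      fix z x :: real assume zx: "0 \<le> z" "z < 1" "0 \<le> x" "x < 1"
      have "0 \<le> B" using B[OF zx(3,4)] norm_ge_zero order_trans by blast
      have "taylor_kernel k z y * (taylor_kernel 0 x z * norm (F x)) \<le> 1 * (1 * B)"
        using zx y \<open>0 \<le> B\<close> by (intro mult_mono taylor_kernel_le_1 B mult_nonneg_nonneg taylor_kernel_nonneg) auto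
      then show "\<bar>taylor_kernel k z y\<bar> * (\<bar>taylor_kernel 0 x z\<bar> * norm (F x)) \<le> B"
        using taylor_kernel_nonneg by simp
    qed
    show "?f \<in> borel_measurable (unit_lborel \<Otimes>\<^sub>M unit_lborel)" by measurable
  qed
  have "iter_tail k (iter_tail 0 F) y = (\<integral>z. (\<integral>x. ?f (z, x) \<partial>unit_lborel) \<partial>unit_lborel)"
    unfolding iter_tail_def by simp
  also have "\<dots> = (\<integral>x. (\<integral>z. ?f (z, x) \<partial>unit_lborel) \<partial>unit_lborel)"
    using Fubini_integral[OF int] by simp
  also have "\<dots> = iter_tail (Suc k) F y"
    unfolding iter_tail_def
  proof (rule Bochner_Integration.integral_cong)
    fix x assume "x \<in> space unit_lborel"
    then have x: "0 \<le> x" "x < 1" by auto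
    have "(\<integral>z. ?f (z, x) \<partial>unit_lborel) = (\<integral>z. of_real (taylor_kernel k z y * taylor_kernel 0 x z) * F x \<partial>unit_lborel)"
      by (simp add: mult.assoc)
    also have "\<dots> = of_real (\<integral>z. taylor_kernel k z y * taylor_kernel 0 x z \<partial>unit_lborel) * F x"
      by (simp only: integral_mult_left_zero integral_complex_of_real)
    finally show "(\<integral>z. ?f (z, x) \<partial>unit_lborel) = of_real (taylor_kernel (Suc k) x y) * F x"
      using integral_taylor_kernel[OF y x(2)] by simp
  qed simp
  finally show ?thesis by simp
qed

text \<open>The exponent gained by k integrations. A position a counts as a - 1 because the gain is
  the length of a cell of level a - 1.\<close>

definition level_sum :: "nat \<Rightarrow> nat list \<Rightarrow> nat" where
  "level_sum k as = (\<Sum>a\<leftarrow>take k as. a - 1)"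

text \<open>Induction on k: one integration removes the leading position a and replaces
  \<open>G\<close> by \<open>cell_tail\<close>, which is smaller by the factor q^(-(a-1)) and has
  the period q^(-(a-1)). Hence \<open>G\<close>, its bound and its period have to stay arbitrary.
  The three conclusions give the decay, the orthogonality to the monomial of degree k, and the
  mean-zero property that lets a variation act on the last kernel.\<close>

lemma iter_tail_periodic_walsh:
  fixes w :: "nat \<Rightarrow> nat \<Rightarrow> complex"
  assumes q: "0 < q"
    and "G \<in> borel_measurable borel" "\<And>x. norm (G x) \<le> B" "periodic (1 / real q ^ p) G"
    and "sorted_wrt (>) as" "\<And>a. a \<in> set as \<Longrightarrow> 1 \<le> a" "\<And>a. a \<in> set as \<Longrightarrow> a \<le> p"
    and w: "\<And>a. a \<in> set as \<Longrightarrow> (\<Sum>d<q. w a d) = 0" "\<And>a d. a \<in> set as \<Longrightarrow> norm (w a d) \<le> 1"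
  shows "(\<forall>y. 0 \<le> y \<and> y < 1 \<longrightarrow>
        norm (iter_tail k (\<lambda>x. G x * walsh q w as x) y) \<le> B / real q ^ level_sum (Suc k) as) \<and>
     (k < length as \<longrightarrow> iter_tail k (\<lambda>x. G x * walsh q w as x) 0 = 0) \<and>
     (Suc k < length as \<longrightarrow> (\<forall>c < q ^ (as ! Suc k - 1).
        (\<integral>x. indicator {real c / real q ^ (as ! Suc k - 1)..<(real c + 1) / real q ^ (as ! Suc k - 1)} x *\<^sub>R
            iter_tail k (\<lambda>x. G x * walsh q w as x) x \<partial>unit_lborel) = 0))"
  using assms(2-)
proof (induction k arbitrary: G B p as)
  case (0 G B p as)
  note [measurable] = 0(1)
  show ?case
  proof (cases as)
    case Nil
    then show ?thesis using norm_iter_tail_le[OF 0(1), of B] 0(2) by (auto simp: level_sum_def)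
  next
    case (Cons a as')
    have a: "1 \<le> a" "a \<le> p" and as': "\<And>b. b \<in> set as' \<Longrightarrow> b \<le> a - 1"
      using 0(4,5,6) unfolding Cons by fastforce+
    have wa: "(\<Sum>d<q. w a d) = 0" "\<And>d. norm (w a d) \<le> 1" using 0(7,8) unfolding Cons by auto
    have per: "periodic (1 / real q ^ a) G" "periodic (1 / real q ^ (a - 1)) G"
      using periodic_power[OF 0(3) _ q] a by auto
    let ?G' = "cell_tail q (w a) a G"
    have T: "iter_tail 0 (\<lambda>x. G x * walsh q w as x) y = ?G' y * walsh q w as' y" if "0 \<le> y" "y < 1" for y
      using integral_tail_eq_cell_tail[where w = w and a = a and as = as', OF 0(1,2) per(1) q a(1) wa as' that] iter_tail_0[OF that(1)] unfolding Cons by simp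
    have N: "norm (walsh q w as' y) \<le> 1" for y by (rule norm_walsh_le_1) (use 0(8) Cons in auto)
    have nG: "norm (?G' y) \<le> B / real q ^ (a - 1)" for y by (rule norm_cell_tail_le[OF 0(1,2) q wa(2)])
    \<comment> \<open>At 0 the tail is a full cell, over which the digit at a averages to
      zero.\<close>
    have G0: "?G' 0 = 0"
      using integral_cell_digit_eq_0[OF 0(1,2) per(1) q a(1) wa(1), of 0] unfolding cell_tail_def cell_end_def by simp
    have p': "periodic (1 / real q ^ (a - 1)) ?G'" by (rule periodic_cell_tail[OF per(2) q a(1)])
    have "norm (iter_tail 0 (\<lambda>x. G x * walsh q w as x) y) \<le> B / real q ^ level_sum (Suc 0) as" if "0 \<le> y" "y < 1" for y
      using mult_mono[OF nG[of y] N[of y]] order_trans[OF norm_ge_zero nG[of y]] T[OF that]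
      by (simp add: norm_mult Cons level_sum_def)
    moreover have "iter_tail 0 (\<lambda>x. G x * walsh q w as x) 0 = 0" using T[of 0] G0 by simp
    moreover have "(\<integral>x. indicator {real c / real q ^ (as ! Suc 0 - 1)..<(real c + 1) / real q ^ (as ! Suc 0 - 1)} x *\<^sub>R
            iter_tail 0 (\<lambda>x. G x * walsh q w as x) x \<partial>unit_lborel) = 0"
      if len: "Suc 0 < length as" and c: "c < q ^ (as ! Suc 0 - 1)" for c
    proof -
      obtain b as'' where as'': "as' = b # as''" using len Cons by (cases as') auto
      have b: "1 \<le> b" "b \<le> a - 1" and as2: "\<And>d. d \<in> set as'' \<Longrightarrow> d \<le> b - 1"
        using 0(4,5,6) as' unfolding Cons as'' by fastforce+
      \<comment> \<open>On a cell of level b - 1 the positions after b are frozen. The digit at b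
        averages to zero there because \<open>?G'\<close>, having period q^(-(a-1)) with b \<le> a -
        1, also has period q^(-b).\<close>
      define L where "L = q ^ (b - 1)"
      have L: "0 < L" "real q ^ (b - 1) = real L" using q by (auto simp: L_def)
      let ?I = "{real c / real L..<(real c + 1) / real L}"
      have cL: "c < L" using c by (simp add: Cons as'' L_def)
      have I: "x \<in> ?I \<longleftrightarrow> \<lfloor>real L * x\<rfloor> = int c" for x
        using mem_cell_iff[of "real L" x "int c"] L by simp
      have sub: "0 \<le> x \<and> x < 1" if "x \<in> ?I" for x
      proof -
        from that have "x < (real c + 1) / real L" "real c / real L \<le> x" by auto
        moreover have "(real c + 1) / real L \<le> 1" using cL by (simp add: field_simps)
        moreover have "0 \<le> real c / real L" by simp
        ultimately show ?thesis by linarith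
      qed
      have R: "walsh q w as'' x = walsh q w as'' (real c / real L)" if "x \<in> ?I" for x
      proof -
        have "\<lfloor>real L * x\<rfloor> = \<lfloor>real L * (real c / real L)\<rfloor>" using iffD1[OF I that] L(1) by simp
        then show ?thesis by (intro walsh_cong_cell[where p = "b - 1", OF q as2, unfolded L])
      qed
      have "(\<integral>x. indicator ?I x *\<^sub>R iter_tail 0 (\<lambda>x. G x * walsh q w as x) x \<partial>unit_lborel) =
        (\<integral>x. walsh q w as'' (real c / real L) * (indicator ?I x *\<^sub>R (?G' x * w b (digit q b x))) \<partial>lborel)"
        unfolding integral_unit_lborel
      proof (rule Bochner_Integration.integral_cong)
        fix x
        show "indicator {0..<1} x *\<^sub>R indicator ?I x *\<^sub>R iter_tail 0 (\<lambda>x. G x * walsh q w as x) x =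
           walsh q w as'' (real c / real L) * (indicator ?I x *\<^sub>R (?G' x * w b (digit q b x)))"
          using sub[of x] T[of x] R[of x] by (cases "x \<in> ?I") (auto simp: as'')
      qed simp
      also have "\<dots> = walsh q w as'' (real c / real L) * (\<integral>x. (indicator ?I x *\<^sub>R (?G' x * w b (digit q b x))) \<partial>lborel)"
        by (rule integral_mult_right_zero)
      also have "(\<integral>x. (indicator ?I x *\<^sub>R (?G' x * w b (digit q b x))) \<partial>lborel) = 0"
        using integral_cell_digit_eq_0[of ?G' "B / real q ^ (a - 1)" q b "w b" "int c"] nG periodic_power[OF p' b(2) q] q b(1) 0(7)[of b]
        unfolding L by (simp add: Cons as'')
      moreover have "as ! Suc 0 = b" by (simp add: Cons as'')
      ultimately show ?thesis by (simp only: L mult_zero_right)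
    qed
    ultimately show ?thesis by blast
  qed
next
  case (Suc k G B p as)
  note [measurable] = Suc.prems(1)
  let ?F = "\<lambda>x. G x * walsh q w as x"
  have FB: "norm (?F x) \<le> B" for x
    using mult_mono[OF Suc.prems(2)[of x] norm_walsh_le_1[of as w q x]] order_trans[OF norm_ge_zero Suc.prems(2)[of x]] Suc.prems(8)
    by (simp add: norm_mult)
  have Fm: "?F \<in> borel_measurable borel" by measurable
  show ?case
  proof (cases as)
    case Nil
    then show ?thesis using norm_iter_tail_le[OF Suc.prems(1), of B] Suc.prems(2) by (auto simp: level_sum_def)
  next
    case (Cons a as')
    have a: "1 \<le> a" "a \<le> p" and as': "\<And>b. b \<in> set as' \<Longrightarrow> b \<le> a - 1"
      using Suc.prems(4,5,6) unfolding Cons by fastforce+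
    have wa: "(\<Sum>d<q. w a d) = 0" "\<And>d. norm (w a d) \<le> 1" using Suc.prems(7,8) unfolding Cons by auto
    have per: "periodic (1 / real q ^ a) G" "periodic (1 / real q ^ (a - 1)) G"
      using periodic_power[OF Suc.prems(3) _ q] a by auto
    let ?G' = "cell_tail q (w a) a G"
    have T: "iter_tail 0 ?F y = ?G' y * walsh q w as' y" if "0 \<le> y" "y < 1" for y
      using integral_tail_eq_cell_tail[where w = w and a = a and as = as', OF Suc.prems(1,2) per(1) q a(1) wa as' that] iter_tail_0[OF that(1)] unfolding Cons by simp
    \<comment> \<open>k + 2 integrations of the product are k + 1 integrations of the product with
      the leading position removed, to which the induction hypothesis applies.\<close>
    have T': "iter_tail (Suc k) ?F y = iter_tail k (\<lambda>x. ?G' x * walsh q w as' x) y" if "0 \<le> y" for y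
      using iter_tail_Suc[OF Fm FB that] iter_tail_cong[OF T] by simp
    have IH: "(\<forall>y. 0 \<le> y \<and> y < 1 \<longrightarrow>
        norm (iter_tail k (\<lambda>x. ?G' x * walsh q w as' x) y) \<le> B / real q ^ (a - 1) / real q ^ level_sum (Suc k) as') \<and>
     (k < length as' \<longrightarrow> iter_tail k (\<lambda>x. ?G' x * walsh q w as' x) 0 = 0) \<and>
     (Suc k < length as' \<longrightarrow> (\<forall>c < q ^ (as' ! Suc k - 1).
        (\<integral>x. indicator {real c / real q ^ (as' ! Suc k - 1)..<(real c + 1) / real q ^ (as' ! Suc k - 1)} x *\<^sub>R
            iter_tail k (\<lambda>x. ?G' x * walsh q w as' x) x \<partial>unit_lborel) = 0))"
    proof (rule Suc.IH)
      show "norm (?G' y) \<le> B / real q ^ (a - 1)" for y by (rule norm_cell_tail_le[OF Suc.prems(1,2) q wa(2)])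
      show "periodic (1 / real q ^ (a - 1)) ?G'" by (rule periodic_cell_tail[OF per(2) q a(1)])
    qed (use Suc.prems(4-8) as' in \<open>auto simp: Cons\<close>)
    have int: "(\<integral>x. indicator I x *\<^sub>R iter_tail (Suc k) ?F x \<partial>unit_lborel) = (\<integral>x. indicator I x *\<^sub>R iter_tail k (\<lambda>x. ?G' x * walsh q w as' x) x \<partial>unit_lborel)" for I
      by (rule Bochner_Integration.integral_cong) (use T' in auto)
    have ls: "B / real q ^ (a - 1) / real q ^ level_sum (Suc k) as' = B / real q ^ level_sum (Suc (Suc k)) as"
      by (simp add: Cons level_sum_def power_add)
    show ?thesis using IH T' unfolding int ls by (auto simp: Cons)
  qed
qed

section \<open>Integration over the unit cube\<close>

abbreviation unit_cube :: "nat set \<Rightarrow> (nat \<Rightarrow> real) measure" where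
  "unit_cube u \<equiv> \<Pi>\<^sub>M j\<in>u. unit_lborel"

interpretation cube: product_prob_space "\<lambda>_::nat. unit_lborel" UNIV
  by standard

lemma prob_space_unit_cube: "prob_space (unit_cube u)"
  by (rule prob_space_PiM) (rule prob_space_unit_lborel)

lemma space_unit_cube [simp]: "space (unit_cube u) = cube u"
  by (simp add: space_PiM cube_def)

lemma measure_unit_cube [simp]: "measure (unit_cube u) (cube u) = 1"
  using prob_space.prob_space[OF prob_space_unit_cube, of u] by simp

lemma cubeD: "x \<in> cube u \<Longrightarrow> j \<in> u \<Longrightarrow> 0 \<le> x j \<and> x j < 1"
  unfolding cube_def by (drule PiE_mem) auto

text \<open>The two sigma-algebras agree because the identity is measurable in either direction, and
  the measures agree on products of subsets of [0,1), which determine them.\<close>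

lemma restrict_space_lborel_cube:
  assumes u: "finite u"
  shows "restrict_space (lebesgue_on_vars u) (cube u) = unit_cube u"
proof (rule cube.PiM_eqI[OF u])
  have cm: "cube u \<in> sets (lebesgue_on_vars u)"
    unfolding cube_def by (rule sets_PiM_I_finite) (use u in auto)
  let ?R = "restrict_space (lebesgue_on_vars u) (cube u)"
  have spR: "space ?R = cube u" using sets.sets_into_space[OF cm] by (auto simp: space_restrict_space)
  show "sets ?R = sets (unit_cube u)"
  proof
    have "(\<lambda>x. x) \<in> unit_cube u \<rightarrow>\<^sub>M ?R"
    proof (rule measurable_restrict_space2)
      show "(\<lambda>x. x) \<in> space (unit_cube u) \<rightarrow> cube u" by simp
      show "(\<lambda>x. x) \<in> unit_cube u \<rightarrow>\<^sub>M lebesgue_on_vars u"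
      proof (rule measurable_PiM_single')
        fix i assume i: "i \<in> u"
        have "(\<lambda>x. x) \<in> unit_lborel \<rightarrow>\<^sub>M lborel"
          unfolding unit_lborel_def by (rule measurable_restrict_space1) simp
        from measurable_compose[OF measurable_component_singleton[OF i] this]
        show "(\<lambda>x. x i) \<in> unit_cube u \<rightarrow>\<^sub>M lborel" by simp
      qed (auto simp: cube_def space_PiM PiE_def)
    qed
    then show "sets ?R \<subseteq> sets (unit_cube u)"
      using spR measurable_sets[of "\<lambda>x. x" "unit_cube u" ?R] sets.sets_into_space[of _ ?R]
      by (fastforce simp: vimage_def Int_absorb2)
    have "(\<lambda>x. x) \<in> ?R \<rightarrow>\<^sub>M unit_cube u"
    proof (rule measurable_PiM_single')
      fix i assume i: "i \<in> u"
      show "(\<lambda>x. x i) \<in> ?R \<rightarrow>\<^sub>M unit_lborel"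
        unfolding unit_lborel_def
      proof (rule measurable_restrict_space2)
        show "(\<lambda>x. x i) \<in> space ?R \<rightarrow> {0..<1}" unfolding spR using i by (auto simp: cube_def)
        show "(\<lambda>x. x i) \<in> ?R \<rightarrow>\<^sub>M lborel"
          by (rule measurable_restrict_space1) (rule measurable_component_singleton[OF i])
      qed
    qed (unfold spR, auto simp: cube_def)
    then show "sets (unit_cube u) \<subseteq> sets ?R"
      using spR measurable_sets[of "\<lambda>x. x" ?R "unit_cube u"] sets.sets_into_space[of _ "unit_cube u"]
      by (fastforce simp: vimage_def Int_absorb2)
  qed
  interpret L: product_sigma_finite "\<lambda>_::nat. lborel :: real measure" ..
  fix A :: "nat \<Rightarrow> real set" assume A: "\<And>i. i \<in> u \<Longrightarrow> A i \<in> sets unit_lborel"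
  have A': "A i \<subseteq> {0..<1}" "A i \<in> sets lborel" if "i \<in> u" for i
    using A[OF that] by (auto simp: unit_lborel_def sets_restrict_space)
  have "emeasure ?R (Pi\<^sub>E u A) = emeasure (lebesgue_on_vars u) (Pi\<^sub>E u A)"
    using A'(1) cm by (intro emeasure_restrict_space) (auto simp: cube_def)
  also have "\<dots> = (\<Prod>i\<in>u. emeasure lborel (A i))"
    by (rule L.emeasure_PiM[OF u A'(2)])
  also have "\<dots> = (\<Prod>i\<in>u. emeasure unit_lborel (A i))"
    unfolding unit_lborel_def using A'(1) by (intro prod.cong refl emeasure_restrict_space[symmetric]) auto
  finally show "emeasure ?R (Pi\<^sub>E u A) = (\<Prod>i\<in>u. emeasure unit_lborel (A i))" .
qed

lemma cube_in_sets: "finite u \<Longrightarrow> cube u \<in> sets (lebesgue_on_vars u)"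
  unfolding cube_def by (rule sets_PiM_I_finite) auto

lemma set_integrable_cube_iff:
  fixes f :: "(nat \<Rightarrow> real) \<Rightarrow> real"
  assumes "finite u"
  shows "set_integrable (lebesgue_on_vars u) (cube u) f \<longleftrightarrow> integrable (unit_cube u) f"
  unfolding restrict_space_lborel_cube[OF assms, symmetric] set_integrable_def
  using cube_in_sets[OF assms] by (subst integrable_restrict_space) (auto simp: sets.Int_space_eq2)

lemma set_integral_cube_eq:
  fixes f :: "(nat \<Rightarrow> real) \<Rightarrow> real"
  assumes "finite u"
  shows "(LINT x:cube u|lebesgue_on_vars u. f x) = integral\<^sup>L (unit_cube u) f"
  unfolding restrict_space_lborel_cube[OF assms, symmetric] set_lebesgue_integral_def
  using cube_in_sets[OF assms] by (subst integral_restrict_space) (auto simp: sets.Int_space_eq2)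

lemma integral_unit_cube_empty:
  fixes f :: "(nat \<Rightarrow> real) \<Rightarrow> 'b::{banach,second_countable_topology}"
  shows "integral\<^sup>L (unit_cube {}) f = f (\<lambda>_. undefined)"
  by (simp add: PiM_empty lebesgue_integral_count_space_finite)

text \<open>Fubini with the new coordinate outermost, by transport along the map that inserts x at
  i.\<close>

lemma unit_cube_insert:
  fixes f :: "(nat \<Rightarrow> real) \<Rightarrow> 'b::{banach,second_countable_topology}"
  assumes f: "integrable (unit_cube (insert i w)) f"
  shows integrable_unit_cube_insert: "integrable unit_lborel (\<lambda>x. \<integral>z. f (z(i := x)) \<partial>unit_cube w)"
    and integral_unit_cube_insert: "integral\<^sup>L (unit_cube (insert i w)) f = (\<integral>x. (\<integral>z. f (z(i := x)) \<partial>unit_cube w) \<partial>unit_lborel)"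
proof -
  interpret W: prob_space "unit_cube w" by (rule prob_space_unit_cube)
  interpret P: pair_prob_space unit_lborel "unit_cube w" ..
  have D: "distr (unit_lborel \<Otimes>\<^sub>M unit_cube w) (unit_cube (insert i w)) (\<lambda>(x, X). X(i := x)) = unit_cube (insert i w)"
    by (rule distr_pair_PiM_eq_PiM) (rule prob_space_unit_lborel)+
  have m: "(\<lambda>(x, X). X(i := x)) \<in> unit_lborel \<Otimes>\<^sub>M unit_cube w \<rightarrow>\<^sub>M unit_cube (insert i w)"
    by measurable
  have "integrable (unit_lborel \<Otimes>\<^sub>M unit_cube w) (\<lambda>p. f ((\<lambda>(x, X). X(i := x)) p))"
    by (rule integrable_distr[OF m]) (simp add: D f)
  then have int: "integrable (unit_lborel \<Otimes>\<^sub>M unit_cube w) (\<lambda>(x, X). f (X(i := x)))"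
    by (simp add: split_def)
  show "integrable unit_lborel (\<lambda>x. \<integral>z. f (z(i := x)) \<partial>unit_cube w)"
    using P.integrable_fst[OF int] by simp
  have "integral\<^sup>L (unit_cube (insert i w)) f = integral\<^sup>L (distr (unit_lborel \<Otimes>\<^sub>M unit_cube w) (unit_cube (insert i w)) (\<lambda>(x, X). X(i := x))) f"
    by (simp add: D)
  also have "\<dots> = (\<integral>p. f ((\<lambda>(x, X). X(i := x)) p) \<partial>(unit_lborel \<Otimes>\<^sub>M unit_cube w))"
    using f by (intro integral_distr[OF m]) auto
  also have "\<dots> = (\<integral>x. (\<integral>z. f (z(i := x)) \<partial>unit_cube w) \<partial>unit_lborel)"
    using P.integral_fst[OF int] by (simp add: split_def)
  finally show "integral\<^sup>L (unit_cube (insert i w)) f = (\<integral>x. (\<integral>z. f (z(i := x)) \<partial>unit_cube w) \<partial>unit_lborel)" .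
qed

lemma sum_PiE_insert:
  fixes f :: "('i \<Rightarrow> 'b) \<Rightarrow> 'c::comm_monoid_add"
  assumes "i \<notin> I"
  shows "(\<Sum>g\<in>Pi\<^sub>E (insert i I) B. f g) = (\<Sum>b\<in>B i. \<Sum>g\<in>Pi\<^sub>E I B. f (g(i := b)))"
proof -
  have "(\<Sum>g\<in>Pi\<^sub>E (insert i I) B. f g) = (\<Sum>p\<in>B i \<times> Pi\<^sub>E I B. f ((\<lambda>(y, g). g(i := y)) p))"
    unfolding PiE_insert_eq by (rule sum.reindex[unfolded o_def, OF inj_combinator[OF assms]])
  then show ?thesis by (simp add: sum.cartesian_product split_def)
qed

lemma integrable_bounded_mult:
  fixes f :: "'b \<Rightarrow> complex"
  assumes "integrable M f" and [measurable]: "g \<in> borel_measurable M" and B: "\<And>x. x \<in> space M \<Longrightarrow> norm (g x) \<le> B"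
  shows "integrable M (\<lambda>x. f x * g x)"
proof (rule Bochner_Integration.integrable_bound)
  have [measurable]: "f \<in> borel_measurable M" using assms(1) by auto
  show "integrable M (\<lambda>x. B * norm (f x))" using assms(1) by simp
  show "(\<lambda>x. f x * g x) \<in> borel_measurable M" by measurable
  show "AE x in M. norm (f x * g x) \<le> norm (B * norm (f x))"
  proof (rule AE_I2)
    fix x assume x: "x \<in> space M"
    have "norm (f x) * norm (g x) \<le> norm (f x) * B" using B[OF x] by (intro mult_left_mono) auto
    also have "\<dots> \<le> norm (B * norm (f x))" by (simp add: mult.commute)
    finally show "norm (f x * g x) \<le> norm (B * norm (f x))" by (simp add: norm_mult)
  qed
qed

lemma measurable_prod_coordinates:
  fixes \<theta> :: "nat \<Rightarrow> real \<Rightarrow> complex"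
  assumes "\<And>j. j \<in> w \<Longrightarrow> \<theta> j \<in> borel_measurable unit_lborel" "w \<subseteq> u"
  shows "(\<lambda>x. \<Prod>j\<in>w. \<theta> j (x j)) \<in> borel_measurable (unit_cube u)"
proof (rule borel_measurable_prod)
  fix j assume j: "j \<in> w"
  with assms(2) have "j \<in> u" by auto
  from measurable_compose[OF measurable_component_singleton[OF this] assms(1)[OF j]]
  show "(\<lambda>x. \<theta> j (x j)) \<in> borel_measurable (unit_cube u)" by simp
qed

lemma norm_prod_coordinates_le:
  fixes \<theta> :: "nat \<Rightarrow> real \<Rightarrow> complex"
  assumes "\<And>j x. j \<in> w \<Longrightarrow> 0 \<le> x \<Longrightarrow> x < 1 \<Longrightarrow> norm (\<theta> j x) \<le> B j" "w \<subseteq> u" "x \<in> cube u"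
  shows "norm (\<Prod>j\<in>w. \<theta> j (x j)) \<le> (\<Prod>j\<in>w. B j)"
  unfolding prod_norm[symmetric]
proof (rule prod_mono)
  fix j assume "j \<in> w"
  then have "0 \<le> x j" "x j < 1" using assms(2,3) by (auto simp: cube_def PiE_def Pi_def)
  then show "0 \<le> norm (\<theta> j (x j)) \<and> norm (\<theta> j (x j)) \<le> B j" using assms(1) \<open>j \<in> w\<close> by simp
qed

section \<open>Box differences\<close>

text \<open>
  Differences are weighted by box volumes in the variation, so it controls only differences across a
  fixed fraction of a cell. A shorter increment is a difference of two longer ones.
\<close>

definition admissible_gap :: "nat \<Rightarrow> (nat \<Rightarrow> real) \<Rightarrow> (nat \<Rightarrow> real) \<Rightarrow> bool" where
  "admissible_gap L lo hi \<longleftrightarrow>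
     (\<forall>c<L. real c / real L \<le> lo c \<and> lo c + 1 / (4 * real L) \<le> hi c \<and> hi c < (real c + 1) / real L)"

lemma sum_differences_from_left_end:
  fixes h :: "real \<Rightarrow> complex"
  assumes L: "0 < L"
    and M: "\<And>lo hi. admissible_gap L lo hi \<Longrightarrow> (\<Sum>c<L. norm (h (hi c) - h (lo c))) \<le> M"
    and \<xi>: "0 \<le> \<xi>" "\<xi> < 1 / real L"
  shows "(\<Sum>c<L. norm (h (real c / real L + \<xi>) - h (real c / real L))) \<le> 2 * M"
proof -
  have L': "0 < real L" using L by simp
  have gap: "admissible_gap L (\<lambda>c. real c / real L + r) (\<lambda>c. real c / real L + r')"
    if "0 \<le> r" "r + 1 / (4 * real L) \<le> r'" "r' < 1 / real L" for r r'
    using that L' unfolding admissible_gap_def by (auto simp: add_divide_distrib)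
  have "0 \<le> M" using order_trans[OF sum_nonneg M[OF gap[of 0 "1 / (4 * real L)"]]] L' by (simp add: field_simps)
  show ?thesis
  proof (cases "1 / (4 * real L) \<le> \<xi>")
    case True
    then show ?thesis using M[OF gap[of 0 \<xi>]] \<xi> \<open>0 \<le> M\<close> by simp
  next
    case False
    \<comment> \<open>Three quarters of a cell: at least a quarter away from the left end and from
      every \<open>\<xi>\<close> below one half, and still inside the cell.\<close>
    let ?z = "3 / (4 * real L)"
    have z: "?z = 1 / (4 * real L) + 2 / (4 * real L)" "?z < 1 / real L" "1 / (4 * real L) \<le> ?z"
      using L' by (auto simp: field_simps)
    have "\<xi> < 2 / (4 * real L)" using False L' by (auto simp: field_simps)
    have 1: "(\<Sum>c<L. norm (h (real c / real L + ?z) - h (real c / real L + \<xi>))) \<le> M"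
      by (rule M[OF gap]) (use \<xi> z \<open>\<xi> < 2 / (4 * real L)\<close> in linarith)+
    have 2: "(\<Sum>c<L. norm (h (real c / real L + ?z) - h (real c / real L + 0))) \<le> M"
      by (rule M[OF gap]) (use z in linarith)+
    have "(\<Sum>c<L. norm (h (real c / real L + \<xi>) - h (real c / real L))) \<le>
      (\<Sum>c<L. norm (h (real c / real L + ?z) - h (real c / real L + 0)) + norm (h (real c / real L + ?z) - h (real c / real L + \<xi>)))"
    proof (rule sum_mono)
      fix c
      show "norm (h (real c / real L + \<xi>) - h (real c / real L)) \<le>
        norm (h (real c / real L + ?z) - h (real c / real L + 0)) + norm (h (real c / real L + ?z) - h (real c / real L + \<xi>))"
        using norm_triangle_ineq4[of "h (real c / real L + ?z) - h (real c / real L)" "h (real c / real L + ?z) - h (real c / real L + \<xi>)"]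
        by simp
    qed
    then show ?thesis using 1 2 by (simp add: sum.distrib)
  qed
qed

text \<open>As \<open>\<theta>\<close> has mean zero on every cell, the value of \<open>h\<close> at
  the left end can be subtracted there for free. All cells are moved onto the first one and the
  differences at a common offset are summed before integrating, so that \<open>M\<close> controls
  the whole sum at once.\<close>

lemma norm_integral_le_differences:
  fixes h \<theta> :: "real \<Rightarrow> complex"
  assumes L: "0 < L" and h: "integrable unit_lborel h"
    and \<theta>[measurable]: "\<theta> \<in> borel_measurable unit_lborel"
    and B: "\<And>x. 0 \<le> x \<Longrightarrow> x < 1 \<Longrightarrow> norm (\<theta> x) \<le> B"
    and mean: "\<And>c. c < L \<Longrightarrow> (\<integral>x. indicator {real c / real L..<(real c + 1) / real L} x *\<^sub>R \<theta> x \<partial>unit_lborel) = 0"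
    and M: "\<And>lo hi. admissible_gap L lo hi \<Longrightarrow> (\<Sum>c<L. norm (h (hi c) - h (lo c))) \<le> M"
  shows "norm (\<integral>x. h x * \<theta> x \<partial>unit_lborel) \<le> M * (2 * B / real L)"
proof -
  have L': "0 < real L" using L by simp
  have B0: "0 \<le> B" using order_trans[OF norm_ge_zero B[of 0]] by simp
  let ?I = "\<lambda>c::nat. {real c / real L..<(real c + 1) / real L}"
  have I: "x \<in> ?I c \<longleftrightarrow> \<lfloor>real L * x\<rfloor> = int c" for x c
    using mem_cell_iff[OF L', of x "int c"] by simp
  have ind: "indicator (?I c) x = (if \<lfloor>real L * x\<rfloor> = int c then 1 else 0 :: real)" for x c
    unfolding indicator_def I by simp
  have sub: "0 \<le> x \<and> x < 1" if "x \<in> ?I c" "c < L" for x c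
  proof -
    from that have "x < (real c + 1) / real L" "real c / real L \<le> x" by auto
    moreover have "(real c + 1) / real L \<le> 1" using that(2) by (simp add: field_simps)
    moreover have "0 \<le> real c / real L" by simp
    ultimately show ?thesis by linarith
  qed
  \<comment> \<open>Extension by zero gives integrals over the line, where moving a cell is an
    affine substitution.\<close>
  define h0 where "h0 x = indicator {0..<1} x *\<^sub>R h x" for x
  define \<theta>0 where "\<theta>0 x = indicator {0..<1} x *\<^sub>R \<theta> x" for x
  have h0: "integrable lborel h0"
    using h unfolding unit_lborel_def h0_def by (subst (asm) integrable_restrict_space) auto
  have [measurable]: "h0 \<in> borel_measurable borel" using h0 by auto
  have [measurable]: "\<theta>0 \<in> borel_measurable borel"
    using \<theta> unfolding unit_lborel_def \<theta>0_def by (subst (asm) borel_measurable_restrict_space_iff) auto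
  have \<theta>0B: "norm (\<theta>0 x) \<le> B" for x using B[of x] B0 by (auto simp: \<theta>0_def indicator_def)
  let ?J = "{0..<1 / real L}"
  let ?f = "\<lambda>c x. indicator ?J x *\<^sub>R ((h0 (real c / real L + x) - h0 (real c / real L)) * \<theta>0 (real c / real L + x))"
  have int0: "integrable lborel (\<lambda>x. indicator (?I c) x *\<^sub>R (h0 x * \<theta>0 x))" for c
  proof -
    have "integrable lborel (\<lambda>x. h0 x * (indicator (?I c) x *\<^sub>R \<theta>0 x))"
      by (rule integrable_bounded_mult[where B = B, OF h0]) (use \<theta>0B B0 in \<open>auto simp: indicator_def\<close>)
    then show ?thesis by simp
  qed
  have int1: "integrable lborel (\<lambda>x. indicator (?I c) x *\<^sub>R \<theta>0 x)" for c
    by (rule integrable_indicator_Ico) (use \<theta>0B in auto)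
  have intf: "integrable lborel (?f c)" and eqf: "(\<integral>x. indicator (?I c) x *\<^sub>R (h0 x * \<theta>0 x) \<partial>lborel) = (\<integral>x. ?f c x \<partial>lborel)"
    if c: "c < L" for c
  proof -
    have e: "indicator (?I c) (real c / real L + 1 * x) = (indicator ?J x :: real)" for x
      by (auto simp: indicator_def add_divide_distrib)
    have int2: "integrable lborel (\<lambda>x. indicator (?I c) x *\<^sub>R (h0 x * \<theta>0 x) - h0 (real c / real L) * (indicator (?I c) x *\<^sub>R \<theta>0 x))"
      by (intro Bochner_Integration.integrable_diff int0 integrable_mult_right int1)
    have feq: "?f c x = indicator (?I c) (real c / real L + 1 * x) *\<^sub>R (h0 (real c / real L + 1 * x) * \<theta>0 (real c / real L + 1 * x)) -
       h0 (real c / real L) * (indicator (?I c) (real c / real L + 1 * x) *\<^sub>R \<theta>0 (real c / real L + 1 * x))" for x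
      unfolding e by (simp add: algebra_simps)
    show "integrable lborel (?f c)"
      unfolding feq using lborel_integrable_real_affine[OF int2, of 1 "real c / real L"] by simp
    have "(\<integral>x. indicator (?I c) x *\<^sub>R \<theta>0 x \<partial>lborel) = (\<integral>x. indicator (?I c) x *\<^sub>R \<theta> x \<partial>unit_lborel)"
      unfolding integral_unit_lborel \<theta>0_def by (intro Bochner_Integration.integral_cong) auto
    also have "\<dots> = 0" by (rule mean[OF c])
    finally have "(\<integral>x. indicator (?I c) x *\<^sub>R \<theta>0 x \<partial>lborel) = 0" .
    then have "(\<integral>x. indicator (?I c) x *\<^sub>R (h0 x * \<theta>0 x) \<partial>lborel) =
      (\<integral>x. indicator (?I c) x *\<^sub>R (h0 x * \<theta>0 x) - h0 (real c / real L) * (indicator (?I c) x *\<^sub>R \<theta>0 x) \<partial>lborel)"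
      by (subst Bochner_Integration.integral_diff[OF int0 integrable_mult_right[OF int1]]) (simp only: integral_mult_right_zero mult_zero_right diff_zero)
    also have "\<dots> = (\<integral>x. ?f c x \<partial>lborel)"
      unfolding feq by (subst lborel_integral_real_affine[of 1 _ "real c / real L"]) simp_all
    finally show "(\<integral>x. indicator (?I c) x *\<^sub>R (h0 x * \<theta>0 x) \<partial>lborel) = (\<integral>x. ?f c x \<partial>lborel)" .
  qed
  have split: "indicator {0..<1} x *\<^sub>R (h x * \<theta> x) = (\<Sum>c<L. indicator (?I c) x *\<^sub>R (h0 x * \<theta>0 x))" for x
  proof (cases "0 \<le> x \<and> x < 1")
    case True
    then have f: "0 \<le> \<lfloor>real L * x\<rfloor>" "\<lfloor>real L * x\<rfloor> < int L" using L' by (simp_all add: floor_less_iff)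
    have "(\<Sum>c<L. indicator (?I c) x *\<^sub>R (h0 x * \<theta>0 x)) = (\<Sum>c<L. if c = nat \<lfloor>real L * x\<rfloor> then h0 x * \<theta>0 x else 0)"
      unfolding ind using f by (intro sum.cong refl) auto
    also have "\<dots> = h0 x * \<theta>0 x" using f by (simp add: nat_less_iff)
    finally show ?thesis using True by (simp add: h0_def \<theta>0_def)
  next
    case False
    then have "x \<notin> ?I c" if "c < L" for c using sub[OF _ that] by blast
    then have "(\<Sum>c<L. indicator (?I c) x *\<^sub>R (h0 x * \<theta>0 x)) = 0" by (intro sum.neutral) (auto simp: indicator_def)
    then show ?thesis using False by (auto simp: indicator_def)
  qed
  have "(\<integral>x. h x * \<theta> x \<partial>unit_lborel) = (\<Sum>c<L. \<integral>x. indicator (?I c) x *\<^sub>R (h0 x * \<theta>0 x) \<partial>lborel)"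
    unfolding integral_unit_lborel split by (rule Bochner_Integration.integral_sum[OF int0])
  also have "\<dots> = (\<Sum>c<L. \<integral>x. ?f c x \<partial>lborel)" by (intro sum.cong refl eqf) auto
  also have "\<dots> = (\<integral>x. (\<Sum>c<L. ?f c x) \<partial>lborel)"
    by (rule Bochner_Integration.integral_sum[symmetric]) (use intf in auto)
  finally have eq: "(\<integral>x. h x * \<theta> x \<partial>unit_lborel) = (\<integral>x. (\<Sum>c<L. ?f c x) \<partial>lborel)" .
  \<comment> \<open>For each offset x the sum over the cells is at most 2 M B, and x ranges over an
    interval of length 1 / L.\<close>
  have pw: "norm (\<Sum>c<L. ?f c x) \<le> indicator ?J x *\<^sub>R (2 * M * B)" for x
  proof (cases "x \<in> ?J")
    case True
    have "h0 (real c / real L + x) = h (real c / real L + x)" "h0 (real c / real L) = h (real c / real L)" if "c < L" for c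
    proof -
      have "real c / real L + x \<in> ?I c" "real c / real L \<in> ?I c" using True L' by (auto simp: add_divide_distrib)
      from this[THEN sub[OF _ that]] show "h0 (real c / real L + x) = h (real c / real L + x)" "h0 (real c / real L) = h (real c / real L)"
        by (auto simp: h0_def)
    qed
    then have fc: "norm (?f c x) \<le> norm (h (real c / real L + x) - h (real c / real L)) * B" if "c < L" for c
      using True that \<theta>0B[of "real c / real L + x"] by (simp add: norm_mult mult_left_mono)
    have "norm (\<Sum>c<L. ?f c x) \<le> (\<Sum>c<L. norm (h (real c / real L + x) - h (real c / real L)) * B)"
      by (rule sum_norm_le) (rule fc, simp)
    also have "\<dots> = (\<Sum>c<L. norm (h (real c / real L + x) - h (real c / real L))) * B" by (simp add: sum_distrib_right)
    also have "\<dots> \<le> 2 * M * B"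
      by (rule mult_right_mono[OF sum_differences_from_left_end[OF L M] B0]) (use True in auto)
    finally show ?thesis using True by (simp only: indicator_simps scaleR_one)
  next
    case False
    then have "indicator ?J x = (0 :: real)" by (rule indicator_simps)
    then show ?thesis by (simp only: scaleR_zero_left sum.neutral_const norm_zero order_refl)
  qed
  have "norm (\<integral>x. (\<Sum>c<L. ?f c x) \<partial>lborel) \<le> (\<integral>x. indicator ?J x *\<^sub>R (2 * M * B) \<partial>lborel)"
  proof (rule Bochner_Integration.integral_norm_bound_integral)
    show "integrable lborel (\<lambda>x. \<Sum>c<L. ?f c x)" by (rule Bochner_Integration.integrable_sum) (use intf in auto)
    show "integrable lborel (\<lambda>x. indicator ?J x *\<^sub>R (2 * M * B))"
      by (rule integrable_indicator_Ico[where B = "\<bar>2 * M * B\<bar>"]) auto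
  qed (rule pw)
  also have "\<dots> = M * (2 * B / real L)" using L' by simp
  finally show ?thesis unfolding eq .
qed

section \<open>Box differences in several variables\<close>

text \<open>The complex version is needed since the induction on the variables forms combinations
  with unimodular coefficients.\<close>

definition cbox_diff :: "nat set \<Rightarrow> ((nat \<Rightarrow> real) \<Rightarrow> complex) \<Rightarrow> (nat \<Rightarrow> real) \<times> (nat \<Rightarrow> real) \<Rightarrow> complex" where
  "cbox_diff u g J = (\<Sum>v\<in>Pow u. (-1) ^ card v * g (vertex u J v))"

lemma cbox_diff_of_real: "cbox_diff u (\<lambda>x. of_real (g x)) J = of_real (box_diff u g J)"
  by (simp add: cbox_diff_def box_diff_def)

lemma cbox_diff_empty [simp]: "cbox_diff {} g J = g (\<lambda>_. undefined)"
  by (simp add: cbox_diff_def vertex_def split_def restrict_def)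

text \<open>The subsets of \<open>insert i u\<close> split by membership of i, and those containing
  i carry one more sign, hence lower minus upper.\<close>

lemma cbox_diff_insert:
  assumes "finite u" "i \<notin> u"
  shows "cbox_diff (insert i u) g (x, y) =
     cbox_diff u (\<lambda>z. g (z(i := x i))) (x, y) - cbox_diff u (\<lambda>z. g (z(i := y i))) (x, y)"
proof -
  have 1: "vertex (insert i u) (x, y) v = (vertex u (x, y) v)(i := x i)" if "v \<subseteq> u" for v
    using that assms by (auto simp: vertex_def fun_eq_iff restrict_def)
  have 2: "vertex (insert i u) (x, y) (insert i v) = (vertex u (x, y) v)(i := y i)" if "v \<subseteq> u" for v
    using that assms by (auto simp: vertex_def fun_eq_iff restrict_def)
  have inj: "inj_on (insert i) (Pow u)" using assms by (auto simp: inj_on_def)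
  have "cbox_diff (insert i u) g (x, y) = (\<Sum>v\<in>Pow u. (-1) ^ card v * g (vertex (insert i u) (x, y) v)) +
      (\<Sum>v\<in>insert i ` Pow u. (-1) ^ card v * g (vertex (insert i u) (x, y) v))"
    unfolding cbox_diff_def Pow_insert by (rule sum.union_disjoint) (use assms in auto)
  also have "(\<Sum>v\<in>insert i ` Pow u. (-1) ^ card v * g (vertex (insert i u) (x, y) v)) =
      (\<Sum>v\<in>Pow u. (-1) ^ card (insert i v) * g (vertex (insert i u) (x, y) (insert i v)))"
    by (rule sum.reindex[unfolded o_def, OF inj])
  also have "\<dots> = (\<Sum>v\<in>Pow u. - ((-1) ^ card v * g ((vertex u (x, y) v)(i := y i))))"
  proof (rule sum.cong)
    fix v assume v: "v \<in> Pow u"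
    then have "finite v" "i \<notin> v" using assms finite_subset by auto
    then show "(-1) ^ card (insert i v) * g (vertex (insert i u) (x, y) (insert i v)) = - ((-1) ^ card v * g ((vertex u (x, y) v)(i := y i)))"
      using v 2 by simp
  qed simp
  also have "(\<Sum>v\<in>Pow u. (-1) ^ card v * g (vertex (insert i u) (x, y) v)) = (\<Sum>v\<in>Pow u. (-1) ^ card v * g ((vertex u (x, y) v)(i := x i)))"
    using 1 by (intro sum.cong) auto
  finally show ?thesis unfolding cbox_diff_def by (simp only: sum_negf diff_conv_add_uminus)
qed

lemma cbox_diff_cong: "(\<And>j. j \<in> u \<Longrightarrow> x j = x' j \<and> y j = y' j) \<Longrightarrow> cbox_diff u g (x, y) = cbox_diff u g (x', y')"
  unfolding cbox_diff_def vertex_def by (intro sum.cong refl arg_cong2[where f = "(*)"] arg_cong[where f = g]) (auto simp: restrict_def)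

lemma cbox_diff_diff: "cbox_diff u (\<lambda>z. f z - g z) J = cbox_diff u f J - cbox_diff u g J"
  by (simp add: cbox_diff_def sum_subtractf right_diff_distrib)

lemma cbox_diff_sum_mult: "cbox_diff u (\<lambda>z. \<Sum>c\<in>A. k c * f c z) J = (\<Sum>c\<in>A. k c * cbox_diff u (f c) J)"
  unfolding cbox_diff_def sum_distrib_left by (subst sum.swap) (simp add: mult_ac)

text \<open>The induction on the variables fixes coordinates at prescribed points, for which
  integrability of almost every section is not enough.\<close>

definition section_integrable :: "nat set \<Rightarrow> ((nat \<Rightarrow> real) \<Rightarrow> complex) \<Rightarrow> bool" where
  "section_integrable u g \<longleftrightarrow>
     (\<forall>w\<subseteq>u. \<forall>x\<in>cube w. integrable (unit_cube (u - w)) (\<lambda>y. g (merge w (u - w) (x, y))))"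

lemma section_integrableD:
  assumes "section_integrable u g"
  shows "integrable (unit_cube u) g"
proof -
  have "integrable (unit_cube u) (\<lambda>y. g (merge {} u (\<lambda>_. undefined, y)))"
    using assms unfolding section_integrable_def by (elim allE[of _ "{}"]) (auto simp: cube_def)
  moreover have "merge {} u (\<lambda>_. undefined, y) = y" if "y \<in> cube u" for y
    using that by (auto simp: merge_def cube_def PiE_def extensional_def)
  ultimately show ?thesis by (subst Bochner_Integration.integrable_cong[OF refl, where g = "\<lambda>y. g (merge {} u (\<lambda>_. undefined, y))"]) auto
qed

lemma section_integrable_upd:
  assumes g: "section_integrable (insert i u) g" and i: "i \<notin> u" and t: "0 \<le> t" "t < 1"
  shows "section_integrable u (\<lambda>z. g (z(i := t)))"
  unfolding section_integrable_def
proof (intro allI impI ballI)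
  fix w x assume w: "w \<subseteq> u" and x: "x \<in> cube w"
  have "x(i := t) \<in> cube (insert i w)" using x t by (auto simp: cube_def PiE_def extensional_def Pi_def)
  moreover have "insert i u - insert i w = u - w" using i by auto
  ultimately have "integrable (unit_cube (u - w)) (\<lambda>y. g (merge (insert i w) (u - w) (x(i := t), y)))"
    using g w unfolding section_integrable_def by (elim allE[of _ "insert i w"]) auto
  moreover have "merge (insert i w) (u - w) (x(i := t), y) = (merge w (u - w) (x, y))(i := t)" for y
    using i w by (auto simp: merge_def fun_eq_iff)
  ultimately show "integrable (unit_cube (u - w)) (\<lambda>y. g ((merge w (u - w) (x, y))(i := t)))" by simp
qed

lemma section_integrable_sum:
  assumes "\<And>c. c \<in> A \<Longrightarrow> section_integrable u (f c)"
  shows "section_integrable u (\<lambda>z. \<Sum>c\<in>A. k c * f c z)"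
  using assms unfolding section_integrable_def
  by (intro allI impI ballI Bochner_Integration.integrable_sum integrable_mult_right) blast

lemma section_integrable_diff:
  assumes "section_integrable u f" "section_integrable u g"
  shows "section_integrable u (\<lambda>z. f z - g z)"
  using assms unfolding section_integrable_def
  by (intro allI impI ballI Bochner_Integration.integrable_diff) auto

lemma cnj_sgn_mult_self: "cnj (sgn z) * z = of_real (cmod z)"
proof (cases "z = 0")
  case False
  have "cnj (sgn z) * z = cnj z * z / of_real (cmod z)" by (simp add: sgn_eq)
  also have "cnj z * z = of_real (cmod z) * of_real (cmod z)"
    using complex_norm_square[of z] by (simp only: power2_eq_square mult.commute of_real_mult)
  finally show ?thesis using False by simp
qed simp

text \<open>
  Unimodular factors turn the sum over cells of norms of differences in one variable into the norm of
  a single integral, to which the induction hypothesis for the remaining variables applies.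
\<close>

lemma norm_integral_le_box_differences:
  assumes "finite u" "section_integrable u g"
    and "\<And>j. j \<in> u \<Longrightarrow> 0 < L j"
    and "\<And>j. j \<in> u \<Longrightarrow> \<theta> j \<in> borel_measurable unit_lborel"
    and "\<And>j x. j \<in> u \<Longrightarrow> 0 \<le> x \<Longrightarrow> x < 1 \<Longrightarrow> norm (\<theta> j x) \<le> B j"
    and "\<And>j c. j \<in> u \<Longrightarrow> c < L j \<Longrightarrow>
        (\<integral>x. indicator {real c / real (L j)..<(real c + 1) / real (L j)} x *\<^sub>R \<theta> j x \<partial>unit_lborel) = 0"
    and "\<And>lo hi. (\<And>j. j \<in> u \<Longrightarrow> admissible_gap (L j) (lo j) (hi j)) \<Longrightarrow>
        (\<Sum>c\<in>Pi\<^sub>E u (\<lambda>j. {..<L j}). norm (cbox_diff u g (\<lambda>j. lo j (c j), \<lambda>j. hi j (c j)))) \<le> M"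
  shows "norm (\<integral>x. g x * (\<Prod>j\<in>u. \<theta> j (x j)) \<partial>unit_cube u) \<le> M * (\<Prod>j\<in>u. 2 * B j / real (L j))"
  using assms
proof (induction u arbitrary: g M rule: finite_induct)
  case empty
  then show ?case using empty.prems(6)[of "\<lambda>_ _. 0" "\<lambda>_ _. 0"] by (simp add: integral_unit_cube_empty)
next
  case (insert i u g M)
  let ?W = "\<lambda>z. \<Prod>j\<in>u. \<theta> j (z j)"
  have W: "?W \<in> borel_measurable (unit_cube u)" "\<And>z. z \<in> cube u \<Longrightarrow> norm (?W z) \<le> (\<Prod>j\<in>u. B j)"
    by (rule measurable_prod_coordinates norm_prod_coordinates_le; use insert.prems in auto)+
  have W': "(\<lambda>x. \<Prod>j\<in>insert i u. \<theta> j (x j)) \<in> borel_measurable (unit_cube (insert i u))"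
    "\<And>z. z \<in> cube (insert i u) \<Longrightarrow> norm (\<Prod>j\<in>insert i u. \<theta> j (z j)) \<le> (\<Prod>j\<in>insert i u. B j)"
    by (rule measurable_prod_coordinates norm_prod_coordinates_le; use insert.prems in auto)+
  have W'': "(\<lambda>x. ?W x) \<in> borel_measurable (unit_cube (insert i u))"
    "\<And>z. z \<in> cube (insert i u) \<Longrightarrow> norm (?W z) \<le> (\<Prod>j\<in>u. B j)"
    by (rule measurable_prod_coordinates norm_prod_coordinates_le; use insert.prems in auto)+
  have gint: "integrable (unit_cube (insert i u)) g" by (rule section_integrableD) fact
  \<comment> \<open>All variables except i are integrated out. The one-variable estimate is applied
    to \<open>h\<close>, and its hypothesis on the differences of \<open>h\<close> comes from the
    induction hypothesis.\<close>
  define h where "h x = (\<integral>z. g (z(i := x)) * ?W z \<partial>unit_cube u)" for x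
  have upd: "(\<Prod>j\<in>insert i u. \<theta> j ((z(i := x)) j)) = \<theta> i x * ?W z" "?W (z(i := x)) = ?W z" for z x
    using insert.hyps by (auto simp: intro!: prod.cong)
  have int1: "integrable (unit_cube (insert i u)) (\<lambda>x. g x * (\<Prod>j\<in>insert i u. \<theta> j (x j)))"
    by (rule integrable_bounded_mult[OF gint W'(1)]) (use W'(2) in auto)
  have int2: "integrable (unit_cube (insert i u)) (\<lambda>x. g x * ?W x)"
    by (rule integrable_bounded_mult[OF gint W''(1)]) (use W''(2) in auto)
  have hint: "integrable unit_lborel h"
    using integrable_unit_cube_insert[OF int2] unfolding upd h_def .
  have "(\<integral>x. g x * (\<Prod>j\<in>insert i u. \<theta> j (x j)) \<partial>unit_cube (insert i u)) =
     (\<integral>x. (\<integral>z. g (z(i := x)) * (\<theta> i x * ?W z) \<partial>unit_cube u) \<partial>unit_lborel)"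
    using integral_unit_cube_insert[OF int1] unfolding upd .
  also have "\<dots> = (\<integral>x. h x * \<theta> i x \<partial>unit_lborel)"
  proof (rule Bochner_Integration.integral_cong[OF refl])
    fix x
    have "(\<integral>z. g (z(i := x)) * (\<theta> i x * ?W z) \<partial>unit_cube u) = (\<integral>z. (g (z(i := x)) * ?W z) * \<theta> i x \<partial>unit_cube u)"
      by (simp add: mult_ac)
    then show "(\<integral>z. g (z(i := x)) * (\<theta> i x * ?W z) \<partial>unit_cube u) = h x * \<theta> i x"
      unfolding h_def by (simp only: integral_mult_left_zero)
  qed
  finally have eq: "(\<integral>x. g x * (\<Prod>j\<in>insert i u. \<theta> j (x j)) \<partial>unit_cube (insert i u)) = (\<integral>x. h x * \<theta> i x \<partial>unit_lborel)" .
  have "norm (\<integral>x. h x * \<theta> i x \<partial>unit_lborel) \<le> (M * (\<Prod>j\<in>u. 2 * B j / real (L j))) * (2 * B i / real (L i))"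
  proof (rule norm_integral_le_differences)
    fix lo hi assume gap: "admissible_gap (L i) lo hi"
    have Li: "0 < real (L i)" using insert.prems(2) by simp
    have bd: "0 \<le> lo c" "lo c < 1" "0 \<le> hi c" "hi c < 1" if "c < L i" for c
    proof -
      have "real c / real (L i) \<le> lo c" "lo c + 1 / (4 * real (L i)) \<le> hi c" "hi c < (real c + 1) / real (L i)"
        using gap that unfolding admissible_gap_def by auto
      moreover have "(real c + 1) / real (L i) \<le> 1" using that by (simp add: field_simps)
      moreover have "0 \<le> real c / real (L i)" "0 < 1 / (4 * real (L i))" using Li by simp_all
      ultimately show "0 \<le> lo c" "lo c < 1" "0 \<le> hi c" "hi c < 1" by linarith+
    qed
    define \<sigma> where "\<sigma> c = cnj (sgn (h (hi c) - h (lo c)))" for c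
    have \<sigma>: "\<sigma> c * (h (hi c) - h (lo c)) = of_real (norm (h (hi c) - h (lo c)))" for c
      unfolding \<sigma>_def by (rule cnj_sgn_mult_self)
    have \<sigma>1: "norm (\<sigma> c) \<le> 1" for c unfolding \<sigma>_def by (simp add: norm_sgn)
    define g' where "g' z = (\<Sum>c<L i. \<sigma> c * (g (z(i := hi c)) - g (z(i := lo c))))" for z
    have si: "section_integrable u (\<lambda>z. g (z(i := hi c)) - g (z(i := lo c)))" if "c < L i" for c
      by (intro section_integrable_diff section_integrable_upd insert.prems insert.hyps bd that)
    have g': "section_integrable u g'"
      unfolding g'_def by (rule section_integrable_sum) (use si in auto)
    have ints: "integrable (unit_cube u) (\<lambda>z. g (z(i := t)) * ?W z)" if "0 \<le> t" "t < 1" for t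
      by (rule integrable_bounded_mult[OF section_integrableD[OF section_integrable_upd[OF insert.prems(1) insert.hyps(2) that]] W(1)])
        (rule W(2), simp)
    have "(\<integral>z. g' z * ?W z \<partial>unit_cube u) = (\<integral>z. (\<Sum>c<L i. \<sigma> c * (g (z(i := hi c)) * ?W z - g (z(i := lo c)) * ?W z)) \<partial>unit_cube u)"
      unfolding g'_def by (simp only: sum_distrib_right mult.assoc left_diff_distrib)
    also have "\<dots> = (\<Sum>c<L i. \<integral>z. \<sigma> c * (g (z(i := hi c)) * ?W z - g (z(i := lo c)) * ?W z) \<partial>unit_cube u)"
      by (rule Bochner_Integration.integral_sum) (intro integrable_mult_right Bochner_Integration.integrable_diff ints bd; simp)
    also have "\<dots> = (\<Sum>c<L i. \<sigma> c * (h (hi c) - h (lo c)))"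
    proof (rule sum.cong[OF refl])
      fix c assume "c \<in> {..<L i}"
      then have c: "c < L i" by simp
      show "(\<integral>z. \<sigma> c * (g (z(i := hi c)) * ?W z - g (z(i := lo c)) * ?W z) \<partial>unit_cube u) = \<sigma> c * (h (hi c) - h (lo c))"
        unfolding h_def integral_mult_right_zero Bochner_Integration.integral_diff[OF ints[OF bd(3,4)[OF c]] ints[OF bd(1,2)[OF c]]] ..
    qed
    also have "\<dots> = of_real (\<Sum>c<L i. norm (h (hi c) - h (lo c)))" unfolding \<sigma> by simp
    finally have "(\<Sum>c<L i. norm (h (hi c) - h (lo c))) \<le> norm (\<integral>z. g' z * ?W z \<partial>unit_cube u)"
      by (simp only: norm_of_real abs_ge_self)
    also have "\<dots> \<le> M * (\<Prod>j\<in>u. 2 * B j / real (L j))"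
    proof (rule insert.IH[OF g'])
      fix lo' hi' assume gap': "\<And>j. j \<in> u \<Longrightarrow> admissible_gap (L j) (lo' j) (hi' j)"
      let ?lo = "lo'(i := lo)" and ?hi = "hi'(i := hi)"
      \<comment> \<open>A box difference of \<open>g'\<close> over u is a combination, with
        coefficients of norm at most 1, of box differences of \<open>g\<close> over all variables,
        one for each cell in direction i. So the same \<open>M\<close> serves for
        \<open>g'\<close>.\<close>
      have cd: "cbox_diff u g' (\<lambda>j. lo' j (c j), \<lambda>j. hi' j (c j)) =
         (\<Sum>b<L i. - \<sigma> b * cbox_diff (insert i u) g (\<lambda>j. ?lo j ((c(i := b)) j), \<lambda>j. ?hi j ((c(i := b)) j)))" for c
      proof -
        have e: "cbox_diff u G (\<lambda>j. ?lo j ((c(i := b)) j), \<lambda>j. ?hi j ((c(i := b)) j)) =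
            cbox_diff u G (\<lambda>j. lo' j (c j), \<lambda>j. hi' j (c j))" for G b
          by (rule cbox_diff_cong) (use insert.hyps in auto)
        have "cbox_diff (insert i u) g (\<lambda>j. ?lo j ((c(i := b)) j), \<lambda>j. ?hi j ((c(i := b)) j)) =
           - cbox_diff u (\<lambda>z. g (z(i := hi b)) - g (z(i := lo b))) (\<lambda>j. lo' j (c j), \<lambda>j. hi' j (c j))" for b
          unfolding cbox_diff_insert[OF insert.hyps] cbox_diff_diff e by simp
        then show ?thesis unfolding g'_def cbox_diff_sum_mult by simp
      qed
      have "(\<Sum>c\<in>Pi\<^sub>E u (\<lambda>j. {..<L j}). norm (cbox_diff u g' (\<lambda>j. lo' j (c j), \<lambda>j. hi' j (c j)))) \<le>
        (\<Sum>c\<in>Pi\<^sub>E u (\<lambda>j. {..<L j}). \<Sum>b<L i. norm (cbox_diff (insert i u) g (\<lambda>j. ?lo j ((c(i := b)) j), \<lambda>j. ?hi j ((c(i := b)) j))))"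
        unfolding cd
      proof (intro sum_mono sum_norm_le)
        fix c b
        show "norm (- \<sigma> b * cbox_diff (insert i u) g (\<lambda>j. ?lo j ((c(i := b)) j), \<lambda>j. ?hi j ((c(i := b)) j))) \<le>
          norm (cbox_diff (insert i u) g (\<lambda>j. ?lo j ((c(i := b)) j), \<lambda>j. ?hi j ((c(i := b)) j)))"
          using \<sigma>1[of b] by (simp only: norm_mult norm_minus_cancel mult_left_le_one_le norm_ge_zero)
      qed
      also have "\<dots> = (\<Sum>c\<in>Pi\<^sub>E (insert i u) (\<lambda>j. {..<L j}). norm (cbox_diff (insert i u) g (\<lambda>j. ?lo j (c j), \<lambda>j. ?hi j (c j))))"
        unfolding sum_PiE_insert[OF insert.hyps(2)] by (rule sum.swap)
      also have "\<dots> \<le> M" by (rule insert.prems(6)) (use gap gap' insert.hyps in auto)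
      finally show "(\<Sum>c\<in>Pi\<^sub>E u (\<lambda>j. {..<L j}). norm (cbox_diff u g' (\<lambda>j. lo' j (c j), \<lambda>j. hi' j (c j)))) \<le> M" .
    qed (use insert.prems in auto)
    finally show "(\<Sum>c<L i. norm (h (hi c) - h (lo c))) \<le> M * (\<Prod>j\<in>u. 2 * B j / real (L j))" .
  qed (use insert.prems hint in auto)
  then show ?case unfolding eq using insert.hyps by (simp add: mult_ac)
qed

section \<open>Generalized Vitali variation\<close>

text \<open>After division by the right-hand side, Young's inequality is applied to each term; total
  weight below 1 is harmless because it enters with the nonnegative factor 1 - 1/p.\<close>

lemma sum_le_power_mean:
  fixes a v :: "'i \<Rightarrow> real"
  assumes S: "finite S" and v: "\<And>i. i \<in> S \<Longrightarrow> 0 \<le> v i" and a: "\<And>i. i \<in> S \<Longrightarrow> 0 \<le> a i"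
    and v1: "sum v S \<le> 1" and p: "1 \<le> p"
  shows "(\<Sum>i\<in>S. v i * a i) \<le> (\<Sum>i\<in>S. v i * a i powr p) powr (1 / p)"
proof -
  define X where "X = (\<Sum>i\<in>S. v i * a i powr p)"
  have X0: "0 \<le> X" unfolding X_def by (intro sum_nonneg mult_nonneg_nonneg v) auto
  show ?thesis
  proof (cases "X = 0")
    case True
    have "v i * a i powr p = 0" if "i \<in> S" for i
      using sum_nonneg_0[OF S _ True[unfolded X_def] that] v by simp
    then have "v i * a i = 0" if "i \<in> S" for i using that by fastforce
    then show ?thesis using True unfolding X_def by simp
  next
    case False
    define Y where "Y = X powr (1 / p)"
    have Y: "0 < Y" "Y powr p = X" using False X0 p by (auto simp: Y_def powr_powr)
    \<comment> \<open>The weighted inequality of arithmetic and geometric means for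
      \<open>t powr p\<close> and 1, with weights 1/p and 1 - 1/p.\<close>
    have young: "t \<le> (1 - 1 / p) + t powr p / p" if "0 \<le> t" for t
    proof (cases "t = 0")
      case True
      then show ?thesis using p by simp
    next
      case False
      then show ?thesis using Youngs_inequality_0[of "1 / p" "1 - 1 / p" "t powr p" 1] that p by (simp add: powr_powr)
    qed
    have "(\<Sum>i\<in>S. v i * a i) / Y = (\<Sum>i\<in>S. v i * (a i / Y))" by (simp add: sum_divide_distrib)
    also have "\<dots> \<le> (\<Sum>i\<in>S. v i * ((1 - 1 / p) + (a i / Y) powr p / p))"
      using Y a v by (intro sum_mono mult_left_mono young) auto
    also have "\<dots> = (\<Sum>i\<in>S. v i * (1 - 1 / p) + v i * a i powr p / (X * p))"
      using a Y by (intro sum.cong refl) (simp add: powr_divide algebra_simps)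
    also have "\<dots> = (1 - 1 / p) * sum v S + X / (X * p)"
    proof -
      have "(\<Sum>i\<in>S. v i * (1 - 1 / p)) = (1 - 1 / p) * sum v S"
        by (simp only: sum_distrib_right[symmetric] mult.commute)
      moreover have "(\<Sum>i\<in>S. v i * a i powr p / (X * p)) = X / (X * p)"
        unfolding sum_divide_distrib[symmetric] X_def ..
      ultimately show ?thesis by (simp only: sum.distrib)
    qed
    also have "\<dots> \<le> (1 - 1 / p) * 1 + X / (X * p)"
      using p v1 by (intro add_right_mono mult_left_mono) auto
    also have "\<dots> = 1" using False p by simp
    finally show ?thesis using Y(1) unfolding Y_def X_def by (simp add: divide_le_eq)
  qed
qed

lemma admissible_gapD:
  assumes "admissible_gap L lo hi" "c < L"
  shows "real c / real L \<le> lo c" "lo c + 1 / (4 * real L) \<le> hi c" "hi c < real c / real L + 1 / real L"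
    "lo c < hi c" "real c / real L + 1 / real L \<le> 1"
proof -
  have *: "(real c + 1) / real L = real c / real L + 1 / real L" for c by (rule add_divide_distrib)
  show "real c / real L \<le> lo c" and 1: "lo c + 1 / (4 * real L) \<le> hi c" and "hi c < real c / real L + 1 / real L"
    using assms unfolding admissible_gap_def * by auto
  have "0 < 1 / (4 * real L)" using assms(2) by simp
  with 1 show "lo c < hi c" by linarith
  have "(real c + 1) / real L \<le> 1" using assms(2) by (simp add: divide_le_eq)
  then show "real c / real L + 1 / real L \<le> 1" unfolding * .
qed

section \<open>Partitions of the cube that contain prescribed boxes\<close>

text \<open>Each cell is cut at \<open>lo c\<close> and \<open>hi c\<close>. The condition on the
  end points removes the first piece when \<open>lo c\<close> is the left end of the cell, since
  boxes of a partition must not be degenerate.\<close>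

definition cell_intervals :: "nat \<Rightarrow> (nat \<Rightarrow> real) \<Rightarrow> (nat \<Rightarrow> real) \<Rightarrow> (real \<times> real) set" where
  "cell_intervals L lo hi = (\<Union>c<L. {I \<in> {(real c / real L, lo c), (lo c, hi c), (hi c, (real c + 1) / real L)}. fst I < snd I})"

lemma cell_intervals_cell:
  assumes "admissible_gap L lo hi" "0 < L"
    and "x \<in> {fst I..<snd I}" "c < L" "I \<in> {(real c / real L, lo c), (lo c, hi c), (hi c, (real c + 1) / real L)}"
  shows "\<lfloor>real L * x\<rfloor> = int c"
proof -
  have L: "0 < 1 / (4 * real L)" using assms(2) by simp
  have "real c / real L \<le> lo c" "lo c + 1 / (4 * real L) \<le> hi c" "hi c < (real c + 1) / real L"
    using assms(1,4) unfolding admissible_gap_def by auto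
  moreover from this L have "lo c < hi c" by linarith
  ultimately have "real c / real L \<le> fst I" "snd I \<le> (real c + 1) / real L"
    using assms(5) by (elim insertE emptyE; simp)+
  with assms(3) have "x \<in> {of_int (int c) / real L..<(of_int (int c) + 1) / real L}" by simp
  moreover have "0 < real L" using assms(2) by simp
  ultimately show ?thesis using mem_cell_iff[of "real L" x "int c"] by blast
qed

lemma cell_intervals_disjoint:
  assumes gap: "admissible_gap L lo hi" and L: "0 < L" and I: "I \<in> cell_intervals L lo hi" "J \<in> cell_intervals L lo hi"
    and x: "x \<in> {fst I..<snd I}" "x \<in> {fst J..<snd J}"
  shows "I = J"
proof -
  obtain c where c: "c < L" "I \<in> {(real c / real L, lo c), (lo c, hi c), (hi c, (real c + 1) / real L)}"
    using I(1) unfolding cell_intervals_def by auto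
  obtain d where d: "d < L" "J \<in> {(real d / real L, lo d), (lo d, hi d), (hi d, (real d + 1) / real L)}"
    using I(2) unfolding cell_intervals_def by auto
  have "c = d" using cell_intervals_cell[OF gap L x(1) c] cell_intervals_cell[OF gap L x(2) d] by simp
  with c d x admissible_gapD(4)[OF gap c(1)] show ?thesis by auto
qed

lemma cell_intervals_cover:
  assumes gap: "admissible_gap L lo hi" and L: "0 < L" and x: "0 \<le> x" "x < 1"
  shows "\<exists>I\<in>cell_intervals L lo hi. x \<in> {fst I..<snd I}"
proof -
  define c where "c = nat \<lfloor>real L * x\<rfloor>"
  have f: "0 \<le> \<lfloor>real L * x\<rfloor>" "\<lfloor>real L * x\<rfloor> < int L" using L x by (simp_all add: floor_less_iff)
  then have c: "c < L" "int c = \<lfloor>real L * x\<rfloor>" by (auto simp: c_def nat_less_iff)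
  have xc: "real c / real L \<le> x" "x < (real c + 1) / real L"
  proof -
    have "0 < real L" using L by simp
    from iffD2[OF mem_cell_iff[OF this] c(2)[symmetric]]
    show "real c / real L \<le> x" "x < (real c + 1) / real L" by simp_all
  qed
  consider "x < lo c" | "lo c \<le> x" "x < hi c" | "hi c \<le> x" by linarith
  then obtain I where "I \<in> {(real c / real L, lo c), (lo c, hi c), (hi c, (real c + 1) / real L)}" "x \<in> {fst I..<snd I}"
  proof cases
    case 1 then show ?thesis using that[of "(real c / real L, lo c)"] xc by auto
  next
    case 2 then show ?thesis using that[of "(lo c, hi c)"] xc by auto
  next
    case 3 then show ?thesis using that[of "(hi c, (real c + 1) / real L)"] xc by auto
  qed
  then show ?thesis using c(1) unfolding cell_intervals_def by fastforce
qed

lemma cell_intervals_subset: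
  assumes gap: "admissible_gap L lo hi" and L: "0 < L" and I: "I \<in> cell_intervals L lo hi" and x: "x \<in> {fst I..<snd I}"
  shows "0 \<le> x \<and> x < 1"
proof -
  obtain c where c: "c < L" "I \<in> {(real c / real L, lo c), (lo c, hi c), (hi c, (real c + 1) / real L)}"
    using I unfolding cell_intervals_def by auto
  have "\<lfloor>real L * x\<rfloor> = int c" by (rule cell_intervals_cell[OF gap L x c])
  then have "0 \<le> \<lfloor>real L * x\<rfloor>" "\<lfloor>real L * x\<rfloor> < int L" using c by auto
  then have "0 \<le> real L * x" "real L * x < real L" by (simp_all add: floor_less_iff)
  then show ?thesis using L by (simp add: zero_le_mult_iff)
qed

text \<open>Converts one interval per coordinate into a pair of corners. It is injective, so
  different choices of intervals remain different boxes.\<close>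

definition boxes :: "(nat \<Rightarrow> real \<times> real) \<Rightarrow> (nat \<Rightarrow> real) \<times> (nat \<Rightarrow> real)" where
  "boxes p = (\<lambda>j. fst (p j), \<lambda>j. snd (p j))"

lemma inj_boxes: "inj boxes"
  by (rule injI) (auto simp: boxes_def fun_eq_iff prod_eq_iff)

lemma box_set_boxes: "box_set u (boxes p) = (\<Pi>\<^sub>E j\<in>u. {fst (p j)..<snd (p j)})"
  by (simp add: box_set_def boxes_def)

lemma box_partition_cell_intervals:
  assumes u: "finite u" and L: "\<And>j. j \<in> u \<Longrightarrow> 0 < L j" and gap: "\<And>j. j \<in> u \<Longrightarrow> admissible_gap (L j) (lo j) (hi j)"
  shows "box_partition u (boxes ` (\<Pi>\<^sub>E j\<in>u. cell_intervals (L j) (lo j) (hi j)))"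
proof -
  let ?Q = "\<lambda>j. cell_intervals (L j) (lo j) (hi j)"
  have fin: "finite (?Q j)" for j by (simp add: cell_intervals_def)
  have pos: "fst I < snd I" if "I \<in> ?Q j" for I j using that by (auto simp: cell_intervals_def)
  have 1: "finite (boxes ` (\<Pi>\<^sub>E j\<in>u. ?Q j))" by (intro finite_imageI finite_PiE u fin)
  have 2: "\<forall>(x, y)\<in>boxes ` (\<Pi>\<^sub>E j\<in>u. ?Q j). \<forall>j\<in>u. x j < y j"
    using pos by (auto simp: boxes_def dest: PiE_mem)
  have 3: "disjoint_family_on (box_set u) (boxes ` (\<Pi>\<^sub>E j\<in>u. ?Q j))"
    unfolding disjoint_family_on_def
  proof (intro ballI impI)
    fix J J' assume J: "J \<in> boxes ` (\<Pi>\<^sub>E j\<in>u. ?Q j)" "J' \<in> boxes ` (\<Pi>\<^sub>E j\<in>u. ?Q j)" "J \<noteq> J'"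
    then obtain p p' where p: "p \<in> (\<Pi>\<^sub>E j\<in>u. ?Q j)" "J = boxes p" "p' \<in> (\<Pi>\<^sub>E j\<in>u. ?Q j)" "J' = boxes p'" by blast
    show "box_set u J \<inter> box_set u J' = {}"
    proof (rule ccontr)
      assume "box_set u J \<inter> box_set u J' \<noteq> {}"
      then obtain x where x: "x \<in> box_set u J" "x \<in> box_set u J'" by blast
      have "p j = p' j" if j: "j \<in> u" for j
        by (rule cell_intervals_disjoint[OF gap[OF j] L[OF j] PiE_mem[OF p(1) j] PiE_mem[OF p(3) j]
              PiE_mem[OF x(1)[unfolded p(2) box_set_boxes] j] PiE_mem[OF x(2)[unfolded p(4) box_set_boxes] j]])
      then have "p = p'" by (rule PiE_ext[OF p(1,3)])
      with p J(3) show False by simp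
    qed
  qed
  have 4: "(\<Union>J\<in>boxes ` (\<Pi>\<^sub>E j\<in>u. ?Q j). box_set u J) = cube u"
  proof (rule subset_antisym; rule subsetI)
    fix x assume "x \<in> (\<Union>J\<in>boxes ` (\<Pi>\<^sub>E j\<in>u. ?Q j). box_set u J)"
    then obtain p where p: "p \<in> (\<Pi>\<^sub>E j\<in>u. ?Q j)" "x \<in> (\<Pi>\<^sub>E j\<in>u. {fst (p j)..<snd (p j)})" by (auto simp: box_set_boxes)
    have "0 \<le> x j \<and> x j < 1" if j: "j \<in> u" for j
      by (rule cell_intervals_subset[OF gap[OF j] L[OF j] PiE_mem[OF p(1) j] PiE_mem[OF p(2) j]])
    moreover have "x \<in> extensional u" using p(2) by (simp add: PiE_def)
    ultimately show "x \<in> cube u" by (auto simp: cube_def PiE_def)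
  next
    fix x assume x: "x \<in> cube u"
    then have "\<exists>I. I \<in> ?Q j \<and> x j \<in> {fst I..<snd I}" if j: "j \<in> u" for j
      using cell_intervals_cover[OF gap[OF j] L[OF j], of "x j"] j unfolding cube_def by (fastforce dest: PiE_mem)
    then have "\<forall>j\<in>u. \<exists>I. I \<in> ?Q j \<and> x j \<in> {fst I..<snd I}" by blast
    from bchoice[OF this] obtain I where I: "\<And>j. j \<in> u \<Longrightarrow> I j \<in> ?Q j \<and> x j \<in> {fst (I j)..<snd (I j)}" by blast
    have "restrict I u \<in> (\<Pi>\<^sub>E j\<in>u. ?Q j)" using I by (simp add: restrict_PiE_iff)
    moreover have "x \<in> box_set u (boxes (restrict I u))"
      using I x unfolding box_set_boxes by (auto simp: cube_def PiE_def)
    ultimately show "x \<in> (\<Union>J\<in>boxes ` (\<Pi>\<^sub>E j\<in>u. ?Q j). box_set u J)" by blast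
  qed
  show ?thesis unfolding box_partition_def using 1 2 3 4 by blast
qed

text \<open>The prescribed boxes belong to a partition, and each has volume at least the product of
  the 1 / (4 L j). Hence the factor vol^(1 - lam) can be inserted at the cost of the product of the
  4 L j to the power 1 - lam, which turns each difference into a volume-weighted quotient of the
  variation. Their total volume is at most 1, so the power mean inequality raises the sum to the
  exponent p.\<close>

lemma box_differences_le_vitali:
  assumes u: "finite u" and lam: "0 < lam" "lam \<le> 1" and p: "1 \<le> p"
    and V: "vitali_variation lam p u g < \<infinity>"
    and L: "\<And>j. j \<in> u \<Longrightarrow> 0 < L j" and gap: "\<And>j. j \<in> u \<Longrightarrow> admissible_gap (L j) (lo j) (hi j)"
  shows "(\<Sum>c\<in>Pi\<^sub>E u (\<lambda>j. {..<L j}). \<bar>box_diff u g (\<lambda>j. lo j (c j), \<lambda>j. hi j (c j))\<bar>) \<le>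
     (\<Prod>j\<in>u. 4 * real (L j)) powr (1 - lam) * enn2real (vitali_variation lam p u g)"
proof -
  let ?C = "Pi\<^sub>E u (\<lambda>j. {..<L j})"
  define pc where "pc c = (\<lambda>j\<in>u. (lo j (c j), hi j (c j)))" for c
  let ?P = "boxes ` (\<Pi>\<^sub>E j\<in>u. cell_intervals (L j) (lo j) (hi j))"
  let ?S = "(\<lambda>c. boxes (pc c)) ` ?C"
  let ?P' = "{J \<in> ?P. \<forall>v\<in>Pow u. vertex u J v \<in> cube u}"
  have finC: "finite ?C" using u by (intro finite_PiE) auto
  note gapD = admissible_gapD[OF gap]
  have pcQ: "pc c \<in> (\<Pi>\<^sub>E j\<in>u. cell_intervals (L j) (lo j) (hi j))" if c: "c \<in> ?C" for c
    unfolding pc_def restrict_PiE_iff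
  proof
    fix j assume j: "j \<in> u"
    then have "c j < L j" using c by auto
    then show "(lo j (c j), hi j (c j)) \<in> cell_intervals (L j) (lo j) (hi j)"
      using gapD(4)[OF j] unfolding cell_intervals_def by (intro UN_I[of "c j"]) simp_all
  qed
  \<comment> \<open>The lower corner of a box determines the cell in every coordinate.\<close>
  have inj: "inj_on (\<lambda>c. boxes (pc c)) ?C"
  proof (rule inj_onI)
    fix c d assume c: "c \<in> ?C" and d: "d \<in> ?C" and e: "boxes (pc c) = boxes (pc d)"
    have pe: "pc c = pc d" using e inj_boxes by (simp add: inj_eq)
    show "c = d"
    proof (rule PiE_ext[OF c d])
      fix j assume j: "j \<in> u"
      then have cj: "c j < L j" "d j < L j" using c d by auto
      have l: "lo j (c j) = lo j (d j)" using fun_cong[OF pe, of j] j by (simp add: pc_def)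
      have f1: "\<lfloor>real (L j) * lo j (c j)\<rfloor> = int (c j)"
        by (rule cell_intervals_cell[OF gap[OF j] L[OF j], of _ "(lo j (c j), hi j (c j))"])
          (use gapD(4)[OF j cj(1)] cj in auto)
      have f2: "\<lfloor>real (L j) * lo j (d j)\<rfloor> = int (d j)"
        by (rule cell_intervals_cell[OF gap[OF j] L[OF j], of _ "(lo j (d j), hi j (d j))"])
          (use gapD(4)[OF j cj(2)] cj in auto)
      show "c j = d j" using f1[unfolded l] f2 by linarith
    qed
  qed
  have bd: "box_diff u g (boxes (pc c)) = box_diff u g (\<lambda>j. lo j (c j), \<lambda>j. hi j (c j))" for c
    unfolding box_diff_def vertex_def boxes_def pc_def
    by (intro sum.cong refl arg_cong2[where f = "(*)"] arg_cong[where f = g]) (auto simp: restrict_def)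
  have bv: "box_vol u (boxes (pc c)) = (\<Prod>j\<in>u. hi j (c j) - lo j (c j))" for c
    unfolding box_vol_def boxes_def pc_def by (auto intro!: prod.cong)
  have vpos: "0 < box_vol u J" if J: "J \<in> ?P" for J
  proof -
    obtain I where I: "I \<in> (\<Pi>\<^sub>E j\<in>u. cell_intervals (L j) (lo j) (hi j))" "J = boxes I" using J by (elim imageE)
    have "fst (I j) < snd (I j)" if "j \<in> u" for j
      using PiE_mem[OF I(1) that] by (auto simp: cell_intervals_def)
    then show ?thesis unfolding I(2) by (auto simp: box_vol_def boxes_def intro!: prod_pos)
  qed
  \<comment> \<open>The upper corners stay below 1, as \<open>hi\<close> lies strictly inside its
    cell, so none of these boxes is omitted from the variation.\<close>
  have SP: "?S \<subseteq> ?P'"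
  proof
    fix J assume "J \<in> ?S"
    then obtain c where c: "c \<in> ?C" and J: "J = boxes (pc c)" by blast
    have "vertex u J v \<in> cube u" for v
    proof -
      have "0 \<le> (if j \<in> v then hi j (c j) else lo j (c j)) \<and> (if j \<in> v then hi j (c j) else lo j (c j)) < 1" if j: "j \<in> u" for j
      proof -
        have cj: "c j < L j" using c j by auto
        moreover have "0 \<le> real (c j) / real (L j)" by simp
        ultimately show ?thesis using gapD(1,3,4,5)[OF j cj] by (auto split: if_splits; linarith)
      qed
      moreover have "vertex u J v = (\<lambda>j\<in>u. if j \<in> v then hi j (c j) else lo j (c j))"
        by (auto simp: J vertex_def boxes_def pc_def restrict_def fun_eq_iff)
      ultimately show ?thesis by (simp only: cube_def restrict_PiE_iff atLeastLessThan_iff) blast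
    qed
    moreover have "J \<in> ?P" unfolding J by (rule imageI[OF pcQ[OF c]])
    ultimately show "J \<in> ?P'" by (intro CollectI conjI ballI)
  qed
  have finP: "finite ?P'" using box_partition_cell_intervals[OF u L gap] by (simp add: box_partition_def)
  define a where "a J = \<bar>box_diff u g J / box_vol u J powr lam\<bar>" for J
  have "ennreal ((\<Sum>J\<in>?P'. box_vol u J * a J powr p) powr (1 / p)) \<le> vitali_variation lam p u g"
    unfolding vitali_variation_def a_def
    by (rule SUP_upper2[of ?P], rule CollectI, rule box_partition_cell_intervals[OF u L gap]) (assumption | rule order_refl)+
  then have Vb: "(\<Sum>J\<in>?P'. box_vol u J * a J powr p) powr (1 / p) \<le> enn2real (vitali_variation lam p u g)"
    using enn2real_mono[of _ "vitali_variation lam p u g"] V by fastforce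
  have vol1: "(\<Sum>J\<in>?S. box_vol u J) \<le> 1"
  proof -
    have "(\<Sum>J\<in>?S. box_vol u J) = (\<Sum>c\<in>?C. \<Prod>j\<in>u. hi j (c j) - lo j (c j))"
      unfolding sum.reindex[OF inj] by (simp add: bv)
    also have "\<dots> = (\<Prod>j\<in>u. \<Sum>b<L j. hi j b - lo j b)"
      by (rule prod_sum_PiE[symmetric]) (use u in auto)
    also have "\<dots> \<le> (\<Prod>j\<in>u. 1)"
    proof (rule prod_mono)
      fix j assume j: "j \<in> u"
      have "(\<Sum>b<L j. hi j b - lo j b) \<le> (\<Sum>b<L j. 1 / real (L j))"
      proof (rule sum_mono)
        fix b assume "b \<in> {..<L j}"
        then have "b < L j" by simp
        from admissible_gapD(1,3)[OF gap[OF j] this] show "hi j b - lo j b \<le> 1 / real (L j)" by linarith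
      qed
      also have "\<dots> = 1" using L[OF j] by simp
      finally show "0 \<le> (\<Sum>b<L j. hi j b - lo j b) \<and> (\<Sum>b<L j. hi j b - lo j b) \<le> 1"
        using gapD(4)[OF j] by (auto intro!: sum_nonneg simp: less_imp_le)
    qed
    finally show ?thesis by simp
  qed
  let ?K = "(\<Prod>j\<in>u. 4 * real (L j)) powr (1 - lam)"
  have "(\<Sum>c\<in>?C. \<bar>box_diff u g (\<lambda>j. lo j (c j), \<lambda>j. hi j (c j))\<bar>) = (\<Sum>J\<in>?S. \<bar>box_diff u g J\<bar>)"
    unfolding sum.reindex[OF inj] by (simp add: bd)
  also have "\<dots> \<le> (\<Sum>J\<in>?S. ?K * (box_vol u J * a J))"
  proof (rule sum_mono)
    fix J assume "J \<in> ?S"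
    then obtain c where c: "c \<in> ?C" and J: "J = boxes (pc c)" by blast
    have v: "0 < box_vol u J" using vpos SP \<open>J \<in> ?S\<close> by blast
    have K0: "0 < (\<Prod>j\<in>u. 4 * real (L j))" by (rule prod_pos) (use L in auto)
    have "1 = (\<Prod>j\<in>u. (4 * real (L j)) * (1 / (4 * real (L j))))" using L by (intro prod.neutral[symmetric]) auto
    also have "\<dots> \<le> (\<Prod>j\<in>u. (4 * real (L j)) * (hi j (c j) - lo j (c j)))"
    proof (intro prod_mono conjI mult_left_mono)
      fix j assume j: "j \<in> u"
      then have "c j < L j" using c by auto
      from gapD(2)[OF j this] show "1 / (4 * real (L j)) \<le> hi j (c j) - lo j (c j)" by linarith
    qed auto
    finally have "1 \<le> (\<Prod>j\<in>u. 4 * real (L j)) * box_vol u J" by (simp add: J bv prod.distrib)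
    then have "1 \<le> ((\<Prod>j\<in>u. 4 * real (L j)) * box_vol u J) powr (1 - lam)" using lam by (intro ge_one_powr_ge_zero) auto
    then have "1 \<le> ?K * box_vol u J powr (1 - lam)" using v K0 by (simp add: powr_mult)
    then have "1 * \<bar>box_diff u g J\<bar> \<le> (?K * box_vol u J powr (1 - lam)) * \<bar>box_diff u g J\<bar>" by (rule mult_right_mono) simp
    also have "\<dots> = ?K * (box_vol u J * a J)"
      using v unfolding a_def by (simp add: powr_diff abs_divide)
    finally show "\<bar>box_diff u g J\<bar> \<le> ?K * (box_vol u J * a J)" by simp
  qed
  also have "\<dots> = ?K * (\<Sum>J\<in>?S. box_vol u J * a J)" by (simp add: sum_distrib_left)
  also have "\<dots> \<le> ?K * ((\<Sum>J\<in>?S. box_vol u J * a J powr p) powr (1 / p))"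
  proof (intro mult_left_mono sum_le_power_mean p vol1)
    show "finite ?S" using finC by simp
    show "0 \<le> box_vol u J" if "J \<in> ?S" for J using vpos[of J] SP that by (auto simp: less_imp_le)
  qed (auto simp: a_def)
  also have "\<dots> \<le> ?K * ((\<Sum>J\<in>?P'. box_vol u J * a J powr p) powr (1 / p))"
  proof (intro mult_left_mono powr_mono2 sum_mono2 finP SP)
    show "0 \<le> (\<Sum>J\<in>?S. box_vol u J * a J powr p)"
    proof (intro sum_nonneg mult_nonneg_nonneg powr_ge_zero)
      fix J assume "J \<in> ?S"
      with SP have "J \<in> ?P" by blast
      from vpos[OF this] show "0 \<le> box_vol u J" by simp
    qed
    show "0 \<le> box_vol u J * a J powr p" if "J \<in> ?P' - ?S" for J using vpos[of J] that by (auto simp: less_imp_le)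
  qed (use p in auto)
  also have "\<dots> \<le> ?K * enn2real (vitali_variation lam p u g)" by (intro mult_left_mono Vb) auto
  finally show ?thesis .
qed

section \<open>Anchored Taylor expansion\<close>

text \<open>Taylor's formula on [0,x]; the kernel vanishes beyond x, so the remainder may be written
  over all of [0,1).\<close>

lemma taylor_unit_interval:
  fixes f :: "nat \<Rightarrow> real \<Rightarrow> real"
  assumes \<delta>: "1 \<le> \<delta>"
    and f: "\<And>i z. i < \<delta> \<Longrightarrow> 0 \<le> z \<Longrightarrow> z < 1 \<Longrightarrow> (f i has_vector_derivative f (Suc i) z) (at z within {0..<1})"
    and cont: "continuous_on {0..<1} (f \<delta>)" and x: "0 \<le> x" "x < 1"
  shows "f 0 x = (\<Sum>i<\<delta>. x ^ i / fact i * f i 0) + (\<integral>y. taylor_kernel (\<delta> - 1) x y * f \<delta> y \<partial>unit_lborel)"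
proof -
  let ?g = "\<lambda>t. ((x - t) ^ (\<delta> - 1) / fact (\<delta> - 1)) *\<^sub>R f \<delta> t"
  have "(?g has_integral f 0 x - (\<Sum>i<\<delta>. ((x - 0) ^ i / fact i) *\<^sub>R f i 0)) {0..x}"
  proof (rule Taylor_has_integral)
    show "(f m has_vector_derivative f (Suc m) t) (at t within {0..x})" if "m < \<delta>" "0 \<le> t" "t \<le> x" for m t
      by (rule has_vector_derivative_within_subset[OF f]) (use that x in auto)
  qed (use \<delta> x in auto)
  from integral_unique[OF this] have I: "integral {0..x} ?g = f 0 x - (\<Sum>i<\<delta>. x ^ i / fact i * f i 0)"
    by (simp only: diff_zero real_scaleR_def)
  have c: "continuous_on {0..x} ?g"
    by (intro continuous_intros continuous_on_subset[OF cont]) (use x in auto)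
  have "set_integrable lborel {0..x} ?g"
    unfolding set_integrable_def by (rule borel_integrable_compact) (use c in auto)
  from set_borel_integral_eq_integral(2)[OF this]
  have "(\<integral>t. indicator {0..x} t *\<^sub>R ?g t \<partial>lborel) = f 0 x - (\<Sum>i<\<delta>. x ^ i / fact i * f i 0)"
    unfolding set_lebesgue_integral_def I .
  moreover have "(\<integral>y. taylor_kernel (\<delta> - 1) x y * f \<delta> y \<partial>unit_lborel) = (\<integral>t. indicator {0..x} t *\<^sub>R ?g t \<partial>lborel)"
    unfolding integral_unit_lborel
    by (intro Bochner_Integration.integral_cong) (use x in \<open>auto simp: indicator_def taylor_kernel_def\<close>)
  ultimately show ?thesis by simp
qed

section \<open>Measurability and compactness in the cube\<close>

text \<open>Continuity on the cube refers to the product topology on all functions on nat, whose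
  Borel sets are generated by the coordinates; those outside \<open>u\<close> are constant on the
  cube.\<close>

lemma measurable_unit_cube_borel: "(\<lambda>x. x) \<in> unit_cube u \<rightarrow>\<^sub>M borel"
proof -
  have "(\<lambda>x. x) \<in> unit_cube u \<rightarrow>\<^sub>M (\<Pi>\<^sub>M i\<in>(UNIV :: nat set). (borel :: real measure))"
  proof (rule measurable_PiM_single')
    fix i :: nat
    show "(\<lambda>x. x i) \<in> borel_measurable (unit_cube u)"
    proof (cases "i \<in> u")
      case True
      have "(\<lambda>x. x) \<in> borel_measurable unit_lborel" by (rule borel_measurable_unit_lborel) simp
      from measurable_compose[OF measurable_component_singleton[OF True] this] show ?thesis by simp
    next
      case False
      have "(\<lambda>x. undefined) \<in> borel_measurable (unit_cube u)" by simp
      then show ?thesis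
        by (rule iffD1[OF measurable_cong, rotated]) (use False in \<open>auto simp: cube_def PiE_def extensional_def\<close>)
    qed
  qed auto
  then show ?thesis by (simp only: measurable_cong_sets[OF refl sets_PiM_equal_borel])
qed

lemma borel_measurable_continuous_on_cube:
  fixes g :: "(nat \<Rightarrow> real) \<Rightarrow> real"
  assumes "continuous_on (cube u) g"
  shows "g \<in> borel_measurable (unit_cube u)"
proof -
  have "(\<lambda>x. x) \<in> unit_cube u \<rightarrow>\<^sub>M restrict_space borel (cube u)"
    by (rule measurable_restrict_space2[OF _ measurable_unit_cube_borel]) simp
  from measurable_compose[OF this borel_measurable_continuous_on_restrict[OF assms]] show ?thesis by simp
qed

text \<open>Tychonoff's theorem, with the coordinates outside \<open>S\<close> confined to the
  single value \<open>undefined\<close>.\<close>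

lemma compact_PiE_box:
  fixes a b :: "nat \<Rightarrow> real"
  shows "compact (\<Pi>\<^sub>E j\<in>S. {a j..b j})"
proof -
  have "(\<Pi>\<^sub>E j\<in>S. {a j..b j}) = Pi\<^sub>E UNIV (\<lambda>j. if j \<in> S then {a j..b j} else {undefined})"
    by (auto simp: PiE_def extensional_def Pi_def split: if_splits)
  moreover have "compactin (product_topology (\<lambda>i::nat. euclidean) UNIV) (Pi\<^sub>E UNIV (\<lambda>j. if j \<in> S then {a j..b j} else {undefined :: real}))"
    unfolding compactin_PiE by auto
  ultimately show ?thesis unfolding euclidean_product_topology by simp
qed

text \<open>The evaluation point once the variables in \<open>V\<close> have been expanded: those in
  \<open>u\<close> have become integration variables, the rest of \<open>V\<close> is anchored at 0,
  and the others still carry x.\<close>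

definition mixed_point :: "nat \<Rightarrow> nat set \<Rightarrow> nat set \<Rightarrow> (nat \<Rightarrow> real) \<Rightarrow> (nat \<Rightarrow> real) \<Rightarrow> nat \<Rightarrow> real" where
  "mixed_point s V u y x = (\<lambda>j\<in>{1..s}. if j \<in> V then (if j \<in> u then y j else 0) else x j)"

lemma mixed_point_in_cube: "x \<in> cube {1..s} \<Longrightarrow> u \<subseteq> V \<Longrightarrow> y \<in> cube u \<Longrightarrow> mixed_point s V u y x \<in> cube {1..s}"
  using cubeD[of x "{1..s}"] cubeD[of y u] unfolding mixed_point_def by (subst cube_def) auto

lemma mixed_point_measurable:
  assumes x: "x \<in> cube {1..s}"
  shows "(\<lambda>y. mixed_point s V u y x) \<in> unit_cube u \<rightarrow>\<^sub>M unit_cube {1..s}"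
  unfolding mixed_point_def
proof (rule measurable_restrict)
  fix j assume j: "j \<in> {1..s}"
  then have "0 \<le> x j \<and> x j < 1" by (rule cubeD[OF x])
  then show "(\<lambda>y. if j \<in> V then if j \<in> u then y j else 0 else x j) \<in> unit_cube u \<rightarrow>\<^sub>M unit_lborel"
    by (cases "j \<in> V"; cases "j \<in> u") (auto intro: measurable_component_singleton)
qed

lemma measurable_prod_kernel:
  fixes k :: nat and x :: "nat \<Rightarrow> real"
  assumes "w \<subseteq> u"
  shows "(\<lambda>y. \<Prod>j\<in>w. taylor_kernel k (x j) (y j)) \<in> borel_measurable (unit_cube u)"
proof (rule borel_measurable_prod)
  fix j assume "j \<in> w"
  then have j: "j \<in> u" using assms by auto
  have "(\<lambda>t. taylor_kernel k (x j) t) \<in> borel_measurable unit_lborel"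
    by (rule borel_measurable_unit_lborel) measurable
  from measurable_compose[OF measurable_component_singleton[OF j] this]
  show "(\<lambda>y. taylor_kernel k (x j) (y j)) \<in> borel_measurable (unit_cube u)" by simp
qed

text \<open>\<open>G\<close> may be unbounded near the upper faces of the cube. The product of
  kernels vanishes unless y j \<le> x j for all j in u, so only the values of \<open>G\<close> on
  the compact box below x matter.\<close>

lemma integrable_mixed_point:
  assumes G: "continuous_on (cube {1..s}) G" and x: "x \<in> cube {1..s}" and uV: "u \<subseteq> V" "V \<subseteq> {1..s}"
  shows "integrable (unit_cube u) (\<lambda>y. G (mixed_point s V u y x) * (\<Prod>j\<in>u. taylor_kernel k (x j) (y j)))"
proof -
  interpret prob_space "unit_cube u" by (rule prob_space_unit_cube)
  have xb: "0 \<le> x j" "x j < 1" if "j \<in> {1..s}" for j using cubeD[OF x that] by auto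
  let ?K = "\<Pi>\<^sub>E j\<in>{1..s}. {0..x j}"
  have "?K \<subseteq> cube {1..s}" unfolding cube_def by (rule PiE_mono) (use xb in fastforce)
  then have "bounded (G ` ?K)"
    by (intro compact_imp_bounded compact_continuous_image compact_PiE_box continuous_on_subset[OF G])
  then obtain B where B: "\<And>z. z \<in> ?K \<Longrightarrow> \<bar>G z\<bar> \<le> B" by (auto simp: bounded_iff)

  have B0: "0 \<le> B"
  proof -
    have "(\<lambda>j\<in>{1..s}. 0) \<in> ?K" using xb by auto
    from B[OF this] show ?thesis by linarith
  qed
  show ?thesis
  proof (rule integrable_const_bound[of _ B])
    show "(\<lambda>y. G (mixed_point s V u y x) * (\<Prod>j\<in>u. taylor_kernel k (x j) (y j))) \<in> borel_measurable (unit_cube u)"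
      by (intro borel_measurable_times measurable_prod_kernel order_refl
          measurable_compose[OF mixed_point_measurable[OF x] borel_measurable_continuous_on_cube[OF G]])
    show "AE y in unit_cube u. norm (G (mixed_point s V u y x) * (\<Prod>j\<in>u. taylor_kernel k (x j) (y j))) \<le> B"
    proof (rule AE_I2)
      fix y assume "y \<in> space (unit_cube u)"
      then have "y \<in> cube u" by simp
      then have yb: "0 \<le> y j" "y j < 1" if "j \<in> u" for j using cubeD[OF _ that] by auto
      have u: "finite u" using finite_subset[OF order_trans[OF uV] finite_atLeastAtMost] .
      show "norm (G (mixed_point s V u y x) * (\<Prod>j\<in>u. taylor_kernel k (x j) (y j))) \<le> B"
      proof (cases "\<forall>j\<in>u. y j \<le> x j")
        case True
        have "mixed_point s V u y x \<in> ?K"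
          using True yb xb uV unfolding mixed_point_def by auto
        then have "\<bar>G (mixed_point s V u y x)\<bar> \<le> B" by (rule B)
        moreover have "(\<Prod>j\<in>u. taylor_kernel k (x j) (y j)) \<le> (\<Prod>j\<in>u. 1)"
          using xb yb uV by (intro prod_mono conjI taylor_kernel_nonneg taylor_kernel_le_1) (auto simp: less_imp_le subset_iff)
        moreover have "0 \<le> (\<Prod>j\<in>u. taylor_kernel k (x j) (y j))" by (intro prod_nonneg ballI taylor_kernel_nonneg)
        ultimately show ?thesis using mult_mono[of "\<bar>G (mixed_point s V u y x)\<bar>" B "(\<Prod>j\<in>u. taylor_kernel k (x j) (y j))" 1] B0
          by (simp only: real_norm_def abs_mult abs_of_nonneg prod.neutral_const mult_1_right simp_thms zero_le_one abs_ge_zero)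
      next
        case False
        then have "(\<Prod>j\<in>u. taylor_kernel k (x j) (y j)) = 0" using u by (intro prod_zero) (auto simp: taylor_kernel_def)
        then show ?thesis using B0 by simp
      qed
    qed
  qed
qed

section \<open>Taylor expansion in one variable after the other\<close>

lemma foldr_partial_deriv_funpow:
  "foldr (\<lambda>j. partial_deriv j ^^ \<tau> j) xs f = foldr partial_deriv (concat (map (\<lambda>j. replicate (\<tau> j) j) xs)) f"
  by (induction xs) simp_all

lemma count_list_concat_replicate:
  "distinct xs \<Longrightarrow> count_list (concat (map (\<lambda>j. replicate (\<tau> j) j) xs)) i = (if i \<in> set xs then \<tau> i else 0)"
proof (induction xs)
  case (Cons a xs)
  have "count_list (replicate n a) i = (if i = a then n else 0)" for n by (induction n) auto
  then show ?case using Cons by (auto simp: count_list_append)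
qed simp

text \<open>\<open>smooth_mixed\<close> speaks of lists of differentiations and the expansion of
  powers; a list made of blocks of equal variables translates one into the other.\<close>

lemma smooth_mixed_deriv_power:
  fixes f :: "(nat \<Rightarrow> real) \<Rightarrow> real"
  assumes f: "smooth_mixed \<delta> s f" and xs: "distinct (j # xs)" "set (j # xs) \<subseteq> {1..s}"
    and \<tau>: "\<forall>i\<in>set xs. \<tau> i \<le> \<delta>" and b: "b \<le> \<delta>"
  defines "F \<equiv> (partial_deriv j ^^ b) (foldr (\<lambda>j. partial_deriv j ^^ \<tau> j) xs f)"
  shows "continuous_on (cube {1..s}) F"
    and "b < \<delta> \<Longrightarrow> x \<in> cube {1..s} \<Longrightarrow> ((\<lambda>z. F (x(j := z))) has_vector_derivative partial_deriv j F x) (at (x j) within {0..<1})"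
proof -
  let ?\<tau> = "\<tau>(j := b)"
  let ?js = "concat (map (\<lambda>j. replicate (?\<tau> j) j) (j # xs))"
  have "foldr (\<lambda>j. partial_deriv j ^^ ?\<tau> j) xs f = foldr (\<lambda>j. partial_deriv j ^^ \<tau> j) xs f"
    using xs by (intro foldr_cong) auto
  then have F: "F = foldr partial_deriv ?js f"
    unfolding F_def foldr_partial_deriv_funpow[symmetric] by simp
  have cnt: "count_list ?js i = (if i \<in> set (j # xs) then ?\<tau> i else 0)" for i
    by (rule count_list_concat_replicate) (rule xs)
  have js: "set ?js \<subseteq> {1..s} \<and> (\<forall>i. count_list ?js i \<le> \<delta>)"
    unfolding cnt using xs \<tau> b by (auto split: if_splits)
  have *: "continuous_on (cube {1..s}) (foldr partial_deriv ?js f) \<and>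
        (\<forall>j\<in>{1..s}. count_list ?js j < \<delta> \<longrightarrow> (\<forall>x\<in>cube {1..s}. (\<lambda>z. foldr partial_deriv ?js f (x(j := z))) differentiable (at (x j) within {0..<1})))"
    using f js unfolding smooth_mixed_def by blast
  then show "continuous_on (cube {1..s}) F" unfolding F by blast
  assume "b < \<delta>" "x \<in> cube {1..s}"
  then have "(\<lambda>z. F (x(j := z))) differentiable (at (x j) within {0..<1})"
    using * xs(2) unfolding F cnt by simp
  then show "((\<lambda>z. F (x(j := z))) has_vector_derivative partial_deriv j F x) (at (x j) within {0..<1})"
    unfolding partial_deriv_def vector_derivative_works .
qed

lemma taylor_coordinate:
  fixes f :: "(nat \<Rightarrow> real) \<Rightarrow> real"
  assumes \<delta>: "1 \<le> \<delta>" and f: "smooth_mixed \<delta> s f" and xs: "distinct (j # xs)" "set (j # xs) \<subseteq> {1..s}"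
    and \<tau>: "\<forall>i\<in>set xs. \<tau> i \<le> \<delta>" and x: "x \<in> cube {1..s}"
  defines "F \<equiv> foldr (\<lambda>j. partial_deriv j ^^ \<tau> j) xs f"
  shows "F x = (\<Sum>i<\<delta>. x j ^ i / fact i * (partial_deriv j ^^ i) F (x(j := 0))) +
     (\<integral>y. taylor_kernel (\<delta> - 1) (x j) y * (partial_deriv j ^^ \<delta>) F (x(j := y)) \<partial>unit_lborel)"
proof -
  have j: "j \<in> {1..s}" using xs by auto
  then have xj: "0 \<le> x j" "x j < 1" using cubeD[OF x] by auto
  have upd: "x(j := z) \<in> cube {1..s}" if "0 \<le> z" "z < 1" for z
    using x j that by (auto simp: cube_def PiE_def extensional_def Pi_def)
  have "(partial_deriv j ^^ 0) F (x(j := x j)) = (\<Sum>i<\<delta>. x j ^ i / fact i * (partial_deriv j ^^ i) F (x(j := 0))) +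
     (\<integral>y. taylor_kernel (\<delta> - 1) (x j) y * (partial_deriv j ^^ \<delta>) F (x(j := y)) \<partial>unit_lborel)"
  proof (rule taylor_unit_interval[OF \<delta> _ _ xj])
    fix i z assume i: "i < \<delta>" and z: "0 \<le> z" "(z::real) < 1"
    show "((\<lambda>z. (partial_deriv j ^^ i) F (x(j := z))) has_vector_derivative (partial_deriv j ^^ Suc i) F (x(j := z))) (at z within {0..<1})"
      using smooth_mixed_deriv_power(2)[where \<tau> = \<tau>, OF f xs \<tau> _ i upd[OF z]] i unfolding F_def by simp
  next
    have c1: "continuous_on {0..<1} (\<lambda>z. x(j := z))"
    proof (rule continuous_on_coordinatewise_then_product)
      show "continuous_on {0..<1} (\<lambda>z. (x(j := z)) i)" for i by (cases "i = j") (auto intro: continuous_intros)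
    qed
    have c2: "continuous_on (cube {1..s}) ((partial_deriv j ^^ \<delta>) F)"
      using smooth_mixed_deriv_power(1)[where \<tau> = \<tau>, OF f xs \<tau> order_refl] unfolding F_def by simp
    show "continuous_on {0..<1} (\<lambda>z. (partial_deriv j ^^ \<delta>) F (x(j := z)))"
      by (rule continuous_on_compose2[OF c2 c1]) (use upd in \<open>force simp del: fun_upd_apply\<close>)
  qed
  then show ?thesis by simp
qed

text \<open>Induction on the list: the integrand of the shorter expansion is expanded in the next
  variable j, for fixed y. Orders below \<open>\<delta>\<close> anchor j at 0, and order
  \<open>\<delta>\<close> adds j to the integration variables. The head of the list is both expanded
  and differentiated last, as in \<open>foldr\<close>.\<close>

lemma taylor_expansion_suffix:
  fixes f :: "(nat \<Rightarrow> real) \<Rightarrow> real"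
  assumes \<delta>: "1 \<le> \<delta>" and f: "smooth_mixed \<delta> s f" and x: "x \<in> cube {1..s}"
    and "distinct xs" "set xs \<subseteq> {1..s}"
  shows "f x = (\<Sum>\<tau>\<in>(set xs \<rightarrow>\<^sub>E {0..\<delta>}). (\<Prod>j\<in>{j\<in>set xs. \<tau> j < \<delta>}. x j ^ \<tau> j / fact (\<tau> j)) *
     (\<integral>y. foldr (\<lambda>j. partial_deriv j ^^ \<tau> j) xs f (mixed_point s (set xs) {j\<in>set xs. \<tau> j = \<delta>} y x) *
        (\<Prod>j\<in>{j\<in>set xs. \<tau> j = \<delta>}. taylor_kernel (\<delta> - 1) (x j) (y j)) \<partial>unit_cube {j\<in>set xs. \<tau> j = \<delta>}))"
  using assms(4,5)
proof (induction xs)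
  case Nil
  have "mixed_point s {} {} y x = x" for y
    using x by (auto simp: mixed_point_def cube_def PiE_def extensional_def fun_eq_iff)
  then show ?case by (simp add: integral_unit_cube_empty)
next
  case (Cons j xs)
  let ?V = "set xs" and ?D = "\<lambda>\<tau>. foldr (\<lambda>j. partial_deriv j ^^ \<tau> j) xs f"
  let ?u = "\<lambda>\<tau>. {j\<in>set xs. \<tau> j = \<delta>}" and ?ker = "taylor_kernel (\<delta> - 1)"
  let ?W = "\<lambda>\<tau> y. \<Prod>j\<in>?u \<tau>. ?ker (x j) (y j)"
  have jV: "j \<notin> ?V" and j: "j \<in> {1..s}" and V: "?V \<subseteq> {1..s}" using Cons.prems by auto
  have xs': "distinct (j # xs)" "set (j # xs) \<subseteq> {1..s}" using Cons.prems by auto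
  have step: "(\<integral>y. ?D \<tau> (mixed_point s ?V (?u \<tau>) y x) * ?W \<tau> y \<partial>unit_cube (?u \<tau>)) =
     (\<Sum>b<\<delta>. x j ^ b / fact b * (\<integral>y. (partial_deriv j ^^ b) (?D \<tau>) (mixed_point s (insert j ?V) (?u \<tau>) y x) * ?W \<tau> y \<partial>unit_cube (?u \<tau>))) +
     (\<integral>y. (partial_deriv j ^^ \<delta>) (?D \<tau>) (mixed_point s (insert j ?V) (insert j (?u \<tau>)) y x) *
         (\<Prod>j\<in>insert j (?u \<tau>). ?ker (x j) (y j)) \<partial>unit_cube (insert j (?u \<tau>)))"
    if \<tau>: "\<tau> \<in> ?V \<rightarrow>\<^sub>E {0..\<delta>}" for \<tau>
  proof -
    have \<tau>': "\<forall>i\<in>set xs. \<tau> i \<le> \<delta>" using \<tau> by auto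
    have ju: "j \<notin> ?u \<tau>" and fu: "finite (?u \<tau>)" using jV by auto
    have mp0: "(mixed_point s ?V (?u \<tau>) y x)(j := 0) = mixed_point s (insert j ?V) (?u \<tau>) y x" for y
      using jV j by (auto simp: mixed_point_def fun_eq_iff)
    have mpt: "(mixed_point s ?V (?u \<tau>) y x)(j := t) = mixed_point s (insert j ?V) (insert j (?u \<tau>)) (y(j := t)) x" for y t
      using jV j by (auto simp: mixed_point_def fun_eq_iff)
    have mpj: "mixed_point s ?V (?u \<tau>) y x j = x j" for y using jV j by (simp add: mixed_point_def)
    have Wt: "(\<Prod>i\<in>insert j (?u \<tau>). ?ker (x i) ((y(j := t)) i)) = ?ker (x j) t * ?W \<tau> y" for y t
      using ju fu by (auto intro!: prod.cong)
    have c: "continuous_on (cube {1..s}) ((partial_deriv j ^^ b) (?D \<tau>))" if "b \<le> \<delta>" for b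
      by (rule smooth_mixed_deriv_power(1)[where \<tau> = \<tau>, OF f xs' \<tau>' that])
    have i1: "integrable (unit_cube (?u \<tau>)) (\<lambda>y. (partial_deriv j ^^ b) (?D \<tau>) (mixed_point s (insert j ?V) (?u \<tau>) y x) * ?W \<tau> y)" if "b \<le> \<delta>" for b
      by (rule integrable_mixed_point[OF c[OF that] x]) (use j V in auto)
    let ?f = "\<lambda>y. (partial_deriv j ^^ \<delta>) (?D \<tau>) (mixed_point s (insert j ?V) (insert j (?u \<tau>)) y x) *
         (\<Prod>j\<in>insert j (?u \<tau>). ?ker (x j) (y j))"
    have i2: "integrable (unit_cube (insert j (?u \<tau>))) ?f"
      by (rule integrable_mixed_point[OF c[OF order_refl] x]) (use j V in auto)
    have pt: "?D \<tau> (mixed_point s ?V (?u \<tau>) y x) * ?W \<tau> y =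
       (\<Sum>b<\<delta>. x j ^ b / fact b * ((partial_deriv j ^^ b) (?D \<tau>) (mixed_point s (insert j ?V) (?u \<tau>) y x) * ?W \<tau> y)) +
       (\<integral>t. ?f (y(j := t)) \<partial>unit_lborel)" if y: "y \<in> cube (?u \<tau>)" for y
    proof -
      have m: "mixed_point s ?V (?u \<tau>) y x \<in> cube {1..s}" by (rule mixed_point_in_cube[OF x _ y]) auto
      have "?D \<tau> (mixed_point s ?V (?u \<tau>) y x) * ?W \<tau> y =
        (\<Sum>b<\<delta>. x j ^ b / fact b * (partial_deriv j ^^ b) (?D \<tau>) (mixed_point s (insert j ?V) (?u \<tau>) y x)) * ?W \<tau> y +
        (\<integral>t. ?ker (x j) t * (partial_deriv j ^^ \<delta>) (?D \<tau>) (mixed_point s (insert j ?V) (insert j (?u \<tau>)) (y(j := t)) x) \<partial>unit_lborel) * ?W \<tau> y"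
        using taylor_coordinate[where \<tau> = \<tau>, OF \<delta> f xs' \<tau>' m, unfolded mpj mp0, unfolded mpt] by (simp only: distrib_right)
      also have "(\<integral>t. ?ker (x j) t * (partial_deriv j ^^ \<delta>) (?D \<tau>) (mixed_point s (insert j ?V) (insert j (?u \<tau>)) (y(j := t)) x) \<partial>unit_lborel) * ?W \<tau> y =
         (\<integral>t. ?f (y(j := t)) \<partial>unit_lborel)"
        unfolding Wt by (subst integral_mult_left_zero[symmetric]) (simp only: mult_ac)
      finally show ?thesis by (simp only: sum_distrib_right mult.assoc)
    qed
    \<comment> \<open>Integrability of the inner remainder integral is read off from the Taylor
      identity, all of whose other terms are integrable.\<close>
    have i3: "integrable (unit_cube (?u \<tau>)) (\<lambda>y. \<integral>t. ?f (y(j := t)) \<partial>unit_lborel)"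
    proof -
      have "integrable (unit_cube (?u \<tau>)) (\<lambda>y. ?D \<tau> (mixed_point s ?V (?u \<tau>) y x) * ?W \<tau> y -
         (\<Sum>b<\<delta>. x j ^ b / fact b * ((partial_deriv j ^^ b) (?D \<tau>) (mixed_point s (insert j ?V) (?u \<tau>) y x) * ?W \<tau> y)))"
      proof (intro Bochner_Integration.integrable_diff Bochner_Integration.integrable_sum integrable_mult_right i1)
        show "integrable (unit_cube (?u \<tau>)) (\<lambda>y. ?D \<tau> (mixed_point s ?V (?u \<tau>) y x) * ?W \<tau> y)"
          by (rule integrable_mixed_point[OF _ x]) (use c[of 0] V in auto)
      qed auto
      then show ?thesis
        by (rule iffD1[OF Bochner_Integration.integrable_cong[OF refl], rotated]) (use pt in auto)
    qed
    have "(\<integral>y. ?D \<tau> (mixed_point s ?V (?u \<tau>) y x) * ?W \<tau> y \<partial>unit_cube (?u \<tau>)) =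
      (\<integral>y. (\<Sum>b<\<delta>. x j ^ b / fact b * ((partial_deriv j ^^ b) (?D \<tau>) (mixed_point s (insert j ?V) (?u \<tau>) y x) * ?W \<tau> y)) +
       (\<integral>t. ?f (y(j := t)) \<partial>unit_lborel) \<partial>unit_cube (?u \<tau>))"
      by (rule Bochner_Integration.integral_cong[OF refl]) (use pt in auto)
    also have "\<dots> = (\<Sum>b<\<delta>. \<integral>y. x j ^ b / fact b * ((partial_deriv j ^^ b) (?D \<tau>) (mixed_point s (insert j ?V) (?u \<tau>) y x) * ?W \<tau> y) \<partial>unit_cube (?u \<tau>)) +
       (\<integral>y. (\<integral>t. ?f (y(j := t)) \<partial>unit_lborel) \<partial>unit_cube (?u \<tau>))"
    proof -
      have i1': "integrable (unit_cube (?u \<tau>)) (\<lambda>y. x j ^ b / fact b * ((partial_deriv j ^^ b) (?D \<tau>) (mixed_point s (insert j ?V) (?u \<tau>) y x) * ?W \<tau> y))" if "b \<in> {..<\<delta>}" for b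
        using i1[of b] that by simp
      show ?thesis
        by (subst Bochner_Integration.integral_add[OF Bochner_Integration.integrable_sum[OF i1'] i3], assumption)
          (subst Bochner_Integration.integral_sum[OF i1'], assumption, rule refl)
    qed
    also have "(\<integral>y. (\<integral>t. ?f (y(j := t)) \<partial>unit_lborel) \<partial>unit_cube (?u \<tau>)) = integral\<^sup>L (unit_cube (insert j (?u \<tau>))) ?f"
      by (rule cube.product_integral_insert[OF fu ju i2, symmetric])
    finally show ?thesis by (simp only: integral_mult_right_zero)
  qed
  let ?T = "\<lambda>\<tau>. (\<Prod>i\<in>{i\<in>set (j # xs). \<tau> i < \<delta>}. x i ^ \<tau> i / fact (\<tau> i)) *
     (\<integral>y. foldr (\<lambda>j. partial_deriv j ^^ \<tau> j) (j # xs) f (mixed_point s (set (j # xs)) {i\<in>set (j # xs). \<tau> i = \<delta>} y x) *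
        (\<Prod>i\<in>{i\<in>set (j # xs). \<tau> i = \<delta>}. ?ker (x i) (y i)) \<partial>unit_cube {i\<in>set (j # xs). \<tau> i = \<delta>})"
  let ?X = "\<lambda>\<tau>. \<Prod>i\<in>{i\<in>?V. \<tau> i < \<delta>}. x i ^ \<tau> i / fact (\<tau> i)"
  have fo: "foldr (\<lambda>i. partial_deriv i ^^ (\<tau>(j := b)) i) (j # xs) f = (partial_deriv j ^^ b) (?D \<tau>)" for \<tau> b
  proof -
    have "foldr (\<lambda>i. partial_deriv i ^^ (\<tau>(j := b)) i) xs f = ?D \<tau>" using jV by (intro foldr_cong) auto
    then show ?thesis by simp
  qed
  have Xc: "(\<Prod>i\<in>{i\<in>?V. \<tau> i < \<delta>}. x i ^ (\<tau>(j := b)) i / fact ((\<tau>(j := b)) i)) = ?X \<tau>" for \<tau> b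
  proof (rule prod.cong[OF refl])
    fix i assume "i \<in> {i\<in>?V. \<tau> i < \<delta>}"
    then have "i \<noteq> j" using jV by auto
    then show "x i ^ (\<tau>(j := b)) i / fact ((\<tau>(j := b)) i) = x i ^ \<tau> i / fact (\<tau> i)" by simp
  qed
  have T1: "?T (\<tau>(j := b)) = ?X \<tau> * (x j ^ b / fact b * (\<integral>y. (partial_deriv j ^^ b) (?D \<tau>) (mixed_point s (insert j ?V) (?u \<tau>) y x) * ?W \<tau> y \<partial>unit_cube (?u \<tau>)))"
    if "b < \<delta>" for \<tau> b
  proof -
    have s1: "{i\<in>set (j # xs). (\<tau>(j := b)) i < \<delta>} = insert j {i\<in>?V. \<tau> i < \<delta>}"
      and s2: "{i\<in>set (j # xs). (\<tau>(j := b)) i = \<delta>} = ?u \<tau>" using that jV by auto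
    have "(\<Prod>i\<in>insert j {i\<in>?V. \<tau> i < \<delta>}. x i ^ (\<tau>(j := b)) i / fact ((\<tau>(j := b)) i)) = x j ^ b / fact b * ?X \<tau>"
      by (subst prod.insert) (use jV in \<open>simp_all add: Xc del: fun_upd_apply\<close>, simp)
    then show ?thesis unfolding s1 s2 fo by (simp add: mult_ac)
  qed
  have T2: "?T (\<tau>(j := \<delta>)) = ?X \<tau> * (\<integral>y. (partial_deriv j ^^ \<delta>) (?D \<tau>) (mixed_point s (insert j ?V) (insert j (?u \<tau>)) y x) *
         (\<Prod>j\<in>insert j (?u \<tau>). ?ker (x j) (y j)) \<partial>unit_cube (insert j (?u \<tau>)))" for \<tau>
  proof -
    have s1: "{i\<in>set (j # xs). (\<tau>(j := \<delta>)) i < \<delta>} = {i\<in>?V. \<tau> i < \<delta>}"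
      and s2: "{i\<in>set (j # xs). (\<tau>(j := \<delta>)) i = \<delta>} = insert j (?u \<tau>)" using jV by auto
    have "(\<Prod>i\<in>{i\<in>?V. \<tau> i < \<delta>}. x i ^ (\<tau>(j := \<delta>)) i / fact ((\<tau>(j := \<delta>)) i)) = ?X \<tau>"
      by (rule Xc)
    then show ?thesis unfolding s1 s2 fo by simp
  qed
  have "f x = (\<Sum>\<tau>\<in>(?V \<rightarrow>\<^sub>E {0..\<delta>}). ?X \<tau> * (\<integral>y. ?D \<tau> (mixed_point s ?V (?u \<tau>) y x) * ?W \<tau> y \<partial>unit_cube (?u \<tau>)))"
    using Cons.IH Cons.prems by simp
  also have "\<dots> = (\<Sum>\<tau>\<in>(?V \<rightarrow>\<^sub>E {0..\<delta>}). (\<Sum>b<\<delta>. ?T (\<tau>(j := b))) + ?T (\<tau>(j := \<delta>)))"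
  proof (rule sum.cong[OF refl])
    fix \<tau> assume \<tau>: "\<tau> \<in> ?V \<rightarrow>\<^sub>E {0..\<delta>}"
    have "(\<Sum>b<\<delta>. ?T (\<tau>(j := b))) = (\<Sum>b<\<delta>. ?X \<tau> * (x j ^ b / fact b * (\<integral>y. (partial_deriv j ^^ b) (?D \<tau>) (mixed_point s (insert j ?V) (?u \<tau>) y x) * ?W \<tau> y \<partial>unit_cube (?u \<tau>))))"
      by (rule sum.cong[OF refl], rule T1) simp
    then show "?X \<tau> * (\<integral>y. ?D \<tau> (mixed_point s ?V (?u \<tau>) y x) * ?W \<tau> y \<partial>unit_cube (?u \<tau>)) = (\<Sum>b<\<delta>. ?T (\<tau>(j := b))) + ?T (\<tau>(j := \<delta>))"
      unfolding T2 step[OF \<tau>] by (simp only: distrib_left sum_distrib_left)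
  qed
  also have "\<dots> = (\<Sum>\<tau>\<in>(?V \<rightarrow>\<^sub>E {0..\<delta>}). \<Sum>b\<in>{0..\<delta>}. ?T (\<tau>(j := b)))"
  proof -
    have "{0..\<delta>} = insert \<delta> {..<\<delta>}" by auto
    then show ?thesis by (simp add: add.commute)
  qed
  also have "\<dots> = (\<Sum>\<tau>\<in>(insert j ?V \<rightarrow>\<^sub>E {0..\<delta>}). ?T \<tau>)"
    unfolding sum_PiE_insert[OF jV] by (rule sum.swap)
  finally show ?case by simp
qed

lemma taylor_expansion_anchored:
  fixes f :: "(nat \<Rightarrow> real) \<Rightarrow> real"
  assumes \<delta>: "1 \<le> \<delta>" and f: "smooth_mixed \<delta> s f" and x: "x \<in> cube {1..s}"
  shows "f x = (\<Sum>\<tau>\<in>({1..s} \<rightarrow>\<^sub>E {0..\<delta>}). (\<Prod>j\<in>{j\<in>{1..s}. \<tau> j < \<delta>}. x j ^ \<tau> j / fact (\<tau> j)) *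
     (\<integral>y. anchored s {j\<in>{1..s}. \<tau> j = \<delta>} (mixed_deriv s \<tau> f) y *
        (\<Prod>j\<in>{j\<in>{1..s}. \<tau> j = \<delta>}. taylor_kernel (\<delta> - 1) (x j) (y j)) \<partial>unit_cube {j\<in>{1..s}. \<tau> j = \<delta>}))"
proof -
  have S: "set [1..<Suc s] = {1..s}" by auto
  have mp: "mixed_point s {1..s} u y x = (\<lambda>j\<in>{1..s}. if j \<in> u then y j else 0)" for u y
    by (auto simp: mixed_point_def restrict_def)
  show ?thesis
    using taylor_expansion_suffix[OF \<delta> f x, of "[1..<Suc s]"] unfolding S mp mixed_deriv_def anchored_def by simp
qed

section \<open>The dual net\<close>

definition desc :: "nat set \<Rightarrow> nat list" where
  "desc A = rev (sorted_list_of_set A)"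

lemma set_desc [simp]: "finite A \<Longrightarrow> set (desc A) = A"
  by (simp add: desc_def)

lemma length_desc [simp]: "length (desc A) = card A"
  by (simp add: desc_def)

lemma sorted_wrt_desc: "sorted_wrt (>) (desc A)"
  unfolding desc_def sorted_wrt_rev using strict_sorted_list_of_set[of A] by simp

text \<open>The contribution of one coordinate to the sum in the net condition. For
  \<open>\<alpha> = 1\<close> it is the Niederreiter-Rosenbloom-Tsfasman weight of a digit vector
  with support \<open>A\<close>.\<close>

definition top_sum :: "nat \<Rightarrow> nat set \<Rightarrow> nat" where
  "top_sum \<alpha> A = (\<Sum>a\<leftarrow>take \<alpha> (desc A). a)"

text \<open>Padding with 0 lets the leading positions be recorded as a tuple of fixed length,
  whatever the size of the set.\<close>

definition head_pos :: "nat set \<Rightarrow> nat \<Rightarrow> nat" where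
  "head_pos A l = (if l < card A then desc A ! l else 0)"

lemma sum_list_take_nth: "(\<Sum>a\<leftarrow>take \<alpha> xs. f a) = (\<Sum>l<\<alpha>. if l < length xs then f (xs ! l) else (0::nat))"
proof (induction xs arbitrary: \<alpha>)
  case (Cons a xs)
  then show ?case by (cases \<alpha>) (simp_all add: sum.lessThan_Suc_shift del: sum.lessThan_Suc cong: if_cong)
qed simp

lemma top_sum_eq: "top_sum \<alpha> A = (\<Sum>l<\<alpha>. head_pos A l)"
  unfolding top_sum_def head_pos_def using sum_list_take_nth[of "\<lambda>a. a" \<alpha> "desc A"] by simp

lemma head_pos_antimono: "l \<le> l' \<Longrightarrow> head_pos A l' \<le> head_pos A l"
  using sorted_wrt_nth_less[OF sorted_wrt_desc, of l l' A] unfolding head_pos_def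
  by (cases "l = l'") (auto simp: less_imp_le)

lemma head_pos_le: "finite A \<Longrightarrow> A \<subseteq> {..N} \<Longrightarrow> head_pos A l \<le> N"
  unfolding head_pos_def using nth_mem[of l "desc A"] by auto

text \<open>An element outside the first \<open>\<alpha>\<close> entries of the descending list is
  smaller than the last of these. If \<open>A\<close> has fewer than \<open>\<alpha>\<close>
  elements, the bound is the padding 0 and every element qualifies.\<close>

lemma head_pos_mem:
  assumes A: "finite A" and i: "i \<in> A" and h: "head_pos A (\<alpha> - 1) \<le> i" and \<alpha>: "1 \<le> \<alpha>"
  shows "\<exists>l<\<alpha>. head_pos A l = i"
proof -
  have "i \<in> set (desc A)" using A i by simp
  then obtain l where l: "l < card A" "desc A ! l = i" by (auto simp: in_set_conv_nth)
  have "l < \<alpha>"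
  proof (rule ccontr)
    assume "\<not> l < \<alpha>"
    then have "\<alpha> - 1 < l" using \<alpha> by simp
    then have "desc A ! l < desc A ! (\<alpha> - 1)" using sorted_wrt_nth_less[OF sorted_wrt_desc, of "\<alpha> - 1" l A] l by simp
    moreover have "head_pos A (\<alpha> - 1) = desc A ! (\<alpha> - 1)" using \<open>\<alpha> - 1 < l\<close> l by (simp add: head_pos_def)
    ultimately show False using h l by simp
  qed
  then show ?thesis using l by (auto simp: head_pos_def)
qed

lemma le_head_pos_0: "finite A \<Longrightarrow> i \<in> A \<Longrightarrow> i \<le> head_pos A 0"
proof -
  assume A: "finite A" and i: "i \<in> A"
  have "i \<in> set (desc A)" using A i by simp
  then obtain l where l: "l < card A" "desc A ! l = i" by (auto simp: in_set_conv_nth)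
  then have "i = head_pos A l" by (simp add: head_pos_def)
  then show ?thesis using head_pos_antimono[of 0 l A] by simp
qed

text \<open>From index l on the list holds \<open>length xs - l\<close> distinct positive numbers,
  and entry l is the largest of them.\<close>

lemma sorted_desc_nth_ge: "sorted_wrt (>) xs \<Longrightarrow> (\<And>x. x \<in> set xs \<Longrightarrow> 1 \<le> x) \<Longrightarrow> l < length xs \<Longrightarrow> length xs - l \<le> (xs ! l :: nat)"
proof (induction xs arbitrary: l)
  case (Cons a xs)
  show ?case
  proof (cases l)
    case 0
    show ?thesis
    proof (cases xs)
      case Nil
      then show ?thesis using Cons.prems 0 by simp
    next
      case (Cons b ys)
      then have "length xs - 0 \<le> xs ! 0" using Cons.IH[of 0] Cons.prems by simp
      moreover have "xs ! 0 < a" using Cons.prems Cons by simp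
      ultimately show ?thesis using 0 by simp
    qed
  next
    case (Suc l')
    then show ?thesis using Cons.IH[of l'] Cons.prems by simp
  qed
qed simp

text \<open>With more than m positions, counting the smaller ones shows that each of the first
  \<open>\<alpha>\<close> is at least \<open>m - \<alpha>\<close>. This is the origin of the loss
  \<open>\<alpha> * \<alpha>\<close> in the weight bound for dual elements.\<close>

lemma top_sum_ge:
  assumes A: "finite A" "A \<subseteq> {1..}" and m: "m < card A"
  shows "real \<alpha> * real m - real (\<alpha> * \<alpha>) \<le> real (top_sum \<alpha> A)"
proof -
  have "m - \<alpha> \<le> head_pos A l" if "l < \<alpha>" for l
  proof (cases "l < card A")
    case True
    then have "card A - l \<le> desc A ! l"
      using sorted_desc_nth_ge[OF sorted_wrt_desc, of A l] A by fastforce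
    then show ?thesis using True that m by (simp add: head_pos_def)
  qed (use that m in simp)
  then have "(\<Sum>l<\<alpha>. m - \<alpha>) \<le> top_sum \<alpha> A" unfolding top_sum_eq by (intro sum_mono) simp
  then have "\<alpha> * (m - \<alpha>) \<le> top_sum \<alpha> A" by simp
  then have "real (\<alpha> * (m - \<alpha>)) \<le> real (top_sum \<alpha> A)" by (rule of_nat_mono)
  then have "real \<alpha> * real (m - \<alpha>) \<le> real (top_sum \<alpha> A)" unfolding of_nat_mult .
  moreover have "real \<alpha> * (real m - real \<alpha>) \<le> real \<alpha> * real (m - \<alpha>)" by (intro mult_left_mono) auto
  moreover have "real \<alpha> * (real m - real \<alpha>) = real \<alpha> * real m - real (\<alpha> * \<alpha>)"
    unfolding of_nat_mult by (rule right_diff_distrib)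
  ultimately show ?thesis by linarith
qed

section \<open>Geometric sums over lattice points\<close>

text \<open>Induction on the number of coordinates. If the new coordinate b is at most L, the others
  have to reach L - b, and each of at most L + 1 such cases contributes the same power of \<rho>; if
  b exceeds L, the others are free and b gives a geometric tail. The bound is uniform in the cut-off
  \<open>N\<close>.\<close>

lemma sum_power_lattice_le:
  fixes \<rho> :: real
  assumes \<rho>: "0 < \<rho>" "\<rho> < 1"
  shows "finite I \<Longrightarrow> I \<noteq> {} \<Longrightarrow> (\<Sum>a\<in>{a\<in>I \<rightarrow>\<^sub>E {0..N}. L \<le> sum a I}. \<rho> ^ sum a I)
     \<le> \<rho> ^ L * (real L + 1) ^ (card I - 1) / (1 - \<rho>) ^ card I"
proof (induction I arbitrary: L rule: finite_ne_induct)
  case (singleton i)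
  have geo: "(\<Sum>b\<in>{b\<in>{0..N}. L \<le> b}. \<rho> ^ b) \<le> \<rho> ^ L / (1 - \<rho>)"
  proof -
    have "(\<Sum>b\<in>{b\<in>{0..N}. L \<le> b}. \<rho> ^ b) \<le> (\<Sum>b\<in>(\<lambda>i. L + i) ` {0..N}. \<rho> ^ b)"
    proof (rule sum_mono2)
      show "{b\<in>{0..N}. L \<le> b} \<subseteq> (\<lambda>i. L + i) ` {0..N}"
      proof
        fix b assume "b \<in> {b\<in>{0..N}. L \<le> b}"
        then show "b \<in> (\<lambda>i. L + i) ` {0..N}" by (intro image_eqI[of _ _ "b - L"]) auto
      qed
    qed (use \<rho> in auto)
    also have "\<dots> = \<rho> ^ L * (\<Sum>b\<in>{0..N}. \<rho> ^ b)"
      by (subst sum.reindex) (auto simp: power_add sum_distrib_left)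
    also have "(\<Sum>b\<in>{0..N}. \<rho> ^ b) = (1 - \<rho> ^ Suc N) / (1 - \<rho>)"
      using \<rho> by (simp only: atMost_atLeast0[symmetric] sum_gp0) simp
    also have "\<rho> ^ L * ((1 - \<rho> ^ Suc N) / (1 - \<rho>)) \<le> \<rho> ^ L * (1 / (1 - \<rho>))"
      using \<rho> by (intro mult_left_mono divide_right_mono) auto
    finally show ?thesis by simp
  qed
  have "(\<Sum>a\<in>{a\<in>{i} \<rightarrow>\<^sub>E {0..N}. L \<le> sum a {i}}. \<rho> ^ sum a {i}) = (\<Sum>b\<in>{b\<in>{0..N}. L \<le> b}. \<rho> ^ b)"
    by (rule sum.reindex_bij_witness[of _ "\<lambda>b. (\<lambda>_. undefined)(i := b)" "\<lambda>a. a i"])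
      (auto simp: PiE_def extensional_def fun_eq_iff)
  then show ?case using geo by simp
next
  case (insert i I)
  let ?r = "card I"
  have r: "1 \<le> ?r" using insert.hyps by (simp add: Suc_leI card_gt_0_iff)
  let ?S = "\<lambda>L. \<Sum>a\<in>{a\<in>I \<rightarrow>\<^sub>E {0..N}. L \<le> sum a I}. \<rho> ^ sum a I"
  let ?D = "(1 - \<rho>) ^ ?r"
  have D: "0 < ?D" using \<rho> by simp
  have upd: "sum (a(i := b)) (insert i I) = b + sum a I" for a :: "'a \<Rightarrow> nat" and b
  proof -
    have "sum (a(i := b)) I = sum a I" using insert.hyps by (intro sum.cong) auto
    then show ?thesis using insert.hyps by simp
  qed
  have fin: "finite (I \<rightarrow>\<^sub>E {0..N})" using insert.hyps by (intro finite_PiE) auto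
  have fin': "finite (insert i I \<rightarrow>\<^sub>E {0..N})" using insert.hyps by (intro finite_PiE) auto
  have "(\<Sum>a\<in>{a\<in>insert i I \<rightarrow>\<^sub>E {0..N}. L \<le> sum a (insert i I)}. \<rho> ^ sum a (insert i I)) =
     (\<Sum>a\<in>insert i I \<rightarrow>\<^sub>E {0..N}. if L \<le> sum a (insert i I) then \<rho> ^ sum a (insert i I) else 0)"
    by (rule sum.inter_filter[OF fin'])
  also have "\<dots> = (\<Sum>p\<in>{0..N} \<times> (I \<rightarrow>\<^sub>E {0..N}). if L \<le> fst p + sum (snd p) I then \<rho> ^ (fst p + sum (snd p) I) else 0)"
    unfolding PiE_insert_eq
    by (subst sum.reindex[OF inj_combinator[OF insert.hyps(3)]]) (simp only: o_def split_def upd)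
  also have "\<dots> = (\<Sum>b\<in>{0..N}. \<Sum>a\<in>I \<rightarrow>\<^sub>E {0..N}. if L - b \<le> sum a I then \<rho> ^ b * \<rho> ^ sum a I else 0)"
    by (subst sum.cartesian_product[symmetric, where g = "\<lambda>b a. if L \<le> b + sum a I then \<rho> ^ (b + sum a I) else 0", unfolded split_def])
      (auto simp: power_add intro!: sum.cong)
  also have "\<dots> = (\<Sum>b\<in>{0..N}. \<rho> ^ b * ?S (L - b))"
  proof (rule sum.cong[OF refl])
    fix b
    have "(\<Sum>a\<in>I \<rightarrow>\<^sub>E {0..N}. if L - b \<le> sum a I then \<rho> ^ b * \<rho> ^ sum a I else 0) =
       (\<Sum>a\<in>{a\<in>I \<rightarrow>\<^sub>E {0..N}. L - b \<le> sum a I}. \<rho> ^ b * \<rho> ^ sum a I)"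
      by (rule sum.inter_filter[OF fin, symmetric])
    then show "(\<Sum>a\<in>I \<rightarrow>\<^sub>E {0..N}. if L - b \<le> sum a I then \<rho> ^ b * \<rho> ^ sum a I else 0) = \<rho> ^ b * ?S (L - b)"
      by (simp add: sum_distrib_left)
  qed
  \<comment> \<open>For b > L the truncated difference L - b is 0, so the induction hypothesis
    bounds the unrestricted sum by \<open>1 / ?D\<close>.\<close>
  also have "\<dots> \<le> (\<Sum>b\<in>{0..N}. (if b \<le> L then \<rho> ^ L * (real L + 1) ^ (?r - 1) / ?D else 0) + (if Suc L \<le> b then \<rho> ^ b / ?D else 0))"
  proof (rule sum_mono)
    fix b
    have IH: "\<rho> ^ b * ?S (L - b) \<le> \<rho> ^ b * (\<rho> ^ (L - b) * (real (L - b) + 1) ^ (?r - 1) / ?D)"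
      using \<rho> insert.IH[of "L - b"] by (intro mult_left_mono) auto
    show "\<rho> ^ b * ?S (L - b) \<le> (if b \<le> L then \<rho> ^ L * (real L + 1) ^ (?r - 1) / ?D else 0) + (if Suc L \<le> b then \<rho> ^ b / ?D else 0)"
    proof (cases "b \<le> L")
      case True
      have "\<rho> ^ b * (\<rho> ^ (L - b) * (real (L - b) + 1) ^ (?r - 1) / ?D) = \<rho> ^ L * (real (L - b) + 1) ^ (?r - 1) / ?D"
        using True by (simp flip: power_add mult.assoc)
      also have "\<dots> \<le> \<rho> ^ L * (real L + 1) ^ (?r - 1) / ?D"
        using \<rho> by (intro divide_right_mono mult_left_mono power_mono) auto
      finally show ?thesis using IH True by simp
    qed (use IH in simp)
  qed
  also have "\<dots> = (\<Sum>b\<in>{b\<in>{0..N}. b \<le> L}. \<rho> ^ L * (real L + 1) ^ (?r - 1) / ?D) + (\<Sum>b\<in>{b\<in>{0..N}. Suc L \<le> b}. \<rho> ^ b / ?D)"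
    unfolding sum.distrib by (simp only: sum.inter_filter[OF finite_atLeastAtMost])
  also have "\<dots> \<le> (real L + 1) * (\<rho> ^ L * (real L + 1) ^ (?r - 1) / ?D) + \<rho> ^ Suc L / (1 - \<rho>) / ?D"
  proof (rule add_mono)
    have "card {b\<in>{0..N}. b \<le> L} \<le> card {0..L}" by (rule card_mono) auto
    then show "(\<Sum>b\<in>{b\<in>{0..N}. b \<le> L}. \<rho> ^ L * (real L + 1) ^ (?r - 1) / ?D) \<le> (real L + 1) * (\<rho> ^ L * (real L + 1) ^ (?r - 1) / ?D)"
      using \<rho> by (simp only: sum_constant) (intro mult_right_mono; simp)
    have geo: "(\<Sum>b\<in>{b\<in>{0..N}. Suc L \<le> b}. \<rho> ^ b) \<le> \<rho> ^ Suc L / (1 - \<rho>)"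
    proof -
      have "(\<Sum>b\<in>{b\<in>{0..N}. Suc L \<le> b}. \<rho> ^ b) \<le> (\<Sum>b\<in>(\<lambda>i. Suc L + i) ` {0..N}. \<rho> ^ b)"
      proof (rule sum_mono2)
        show "{b\<in>{0..N}. Suc L \<le> b} \<subseteq> (\<lambda>i. Suc L + i) ` {0..N}"
        proof
          fix b assume "b \<in> {b\<in>{0..N}. Suc L \<le> b}"
          then show "b \<in> (\<lambda>i. Suc L + i) ` {0..N}" by (intro image_eqI[of _ _ "b - Suc L"]) auto
        qed
      qed (use \<rho> in auto)
      also have "\<dots> = \<rho> ^ Suc L * (\<Sum>b\<in>{0..N}. \<rho> ^ b)"
        by (subst sum.reindex) (auto simp: power_add sum_distrib_left mult_ac)
      also have "(\<Sum>b\<in>{0..N}. \<rho> ^ b) = (1 - \<rho> ^ Suc N) / (1 - \<rho>)"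
        using \<rho> by (simp only: atMost_atLeast0[symmetric] sum_gp0) simp
      also have "\<rho> ^ Suc L * ((1 - \<rho> ^ Suc N) / (1 - \<rho>)) \<le> \<rho> ^ Suc L * (1 / (1 - \<rho>))"
        using \<rho> by (intro mult_left_mono divide_right_mono) auto
      finally show ?thesis by simp
    qed
    then show "(\<Sum>b\<in>{b\<in>{0..N}. Suc L \<le> b}. \<rho> ^ b / ?D) \<le> \<rho> ^ Suc L / (1 - \<rho>) / ?D"
      using D by (simp only: sum_divide_distrib[symmetric]) (intro divide_right_mono; simp)
  qed
  also have "\<dots> = \<rho> ^ L * ((1 - \<rho>) * (real L + 1) ^ ?r + \<rho>) / ((1 - \<rho>) * ?D)"
  proof -
    have "(real L + 1) * (real L + 1) ^ (?r - 1) = (real L + 1) ^ ?r" using r by (simp flip: power_Suc)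
    then have "(real L + 1) * (\<rho> ^ L * (real L + 1) ^ (?r - 1) / ?D) = \<rho> ^ L * (real L + 1) ^ ?r / ?D"
      by (simp add: mult.left_commute)
    moreover have "0 < 1 - \<rho>" using \<rho> by simp
    ultimately show ?thesis using D by (simp add: field_simps)
  qed
  \<comment> \<open>The tail is absorbed: (1 - \<rho>) X + \<rho> \<le> X for X \<ge> 1.\<close>
  also have "\<dots> \<le> \<rho> ^ L * (real L + 1) ^ ?r / ((1 - \<rho>) * ?D)"
  proof (intro divide_right_mono mult_left_mono)
    have "1 \<le> (real L + 1) ^ ?r" by (intro one_le_power) simp
    then have "\<rho> * 1 \<le> \<rho> * (real L + 1) ^ ?r" using \<rho> by (intro mult_left_mono) auto
    then show "(1 - \<rho>) * (real L + 1) ^ ?r + \<rho> \<le> (real L + 1) ^ ?r" by (simp add: algebra_simps)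
  qed (use \<rho> in auto)
  finally show ?case using insert.hyps by simp
qed

text \<open>
  Independence of the family indexed by \<open>B\<close>; in particular the rows are pairwise distinct.
\<close>

definition indep_rows :: "('p \<Rightarrow> nat \<Rightarrow> 'a::field) \<Rightarrow> nat \<Rightarrow> 'p set \<Rightarrow> bool" where
  "indep_rows r m B \<longleftrightarrow> (\<forall>x. (\<forall>c<m. (\<Sum>p\<in>B. x p * r p c) = 0) \<longrightarrow> (\<forall>p\<in>B. x p = 0))"

text \<open>Each coordinate takes as much of the remaining budget \<open>M\<close> as its own bound
  allows. This decides how many rows to use in each coordinate when their total is capped.\<close>

lemma exists_capped_sum:
  fixes a :: "'i \<Rightarrow> nat"
  assumes "finite I"
  shows "\<exists>b. (\<forall>j\<in>I. b j \<le> a j) \<and> sum b I = min (sum a I) M"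
  using assms
proof (induction I arbitrary: M rule: finite_induct)
  case (insert i I)
  obtain b where b: "\<forall>j\<in>I. b j \<le> a j" "sum b I = min (sum a I) (M - min (a i) M)" using insert.IH by blast
  have "sum (b(i := min (a i) M)) I = sum b I" using insert.hyps by (intro sum.cong) auto
  then have "sum (b(i := min (a i) M)) (insert i I) = min (a i) M + min (sum a I) (M - min (a i) M)"
    using insert.hyps b(2) by simp
  also have "\<dots> = min (a i + sum a I) M" by arith
  also have "\<dots> = min (sum a (insert i I)) M" using insert.hyps by simp
  finally have "sum (b(i := min (a i) M)) (insert i I) = min (sum a (insert i I)) M" .
  then show ?case using b insert.hyps by (intro exI[of _ "b(i := min (a i) M)"]) auto
qed auto

section \<open>Weights and counting in the dual net\<close>

definition support :: "nat \<Rightarrow> (nat \<times> nat \<Rightarrow> 'a::zero) \<Rightarrow> nat \<Rightarrow> nat set" where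
  "support N k j = {i\<in>{1..N}. k (j, i) \<noteq> 0}"

lemma finite_support [simp]: "finite (support N k j)"
  by (simp add: support_def)

text \<open>The net condition restated for sets of row positions. The upper bounds on
  \<open>T\<close> reflect \<open>\<beta> \<le> 1\<close> and
  \<open>\<beta> \<le> \<alpha> m / n\<close>, and \<open>N\<close> is the truncation level of the
  Walsh expansion.\<close>

locale net_rows =
  fixes r :: "nat \<times> nat \<Rightarrow> nat \<Rightarrow> 'a::{field,finite}" and s n m N \<alpha> :: nat and T :: real
  assumes \<alpha>: "1 \<le> \<alpha>" and T: "0 \<le> T" "T \<le> real n" "T \<le> real \<alpha> * real m" and N: "n \<le> N"
    and net: "\<And>A. \<lbrakk>\<And>j. j \<in> {1..s} \<Longrightarrow> A j \<subseteq> {1..n} \<and> card (A j) \<le> m; real (\<Sum>j=1..s. top_sum \<alpha> (A j)) \<le> T\<rbrakk>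
        \<Longrightarrow> indep_rows r m (SIGMA j:{1..s}. A j)"
begin

text \<open>There are N digits per coordinate, but only the first n are constrained: the net points
  have zero digits beyond n.\<close>

definition dual :: "(nat \<times> nat \<Rightarrow> 'a) set" where
  "dual = {k \<in> {1..s} \<times> {1..N} \<rightarrow>\<^sub>E UNIV. \<forall>c<m. (\<Sum>p\<in>{1..s} \<times> {1..n}. k p * r p c) = 0}"

lemma finite_dual: "finite dual"
  unfolding dual_def by (rule finite_subset[OF _ finite_PiE[of "{1..s} \<times> {1..N}" "\<lambda>_. UNIV"]]) auto

text \<open>A position beyond n alone weighs at least n \<ge> T. More than m positions in one
  coordinate are covered by \<open>top_sum_ge\<close> and \<open>T \<le> \<alpha> * m\<close>.
  Otherwise weight at most T would make the rows at the support independent, against the nontrivial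
  relation given by k.\<close>

lemma top_sum_dual_ge:
  assumes k: "k \<in> dual" and j0: "j0 \<in> {1..s}" "support N k j0 \<noteq> {}"
  shows "T - real (\<alpha> * \<alpha>) \<le> real (\<Sum>j=1..s. top_sum \<alpha> (support N k j))"
proof -
  have le: "top_sum \<alpha> (support N k j) \<le> (\<Sum>j=1..s. top_sum \<alpha> (support N k j))" if "j \<in> {1..s}" for j
    by (rule member_le_sum) (use that in auto)
  consider j i where "j \<in> {1..s}" "i \<in> support N k j" "n < i" | j where "j \<in> {1..s}" "m < card (support N k j)"
    | "\<And>j. j \<in> {1..s} \<Longrightarrow> support N k j \<subseteq> {1..n} \<and> card (support N k j) \<le> m"
  proof (cases "\<forall>j\<in>{1..s}. support N k j \<subseteq> {1..n} \<and> card (support N k j) \<le> m")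
    case False
    then obtain j where j: "j \<in> {1..s}" "\<not> support N k j \<subseteq> {1..n} \<or> \<not> card (support N k j) \<le> m" by blast
    then show ?thesis using that(1)[of j] that(2)[of j] by (fastforce simp: support_def)
  qed (use that(3) in blast)
  then show ?thesis
  proof cases
    case 1
    have "i \<le> head_pos (support N k j) 0" using 1 by (intro le_head_pos_0) auto
    also have "\<dots> \<le> top_sum \<alpha> (support N k j)" unfolding top_sum_eq using \<alpha> by (intro member_le_sum) auto
    finally have "real n \<le> real (\<Sum>j=1..s. top_sum \<alpha> (support N k j))" using le[OF 1(1)] 1(3) by linarith
    moreover have "0 \<le> real (\<alpha> * \<alpha>)" by simp
    ultimately show ?thesis using T(2) by linarith
  next
    case 2
    have "real \<alpha> * real m - real (\<alpha> * \<alpha>) \<le> real (top_sum \<alpha> (support N k j))"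
      by (rule top_sum_ge[OF _ _ 2(2)]) (auto simp: support_def)
    also have "\<dots> \<le> real (\<Sum>j=1..s. top_sum \<alpha> (support N k j))" using le[OF 2(1)] by linarith
    finally show ?thesis using T(3) by linarith
  next
    case 3
    let ?B = "SIGMA j:{1..s}. support N k j"
    have "\<not> real (\<Sum>j=1..s. top_sum \<alpha> (support N k j)) \<le> T"
    proof
      assume "real (\<Sum>j=1..s. top_sum \<alpha> (support N k j)) \<le> T"
      then have ind: "indep_rows r m ?B" using 3 by (intro net) auto
      have "(\<Sum>p\<in>?B. k p * r p c) = 0" if "c < m" for c
      proof -
        have "(\<Sum>p\<in>?B. k p * r p c) = (\<Sum>p\<in>{1..s} \<times> {1..n}. k p * r p c)"
        proof (rule sum.mono_neutral_left)
          show "?B \<subseteq> {1..s} \<times> {1..n}" by (rule Sigma_mono[OF order_refl]) (use 3 in blast)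
          show "\<forall>p\<in>{1..s} \<times> {1..n} - ?B. k p * r p c = 0" using N by (auto simp: support_def)
        qed simp
        also have "\<dots> = 0" using k that by (simp add: dual_def)
        finally show ?thesis .
      qed
      then have z: "\<forall>p\<in>?B. k p = 0" using ind unfolding indep_rows_def by blast
      obtain i where i: "i \<in> support N k j0" using j0 by blast
      then have "k (j0, i) = 0" using z j0 by blast
      then show False using i by (simp add: support_def)
    qed
    moreover have "0 \<le> real (\<alpha> * \<alpha>)" by simp
    ultimately show ?thesis by linarith
  qed
qed

text \<open>
  The rows at positions at most \<open>b j\<close> in coordinate \<open>j\<close> are independent as soon as \<open>\<alpha> (b 1 + \<dots> + b s) \<le> T\<close>,
  so the digits of a dual element at these positions are determined by its other digits.
\<close>

lemma card_dual_fiber_le: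
  assumes k0: "k0 \<in> dual" and a: "\<And>j. j \<in> {1..s} \<Longrightarrow> a j \<le> N"
  shows "real (card {k\<in>dual. \<forall>j\<in>{1..s}. \<forall>i\<in>{1..N}. a j \<le> i \<longrightarrow> k (j, i) = k0 (j, i)})
     \<le> real CARD('a) powr (max 0 (real (\<Sum>j=1..s. a j) - T / real \<alpha> + 1))"
proof -
  \<comment> \<open>Up to M rows in initial segments have weight at most
    \<open>\<alpha> * M \<le> T\<close> and so are independent. Rounding down costs the summand 1 in
    the exponent.\<close>
  define M where "M = nat \<lfloor>T / real \<alpha>\<rfloor>"
  have \<alpha>0: "0 < real \<alpha>" using \<alpha> by simp
  have "0 \<le> T / real \<alpha>" using T(1) by simp
  then have "real M = of_int \<lfloor>T / real \<alpha>\<rfloor>" unfolding M_def by simp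
  then have M: "real M \<le> T / real \<alpha>" "T / real \<alpha> < real M + 1" by linarith+
  obtain b where b: "\<forall>j\<in>{1..s}. b j \<le> a j - 1" "sum b {1..s} = min (\<Sum>j=1..s. a j - 1) M"
    using exists_capped_sum[of "{1..s}" "\<lambda>j. a j - 1" M] by auto
  have bM: "b j \<le> M" if "j \<in> {1..s}" for j
    using member_le_sum[of j "{1..s}" b] that b(2) by simp
  have "real n * 1 \<le> real n * real \<alpha>" using \<alpha> by (intro mult_left_mono) auto
  then have Tn: "T / real \<alpha> \<le> real n" using T(2) \<alpha>0 by (simp add: divide_le_eq)
  have Tm: "T / real \<alpha> \<le> real m" using T \<alpha>0 by (simp add: divide_le_eq mult.commute)
  have bn: "b j \<le> n" "b j \<le> m" if "j \<in> {1..s}" for j using bM[OF that] M Tn Tm by linarith+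
  \<comment> \<open>\<open>?E\<close> lists the positions left open in the fibre, those below a j;
    \<open>?B\<close> is a subset of them at which the rows are independent.\<close>
  let ?B = "SIGMA j:{1..s}. {1..b j}" and ?E = "SIGMA j:{1..s}. {1..a j - 1}"
  have ind: "indep_rows r m ?B"
  proof (rule net)
    have "top_sum \<alpha> {1..b j} \<le> \<alpha> * b j" for j
    proof -
      have "top_sum \<alpha> {1..b j} \<le> (\<Sum>l<\<alpha>. b j)" unfolding top_sum_eq by (intro sum_mono head_pos_le) auto
      then show ?thesis by simp
    qed
    then have "(\<Sum>j=1..s. top_sum \<alpha> {1..b j}) \<le> \<alpha> * sum b {1..s}" unfolding sum_distrib_left by (intro sum_mono) auto
    also have "\<dots> \<le> \<alpha> * M" using b(2) by simp
    finally have "real (\<Sum>j=1..s. top_sum \<alpha> {1..b j}) \<le> real \<alpha> * real M"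
      unfolding of_nat_mult[symmetric] by (rule of_nat_mono)
    also have "\<dots> \<le> T" using M(1) \<alpha>0 by (simp add: le_divide_eq mult.commute)
    finally show "real (\<Sum>j=1..s. top_sum \<alpha> {1..b j}) \<le> T" .
  qed (use bn in auto)
  let ?F = "{k\<in>dual. \<forall>j\<in>{1..s}. \<forall>i\<in>{1..N}. a j \<le> i \<longrightarrow> k (j, i) = k0 (j, i)}"
  have BE: "?B \<subseteq> ?E" using b(1) by force
  have finE: "finite ?E" by auto
  have inj: "inj_on (\<lambda>k. restrict k (?E - ?B)) ?F"
  proof (rule inj_onI)
    fix k k' assume k: "k \<in> ?F" and k': "k' \<in> ?F" and e: "restrict k (?E - ?B) = restrict k' (?E - ?B)"
    have eqE: "k p = k' p" if "p \<in> ?E - ?B" for p using fun_cong[OF e, of p] that by simp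
    have out: "k p = k' p" if p: "p \<in> {1..s} \<times> {1..N}" "p \<notin> ?B" for p
    proof (cases "p \<in> ?E")
      case True
      then show ?thesis using eqE p by blast
    next
      case False
      obtain j i where ji: "p = (j, i)" by (cases p)
      then have "j \<in> {1..s}" "i \<in> {1..N}" "a j \<le> i" using p False by auto
      then show ?thesis using k k' unfolding ji by simp
    qed
    \<comment> \<open>Two elements of the fibre that agree on \<open>?E - ?B\<close> differ only on
      \<open>?B\<close>, so their difference is a relation among independent rows.\<close>
    have "(\<Sum>p\<in>?B. (k p - k' p) * r p c) = 0" if c: "c < m" for c
    proof -
      have "(\<Sum>p\<in>?B. (k p - k' p) * r p c) = (\<Sum>p\<in>{1..s} \<times> {1..n}. (k p - k' p) * r p c)"
      proof (rule sum.mono_neutral_left)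
        show "?B \<subseteq> {1..s} \<times> {1..n}" using bn by fastforce
        show "\<forall>p\<in>{1..s} \<times> {1..n} - ?B. (k p - k' p) * r p c = 0"
        proof
          fix p assume p: "p \<in> {1..s} \<times> {1..n} - ?B"
          then have "p \<in> {1..s} \<times> {1..N}" using N by auto
          then show "(k p - k' p) * r p c = 0" using out[of p] p by simp
        qed
      qed simp
      also have "\<dots> = 0" using k k' c by (simp add: dual_def left_diff_distrib sum_subtractf)
      finally show ?thesis .
    qed
    then have "\<forall>p\<in>?B. k p - k' p = 0" using ind unfolding indep_rows_def by (elim allE[of _ "\<lambda>p. k p - k' p"]) blast
    then have "k p = k' p" if "p \<in> {1..s} \<times> {1..N}" for p using out[OF that] by (cases "p \<in> ?B") auto
    moreover have "k \<in> {1..s} \<times> {1..N} \<rightarrow>\<^sub>E UNIV" "k' \<in> {1..s} \<times> {1..N} \<rightarrow>\<^sub>E UNIV" using k k' by (auto simp: dual_def)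
    ultimately show "k = k'" by (intro PiE_ext)
  qed
  have "card ?F \<le> card (?E - ?B \<rightarrow>\<^sub>E (UNIV :: 'a set))"
  proof (rule card_inj_on_le[OF inj])
    show "(\<lambda>k. restrict k (?E - ?B)) ` ?F \<subseteq> (?E - ?B \<rightarrow>\<^sub>E UNIV)"
      by (rule image_subsetI) (simp only: restrict_PiE_iff UNIV_I ball_triv simp_thms)
    show "finite (?E - ?B \<rightarrow>\<^sub>E (UNIV :: 'a set))"
      by (rule finite_PiE) (use finE in \<open>simp_all only: finite_Diff finite\<close>)
  qed
  also have "\<dots> = CARD('a) ^ card (?E - ?B)" using finE by (simp add: card_PiE)
  finally have c1: "real (card ?F) \<le> real CARD('a) ^ card (?E - ?B)" unfolding of_nat_power[symmetric] by (rule of_nat_mono)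
  have cE: "card ?E = (\<Sum>j=1..s. a j - 1)" and cB: "card ?B = sum b {1..s}" by (simp_all add: card_SigmaI)
  have "card (?E - ?B) = card ?E - card ?B" by (rule card_Diff_subset) (use BE in auto)
  then have "real (card (?E - ?B)) = real (\<Sum>j=1..s. a j - 1) - real (min (\<Sum>j=1..s. a j - 1) M)"
    unfolding cE cB b(2) by (simp add: of_nat_diff)
  also have "\<dots> \<le> max 0 (real (\<Sum>j=1..s. a j) - T / real \<alpha> + 1)"
  proof -
    have "(\<Sum>j=1..s. a j - 1) \<le> (\<Sum>j=1..s. a j)" by (intro sum_mono) auto
    then have "real (\<Sum>j=1..s. a j - 1) \<le> real (\<Sum>j=1..s. a j)" by (simp only: of_nat_le_iff)
    then show ?thesis using M(2) by (auto simp: min_def max_def)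
  qed
  finally have c2: "real (card (?E - ?B)) \<le> max 0 (real (\<Sum>j=1..s. a j) - T / real \<alpha> + 1)" .
  have q1: "1 \<le> real CARD('a)" by (simp add: Suc_leI)
  have "real CARD('a) ^ card (?E - ?B) = real CARD('a) powr real (card (?E - ?B))"
    using q1 by (simp add: powr_realpow)
  also have "\<dots> \<le> real CARD('a) powr (max 0 (real (\<Sum>j=1..s. a j) - T / real \<alpha> + 1))"
    using c2 q1 by (rule powr_mono)
  finally show ?thesis using c1 by linarith
qed

text \<open>Dual elements are grouped by their leading positions \<open>P\<close> and the digits
  \<open>W\<close> there. Within a group all digits at or above the last leading position agree, so
  the fibre count applies with that threshold. Being the smallest of \<open>\<alpha>\<close>
  positions, it makes the count grow at most like q to the power 1/\<alpha> times the weight. The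
  factor q^(-\<theta>) per unit of weight beats this because \<theta> > 1/\<alpha>, and \<rho> is
  the resulting ratio.\<close>

lemma sum_dual_le:
  assumes v: "v \<subseteq> {1..s}" "v \<noteq> {}" and \<theta>: "1 / real \<alpha> < \<theta>" "\<theta> \<le> 1" and q2: "2 \<le> CARD('a)"
  defines "q \<equiv> real CARD('a)" and "d \<equiv> card v * \<alpha>"
  defines "\<rho> \<equiv> q powr (1 / real \<alpha> - \<theta>)"
  shows "(\<Sum>k\<in>{k\<in>dual. \<forall>j\<in>{1..s}. support N k j \<noteq> {} \<longleftrightarrow> j \<in> v}.
        q powr (- \<theta> * real (\<Sum>j\<in>v. top_sum \<alpha> (support N k j))))
     \<le> q ^ (s * \<alpha> + 2 * \<alpha> * \<alpha> + 1) * (q powr (- \<theta> * T) * ((T + 2) ^ (d - 1) / (1 - \<rho>) ^ d))"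
proof -
  define I where "I = v \<times> {..<\<alpha>}"
  define K where "K = {k\<in>dual. \<forall>j\<in>{1..s}. support N k j \<noteq> {} \<longleftrightarrow> j \<in> v}"
  define P where "P k = (\<lambda>(j, l)\<in>I. head_pos (support N k j) l)" for k :: "nat \<times> nat \<Rightarrow> 'a"
  \<comment> \<open>At a padded position 0 a dual element takes the value \<open>undefined\<close>,
    so no choice arises there.\<close>
  define W where "W k = (\<lambda>(j, l)\<in>I. k (j, head_pos (support N k j) l))" for k :: "nat \<times> nat \<Rightarrow> 'a"
  define L where "L = nat \<lceil>T - real (\<alpha> * \<alpha>)\<rceil>"
  have q: "1 < q" using q2 by (simp add: q_def)
  have \<alpha>0: "0 < real \<alpha>" using \<alpha> by simp
  have fv: "finite v" using v finite_subset by auto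
  have "{..<\<alpha>} \<noteq> {}" using \<alpha> by (simp add: lessThan_empty_iff)
  then have fI: "finite I" "I \<noteq> {}" "card I = d" using fv v(2) by (simp_all add: I_def d_def card_cartesian_product)
  have fK: "finite K" unfolding K_def using finite_dual by simp
  have \<rho>: "0 < \<rho>" "\<rho> < 1" using q \<theta> by (auto simp: \<rho>_def powr_less_one)
  have sumP: "(\<Sum>j\<in>v. top_sum \<alpha> (support N k j)) = sum (P k) I" for k
  proof -
    have "sum (P k) I = (\<Sum>(j, l)\<in>v \<times> {..<\<alpha>}. head_pos (support N k j) l)"
      unfolding P_def I_def by (intro sum.cong) auto
    also have "\<dots> = (\<Sum>j\<in>v. top_sum \<alpha> (support N k j))" unfolding top_sum_eq by (rule sum.cartesian_product[symmetric])
    finally show ?thesis by simp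
  qed
  have PN: "P k \<in> I \<rightarrow>\<^sub>E {0..N}" for k
  proof -
    have "head_pos (support N k j) l \<le> N" for j l by (rule head_pos_le) (auto simp: support_def)
    then show ?thesis by (auto simp: P_def)
  qed
  have WU: "W k \<in> I \<rightarrow>\<^sub>E UNIV" for k by (simp add: W_def)
  have LP: "L \<le> sum (P k) I" and TP: "T - real (\<alpha> * \<alpha>) \<le> real (sum (P k) I)" if k: "k \<in> K" for k
  proof -
    obtain j0 where j0: "j0 \<in> v" using v by blast
    then have "j0 \<in> {1..s}" "support N k j0 \<noteq> {}" using v k by (auto simp: K_def)
    moreover have "k \<in> dual" using k by (simp add: K_def)
    ultimately have "T - real (\<alpha> * \<alpha>) \<le> real (\<Sum>j=1..s. top_sum \<alpha> (support N k j))" by (rule top_sum_dual_ge[rotated])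
    also have "(\<Sum>j=1..s. top_sum \<alpha> (support N k j)) = (\<Sum>j\<in>v. top_sum \<alpha> (support N k j))"
    proof (rule sum.mono_neutral_right)
      show "\<forall>j\<in>{1..s} - v. top_sum \<alpha> (support N k j) = 0"
      proof
        fix j assume "j \<in> {1..s} - v"
        then have "support N k j = {}" using k by (auto simp: K_def)
        then show "top_sum \<alpha> (support N k j) = 0" by (simp add: top_sum_def desc_def)
      qed
    qed (use v in auto)
    finally show 1: "T - real (\<alpha> * \<alpha>) \<le> real (sum (P k) I)" unfolding sumP .
    then have "\<lceil>T - real (\<alpha> * \<alpha>)\<rceil> \<le> int (sum (P k) I)" by (simp add: ceiling_le_iff)
    then show "L \<le> sum (P k) I" unfolding L_def by linarith
  qed
  define F where "F a = q powr (real (\<alpha> * \<alpha>) + 1 - T / real \<alpha>) * \<rho> ^ sum a I" for a :: "nat \<times> nat \<Rightarrow> nat"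
  have F0: "0 \<le> F a" for a using q \<rho> by (simp add: F_def)
  have fiber: "(\<Sum>k\<in>{k\<in>K. (P k, W k) = (P k0, W k0)}. q powr (- \<theta> * real (sum (P k) I))) \<le> F (P k0)" if k0: "k0 \<in> K" for k0
  proof -
    \<comment> \<open>The threshold is the last of the \<open>\<alpha>\<close> leading positions.
      Outside v there are no nonzero digits, and the threshold 0 prescribes them all.\<close>
    define a where "a j = (if j \<in> v then head_pos (support N k0 j) (\<alpha> - 1) else 0)" for j
    have aN: "a j \<le> N" for j
      unfolding a_def using head_pos_le[of "support N k0 j" N "\<alpha> - 1"] by (auto simp: support_def)
    let ?G = "{k\<in>dual. \<forall>j\<in>{1..s}. \<forall>i\<in>{1..N}. a j \<le> i \<longrightarrow> k (j, i) = k0 (j, i)}"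
    have sub: "{k\<in>K. (P k, W k) = (P k0, W k0)} \<subseteq> ?G"
    proof
      fix k assume "k \<in> {k\<in>K. (P k, W k) = (P k0, W k0)}"
      then have k: "k \<in> K" and PW: "P k = P k0" "W k = W k0" by auto
      have hp: "head_pos (support N k j) l = head_pos (support N k0 j) l" if "j \<in> v" "l < \<alpha>" for j l
        using fun_cong[OF PW(1), of "(j, l)"] that by (simp add: P_def I_def)
      have wv: "k (j, head_pos (support N k j) l) = k0 (j, head_pos (support N k0 j) l)" if "j \<in> v" "l < \<alpha>" for j l
        using fun_cong[OF PW(2), of "(j, l)"] that by (simp add: W_def I_def)
      have "k (j, i) = k0 (j, i)" if j: "j \<in> {1..s}" and i: "i \<in> {1..N}" and ai: "a j \<le> i" for j i
      proof (cases "j \<in> v")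
        case False
        then have "support N k j = {}" "support N k0 j = {}" using j k k0 by (auto simp: K_def)
        then show ?thesis using i by (auto simp: support_def)
      next
        case True
        have h0: "head_pos (support N k0 j) (\<alpha> - 1) \<le> i" using ai True by (simp add: a_def)
        then have h: "head_pos (support N k j) (\<alpha> - 1) \<le> i" using hp[OF True, of "\<alpha> - 1"] \<alpha> by simp
        consider "k (j, i) \<noteq> 0" | "k0 (j, i) \<noteq> 0" | "k (j, i) = 0" "k0 (j, i) = 0" by blast
        then show ?thesis
        proof cases
          case 1
          then have "i \<in> support N k j" using i by (simp add: support_def)
          from head_pos_mem[OF finite_support this h \<alpha>] obtain l where "l < \<alpha>" "head_pos (support N k j) l = i" by blast
          then show ?thesis using wv[OF True] hp[OF True] by metis
        next
          case 2
          then have "i \<in> support N k0 j" using i by (simp add: support_def)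
          from head_pos_mem[OF finite_support this h0 \<alpha>] obtain l where "l < \<alpha>" "head_pos (support N k0 j) l = i" by blast
          then show ?thesis using wv[OF True] hp[OF True] by metis
        qed simp
      qed
      moreover have "k \<in> dual" using k by (simp add: K_def)
      ultimately show "k \<in> ?G" by simp
    qed
    have fG: "finite ?G" using finite_dual by simp
    let ?X = "real (\<Sum>j=1..s. a j)"
    have aX: "real \<alpha> * ?X \<le> real (sum (P k0) I)"
    proof -
      have "(\<Sum>j=1..s. a j) = (\<Sum>j\<in>v. head_pos (support N k0 j) (\<alpha> - 1))"
        unfolding a_def using v by (simp add: sum.If_cases Int_absorb1)
      then have "\<alpha> * (\<Sum>j=1..s. a j) = (\<Sum>j\<in>v. \<Sum>l<\<alpha>. head_pos (support N k0 j) (\<alpha> - 1))" by (simp add: sum_distrib_left)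
      also have "\<dots> \<le> (\<Sum>j\<in>v. \<Sum>l<\<alpha>. head_pos (support N k0 j) l)"
        by (intro sum_mono head_pos_antimono) auto
      also have "\<dots> = sum (P k0) I" unfolding sumP[symmetric] top_sum_eq ..
      finally show ?thesis unfolding of_nat_mult[symmetric] by (rule of_nat_mono)
    qed
    \<comment> \<open>The maximum with 0 is removed by means of weight \<ge>
      \<open>T - \<alpha> * \<alpha>\<close>, at the cost of the summand
      \<open>\<alpha> * \<alpha>\<close>.\<close>
    have expo: "max 0 (?X - T / real \<alpha> + 1) \<le> (real (sum (P k0) I) - T) / real \<alpha> + real (\<alpha> * \<alpha>) + 1"
    proof -
      have "?X \<le> real (sum (P k0) I) / real \<alpha>" using aX \<alpha>0 by (simp add: le_divide_eq mult.commute)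
      moreover have "- real (\<alpha> * \<alpha>) \<le> (real (sum (P k0) I) - T) / real \<alpha>"
      proof -
        have "- real (\<alpha> * \<alpha>) / 1 \<le> - real (\<alpha> * \<alpha>) / real \<alpha>" using \<alpha> by (intro divide_left_mono_neg) auto
        also have "\<dots> \<le> (real (sum (P k0) I) - T) / real \<alpha>" using TP[OF k0] \<alpha>0 by (intro divide_right_mono) auto
        finally show ?thesis by simp
      qed
      moreover have "0 \<le> real (\<alpha> * \<alpha>)" by simp
      ultimately show ?thesis by (simp only: diff_divide_distrib)
    qed
    have "(\<Sum>k\<in>{k\<in>K. (P k, W k) = (P k0, W k0)}. q powr (- \<theta> * real (sum (P k) I))) =
       real (card {k\<in>K. (P k, W k) = (P k0, W k0)}) * q powr (- \<theta> * real (sum (P k0) I))" by simp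
    also have "\<dots> \<le> real (card ?G) * q powr (- \<theta> * real (sum (P k0) I))"
      by (intro mult_right_mono of_nat_mono card_mono fG sub) auto
    also have "\<dots> \<le> q powr (max 0 (?X - T / real \<alpha> + 1)) * q powr (- \<theta> * real (sum (P k0) I))"
    proof (intro mult_right_mono)
      show "real (card ?G) \<le> q powr (max 0 (?X - T / real \<alpha> + 1))"
        unfolding q_def by (rule card_dual_fiber_le) (use k0 aN in \<open>auto simp: K_def\<close>)
    qed auto
    also have "\<dots> \<le> q powr ((real (sum (P k0) I) - T) / real \<alpha> + real (\<alpha> * \<alpha>) + 1) * q powr (- \<theta> * real (sum (P k0) I))"
      using q expo by (intro mult_right_mono powr_mono) auto
    also have "\<dots> = F (P k0)"
      using q unfolding F_def \<rho>_def by (simp add: powr_power powr_add[symmetric] diff_divide_distrib algebra_simps)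
    finally show ?thesis .
  qed
  have "(\<Sum>k\<in>K. q powr (- \<theta> * real (sum (P k) I))) =
     (\<Sum>h\<in>(\<lambda>k. (P k, W k)) ` K. \<Sum>k\<in>{k\<in>K. (P k, W k) = h}. q powr (- \<theta> * real (sum (P k) I)))"
    by (rule sum.image_gen[OF fK])
  also have "\<dots> \<le> (\<Sum>h\<in>(\<lambda>k. (P k, W k)) ` K. F (fst h))"
    by (rule sum_mono) (use fiber in auto)
  also have "\<dots> \<le> (\<Sum>h\<in>{a\<in>I \<rightarrow>\<^sub>E {0..N}. L \<le> sum a I} \<times> (I \<rightarrow>\<^sub>E (UNIV :: 'a set)). F (fst h))"
  proof (rule sum_mono2)
    show "finite ({a\<in>I \<rightarrow>\<^sub>E {0..N}. L \<le> sum a I} \<times> (I \<rightarrow>\<^sub>E (UNIV :: 'a set)))"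
    proof (intro finite_cartesian_product)
      have "finite (I \<rightarrow>\<^sub>E {0..N})" by (rule finite_PiE[OF fI(1)]) simp
      then show "finite {a\<in>I \<rightarrow>\<^sub>E {0..N}. L \<le> sum a I}" by (rule rev_finite_subset) blast
      show "finite (I \<rightarrow>\<^sub>E (UNIV :: 'a set))" by (rule finite_PiE[OF fI(1)]) simp
    qed
    show "(\<lambda>k. (P k, W k)) ` K \<subseteq> {a\<in>I \<rightarrow>\<^sub>E {0..N}. L \<le> sum a I} \<times> (I \<rightarrow>\<^sub>E (UNIV :: 'a set))"
      by (rule image_subsetI, rule SigmaI, rule CollectI, rule conjI[OF PN LP], assumption, rule WU)
  qed (use F0 in auto)
  also have "\<dots> = (\<Sum>a\<in>{a\<in>I \<rightarrow>\<^sub>E {0..N}. L \<le> sum a I}. \<Sum>b\<in>(I \<rightarrow>\<^sub>E (UNIV :: 'a set)). F a)"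
    by (subst sum.cartesian_product) (simp add: split_def)
  also have "\<dots> = q ^ d * (\<Sum>a\<in>{a\<in>I \<rightarrow>\<^sub>E {0..N}. L \<le> sum a I}. F a)"
    using fI by (simp add: card_PiE q_def sum_distrib_left)
  also have "\<dots> = q ^ d * (q powr (real (\<alpha> * \<alpha>) + 1 - T / real \<alpha>) * (\<Sum>a\<in>{a\<in>I \<rightarrow>\<^sub>E {0..N}. L \<le> sum a I}. \<rho> ^ sum a I))"
    unfolding F_def by (simp add: sum_distrib_left)
  also have "\<dots> \<le> q ^ (s * \<alpha>) * (q powr (real (\<alpha> * \<alpha>) + 1 - T / real \<alpha>) * (q powr ((1 / real \<alpha> - \<theta>) * T + real (\<alpha> * \<alpha>)) * (T + 2) ^ (d - 1) / (1 - \<rho>) ^ d))"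
  proof (intro mult_mono)
    have "card v \<le> s" using card_mono[OF _ v(1)] by simp
    then show "q ^ d \<le> q ^ (s * \<alpha>)" unfolding d_def using q by (intro power_increasing) auto
    have "(\<Sum>a\<in>{a\<in>I \<rightarrow>\<^sub>E {0..N}. L \<le> sum a I}. \<rho> ^ sum a I) \<le> \<rho> ^ L * (real L + 1) ^ (d - 1) / (1 - \<rho>) ^ d"
      using sum_power_lattice_le[OF \<rho> fI(1,2), of N L] unfolding fI(3) .
    also have "\<dots> \<le> q powr ((1 / real \<alpha> - \<theta>) * T + real (\<alpha> * \<alpha>)) * (T + 2) ^ (d - 1) / (1 - \<rho>) ^ d"
    proof (intro divide_right_mono mult_mono power_mono)
      have L1: "T - real (\<alpha> * \<alpha>) \<le> real L" unfolding L_def by linarith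
      have L2: "real L \<le> T + 1" unfolding L_def using T(1) by linarith
      show "real L + 1 \<le> T + 2" using L2 by simp
      \<comment> \<open>Replacing L by T in the exponent costs at most another
        \<open>\<alpha> * \<alpha>\<close>, since 0 < \<theta> - 1/\<alpha> \<le> 1. Together with
        the fibre count this gives the exponent \<open>2 * \<alpha> * \<alpha> + 1\<close> in the
        constant.\<close>
      have "\<rho> ^ L = q powr ((1 / real \<alpha> - \<theta>) * real L)" using q unfolding \<rho>_def by (simp add: powr_power mult.commute)
      also have "\<dots> \<le> q powr ((1 / real \<alpha> - \<theta>) * T + real (\<alpha> * \<alpha>))"
      proof (rule powr_mono)
        have "(1 / real \<alpha> - \<theta>) * real L \<le> (1 / real \<alpha> - \<theta>) * (T - real (\<alpha> * \<alpha>))"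
          using L1 \<theta> by (intro mult_left_mono_neg) auto
        also have "\<dots> = (1 / real \<alpha> - \<theta>) * T + (\<theta> - 1 / real \<alpha>) * real (\<alpha> * \<alpha>)" by (simp add: algebra_simps)
        also have "(\<theta> - 1 / real \<alpha>) * real (\<alpha> * \<alpha>) \<le> 1 * real (\<alpha> * \<alpha>)"
        proof (rule mult_right_mono)
          have "0 \<le> 1 / real \<alpha>" by simp
          then show "\<theta> - 1 / real \<alpha> \<le> 1" using \<theta>(2) by linarith
        qed simp
        finally show "(1 / real \<alpha> - \<theta>) * real L \<le> (1 / real \<alpha> - \<theta>) * T + real (\<alpha> * \<alpha>)" by simp
      qed (use q in simp)
      finally show "\<rho> ^ L \<le> q powr ((1 / real \<alpha> - \<theta>) * T + real (\<alpha> * \<alpha>))" .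
    qed (use \<rho> T in auto)
    finally show "(\<Sum>a\<in>{a\<in>I \<rightarrow>\<^sub>E {0..N}. L \<le> sum a I}. \<rho> ^ sum a I) \<le> q powr ((1 / real \<alpha> - \<theta>) * T + real (\<alpha> * \<alpha>)) * (T + 2) ^ (d - 1) / (1 - \<rho>) ^ d" .
  qed (use q \<rho> T in \<open>auto intro!: sum_nonneg mult_nonneg_nonneg\<close>)
  also have "\<dots> = q ^ (s * \<alpha> + 2 * \<alpha> * \<alpha> + 1) * (q powr (- \<theta> * T) * ((T + 2) ^ (d - 1) / (1 - \<rho>) ^ d))"
  proof -
    have "q powr (real (\<alpha> * \<alpha>) + 1 - T / real \<alpha>) * q powr ((1 / real \<alpha> - \<theta>) * T + real (\<alpha> * \<alpha>)) = q powr (real (2 * \<alpha> * \<alpha> + 1)) * q powr (- \<theta> * T)"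
      unfolding powr_add[symmetric] by (rule arg_cong[where f = "\<lambda>z. q powr z"]) (simp add: algebra_simps)
    also have "q powr (real (2 * \<alpha> * \<alpha> + 1)) = q ^ (2 * \<alpha> * \<alpha> + 1)" using q by (intro powr_realpow) simp
    finally show ?thesis by (simp only: power_add mult.assoc times_divide_eq_right times_divide_eq_left mult.left_commute mult.commute)
  qed
  finally show ?thesis unfolding K_def sumP .
qed

end

section \<open>Walsh coefficients\<close>

lemma ennpowr_inverse: "0 < a \<Longrightarrow> ennpowr (ennpowr x a) (1 / a) = x"
  by (cases x) (auto simp: ennpowr_def powr_powr)

lemma ennpowr_mono: "0 < a \<Longrightarrow> x \<le> y \<Longrightarrow> ennpowr x a \<le> ennpowr y a"
  by (cases x; cases y) (auto simp: ennpowr_def powr_mono2 top_unique)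

lemma ennpowr_less_top: "ennpowr x a < \<infinity> \<Longrightarrow> x < \<infinity>"
  by (cases x) (auto simp: ennpowr_def)

text \<open>A single term is dominated by the q-th root of the sum of q-th powers, and a missing
  marginal would make its term infinite.\<close>

lemma hk_variationD:
  assumes hk: "hk_variation lam p q u g < \<infinity>" and u: "finite u" and q: "1 \<le> q" and w: "w \<subseteq> u"
  shows "marginal_exists u w g"
    and "w \<noteq> {} \<Longrightarrow> vitali_variation lam p w (marginal u w g) \<le> hk_variation lam p q u g"
    and "w = {} \<Longrightarrow> ennreal \<bar>marginal u {} g (\<lambda>_. undefined)\<bar> \<le> hk_variation lam p q u g"
proof -
  define t where "t w = (if \<not> marginal_exists u w g then \<infinity>
         else if w = {} then ennreal \<bar>marginal u {} g (\<lambda>_. undefined)\<bar>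
         else vitali_variation lam p w (marginal u w g))" for w
  have "ennpowr (t w) q \<le> (\<Sum>w\<in>Pow u. ennpowr (t w) q)"
    by (rule member_le_sum) (use u w in auto)
  then have "ennpowr (ennpowr (t w) q) (1 / q) \<le> hk_variation lam p q u g"
    unfolding hk_variation_def t_def[symmetric] using q by (intro ennpowr_mono) auto
  then have t: "t w \<le> hk_variation lam p q u g" using q by (simp add: ennpowr_inverse)
  then show m: "marginal_exists u w g" using hk by (auto simp: t_def split: if_splits)
  show "w \<noteq> {} \<Longrightarrow> vitali_variation lam p w (marginal u w g) \<le> hk_variation lam p q u g"
    using t m by (simp add: t_def)
  show "w = {} \<Longrightarrow> ennreal \<bar>marginal u {} g (\<lambda>_. undefined)\<bar> \<le> hk_variation lam p q u g"
    using t m by (simp add: t_def)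
qed

lemma unit_cube_fold:
  fixes f :: "(nat \<Rightarrow> real) \<Rightarrow> 'b::{banach,second_countable_topology}"
  assumes IJ: "I \<inter> J = {}" and fin: "finite I" "finite J" and f: "integrable (unit_cube (I \<union> J)) f"
  shows "integrable (unit_cube I) (\<lambda>x. \<integral>y. f (merge I J (x, y)) \<partial>unit_cube J)"
proof -
  interpret I: prob_space "unit_cube I" by (rule prob_space_unit_cube)
  interpret J: prob_space "unit_cube J" by (rule prob_space_unit_cube)
  interpret P: pair_prob_space "unit_cube I" "unit_cube J" ..
  have "integrable (unit_cube I \<Otimes>\<^sub>M unit_cube J) (\<lambda>p. f (merge I J p))"
    by (rule integrable_distr[OF measurable_merge]) (simp add: cube.distr_merge[OF IJ fin] f)
  then have "integrable (unit_cube I \<Otimes>\<^sub>M unit_cube J) (\<lambda>(x, y). f (merge I J (x, y)))" by (simp add: split_def)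
  from P.integrable_fst[OF this] show ?thesis by simp
qed

lemma marginal_eq: "finite u \<Longrightarrow> marginal u w g x = (\<integral>y. g (merge w (u - w) (x, y)) \<partial>unit_cube (u - w))"
  unfolding marginal_def by (rule set_integral_cube_eq) simp

text \<open>Freezing w in a marginal and integrating the rest is Fubini for the section of g frozen
  at w, whose integrability is part of the existence of the marginal belonging to w.\<close>

lemma section_integrable_marginal:
  assumes u: "finite u" and X: "X \<subseteq> u" and ex: "\<And>w. w \<subseteq> u \<Longrightarrow> marginal_exists u w g"
  shows "section_integrable X (\<lambda>x. of_real (marginal u X g x))"
  unfolding section_integrable_def
proof (intro allI impI ballI)
  fix w x assume w: "w \<subseteq> X" and x: "x \<in> cube w"
  let ?h = "\<lambda>y. g (merge w (u - w) (x, y))"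
  have "integrable (unit_cube (u - w)) ?h"
    using ex[of w] w X x set_integrable_cube_iff[of "u - w" ?h] u unfolding marginal_exists_def by blast
  moreover have "u - w = (X - w) \<union> (u - X)" using w X by auto
  ultimately have "integrable (unit_cube ((X - w) \<union> (u - X))) ?h" by simp
  from unit_cube_fold[OF _ _ _ this]
  have "integrable (unit_cube (X - w)) (\<lambda>y. \<integral>y'. ?h (merge (X - w) (u - X) (y, y')) \<partial>unit_cube (u - X))"
    using u finite_subset[OF X u] by auto
  moreover have "merge w (u - w) (x, merge (X - w) (u - X) (y, y')) = merge X (u - X) (merge w (X - w) (x, y), y')" for y y'
    using w X by (auto simp: merge_def fun_eq_iff)
  ultimately have "integrable (unit_cube (X - w)) (\<lambda>y. marginal u X g (merge w (X - w) (x, y)))"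
    unfolding marginal_eq[OF u] by simp
  then show "integrable (unit_cube (X - w)) (\<lambda>y. complex_of_real (marginal u X g (merge w (X - w) (x, y))))" by simp
qed

lemma integral_eq_sum_cells:
  fixes f :: "real \<Rightarrow> complex"
  assumes L: "0 < L" and f: "integrable unit_lborel f"
  shows "integral\<^sup>L unit_lborel f = (\<Sum>c<L. \<integral>x. indicator {real c / real L..<(real c + 1) / real L} x *\<^sub>R f x \<partial>unit_lborel)"
proof -
  have L': "0 < real L" using L by simp
  let ?I = "\<lambda>c::nat. {real c / real L..<(real c + 1) / real L}"
  have ind: "indicator (?I c) x = (if \<lfloor>real L * x\<rfloor> = int c then 1 else 0 :: real)" for x c
    using mem_cell_iff[OF L', of x "int c"] unfolding indicator_def by simp
  have int: "integrable unit_lborel (\<lambda>x. indicator (?I c) x *\<^sub>R f x)" for c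
  proof -
    have m: "(\<lambda>x. complex_of_real (indicator (?I c) x)) \<in> borel_measurable unit_lborel"
      by (rule borel_measurable_unit_lborel) measurable
    have "integrable unit_lborel (\<lambda>x. f x * of_real (indicator (?I c) x))"
      by (rule integrable_bounded_mult[where B = 1, OF f m]) (auto simp: indicator_def)
    then show ?thesis by (simp add: scaleR_conv_of_real mult.commute)
  qed
  have "(\<Sum>c<L. indicator (?I c) x *\<^sub>R f x) = f x" if x: "0 \<le> x" "x < 1" for x
  proof -
    have fl: "0 \<le> \<lfloor>real L * x\<rfloor>" "\<lfloor>real L * x\<rfloor> < int L" using L' x by (simp_all add: floor_less_iff)
    have "(\<Sum>c<L. indicator (?I c) x *\<^sub>R f x) = (\<Sum>c<L. if c = nat \<lfloor>real L * x\<rfloor> then f x else 0)"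
      unfolding ind using fl by (intro sum.cong refl) auto
    also have "\<dots> = f x" using fl by (simp add: nat_less_iff)
    finally show ?thesis .
  qed
  then have "integral\<^sup>L unit_lborel f = (\<integral>x. (\<Sum>c<L. indicator (?I c) x *\<^sub>R f x) \<partial>unit_lborel)"
    by (intro Bochner_Integration.integral_cong) auto
  also have "\<dots> = (\<Sum>c<L. \<integral>x. indicator (?I c) x *\<^sub>R f x \<partial>unit_lborel)"
    by (rule Bochner_Integration.integral_sum[OF int])
  finally show ?thesis .
qed

text \<open>
  Splitting every kernel into its mean and a mean-zero part reduces the integral to the marginals of
  \<open>g\<close>, which is where the lower-dimensional terms of the Hardy and Krause variation enter.
\<close>

lemma norm_integral_le_hk_variation:
  fixes g :: "(nat \<Rightarrow> real) \<Rightarrow> real" and \<theta> :: "nat \<Rightarrow> real \<Rightarrow> complex"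
  assumes u: "finite u" and lam: "0 < lam" "lam \<le> 1" and p: "1 \<le> p" and q: "1 \<le> q"
    and hk: "hk_variation lam p q u g < \<infinity>"
    and L: "\<And>j. j \<in> u \<Longrightarrow> 0 < L j"
    and \<theta>: "\<And>j. j \<in> u \<Longrightarrow> \<theta> j \<in> borel_measurable unit_lborel"
    and B: "\<And>j x. j \<in> u \<Longrightarrow> 0 \<le> x \<Longrightarrow> x < 1 \<Longrightarrow> norm (\<theta> j x) \<le> B j"
    and mean: "\<And>j. j \<in> u \<Longrightarrow> L j = 1 \<or> (\<forall>c<L j.
        (\<integral>x. indicator {real c / real (L j)..<(real c + 1) / real (L j)} x *\<^sub>R \<theta> j x \<partial>unit_lborel) = 0)"
  shows "norm (\<integral>x. of_real (g x) * (\<Prod>j\<in>u. \<theta> j (x j)) \<partial>unit_cube u)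
     \<le> 32 ^ card u * (\<Prod>j\<in>u. B j * real (L j) powr (- lam)) * enn2real (hk_variation lam p q u g)"
proof -
  define V where "V = enn2real (hk_variation lam p q u g)"
  define b where "b j = B j * real (L j) powr (- lam)" for j
  define \<mu> where "\<mu> j = integral\<^sup>L unit_lborel (\<theta> j)" for j
  define \<eta> where "\<eta> j x = \<theta> j x - \<mu> j" for j x
  have V0: "0 \<le> V" by (simp add: V_def)
  have ex: "marginal_exists u w g" if "w \<subseteq> u" for w by (rule hk_variationD(1)[OF hk u q that])
  have B0: "0 \<le> B j" if "j \<in> u" for j using order_trans[OF norm_ge_zero B[OF that, of 0]] by simp
  have b0: "0 \<le> b j" if "j \<in> u" for j using B0[OF that] by (simp add: b_def)
  have int\<theta>: "integrable unit_lborel (\<theta> j)" if "j \<in> u" for j by (rule integrable_unit_lborel_bounded[OF \<theta>[OF that] B[OF that]])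
  \<comment> \<open>A nonzero mean is possible only for L j = 1, where the factor L^(-lam) is 1; so
    the mean is bounded by \<open>b j\<close> in either case.\<close>
  have \<mu>0: "\<mu> j = 0" if "j \<in> u" "L j \<noteq> 1" for j
    unfolding \<mu>_def integral_eq_sum_cells[OF L[OF that(1)] int\<theta>[OF that(1)]] using mean[OF that(1)] that(2) by (intro sum.neutral) auto
  have \<mu>B: "norm (\<mu> j) \<le> B j" if "j \<in> u" for j unfolding \<mu>_def by (rule norm_integral_unit_lborel_le[OF \<theta>[OF that] B[OF that]])
  have \<mu>b: "norm (\<mu> j) \<le> b j" if "j \<in> u" for j
    using \<mu>0[OF that] \<mu>B[OF that] b0[OF that] by (cases "L j = 1") (auto simp: b_def)
  have \<eta>m: "\<eta> j \<in> borel_measurable unit_lborel" if "j \<in> u" for j unfolding \<eta>_def using \<theta>[OF that] by simp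
  have \<eta>B: "norm (\<eta> j x) \<le> 2 * B j" if "j \<in> u" "0 \<le> x" "x < 1" for j x
    using norm_triangle_ineq4[of "\<theta> j x" "\<mu> j"] B[OF that] \<mu>B[OF that(1)] unfolding \<eta>_def by linarith
  have \<eta>0: "(\<integral>x. indicator {real c / real (L j)..<(real c + 1) / real (L j)} x *\<^sub>R \<eta> j x \<partial>unit_lborel) = 0"
    if j: "j \<in> u" and c: "c < L j" for j c
  proof (cases "L j = 1")
    case True
    then have "(\<integral>x. indicator {real c / real (L j)..<(real c + 1) / real (L j)} x *\<^sub>R \<eta> j x \<partial>unit_lborel) = (\<integral>x. \<theta> j x - \<mu> j \<partial>unit_lborel)"
      using c by (intro Bochner_Integration.integral_cong) (auto simp: \<eta>_def)
    also have "\<dots> = \<mu> j - (\<integral>x. \<mu> j \<partial>unit_lborel)"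
      unfolding \<mu>_def by (rule Bochner_Integration.integral_diff[OF int\<theta>[OF j]]) simp
    also have "\<dots> = 0" using unit_lborel.prob_space by simp
    finally show ?thesis .
  next
    case False
    then show ?thesis using mean[OF j] c \<mu>0[OF j] by (simp add: \<eta>_def)
  qed
  have gint: "integrable (unit_cube u) (\<lambda>x. complex_of_real (g x))"
  proof -
    have "integrable (unit_cube (u - {})) (\<lambda>y. g (merge {} (u - {}) (\<lambda>_. undefined, y)))"
      using ex[of "{}"] set_integrable_cube_iff[of u] u unfolding marginal_exists_def by (simp add: cube_def)
    moreover have "merge {} u (\<lambda>_. undefined, y) = y" if "y \<in> cube u" for y
      using that by (auto simp: merge_def cube_def PiE_def extensional_def)
    ultimately have "integrable (unit_cube u) g"
      by (subst Bochner_Integration.integrable_cong[OF refl, where g = "\<lambda>y. g (merge {} u (\<lambda>_. undefined, y))"]) auto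
    then show ?thesis by simp
  qed
  have int: "integrable (unit_cube u) (\<lambda>x. of_real (g x) * (\<Prod>j\<in>X. \<eta> j (x j)))" if X: "X \<subseteq> u" for X
  proof (rule integrable_bounded_mult[OF gint])
    show "(\<lambda>x. \<Prod>j\<in>X. \<eta> j (x j)) \<in> borel_measurable (unit_cube u)"
      by (rule measurable_prod_coordinates[OF _ X]) (use X in \<open>auto intro: \<eta>m\<close>)
    show "norm (\<Prod>j\<in>X. \<eta> j (x j)) \<le> (\<Prod>j\<in>X. 2 * B j)" if "x \<in> space (unit_cube u)" for x
      by (rule norm_prod_coordinates_le[OF _ X]) (use X that in \<open>auto intro: \<eta>B\<close>)
  qed
  \<comment> \<open>The variables outside X are integrated out of g first, and the box differences
    of the resulting marginal are bounded by its Vitali variation.\<close>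
  have part: "norm (\<integral>x. of_real (g x) * (\<Prod>j\<in>X. \<eta> j (x j)) \<partial>unit_cube u) \<le> V * (\<Prod>j\<in>X. 16 * b j)" if X: "X \<subseteq> u" for X
  proof -
    have fX: "finite X" using X u finite_subset by auto
    have uX: "X \<union> (u - X) = u" using X by auto
    have "(\<integral>x. of_real (g x) * (\<Prod>j\<in>X. \<eta> j (x j)) \<partial>unit_cube u) =
       (\<integral>x. (\<integral>y. of_real (g (merge X (u - X) (x, y))) * (\<Prod>j\<in>X. \<eta> j (merge X (u - X) (x, y) j)) \<partial>unit_cube (u - X)) \<partial>unit_cube X)"
      using cube.product_integral_fold[of X "u - X" "\<lambda>x. of_real (g x) * (\<Prod>j\<in>X. \<eta> j (x j))"] int[OF X] fX u uX by simp
    also have "\<dots> = (\<integral>x. of_real (marginal u X g x) * (\<Prod>j\<in>X. \<eta> j (x j)) \<partial>unit_cube X)"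
    proof (rule Bochner_Integration.integral_cong[OF refl])
      fix x
      have e: "(\<Prod>j\<in>X. \<eta> j (merge X (u - X) (x, y) j)) = (\<Prod>j\<in>X. \<eta> j (x j))" for y
        by (intro prod.cong refl) (simp add: merge_def)
      show "(\<integral>y. of_real (g (merge X (u - X) (x, y))) * (\<Prod>j\<in>X. \<eta> j (merge X (u - X) (x, y) j)) \<partial>unit_cube (u - X)) =
         of_real (marginal u X g x) * (\<Prod>j\<in>X. \<eta> j (x j))"
        unfolding e marginal_eq[OF u] by (simp only: integral_mult_left_zero integral_complex_of_real)
    qed
    finally have eq: "(\<integral>x. of_real (g x) * (\<Prod>j\<in>X. \<eta> j (x j)) \<partial>unit_cube u) = (\<integral>x. of_real (marginal u X g x) * (\<Prod>j\<in>X. \<eta> j (x j)) \<partial>unit_cube X)" .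
    have "norm (\<integral>x. of_real (marginal u X g x) * (\<Prod>j\<in>X. \<eta> j (x j)) \<partial>unit_cube X) \<le>
       ((\<Prod>j\<in>X. 4 * real (L j)) powr (1 - lam) * V) * (\<Prod>j\<in>X. 2 * (2 * B j) / real (L j))"
    proof (rule norm_integral_le_box_differences[OF fX section_integrable_marginal[OF u X ex]])
      fix lo hi assume gap: "\<And>j. j \<in> X \<Longrightarrow> admissible_gap (L j) (lo j) (hi j)"
      have "(\<Sum>c\<in>Pi\<^sub>E X (\<lambda>j. {..<L j}). \<bar>box_diff X (marginal u X g) (\<lambda>j. lo j (c j), \<lambda>j. hi j (c j))\<bar>)
        \<le> (\<Prod>j\<in>X. 4 * real (L j)) powr (1 - lam) * V"
      proof (cases "X = {}")
        case True
        have "enn2real (ennreal \<bar>marginal u {} g (\<lambda>_. undefined)\<bar>) \<le> V"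
          unfolding V_def by (rule enn2real_mono[OF hk_variationD(3)[OF hk u q empty_subsetI refl]]) (use hk in simp)
        then show ?thesis using True by (simp add: box_diff_def vertex_def restrict_def)
      next
        case False
        have le: "vitali_variation lam p X (marginal u X g) \<le> hk_variation lam p q u g"
          by (rule hk_variationD(2)[OF hk u q X False])
        then have "vitali_variation lam p X (marginal u X g) < \<infinity>" using hk by (rule le_less_trans)
        then have "(\<Sum>c\<in>Pi\<^sub>E X (\<lambda>j. {..<L j}). \<bar>box_diff X (marginal u X g) (\<lambda>j. lo j (c j), \<lambda>j. hi j (c j))\<bar>)
          \<le> (\<Prod>j\<in>X. 4 * real (L j)) powr (1 - lam) * enn2real (vitali_variation lam p X (marginal u X g))"
          by (intro box_differences_le_vitali[OF fX lam p]) (use L X gap in auto)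
        also have "\<dots> \<le> (\<Prod>j\<in>X. 4 * real (L j)) powr (1 - lam) * V"
          unfolding V_def by (intro mult_left_mono enn2real_mono le) (use hk in auto)
        finally show ?thesis .
      qed
      then show "(\<Sum>c\<in>Pi\<^sub>E X (\<lambda>j. {..<L j}). norm (cbox_diff X (\<lambda>x. of_real (marginal u X g x)) (\<lambda>j. lo j (c j), \<lambda>j. hi j (c j))))
        \<le> (\<Prod>j\<in>X. 4 * real (L j)) powr (1 - lam) * V"
        unfolding cbox_diff_of_real by (simp only: norm_of_real)
    qed (use X L \<eta>m \<eta>B \<eta>0 in auto)
    also have "\<dots> = V * (\<Prod>j\<in>X. (4 * real (L j)) powr (1 - lam) * (4 * B j / real (L j)))"
    proof -
      have "(\<Prod>j\<in>X. 4 * real (L j)) powr (1 - lam) = (\<Prod>j\<in>X. (4 * real (L j)) powr (1 - lam))"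
        by (rule prod_powr_distrib)
      moreover have "2 * (2 * B j) / real (L j) = 4 * B j / real (L j)" for j by simp
      ultimately show ?thesis by (simp only: prod.distrib mult_ac)
    qed
    also have "\<dots> \<le> V * (\<Prod>j\<in>X. 16 * b j)"
    proof (intro mult_left_mono V0 prod_mono conjI)
      fix j assume "j \<in> X"
      then have j: "j \<in> u" using X by auto
      have Lj: "0 < real (L j)" using L[OF j] by simp
      show "0 \<le> (4 * real (L j)) powr (1 - lam) * (4 * B j / real (L j))" using B0[OF j] Lj by simp
      \<comment> \<open>4^(1 - lam) is replaced by 4 to be free of lam; with the 4 that comes from
        the two factors 2 in front of \<open>B j\<close> this makes 16.\<close>
      have "(4 * real (L j)) powr (1 - lam) = 4 powr (1 - lam) * (real (L j) powr (- lam) * real (L j))"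
        using Lj by (simp add: powr_mult powr_diff powr_minus field_simps)
      also have "4 powr (1 - lam) * (real (L j) powr (- lam) * real (L j)) \<le> 4 powr 1 * (real (L j) powr (- lam) * real (L j))"
        using lam by (intro mult_right_mono powr_mono) auto
      finally have "(4 * real (L j)) powr (1 - lam) * (4 * B j / real (L j)) \<le> (4 * (real (L j) powr (- lam) * real (L j))) * (4 * B j / real (L j))"
        using B0[OF j] by (intro mult_right_mono) auto
      also have "\<dots> = 16 * b j" using Lj by (simp add: b_def)
      finally show "(4 * real (L j)) powr (1 - lam) * (4 * B j / real (L j)) \<le> 16 * b j" .
    qed
    finally show ?thesis unfolding eq .
  qed
  have "(\<integral>x. of_real (g x) * (\<Prod>j\<in>u. \<theta> j (x j)) \<partial>unit_cube u) =
    (\<integral>x. (\<Sum>X\<in>Pow u. (\<Prod>j\<in>u - X. \<mu> j) * (of_real (g x) * (\<Prod>j\<in>X. \<eta> j (x j)))) \<partial>unit_cube u)"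
  proof (rule Bochner_Integration.integral_cong[OF refl])
    fix x
    have "(\<Prod>j\<in>u. \<theta> j (x j)) = (\<Prod>j\<in>u. \<eta> j (x j) + \<mu> j)" by (simp add: \<eta>_def)
    also have "\<dots> = (\<Sum>X\<in>Pow u. (\<Prod>j\<in>X. \<eta> j (x j)) * (\<Prod>j\<in>u - X. \<mu> j))" by (rule prod_add[OF u])
    finally show "of_real (g x) * (\<Prod>j\<in>u. \<theta> j (x j)) = (\<Sum>X\<in>Pow u. (\<Prod>j\<in>u - X. \<mu> j) * (of_real (g x) * (\<Prod>j\<in>X. \<eta> j (x j))))"
      by (simp add: sum_distrib_left mult_ac)
  qed
  also have "\<dots> = (\<Sum>X\<in>Pow u. \<integral>x. (\<Prod>j\<in>u - X. \<mu> j) * (of_real (g x) * (\<Prod>j\<in>X. \<eta> j (x j))) \<partial>unit_cube u)"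
    by (rule Bochner_Integration.integral_sum) (rule integrable_mult_right, rule int, blast)
  also have "\<dots> = (\<Sum>X\<in>Pow u. (\<Prod>j\<in>u - X. \<mu> j) * (\<integral>x. of_real (g x) * (\<Prod>j\<in>X. \<eta> j (x j)) \<partial>unit_cube u))"
    by (simp only: integral_mult_right_zero)
  also have "norm \<dots> \<le> (\<Sum>X\<in>Pow u. V * (\<Prod>j\<in>u. 16 * b j))"
  proof (rule sum_norm_le)
    fix X assume "X \<in> Pow u"
    then have X: "X \<subseteq> u" by simp
    have "norm (\<Prod>j\<in>u - X. \<mu> j) \<le> (\<Prod>j\<in>u - X. 16 * b j)"
      unfolding prod_norm[symmetric]
    proof (intro prod_mono conjI norm_ge_zero)
      fix j assume "j \<in> u - X"
      then show "norm (\<mu> j) \<le> 16 * b j" using \<mu>b[of j] b0[of j] by auto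
    qed
    moreover have "0 \<le> (\<Prod>j\<in>u - X. 16 * b j)" by (rule prod_nonneg) (use b0 in auto)
    ultimately have "norm (\<Prod>j\<in>u - X. \<mu> j) * norm (\<integral>x. of_real (g x) * (\<Prod>j\<in>X. \<eta> j (x j)) \<partial>unit_cube u) \<le>
       (\<Prod>j\<in>u - X. 16 * b j) * (V * (\<Prod>j\<in>X. 16 * b j))"
      by (intro mult_mono part[OF X] norm_ge_zero)
    also have "\<dots> = V * (\<Prod>j\<in>u. 16 * b j)"
      using prod.subset_diff[OF X u, of "\<lambda>j. 16 * b j"] by simp
    finally show "norm ((\<Prod>j\<in>u - X. \<mu> j) * (\<integral>x. of_real (g x) * (\<Prod>j\<in>X. \<eta> j (x j)) \<partial>unit_cube u)) \<le> V * (\<Prod>j\<in>u. 16 * b j)"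
      by (simp only: norm_mult)
  qed
  also have "\<dots> = 32 ^ card u * (\<Prod>j\<in>u. b j) * V"
  proof -
    \<comment> \<open>A factor 16 from each coordinate, and a factor 2 for each from the number of
      subsets X.\<close>
    have "(32 :: real) ^ card u = 2 ^ card u * 16 ^ card u" by (simp flip: power_mult_distrib)
    then show ?thesis using u by (simp add: card_Pow prod.distrib)
  qed
  finally show ?thesis unfolding V_def b_def .
qed

section \<open>Walsh coefficients of a smooth integrand\<close>

definition taylor_index :: "nat \<Rightarrow> nat \<Rightarrow> (nat \<Rightarrow> nat) set" where
  "taylor_index \<delta> s = ({1..s} \<rightarrow>\<^sub>E {0..\<delta>})"

definition top_set :: "nat \<Rightarrow> nat \<Rightarrow> (nat \<Rightarrow> nat) \<Rightarrow> nat set" where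
  "top_set \<delta> s \<tau> = {j\<in>{1..s}. \<tau> j = \<delta>}"

lemma finite_top_set [simp]: "finite (top_set \<delta> s \<tau>)"
  by (simp add: top_set_def)

text \<open>Fubini moves the integration over x inside. With the monomials written as
  \<open>taylor_kernel\<close> at y = 0, every coordinate carries one kernel times
  \<open>\<Omega> j\<close>, so the integral over x factors into iterated tails.\<close>

lemma integral_taylor_term:
  fixes g :: "(nat \<Rightarrow> real) \<Rightarrow> real" and \<Omega> :: "nat \<Rightarrow> real \<Rightarrow> complex" and \<tau> :: "nat \<Rightarrow> nat" and k s :: nat
  assumes u: "u \<subseteq> {1..s}" and g: "integrable (unit_cube u) g"
    and \<Omega>: "\<And>j. j \<in> {1..s} \<Longrightarrow> \<Omega> j \<in> borel_measurable borel"
    and \<Omega>1: "\<And>j x. j \<in> {1..s} \<Longrightarrow> norm (\<Omega> j x) \<le> 1"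
  defines "h \<equiv> \<lambda>x. (\<Prod>j\<in>{1..s} - u. x j ^ \<tau> j / fact (\<tau> j)) * (\<integral>y. g y * (\<Prod>j\<in>u. taylor_kernel k (x j) (y j)) \<partial>unit_cube u)"
  shows "integrable (unit_cube {1..s}) (\<lambda>x. of_real (h x) * (\<Prod>j\<in>{1..s}. \<Omega> j (x j)))"
    and "(\<integral>x. of_real (h x) * (\<Prod>j\<in>{1..s}. \<Omega> j (x j)) \<partial>unit_cube {1..s}) =
     (\<Prod>j\<in>{1..s} - u. iter_tail (\<tau> j) (\<Omega> j) 0) * (\<integral>y. of_real (g y) * (\<Prod>j\<in>u. iter_tail k (\<Omega> j) (y j)) \<partial>unit_cube u)"
proof -
  let ?S = "{1..s}"
  interpret I: prob_space "unit_cube ?S" by (rule prob_space_unit_cube)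
  interpret J: prob_space "unit_cube u" by (rule prob_space_unit_cube)
  interpret P: pair_prob_space "unit_cube ?S" "unit_cube u" ..
  have fu: "finite u" using u finite_subset by auto
  have idm: "(\<lambda>x. x) \<in> borel_measurable unit_lborel" by (rule borel_measurable_unit_lborel) simp
  have cS: "(\<lambda>x. x j) \<in> borel_measurable (unit_cube ?S)" if "j \<in> ?S" for j
    using measurable_compose[OF measurable_component_singleton[OF that] idm] by simp
  have cu: "(\<lambda>x. x j) \<in> borel_measurable (unit_cube u)" if "j \<in> u" for j
    using measurable_compose[OF measurable_component_singleton[OF that] idm] by simp
  define \<phi> where "\<phi> j t y = of_real (if j \<in> u then taylor_kernel k t (y j) else taylor_kernel (\<tau> j) t 0) * \<Omega> j t"
    for j t and y :: "nat \<Rightarrow> real"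
  have \<phi>1: "norm (\<phi> j t y) \<le> 1" if "j \<in> ?S" "0 \<le> t" "t < 1" "y \<in> cube u" for j t y
  proof -
    have "0 \<le> y j" if "j \<in> u" using cubeD[OF \<open>y \<in> cube u\<close> that] by simp
    then have "\<bar>if j \<in> u then taylor_kernel k t (y j) else taylor_kernel (\<tau> j) t 0\<bar> \<le> 1"
      using taylor_kernel_le_1[of t "y j" k] taylor_kernel_le_1[of t 0 "\<tau> j"] taylor_kernel_nonneg[of k t "y j"] taylor_kernel_nonneg[of "\<tau> j" t 0] that
      by auto
    then show ?thesis unfolding \<phi>_def using \<Omega>1[OF that(1), of t] by (simp only: norm_mult norm_of_real mult_le_one norm_ge_zero)
  qed
  let ?H = "\<lambda>(x, y). complex_of_real (g y) * (\<Prod>j\<in>?S. \<phi> j (x j) y)"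
  have \<phi>m: "(\<lambda>p. \<phi> j (fst p j) (snd p)) \<in> borel_measurable (unit_cube ?S \<Otimes>\<^sub>M unit_cube u)" if j: "j \<in> ?S" for j
  proof -
    have [measurable]: "(\<lambda>p. fst p j) \<in> borel_measurable (unit_cube ?S \<Otimes>\<^sub>M unit_cube u)"
      by (rule measurable_compose[OF measurable_fst cS[OF j]])
    have [measurable]: "\<Omega> j \<in> borel_measurable borel" by (rule \<Omega>[OF j])
    show ?thesis
    proof (cases "j \<in> u")
      case True
      have [measurable]: "(\<lambda>p. snd p j) \<in> borel_measurable (unit_cube ?S \<Otimes>\<^sub>M unit_cube u)"
        by (rule measurable_compose[OF measurable_snd cu[OF True]])
      show ?thesis unfolding \<phi>_def if_P[OF True] by measurable
    next
      case False
      show ?thesis unfolding \<phi>_def if_not_P[OF False] by measurable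
    qed
  qed
  \<comment> \<open>The kernels and the functions \<open>\<Omega> j\<close> are bounded by 1 on the
    cube, so the integrability of \<open>g\<close> is inherited.\<close>
  have H: "integrable (unit_cube ?S \<Otimes>\<^sub>M unit_cube u) ?H"
  proof -
    have "integrable (unit_cube ?S \<Otimes>\<^sub>M unit_cube u) (\<lambda>p. complex_of_real (g (snd p)))"
    proof (rule P.Fubini_integrable)
      have gm: "(\<lambda>y. complex_of_real (g y)) \<in> borel_measurable (unit_cube u)" using g by simp
      show "(\<lambda>p. complex_of_real (g (snd p))) \<in> borel_measurable (unit_cube ?S \<Otimes>\<^sub>M unit_cube u)"
        by (rule measurable_compose[OF measurable_snd gm])
      show "integrable (unit_cube ?S) (\<lambda>x. \<integral>y. norm (complex_of_real (g (snd (x, y)))) \<partial>unit_cube u)"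
        by (simp only: snd_conv I.integrable_const)
      show "AE x in unit_cube ?S. integrable (unit_cube u) (\<lambda>y. complex_of_real (g (snd (x, y))))"
        using g by simp
    qed
    then have "integrable (unit_cube ?S \<Otimes>\<^sub>M unit_cube u) (\<lambda>p. complex_of_real (g (snd p)) * (\<Prod>j\<in>?S. \<phi> j (fst p j) (snd p)))"
    proof (rule integrable_bounded_mult)
      show "(\<lambda>p. \<Prod>j\<in>?S. \<phi> j (fst p j) (snd p)) \<in> borel_measurable (unit_cube ?S \<Otimes>\<^sub>M unit_cube u)"
        by (rule borel_measurable_prod) (rule \<phi>m)
      show "norm (\<Prod>j\<in>?S. \<phi> j (fst p j) (snd p)) \<le> 1" if "p \<in> space (unit_cube ?S \<Otimes>\<^sub>M unit_cube u)" for p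
      proof -
        have "norm (\<Prod>j\<in>?S. \<phi> j (fst p j) (snd p)) \<le> (\<Prod>j\<in>?S. 1)"
          unfolding prod_norm[symmetric]
          by (intro prod_mono conjI norm_ge_zero \<phi>1) (use that cubeD[of "fst p" ?S] in \<open>auto simp: space_pair_measure\<close>)
        then show ?thesis by simp
      qed
    qed
    then show ?thesis by (simp add: split_def)
  qed
  have inner: "(\<integral>y. ?H (x, y) \<partial>unit_cube u) = of_real (h x) * (\<Prod>j\<in>?S. \<Omega> j (x j))" if x: "x \<in> cube ?S" for x
  proof -
    have e: "(\<Prod>j\<in>?S. \<phi> j (x j) y) = of_real (\<Prod>j\<in>u. taylor_kernel k (x j) (y j)) * (of_real (\<Prod>j\<in>?S - u. x j ^ \<tau> j / fact (\<tau> j)) * (\<Prod>j\<in>?S. \<Omega> j (x j)))" for y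
    proof -
      have "(\<Prod>j\<in>?S. \<phi> j (x j) y) = (\<Prod>j\<in>?S. of_real (if j \<in> u then taylor_kernel k (x j) (y j) else x j ^ \<tau> j / fact (\<tau> j))) * (\<Prod>j\<in>?S. \<Omega> j (x j))"
        unfolding prod.distrib[symmetric] \<phi>_def by (intro prod.cong refl) (use cubeD[OF x] in \<open>simp add: taylor_kernel_def\<close>)
      also have "(\<Prod>j\<in>?S. complex_of_real (if j \<in> u then taylor_kernel k (x j) (y j) else x j ^ \<tau> j / fact (\<tau> j))) =
         of_real ((\<Prod>j\<in>u. taylor_kernel k (x j) (y j)) * (\<Prod>j\<in>?S - u. x j ^ \<tau> j / fact (\<tau> j)))"
      proof -
        have "(\<Prod>j\<in>?S. if j \<in> u then taylor_kernel k (x j) (y j) else x j ^ \<tau> j / fact (\<tau> j)) =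
           (\<Prod>j\<in>?S - u. x j ^ \<tau> j / fact (\<tau> j)) * (\<Prod>j\<in>u. taylor_kernel k (x j) (y j))"
          using prod.subset_diff[OF u finite_atLeastAtMost, of "\<lambda>j. if j \<in> u then taylor_kernel k (x j) (y j) else x j ^ \<tau> j / fact (\<tau> j)"] by simp
        then show ?thesis by (simp only: of_real_prod[symmetric] mult.commute)
      qed
      finally show ?thesis by (simp only: of_real_mult mult.assoc)
    qed
    have "(\<integral>y. ?H (x, y) \<partial>unit_cube u) = (\<integral>y. of_real (g y * (\<Prod>j\<in>u. taylor_kernel k (x j) (y j))) * (of_real (\<Prod>j\<in>?S - u. x j ^ \<tau> j / fact (\<tau> j)) * (\<Prod>j\<in>?S. \<Omega> j (x j))) \<partial>unit_cube u)"
      by (simp only: prod.case e of_real_mult mult.assoc)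
    also have "\<dots> = of_real (\<integral>y. g y * (\<Prod>j\<in>u. taylor_kernel k (x j) (y j)) \<partial>unit_cube u) * (of_real (\<Prod>j\<in>?S - u. x j ^ \<tau> j / fact (\<tau> j)) * (\<Prod>j\<in>?S. \<Omega> j (x j)))"
      by (simp only: integral_mult_left_zero integral_complex_of_real)
    also have "\<dots> = of_real (h x) * (\<Prod>j\<in>?S. \<Omega> j (x j))" unfolding h_def by (simp only: of_real_mult mult_ac)
    finally show ?thesis .
  qed
  show "integrable (unit_cube ?S) (\<lambda>x. of_real (h x) * (\<Prod>j\<in>?S. \<Omega> j (x j)))"
    by (rule iffD1[OF Bochner_Integration.integrable_cong[OF refl] P.integrable_fst[OF H]]) (use inner in simp)
  have "(\<integral>x. of_real (h x) * (\<Prod>j\<in>?S. \<Omega> j (x j)) \<partial>unit_cube ?S) = (\<integral>x. (\<integral>y. ?H (x, y) \<partial>unit_cube u) \<partial>unit_cube ?S)"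
    by (rule Bochner_Integration.integral_cong[OF refl]) (use inner in simp)
  also have "\<dots> = (\<integral>y. (\<integral>x. ?H (x, y) \<partial>unit_cube ?S) \<partial>unit_cube u)"
    using P.Fubini_integral[OF H] by simp
  also have "\<dots> = (\<integral>y. (\<Prod>j\<in>?S - u. iter_tail (\<tau> j) (\<Omega> j) 0) * (of_real (g y) * (\<Prod>j\<in>u. iter_tail k (\<Omega> j) (y j))) \<partial>unit_cube u)"
  proof (rule Bochner_Integration.integral_cong[OF refl])
    fix y assume "y \<in> space (unit_cube u)"
    then have y: "y \<in> cube u" by simp
    have "(\<integral>x. (\<Prod>j\<in>?S. \<phi> j (x j) y) \<partial>unit_cube ?S) = (\<Prod>j\<in>?S. \<integral>t. \<phi> j t y \<partial>unit_lborel)"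
    proof (rule cube.product_integral_prod)
      fix j assume j: "j \<in> ?S"
      have [measurable]: "\<Omega> j \<in> borel_measurable borel" by (rule \<Omega>[OF j])
      have "(\<lambda>t. \<phi> j t y) \<in> borel_measurable unit_lborel"
        by (rule borel_measurable_unit_lborel) (simp add: \<phi>_def)
      then show "integrable unit_lborel (\<lambda>t. \<phi> j t y)"
        by (rule integrable_unit_lborel_bounded) (rule \<phi>1[OF j _ _ y])
    qed simp
    also have "\<dots> = (\<Prod>j\<in>?S. if j \<in> u then iter_tail k (\<Omega> j) (y j) else iter_tail (\<tau> j) (\<Omega> j) 0)"
      by (intro prod.cong refl) (simp add: \<phi>_def iter_tail_def)
    also have "\<dots> = (\<Prod>j\<in>?S - u. iter_tail (\<tau> j) (\<Omega> j) 0) * (\<Prod>j\<in>u. iter_tail k (\<Omega> j) (y j))"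
      using prod.subset_diff[OF u finite_atLeastAtMost, of "\<lambda>j. if j \<in> u then iter_tail k (\<Omega> j) (y j) else iter_tail (\<tau> j) (\<Omega> j) 0"] by simp
    finally show "(\<integral>x. ?H (x, y) \<partial>unit_cube ?S) = (\<Prod>j\<in>?S - u. iter_tail (\<tau> j) (\<Omega> j) 0) * (of_real (g y) * (\<Prod>j\<in>u. iter_tail k (\<Omega> j) (y j)))"
      by (simp only: prod.case integral_mult_right_zero mult.left_commute)
  qed
  finally show "(\<integral>x. of_real (h x) * (\<Prod>j\<in>?S. \<Omega> j (x j)) \<partial>unit_cube ?S) =
     (\<Prod>j\<in>?S - u. iter_tail (\<tau> j) (\<Omega> j) 0) * (\<integral>y. of_real (g y) * (\<Prod>j\<in>u. iter_tail k (\<Omega> j) (y j)) \<partial>unit_cube u)"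
    by (simp only: integral_mult_right_zero)
qed

text \<open>Up to shifts by one, the exponent on the left is the sum of the first \<delta> positions
  plus lam times the next one. As the positions decrease, replacing the weights 1, ..., 1, lam by
  their mean \<theta> only lowers this sum; the shifts cost at most \<delta> + 1.\<close>

lemma top_weight_le:
  fixes \<delta> q :: nat and lam :: real
  assumes q: "1 \<le> q" and A: "finite A" and lam: "0 \<le> lam" "lam \<le> 1"
  defines "L \<equiv> if \<delta> < card A then q ^ (desc A ! \<delta> - 1) else 1"
  shows "1 / real q ^ level_sum \<delta> (desc A) * real L powr (- lam) \<le>
    real q ^ Suc \<delta> * real q powr (- ((real \<delta> + lam) / (real \<delta> + 1)) * real (top_sum (Suc \<delta>) A))"
proof -
  define h where "h l = real (head_pos A l)" for l
  define \<theta> where "\<theta> = (real \<delta> + lam) / (real \<delta> + 1)"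
  have q0: "0 < real q" "1 \<le> real q" using q by auto
  have "level_sum \<delta> (desc A) = (\<Sum>l<\<delta>. if l < card A then desc A ! l - 1 else 0)"
    unfolding level_sum_def using sum_list_take_nth[of "\<lambda>a. a - 1" \<delta> "desc A"] by simp
  also have "real \<dots> \<ge> (\<Sum>l<\<delta>. h l - 1)"
    unfolding of_nat_sum by (rule sum_mono) (auto simp: h_def head_pos_def)
  finally have e1: "(\<Sum>l<\<delta>. h l) - real \<delta> \<le> real (level_sum \<delta> (desc A))" by (simp add: sum_subtractf)
  define e where "e = (if \<delta> < card A then real (desc A ! \<delta> - 1) else 0)"
  have "real L = real q powr e" unfolding L_def e_def using q0 by (simp add: powr_realpow)
  then have L: "real L powr (- lam) = real q powr (- lam * e)" by (simp add: powr_powr mult.commute)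
  have e2: "lam * h \<delta> - 1 \<le> lam * e"
  proof -
    have "lam * (h \<delta> - 1) \<le> lam * e" using lam by (intro mult_left_mono) (auto simp: e_def h_def head_pos_def)
    then show ?thesis using lam by (simp add: algebra_simps)
  qed
  have "(\<Sum>l<\<delta>. h \<delta>) \<le> (\<Sum>l<\<delta>. h l)" unfolding h_def by (intro sum_mono of_nat_mono head_pos_antimono) auto
  then have hs: "real \<delta> * h \<delta> \<le> (\<Sum>l<\<delta>. h l)" by simp
  \<comment> \<open>The right-hand side exceeds the left-hand side by (1 - lam) / (\<delta> + 1)
    times \<open>(\<Sum>l<\<delta>. h l) - real \<delta> * h \<delta>\<close>.\<close>
  have "\<theta> * ((\<Sum>l<\<delta>. h l) + h \<delta>) \<le> (\<Sum>l<\<delta>. h l) + lam * h \<delta>"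
  proof -
    have d: "0 < real \<delta> + 1" by simp
    have "(1 - lam) * (real \<delta> * h \<delta>) \<le> (1 - lam) * (\<Sum>l<\<delta>. h l)" using hs lam by (intro mult_left_mono) auto
    then have "(real \<delta> + lam) * ((\<Sum>l<\<delta>. h l) + h \<delta>) \<le> ((\<Sum>l<\<delta>. h l) + lam * h \<delta>) * (real \<delta> + 1)"
      by (simp add: algebra_simps)
    then show ?thesis using d unfolding \<theta>_def by (simp add: divide_le_eq)
  qed
  moreover have "real (top_sum (Suc \<delta>) A) = (\<Sum>l<\<delta>. h l) + h \<delta>" unfolding top_sum_eq h_def by simp
  ultimately have "- real (level_sum \<delta> (desc A)) - lam * e \<le> real (Suc \<delta>) - \<theta> * real (top_sum (Suc \<delta>) A)"
    using e1 e2 by simp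
  then have "real q powr (- real (level_sum \<delta> (desc A)) - lam * e) \<le> real q powr (real (Suc \<delta>) - \<theta> * real (top_sum (Suc \<delta>) A))"
    using q0 by (intro powr_mono)
  also have "\<dots> = real q ^ Suc \<delta> * real q powr (- \<theta> * real (top_sum (Suc \<delta>) A))"
    using q0 by (simp only: diff_conv_add_uminus powr_add powr_realpow mult_minus_left)
  also have "real q powr (- real (level_sum \<delta> (desc A)) - lam * e) = 1 / real q ^ level_sum \<delta> (desc A) * real L powr (- lam)"
    unfolding L using q0 by (simp add: powr_diff powr_minus powr_realpow divide_inverse)
  finally show ?thesis unfolding \<theta>_def .
qed

text \<open>Here \<open>r\<close> is the exponent that combines the Vitali variations of the
  marginals. Finite variation for every \<tau> is what a finite \<open>N_functional\<close>
  supplies, also at vanishing weights, where the variation must be 0.\<close>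

locale smooth_integrand =
  fixes \<delta> s :: nat and f :: "(nat \<Rightarrow> real) \<Rightarrow> real" and lam p r :: real
  assumes \<delta>: "1 \<le> \<delta>" and smooth: "smooth_mixed \<delta> s f" and lam: "0 < lam" "lam \<le> 1" and p: "1 \<le> p" and r: "1 \<le> r"
    and hk_finite: "\<And>\<tau>. \<tau> \<in> taylor_index \<delta> s \<Longrightarrow>
      hk_variation lam p r (top_set \<delta> s \<tau>) (anchored s (top_set \<delta> s \<tau>) (mixed_deriv s \<tau> f)) < \<infinity>"
begin

definition D :: "(nat \<Rightarrow> nat) \<Rightarrow> (nat \<Rightarrow> real) \<Rightarrow> real" where
  "D \<tau> = anchored s (top_set \<delta> s \<tau>) (mixed_deriv s \<tau> f)"

definition V :: "(nat \<Rightarrow> nat) \<Rightarrow> real" where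
  "V \<tau> = enn2real (hk_variation lam p r (top_set \<delta> s \<tau>) (D \<tau>))"

definition T :: "(nat \<Rightarrow> nat) \<Rightarrow> (nat \<Rightarrow> real) \<Rightarrow> real" where
  "T \<tau> x = (\<Prod>j\<in>{1..s} - top_set \<delta> s \<tau>. x j ^ \<tau> j / fact (\<tau> j)) *
     (\<integral>y. D \<tau> y * (\<Prod>j\<in>top_set \<delta> s \<tau>. taylor_kernel (\<delta> - 1) (x j) (y j)) \<partial>unit_cube (top_set \<delta> s \<tau>))"

lemma finite_taylor_index: "finite (taylor_index \<delta> s)"
  unfolding taylor_index_def by (intro finite_PiE) auto

lemma expansion:
  assumes x: "x \<in> cube {1..s}"
  shows "f x = (\<Sum>\<tau>\<in>taylor_index \<delta> s. T \<tau> x)"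
proof -
  have "{j\<in>{1..s}. \<tau> j < \<delta>} = {1..s} - top_set \<delta> s \<tau>" if "\<tau> \<in> taylor_index \<delta> s" for \<tau>
  proof -
    have "\<tau> j \<le> \<delta>" if "j \<in> {1..s}" for j using \<open>\<tau> \<in> taylor_index \<delta> s\<close> that unfolding taylor_index_def by (drule_tac PiE_mem) auto
    then show ?thesis by (force simp: top_set_def)
  qed
  then show ?thesis
    unfolding taylor_expansion_anchored[OF \<delta> smooth x] T_def D_def taylor_index_def[symmetric] top_set_def[symmetric]
    by (intro sum.cong refl) simp
qed

lemma integrable_D: "\<tau> \<in> taylor_index \<delta> s \<Longrightarrow> integrable (unit_cube (top_set \<delta> s \<tau>)) (D \<tau>)"
proof -
  assume \<tau>: "\<tau> \<in> taylor_index \<delta> s"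
  let ?u = "top_set \<delta> s \<tau>"
  have "marginal_exists ?u {} (D \<tau>)"
    unfolding D_def by (rule hk_variationD(1)[OF hk_finite[OF \<tau>] _ r]) auto
  then have "integrable (unit_cube ?u) (\<lambda>y. D \<tau> (merge {} ?u (\<lambda>_. undefined, y)))"
    using set_integrable_cube_iff[of ?u] unfolding marginal_exists_def by (simp add: cube_def)
  moreover have "merge {} ?u (\<lambda>_. undefined, y) = y" if "y \<in> cube ?u" for y
    using that by (auto simp: merge_def cube_def PiE_def extensional_def)
  ultimately show ?thesis
    by (subst Bochner_Integration.integrable_cong[OF refl, where g = "\<lambda>y. D \<tau> (merge {} ?u (\<lambda>_. undefined, y))"]) auto
qed

lemma top_set_subset: "top_set \<delta> s \<tau> \<subseteq> {1..s}"
  by (auto simp: top_set_def)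

text \<open>Continuity on the half-open cube does not bound f near the upper faces. Each Taylor term
  is integrable, by the case of constant \<open>\<Omega>\<close>, and f is their finite sum.\<close>

lemma integrable_f: "integrable (unit_cube {1..s}) f"
proof -
  have "integrable (unit_cube {1..s}) (\<lambda>x. complex_of_real (T \<tau> x))" if "\<tau> \<in> taylor_index \<delta> s" for \<tau>
    using integral_taylor_term(1)[OF top_set_subset integrable_D[OF that], where \<Omega> = "\<lambda>_ _. 1" and \<tau> = \<tau> and k = "\<delta> - 1", folded T_def]
    by simp
  then have "integrable (unit_cube {1..s}) (\<lambda>x. T \<tau> x)" if "\<tau> \<in> taylor_index \<delta> s" for \<tau>
    using integrable_Re[of "unit_cube {1..s}" "\<lambda>x. complex_of_real (T \<tau> x)"] that by simp
  then have "integrable (unit_cube {1..s}) (\<lambda>x. \<Sum>\<tau>\<in>taylor_index \<delta> s. T \<tau> x)"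
    by (rule Bochner_Integration.integrable_sum)
  then show ?thesis
    by (rule iffD1[OF Bochner_Integration.integrable_cong[OF refl], rotated]) (simp add: expansion)
qed

text \<open>Each Taylor term factors over the coordinates. A factor of order i < \<delta> vanishes
  if its coordinate has more than i positions, and otherwise has gained all of them; the factors of
  order \<delta> form one integral controlled by the variation. In particular, order 0 in a
  coordinate with positions kills the term, which restricts the sum over \<tau>.\<close>

lemma walsh_coefficient_le:
  fixes \<omega> :: "nat \<Rightarrow> nat \<Rightarrow> nat \<Rightarrow> complex"
  assumes q: "1 \<le> q" and A: "\<And>j. j \<in> {1..s} \<Longrightarrow> A j \<subseteq> {1..N}"
    and \<omega>: "\<And>j a. j \<in> {1..s} \<Longrightarrow> a \<in> A j \<Longrightarrow> (\<Sum>d<q. \<omega> j a d) = 0"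
    and \<omega>1: "\<And>j a d. j \<in> {1..s} \<Longrightarrow> a \<in> A j \<Longrightarrow> norm (\<omega> j a d) \<le> 1"
  shows "norm (\<integral>x. of_real (f x) * (\<Prod>j\<in>{1..s}. walsh q (\<omega> j) (desc (A j)) (x j)) \<partial>unit_cube {1..s})
    \<le> 32 ^ s * real q ^ (s * Suc \<delta>) * real q powr (- ((real \<delta> + lam) / (real \<delta> + 1)) * real (\<Sum>j=1..s. top_sum (Suc \<delta>) (A j)))
      * (\<Sum>\<tau>\<in>{\<tau>\<in>taylor_index \<delta> s. \<forall>j\<in>{1..s}. A j \<noteq> {} \<longrightarrow> 0 < \<tau> j}. V \<tau>)"
proof -
  let ?S = "{1..s}" and ?\<theta> = "(real \<delta> + lam) / (real \<delta> + 1)"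
  define \<Omega> where "\<Omega> j = walsh q (\<omega> j) (desc (A j))" for j
  \<comment> \<open>The number of cells on which the last kernel has mean zero: they belong to the
    position of index \<delta>, the (\<delta>+1)-st largest, and without such a position the whole
    interval is one cell.\<close>
  define L where "L j = (if \<delta> < card (A j) then q ^ (desc (A j) ! \<delta> - 1) else 1)" for j
  define B where "B j = 1 / real q ^ level_sum \<delta> (desc (A j))" for j
  define b where "b j = B j * real (L j) powr (- lam)" for j
  have q0: "0 < q" "1 \<le> real q" using q by auto
  have fA: "finite (A j)" if "j \<in> ?S" for j using A[OF that] finite_subset by blast
  have b0: "0 \<le> b j" for j by (simp add: b_def B_def)
  have \<Omega>m: "\<Omega> j \<in> borel_measurable borel" for j unfolding \<Omega>_def by (rule walsh_measurable)
  have \<Omega>1: "norm (\<Omega> j x) \<le> 1" if "j \<in> ?S" for j x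
    unfolding \<Omega>_def by (rule norm_walsh_le_1) (use \<omega>1 fA that in auto)
  have tail: "(\<forall>y. 0 \<le> y \<and> y < 1 \<longrightarrow> norm (iter_tail k (\<Omega> j) y) \<le> 1 / real q ^ level_sum (Suc k) (desc (A j))) \<and>
     (k < card (A j) \<longrightarrow> iter_tail k (\<Omega> j) 0 = 0) \<and>
     (Suc k < card (A j) \<longrightarrow> (\<forall>c < q ^ (desc (A j) ! Suc k - 1).
        (\<integral>x. indicator {real c / real q ^ (desc (A j) ! Suc k - 1)..<(real c + 1) / real q ^ (desc (A j) ! Suc k - 1)} x *\<^sub>R
            iter_tail k (\<Omega> j) x \<partial>unit_lborel) = 0))" if j: "j \<in> ?S" for j k
  proof -
    have "periodic (1 / real q ^ N) (\<lambda>_. 1 :: complex)" by (simp add: periodic_def)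
    from iter_tail_periodic_walsh[OF q0(1) _ _ this sorted_wrt_desc, of 1 "A j" "\<omega> j" k]
    show ?thesis unfolding \<Omega>_def using A[OF j] \<omega>[OF j] \<omega>1[OF j] fA[OF j] by (auto simp: subset_iff)
  qed
  have tail0: "norm (iter_tail i (\<Omega> j) 0) \<le> b j" if j: "j \<in> ?S" and i: "i < \<delta>" for j i
  proof (cases "i < card (A j)")
    case True
    then show ?thesis using tail[OF j] b0 by simp
  next
    case False
    \<comment> \<open>There are at most i positions, so i + 1 and \<delta> integrations both exhaust
      the list.\<close>
    then have "take (Suc i) (desc (A j)) = take \<delta> (desc (A j))" using i by simp
    then have "level_sum (Suc i) (desc (A j)) = level_sum \<delta> (desc (A j))" by (simp only: level_sum_def)
    moreover have "L j = 1" using False i by (simp add: L_def)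
    ultimately show ?thesis using tail[OF j, of i] by (simp add: b_def B_def)
  qed
  have summand: "norm (\<integral>x. of_real (T \<tau> x) * (\<Prod>j\<in>?S. \<Omega> j (x j)) \<partial>unit_cube ?S) \<le>
      (if \<forall>j\<in>?S. A j \<noteq> {} \<longrightarrow> 0 < \<tau> j then 32 ^ s * (\<Prod>j\<in>?S. b j) * V \<tau> else 0)"
    if \<tau>: "\<tau> \<in> taylor_index \<delta> s" for \<tau>
  proof -
    let ?u = "top_set \<delta> s \<tau>"
    let ?I = "\<integral>y. of_real (D \<tau> y) * (\<Prod>j\<in>?u. iter_tail (\<delta> - 1) (\<Omega> j) (y j)) \<partial>unit_cube ?u"
    have \<tau>\<delta>: "\<tau> j < \<delta>" if "j \<in> ?S - ?u" for j
    proof -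
      have "\<tau> j \<le> \<delta>" using \<tau> that unfolding taylor_index_def by (drule_tac PiE_mem) auto
      then show ?thesis using that by (auto simp: top_set_def)
    qed
    have eq: "(\<integral>x. of_real (T \<tau> x) * (\<Prod>j\<in>?S. \<Omega> j (x j)) \<partial>unit_cube ?S) = (\<Prod>j\<in>?S - ?u. iter_tail (\<tau> j) (\<Omega> j) 0) * ?I"
      unfolding T_def by (rule integral_taylor_term(2)[OF top_set_subset integrable_D[OF \<tau>] \<Omega>m \<Omega>1])
    show ?thesis
    proof (cases "\<forall>j\<in>?S. A j \<noteq> {} \<longrightarrow> 0 < \<tau> j")
      case True
      have "norm (\<Prod>j\<in>?S - ?u. iter_tail (\<tau> j) (\<Omega> j) 0) \<le> (\<Prod>j\<in>?S - ?u. b j)"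
        unfolding prod_norm[symmetric] by (intro prod_mono conjI norm_ge_zero tail0) (use \<tau>\<delta> in auto)
      moreover have "norm ?I \<le> 32 ^ card ?u * (\<Prod>j\<in>?u. b j) * V \<tau>"
        unfolding V_def b_def
      proof (rule norm_integral_le_hk_variation[OF finite_top_set lam p r])
        show "hk_variation lam p r ?u (D \<tau>) < \<infinity>" unfolding D_def by (rule hk_finite[OF \<tau>])
        fix j assume "j \<in> ?u"
        then have j: "j \<in> ?S" using top_set_subset by blast
        show "0 < L j" using q0 by (simp add: L_def)
        show "iter_tail (\<delta> - 1) (\<Omega> j) \<in> borel_measurable unit_lborel"
          by (intro borel_measurable_unit_lborel iter_tail_measurable \<Omega>m)
        show "norm (iter_tail (\<delta> - 1) (\<Omega> j) x) \<le> B j" if "0 \<le> x" "x < 1" for x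
          using tail[OF j, of "\<delta> - 1"] \<delta> that by (simp add: B_def)
        show "L j = 1 \<or> (\<forall>c<L j. (\<integral>x. indicator {real c / real (L j)..<(real c + 1) / real (L j)} x *\<^sub>R iter_tail (\<delta> - 1) (\<Omega> j) x \<partial>unit_lborel) = 0)"
          using tail[OF j, of "\<delta> - 1"] \<delta> by (cases "\<delta> < card (A j)") (simp_all add: L_def)
      qed
      ultimately have "norm (\<Prod>j\<in>?S - ?u. iter_tail (\<tau> j) (\<Omega> j) 0) * norm ?I \<le> (\<Prod>j\<in>?S - ?u. b j) * (32 ^ card ?u * (\<Prod>j\<in>?u. b j) * V \<tau>)"
        by (intro mult_mono prod_nonneg b0 norm_ge_zero)
      also have "\<dots> = 32 ^ card ?u * ((\<Prod>j\<in>?S. b j) * V \<tau>)"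
      proof -
        have ps: "(\<Prod>j\<in>?S. b j) = (\<Prod>j\<in>?S - ?u. b j) * (\<Prod>j\<in>?u. b j)"
          by (rule prod.subset_diff[OF top_set_subset finite_atLeastAtMost])
        show ?thesis unfolding ps by (simp only: mult_ac)
      qed
      also have "\<dots> \<le> 32 ^ s * ((\<Prod>j\<in>?S. b j) * V \<tau>)"
      proof (rule mult_right_mono)
        have "card ?u \<le> s" using card_mono[OF _ top_set_subset[of \<tau>]] by simp
        then show "(32 :: real) ^ card ?u \<le> 32 ^ s" by (intro power_increasing) auto
        show "0 \<le> (\<Prod>j\<in>?S. b j) * V \<tau>" by (intro mult_nonneg_nonneg prod_nonneg b0) (simp add: V_def)
      qed
      finally show ?thesis using True unfolding eq by (simp add: norm_mult mult.assoc)
    next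
      case False
      then obtain j where "j \<in> ?S" "A j \<noteq> {}" "\<not> 0 < \<tau> j" by blast
      then have j: "j \<in> ?S" "A j \<noteq> {}" "\<tau> j = 0" by simp_all
      have "0 < card (A j)" using fA[OF j(1)] j(2) by (simp add: card_gt_0_iff)
      then have "iter_tail (\<tau> j) (\<Omega> j) 0 = 0" using tail[OF j(1), of 0] j(3) by simp
      moreover have "j \<in> ?S - ?u" using j \<delta> by (auto simp: top_set_def)
      ultimately have "(\<Prod>j\<in>?S - ?u. iter_tail (\<tau> j) (\<Omega> j) 0) = 0" by (intro prod_zero) auto
      then show ?thesis using False unfolding eq by auto
    qed
  qed
  have "(\<integral>x. of_real (f x) * (\<Prod>j\<in>?S. \<Omega> j (x j)) \<partial>unit_cube ?S) =
     (\<integral>x. (\<Sum>\<tau>\<in>taylor_index \<delta> s. of_real (T \<tau> x) * (\<Prod>j\<in>?S. \<Omega> j (x j))) \<partial>unit_cube ?S)"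
    by (rule Bochner_Integration.integral_cong[OF refl]) (simp add: expansion sum_distrib_right)
  also have "\<dots> = (\<Sum>\<tau>\<in>taylor_index \<delta> s. \<integral>x. of_real (T \<tau> x) * (\<Prod>j\<in>?S. \<Omega> j (x j)) \<partial>unit_cube ?S)"
  proof (rule Bochner_Integration.integral_sum)
    fix \<tau> assume "\<tau> \<in> taylor_index \<delta> s"
    then show "integrable (unit_cube ?S) (\<lambda>x. of_real (T \<tau> x) * (\<Prod>j\<in>?S. \<Omega> j (x j)))"
      unfolding T_def by (intro integral_taylor_term(1)[OF top_set_subset integrable_D \<Omega>m \<Omega>1])
  qed
  also have "norm \<dots> \<le> (\<Sum>\<tau>\<in>taylor_index \<delta> s. if \<forall>j\<in>?S. A j \<noteq> {} \<longrightarrow> 0 < \<tau> j then 32 ^ s * (\<Prod>j\<in>?S. b j) * V \<tau> else 0)"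
    by (rule sum_norm_le) (rule summand)
  also have "\<dots> = (\<Sum>\<tau>\<in>{\<tau>\<in>taylor_index \<delta> s. \<forall>j\<in>?S. A j \<noteq> {} \<longrightarrow> 0 < \<tau> j}. 32 ^ s * (\<Prod>j\<in>?S. b j) * V \<tau>)"
    by (rule sum.inter_filter[OF finite_taylor_index, symmetric])
  also have "\<dots> = 32 ^ s * (\<Prod>j\<in>?S. b j) * (\<Sum>\<tau>\<in>{\<tau>\<in>taylor_index \<delta> s. \<forall>j\<in>?S. A j \<noteq> {} \<longrightarrow> 0 < \<tau> j}. V \<tau>)"
    by (rule sum_distrib_left[symmetric])
  also have "\<dots> \<le> 32 ^ s * (real q ^ (s * Suc \<delta>) * real q powr (- ?\<theta> * real (\<Sum>j=1..s. top_sum (Suc \<delta>) (A j)))) * (\<Sum>\<tau>\<in>{\<tau>\<in>taylor_index \<delta> s. \<forall>j\<in>?S. A j \<noteq> {} \<longrightarrow> 0 < \<tau> j}. V \<tau>)"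
  proof (intro mult_right_mono mult_left_mono sum_nonneg)
    have "(\<Prod>j\<in>?S. b j) \<le> (\<Prod>j\<in>?S. real q ^ Suc \<delta> * real q powr (- ?\<theta> * real (top_sum (Suc \<delta>) (A j))))"
    proof (intro prod_mono conjI b0)
      fix j assume "j \<in> ?S"
      then show "b j \<le> real q ^ Suc \<delta> * real q powr (- ?\<theta> * real (top_sum (Suc \<delta>) (A j)))"
        unfolding b_def B_def L_def using top_weight_le[OF q fA, of j lam \<delta>] lam by simp
    qed
    also have "\<dots> = real q ^ (s * Suc \<delta>) * real q powr (- ?\<theta> * real (\<Sum>j=1..s. top_sum (Suc \<delta>) (A j)))"
    proof -
      have "(\<Prod>j\<in>?S. real q powr (- ?\<theta> * real (top_sum (Suc \<delta>) (A j)))) = real q powr (\<Sum>j\<in>?S. - ?\<theta> * real (top_sum (Suc \<delta>) (A j)))"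
        using q0 by (intro powr_sum[symmetric]) auto
      moreover have "(\<Sum>j\<in>?S. - ?\<theta> * real (top_sum (Suc \<delta>) (A j))) = - ?\<theta> * real (\<Sum>j=1..s. top_sum (Suc \<delta>) (A j))"
        unfolding of_nat_sum by (rule sum_distrib_left[symmetric])
      moreover have "(\<Prod>j\<in>?S. real q ^ Suc \<delta>) = real q ^ (s * Suc \<delta>)"
        by (simp only: prod_constant card_atLeastAtMost diff_Suc_1 power_mult[symmetric] mult.commute)
      ultimately show ?thesis by (simp only: prod.distrib)
    qed
    finally show "(\<Prod>j\<in>?S. b j) \<le> real q ^ (s * Suc \<delta>) * real q powr (- ?\<theta> * real (\<Sum>j=1..s. top_sum (Suc \<delta>) (A j)))" .
  qed (auto simp: V_def)
  finally show ?thesis unfolding \<Omega>_def by (simp only: mult.assoc)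
qed

end

section \<open>The quadrature error\<close>

lemma floor_power_Suc:
  assumes "0 < q"
  shows "\<lfloor>real q ^ Suc i * x\<rfloor> = int q * \<lfloor>real q ^ i * x\<rfloor> + int (digit q (Suc i) x)"
proof -
  have "\<lfloor>real q ^ i * x\<rfloor> = \<lfloor>real q ^ Suc i * x\<rfloor> div int q"
    using floor_mult_power_div[of q i "Suc i" x] assms by simp
  moreover have "int (digit q (Suc i) x) = \<lfloor>real q ^ Suc i * x\<rfloor> mod int q"
    unfolding digit_def using assms by simp
  ultimately show ?thesis by (simp only: mult_div_mod_eq)
qed

lemma floor_eq_if_digits_eq:
  assumes q: "0 < q" and x: "0 \<le> x" "x < 1" and y: "0 \<le> y" "y < 1"
    and d: "\<And>i. i \<in> {1..N} \<Longrightarrow> digit q i x = digit q i y"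
  shows "\<lfloor>real q ^ N * x\<rfloor> = \<lfloor>real q ^ N * y\<rfloor>"
  using d
proof (induction N)
  case 0
  have "\<lfloor>x\<rfloor> = 0" "\<lfloor>y\<rfloor> = 0" using x y by linarith+
  then show ?case by simp
next
  case (Suc N)
  then show ?case unfolding floor_power_Suc[OF q] by simp
qed

lemma abs_diff_less_if_floor_eq:
  assumes "0 < (L::real)" "\<lfloor>L * x\<rfloor> = \<lfloor>L * y\<rfloor>"
  shows "\<bar>x - y\<bar> < 1 / L"
proof -
  have "\<bar>L * x - L * y\<bar> < 1" using assms(2) by linarith
  then have "L * \<bar>x - y\<bar> < 1" using assms(1) by (simp add: abs_mult flip: right_diff_distrib)
  then show ?thesis using assms(1) by (simp add: field_simps)
qed

text \<open>Digits are at most q - 1, and the sum of (q - 1) q^(-l) telescopes.\<close>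

lemma sum_digits_tail:
  assumes q: "1 \<le> q" and d: "\<And>i. d i < q"
  shows "(\<Sum>l=1..n. real (d l) / real q ^ l) \<le> 1 - 1 / real q ^ n"
proof (induction n)
  case (Suc n)
  have "real (d (Suc n)) \<le> real q - 1" using d[of "Suc n"] by linarith
  then have "real (d (Suc n)) / real q ^ Suc n \<le> (real q - 1) / real q ^ Suc n" by (intro divide_right_mono) auto
  also have "\<dots> = 1 / real q ^ n - 1 / real q ^ Suc n" using q by (simp add: field_simps)
  finally show ?case using Suc by simp
qed simp

text \<open>The digits after position i contribute less than 1 to \<open>q ^ i * x\<close>, so its
  integer part consists of the first i digits alone; padding with zeros treats positions beyond n in
  the same way.\<close>

lemma digits_sum:
  fixes q n :: nat
  assumes q: "1 \<le> q" and d: "\<And>i. d i < q"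
  defines "x \<equiv> \<Sum>l=1..n. real (d l) / real q ^ l"
  shows "0 \<le> x" "x < 1" "\<And>i. 1 \<le> i \<Longrightarrow> digit q i x = (if i \<le> n then d i else 0)"
proof -
  have q0: "0 < real q" using q by simp
  show x0: "0 \<le> x" unfolding x_def by (intro sum_nonneg) auto
  show x1: "x < 1" using sum_digits_tail[where d = d, OF q d, of n] q0 unfolding x_def by (smt (verit) divide_pos_pos zero_less_power)
  define e where "e i = (if i \<le> n then d i else 0)" for i
  have e: "e i < q" for i using d[of i] q by (simp add: e_def)
  have fl: "\<lfloor>real q ^ i * x\<rfloor> = (\<Sum>l=1..i. int (e l) * int q ^ (i - l))" for i
  proof -
    let ?M = "max n i"
    have "x = (\<Sum>l=1..?M. real (e l) / real q ^ l)"
      unfolding x_def by (rule sum.mono_neutral_cong_left) (auto simp: e_def)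
    also have "\<dots> = (\<Sum>l=1..i. real (e l) / real q ^ l) + (\<Sum>l=Suc i..?M. real (e l) / real q ^ l)"
    proof -
      have "{1..?M} = {1..i} \<union> {Suc i..?M}" by auto
      then show ?thesis by (simp only:) (rule sum.union_disjoint, auto)
    qed
    finally have "real q ^ i * x = (\<Sum>l=1..i. real q ^ i * (real (e l) / real q ^ l)) + (\<Sum>l=Suc i..?M. real q ^ i * (real (e l) / real q ^ l))"
      by (simp only: distrib_left sum_distrib_left)
    also have "(\<Sum>l=1..i. real q ^ i * (real (e l) / real q ^ l)) = of_int (\<Sum>l=1..i. int (e l) * int q ^ (i - l))"
      unfolding of_int_sum
    proof (rule sum.cong[OF refl])
      fix l assume "l \<in> {1..i}"
      then have "real q ^ (i - l) = real q ^ i / real q ^ l" using q0 by (intro power_diff) auto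
      then show "real q ^ i * (real (e l) / real q ^ l) = of_int (int (e l) * int q ^ (i - l))" by simp
    qed
    also have "(\<Sum>l=Suc i..?M. real q ^ i * (real (e l) / real q ^ l)) = (\<Sum>l=1..?M - i. real (e (i + l)) / real q ^ l)"
      by (rule sum.reindex_bij_witness[of _ "\<lambda>l. i + l" "\<lambda>l. l - i"]) (use q0 in \<open>auto simp: power_diff\<close>)
    finally have eq: "real q ^ i * x = of_int (\<Sum>l=1..i. int (e l) * int q ^ (i - l)) + (\<Sum>l=1..?M - i. real (e (i + l)) / real q ^ l)" .
    have "0 \<le> (\<Sum>l=1..?M - i. real (e (i + l)) / real q ^ l)" by (intro sum_nonneg) auto
    moreover have "(\<Sum>l=1..?M - i. real (e (i + l)) / real q ^ l) \<le> 1 - 1 / real q ^ (?M - i)"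
      by (rule sum_digits_tail[where d = "\<lambda>l. e (i + l)", OF q e])
    moreover have "0 < 1 / real q ^ (?M - i)" using q0 by simp
    ultimately show ?thesis unfolding eq by linarith
  qed
  show "digit q i x = (if i \<le> n then d i else 0)" if "1 \<le> i" for i
  proof -
    obtain i' where i': "i = Suc i'" using \<open>1 \<le> i\<close> by (cases i) auto
    have "(\<Sum>l=1..i. int (e l) * int q ^ (i - l)) = int q * (\<Sum>l=1..i'. int (e l) * int q ^ (i' - l)) + int (e i)"
    proof -
      have "(\<Sum>l=1..i'. int (e l) * int q ^ (Suc i' - l)) = (\<Sum>l=1..i'. int q * (int (e l) * int q ^ (i' - l)))"
        by (intro sum.cong refl) (simp add: Suc_diff_le)
      then show ?thesis unfolding i' by (simp add: sum_distrib_left)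
    qed
    then have "\<lfloor>real q ^ i * x\<rfloor> mod int q = int (e i)" unfolding fl using e[of i] by simp
    then show ?thesis unfolding digit_def e_def[symmetric] by simp
  qed
qed

lemma base_digits_inj:
  assumes q: "1 \<le> (q::nat)"
  shows "inj_on (\<lambda>h. \<lambda>c\<in>{..<m}. h div q ^ c mod q) {..<q ^ m}"
proof -
  have exp: "h < q ^ m \<Longrightarrow> h = (\<Sum>c<m. (h div q ^ c mod q) * q ^ c)" for h
  proof (induction m arbitrary: h)
    case (Suc m)
    have "h div q < q ^ m" using Suc.prems q by (simp add: div_less_iff_less_mult mult.commute)
    from Suc.IH[OF this] have "h div q = (\<Sum>c<m. (h div q ^ Suc c mod q) * q ^ c)" by (simp add: div_mult2_eq)
    then have "h = q * (\<Sum>c<m. (h div q ^ Suc c mod q) * q ^ c) + h mod q" by (metis mult_div_mod_eq)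
    also have "q * (\<Sum>c<m. (h div q ^ Suc c mod q) * q ^ c) = (\<Sum>c<m. (h div q ^ Suc c mod q) * q ^ Suc c)"
      unfolding sum_distrib_left by (intro sum.cong refl) simp
    finally show ?case by (simp only: sum.lessThan_Suc_shift) simp
  qed simp
  show ?thesis
  proof (rule inj_onI)
    fix h h' assume h: "h \<in> {..<q ^ m}" "h' \<in> {..<q ^ m}"
      and e: "(\<lambda>c\<in>{..<m}. h div q ^ c mod q) = (\<lambda>c\<in>{..<m}. h' div q ^ c mod q)"
    have "h div q ^ c mod q = h' div q ^ c mod q" if "c < m" for c using fun_cong[OF e, of c] that by simp
    then have "(\<Sum>c<m. (h div q ^ c mod q) * q ^ c) = (\<Sum>c<m. (h' div q ^ c mod q) * q ^ c)" by simp
    then show "h = h'" using exp[of h] exp[of h'] h by simp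
  qed
qed

text \<open>Otherwise there would be points of the cube tending to x in every coordinate, hence in
  the product topology, at which f stays at distance at least e from its value at x.\<close>

lemma continuous_on_cube_uniform_at:
  fixes f :: "(nat \<Rightarrow> real) \<Rightarrow> real"
  assumes f: "continuous_on (cube u) f" and x: "x \<in> cube u" and q: "2 \<le> (q::nat)" and e: "0 < e"
  shows "\<exists>N0. \<forall>N\<ge>N0. \<forall>y\<in>cube u. (\<forall>j\<in>u. \<bar>y j - x j\<bar> < 1 / real q ^ N) \<longrightarrow> \<bar>f y - f x\<bar> < e"
proof (rule ccontr)
  assume "\<not> ?thesis"
  then have "\<forall>N0. \<exists>y. y \<in> cube u \<and> (\<forall>j\<in>u. \<bar>y j - x j\<bar> < 1 / real q ^ N0) \<and> e \<le> \<bar>f y - f x\<bar>"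
  proof (intro allI)
    fix N0 assume "\<not> (\<exists>N0. \<forall>N\<ge>N0. \<forall>y\<in>cube u. (\<forall>j\<in>u. \<bar>y j - x j\<bar> < 1 / real q ^ N) \<longrightarrow> \<bar>f y - f x\<bar> < e)"
    then obtain N y where y: "N0 \<le> N" "y \<in> cube u" "\<forall>j\<in>u. \<bar>y j - x j\<bar> < 1 / real q ^ N" "\<not> \<bar>f y - f x\<bar> < e" by blast
    have "1 / real q ^ N \<le> 1 / real q ^ N0" using q y(1) by (intro divide_left_mono power_increasing) auto
    then show "\<exists>y. y \<in> cube u \<and> (\<forall>j\<in>u. \<bar>y j - x j\<bar> < 1 / real q ^ N0) \<and> e \<le> \<bar>f y - f x\<bar>"
      using y by (intro exI[of _ y]) force
  qed
  then obtain Y where Y: "\<And>N. Y N \<in> cube u" "\<And>N j. j \<in> u \<Longrightarrow> \<bar>Y N j - x j\<bar> < 1 / real q ^ N" "\<And>N. e \<le> \<bar>f (Y N) - f x\<bar>"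
    by metis
  have "(\<lambda>N. Y N j) \<longlonglongrightarrow> x j" for j
  proof (cases "j \<in> u")
    case True
    have "(\<lambda>N. 1 / real q ^ N) \<longlonglongrightarrow> 0" using q by (intro LIMSEQ_divide_realpow_zero) auto
    then have "(\<lambda>N. Y N j - x j) \<longlonglongrightarrow> 0"
      by (rule Lim_null_comparison[rotated]) (use Y(2)[OF True] in \<open>auto intro!: always_eventually less_imp_le\<close>)
    then show ?thesis by (simp add: LIM_zero_iff)
  next
    case False
    then have "Y N j = x j" for N using Y(1)[of N] x by (simp add: cube_def PiE_def extensional_def)
    then show ?thesis by simp
  qed
  then have "limitin (product_topology (\<lambda>_. euclidean) UNIV) Y x sequentially"
    by (simp add: limitin_componentwise)
  then have "Y \<longlonglongrightarrow> x" unfolding euclidean_product_topology by simp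
  then have "(\<lambda>N. f (Y N)) \<longlonglongrightarrow> f x"
    using f x Y(1) unfolding continuous_on_sequentially by (auto simp: o_def)
  then have "eventually (\<lambda>N. dist (f (Y N)) (f x) < e) sequentially" using e by (rule tendstoD)
  then obtain N where "dist (f (Y N)) (f x) < e" by (auto simp: eventually_sequentially)
  then show False using Y(3)[of N] by (simp add: dist_real_def)
qed

section \<open>Truncated Walsh expansions at the net points\<close>

locale digital_quadrature = additive_character \<psi> for \<psi> :: "'a::{field,finite} \<Rightarrow> complex" +
  fixes \<phi> :: "nat \<Rightarrow> 'a" and n m s :: nat and C :: "nat \<Rightarrow> 'a mat"
  assumes bij: "bij_betw \<phi> {0..<CARD('a)} UNIV" and \<phi>0: "\<phi> 0 = 0"
    and C: "\<And>j. j \<in> {1..s} \<Longrightarrow> C j \<in> carrier_mat n m"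
begin

definition q :: nat where "q = CARD('a)"

definition r :: "nat \<times> nat \<Rightarrow> nat \<Rightarrow> 'a" where
  "r = (\<lambda>(j, i) c. C j $$ (i - 1, c))"

text \<open>The minus sign makes this the complex conjugate of the Walsh function with digits k in
  coordinate j, so \<open>coef\<close> is a Walsh coefficient.\<close>

definition kernel :: "nat \<Rightarrow> (nat \<times> nat \<Rightarrow> 'a) \<Rightarrow> nat \<Rightarrow> real \<Rightarrow> complex" where
  "kernel N k j = walsh q (\<lambda>i d. \<psi> (- k (j, i) * \<phi> d)) (desc (support N k j))"

definition coef :: "((nat \<Rightarrow> real) \<Rightarrow> real) \<Rightarrow> nat \<Rightarrow> (nat \<times> nat \<Rightarrow> 'a) \<Rightarrow> complex" where
  "coef f N k = (\<integral>x. of_real (f x) * (\<Prod>j\<in>{1..s}. kernel N k j (x j)) \<partial>unit_cube {1..s})"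

abbreviation "point h \<equiv> net_point \<phi> n m s C h"

lemma q_ge_2: "2 \<le> q"
proof -
  have "card {0, 1 :: 'a} \<le> CARD('a)" by (rule card_mono) auto
  then show ?thesis by (simp add: q_def)
qed

lemma kernel_eq: "kernel N k j t = \<psi> (\<Sum>i\<in>{1..N}. - k (j, i) * \<phi> (digit q i t))"
proof -
  have "kernel N k j t = (\<Prod>i\<in>support N k j. \<psi> (- k (j, i) * \<phi> (digit q i t)))"
  proof -
    have d: "distinct (desc (support N k j))" by (simp add: desc_def)
    show ?thesis unfolding kernel_def walsh_def prod.distinct_set_conv_list[OF d, symmetric] by simp
  qed
  also have "\<dots> = (\<Prod>i\<in>{1..N}. \<psi> (- k (j, i) * \<phi> (digit q i t)))"
    by (rule prod.mono_neutral_left) (auto simp: support_def)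
  finally show ?thesis by (simp add: sum)
qed

lemma norm_kernel: "norm (kernel N k j t) = 1"
  unfolding kernel_eq by (rule norm_eq_1)

lemma kernel_measurable: "kernel N k j \<in> borel_measurable borel"
  unfolding kernel_def by (rule walsh_measurable)

text \<open>Under \<phi> the digits of a net point are the entries of the matrix-vector product.
  Beyond n they are 0, and \<open>\<phi> 0 = 0\<close> makes them invisible to the
  characters.\<close>

lemma point_digits:
  assumes j: "j \<in> {1..s}"
  shows "0 \<le> point h j" "point h j < 1"
    and "\<And>i. 1 \<le> i \<Longrightarrow> \<phi> (digit q i (point h j)) = (if i \<le> n then \<Sum>c<m. r (j, i) c * \<phi> (h div q ^ c mod q) else 0)"
proof -
  define y where "y i = vec_index (C j *\<^sub>v digit_vec \<phi> m h) (i - 1)" for i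
  define d where "d i = inv_into {0..<q} \<phi> (y i)" for i
  have img: "\<phi> ` {0..<q} = UNIV" using bij by (simp add: bij_betw_def q_def)
  have d: "d i < q" for i
    using inv_into_into[of "y i" \<phi> "{0..<q}"] img by (simp add: d_def)
  have \<phi>d: "\<phi> (d i) = y i" for i unfolding d_def by (rule f_inv_into_f) (simp add: img)
  have p: "point h j = (\<Sum>l=1..n. real (d l) / real q ^ l)"
    using j unfolding net_point_def d_def y_def q_def by simp
  have q1: "1 \<le> q" using q_ge_2 by simp
  show "0 \<le> point h j" "point h j < 1" unfolding p by (rule digits_sum[where d = d, OF q1 d])+
  show "\<phi> (digit q i (point h j)) = (if i \<le> n then \<Sum>c<m. r (j, i) c * \<phi> (h div q ^ c mod q) else 0)" if i: "1 \<le> i" for i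
  proof (cases "i \<le> n")
    case True
    have "y i = (\<Sum>c<m. r (j, i) c * \<phi> (h div q ^ c mod q))"
    proof -
      have dims: "dim_row (C j) = n" "dim_col (C j) = m" using C[OF j] by auto
      have "y i = row (C j) (i - 1) \<bullet> digit_vec \<phi> m h" using True i dims unfolding y_def by simp
      also have "\<dots> = (\<Sum>c\<in>{0..<m}. r (j, i) c * \<phi> (h div q ^ c mod q))"
        unfolding scalar_prod_def digit_vec_def using True i dims by (simp add: r_def q_def)
      finally show ?thesis by (simp add: lessThan_atLeast0)
    qed
    then show ?thesis using True digits_sum(3)[where d = d, OF q1 d i, of n] \<phi>d unfolding p by simp
  next
    case False
    then show ?thesis using digits_sum(3)[where d = d, OF q1 d i, of n] \<phi>0 unfolding p by simp
  qed
qed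

lemma point_in_cube: "point h \<in> cube {1..s}"
  using point_digits(1,2) unfolding cube_def by (auto simp: net_point_def)

definition index_set :: "nat \<Rightarrow> (nat \<times> nat) set" where
  "index_set N = {1..s} \<times> {1..N}"

definition in_dual :: "(nat \<times> nat \<Rightarrow> 'a) \<Rightarrow> bool" where
  "in_dual k \<longleftrightarrow> (\<forall>c<m. (\<Sum>p\<in>{1..s} \<times> {1..n}. k p * r p c) = 0)"

lemma finite_index_set [simp]: "finite (index_set N)"
  by (simp add: index_set_def)

lemma finite_indices: "finite (index_set N \<rightarrow>\<^sub>E (UNIV :: 'a set))"
  by (rule finite_PiE) auto

text \<open>The base-q digits of h run through all vectors of length m exactly once, so this is a
  full character sum over digit vectors; its coefficient vector \<open>z\<close> vanishes exactly
  when k is dual.\<close>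

lemma sum_points_character:
  assumes N: "n \<le> N"
  shows "(\<Sum>h<q ^ m. \<psi> (\<Sum>p\<in>index_set N. k p * \<phi> (digit q (snd p) (point h (fst p))))) = (if in_dual k then of_nat (q ^ m) else 0)"
proof -
  define z where "z c = (\<Sum>p\<in>{1..s} \<times> {1..n}. k p * r p c)" for c
  define H where "H h = (\<lambda>c\<in>{..<m}. \<phi> (h div q ^ c mod q))" for h
  have e: "(\<Sum>p\<in>index_set N. k p * \<phi> (digit q (snd p) (point h (fst p)))) = (\<Sum>c<m. H h c * z c)" for h
  proof -
    have "(\<Sum>p\<in>index_set N. k p * \<phi> (digit q (snd p) (point h (fst p)))) =
       (\<Sum>p\<in>index_set N. if snd p \<le> n then k p * (\<Sum>c<m. r p c * \<phi> (h div q ^ c mod q)) else 0)"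
      by (rule sum.cong[OF refl]) (use point_digits(3) in \<open>auto simp: index_set_def\<close>)
    also have "\<dots> = (\<Sum>p\<in>{1..s} \<times> {1..n}. k p * (\<Sum>c<m. r p c * \<phi> (h div q ^ c mod q)))"
      by (rule sum.mono_neutral_cong_right) (use N in \<open>auto simp: index_set_def\<close>)
    also have "\<dots> = (\<Sum>p\<in>{1..s} \<times> {1..n}. \<Sum>c<m. H h c * (k p * r p c))"
      unfolding sum_distrib_left H_def by (intro sum.cong refl) (simp add: mult_ac)
    also have "\<dots> = (\<Sum>c<m. H h c * z c)" unfolding z_def sum_distrib_left by (rule sum.swap)
    finally show ?thesis .
  qed
  have inj\<phi>: "inj_on \<phi> {0..<q}" using bij by (simp add: bij_betw_def q_def)
  have q1: "1 \<le> q" using q_ge_2 by simp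
  have injH: "inj_on H {..<q ^ m}"
  proof (rule inj_onI)
    fix h h' assume h: "h \<in> {..<q ^ m}" "h' \<in> {..<q ^ m}" and e: "H h = H h'"
    have "(\<lambda>c\<in>{..<m}. h div q ^ c mod q) = (\<lambda>c\<in>{..<m}. h' div q ^ c mod q)"
    proof (rule restrict_ext)
      fix c assume "c \<in> {..<m}"
      then have "\<phi> (h div q ^ c mod q) = \<phi> (h' div q ^ c mod q)" using fun_cong[OF e, of c] by (simp add: H_def)
      then show "h div q ^ c mod q = h' div q ^ c mod q" using q1 by (intro inj_onD[OF inj\<phi>]) auto
    qed
    then show "h = h'" using inj_onD[OF base_digits_inj[OF q1]] h by blast
  qed
  have "H ` {..<q ^ m} = ({..<m} \<rightarrow>\<^sub>E UNIV)"
  proof (rule card_subset_eq)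
    show "finite ({..<m} \<rightarrow>\<^sub>E (UNIV :: 'a set))" by (rule finite_PiE) auto
    show "H ` {..<q ^ m} \<subseteq> ({..<m} \<rightarrow>\<^sub>E UNIV)"
      by (rule image_subsetI) (simp only: H_def restrict_PiE_iff UNIV_I ball_triv simp_thms)
    show "card (H ` {..<q ^ m}) = card ({..<m} \<rightarrow>\<^sub>E (UNIV :: 'a set))"
      unfolding card_image[OF injH] by (simp add: card_PiE q_def)
  qed
  then have "(\<Sum>h<q ^ m. \<psi> (\<Sum>c<m. H h c * z c)) = (\<Sum>x\<in>{..<m} \<rightarrow>\<^sub>E UNIV. \<psi> (\<Sum>c\<in>{..<m}. x c * z c))"
    using sum.reindex[OF injH, of "\<lambda>x. \<psi> (\<Sum>c\<in>{..<m}. x c * z c)"] by (simp add: o_def)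
  also have "\<dots> = (if \<forall>c\<in>{..<m}. z c = 0 then of_nat CARD('a) ^ card {..<m} else 0)"
    by (rule sum_PiE) simp
  also have "(\<forall>c\<in>{..<m}. z c = 0) \<longleftrightarrow> in_dual k"
    unfolding in_dual_def z_def by (simp only: Ball_def lessThan_iff)
  finally show ?thesis unfolding e by (simp only: card_lessThan of_nat_power q_def)
qed

definition cell :: "nat \<Rightarrow> nat \<Rightarrow> nat \<Rightarrow> real set" where
  "cell N h j = {of_int \<lfloor>real q ^ N * point h j\<rfloor> / real q ^ N..<(of_int \<lfloor>real q ^ N * point h j\<rfloor> + 1) / real q ^ N}"

lemma mem_cell: "t \<in> cell N h j \<longleftrightarrow> \<lfloor>real q ^ N * t\<rfloor> = \<lfloor>real q ^ N * point h j\<rfloor>"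
  unfolding cell_def by (rule mem_cell_iff) (use q_ge_2 in simp)

text \<open>
  A Walsh expansion truncated at level \<open>N\<close> reproduces the mean of \<open>f\<close> over the cell containing a net
  point. Working with these means avoids any question of convergence of the Walsh series.
\<close>

definition local_mean :: "((nat \<Rightarrow> real) \<Rightarrow> real) \<Rightarrow> nat \<Rightarrow> nat \<Rightarrow> real" where
  "local_mean f N h = real q ^ (N * s) * (\<integral>x. f x * (\<Prod>j\<in>{1..s}. indicator (cell N h j) (x j)) \<partial>unit_cube {1..s})"

lemma kernel_prod: "(\<Prod>j\<in>{1..s}. kernel N k j (x j)) = \<psi> (\<Sum>p\<in>index_set N. - k p * \<phi> (digit q (snd p) (x (fst p))))"
  unfolding kernel_eq sum[symmetric] index_set_def sum.cartesian_product by (simp add: split_def)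

text \<open>The double sum over points and frequencies is evaluated in two orders. Summing the
  characters over the frequencies gives a Dirichlet kernel, q^(N s) times the indicator of the cell
  of a net point, hence the local means; summing over the points leaves the dual elements.\<close>

lemma sum_dual_coef:
  assumes N: "n \<le> N" and f: "integrable (unit_cube {1..s}) f"
  shows "(\<Sum>k\<in>{k\<in>index_set N \<rightarrow>\<^sub>E UNIV. in_dual k}. coef f N k) = of_real ((\<Sum>h<q ^ m. local_mean f N h) / real q ^ m)"
proof -
  let ?K = "index_set N \<rightarrow>\<^sub>E (UNIV :: 'a set)"
  let ?e = "\<lambda>h k. \<psi> (\<Sum>p\<in>index_set N. k p * \<phi> (digit q (snd p) (point h (fst p))))"
  have q0: "0 < real q" "0 < q" using q_ge_2 by auto
  have int: "integrable (unit_cube {1..s}) (\<lambda>x. of_real (f x) * (\<Prod>j\<in>{1..s}. kernel N k j (x j)))" for k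
  proof (rule integrable_bounded_mult)
    show "integrable (unit_cube {1..s}) (\<lambda>x. complex_of_real (f x))" using f by simp
    show "(\<lambda>x. \<Prod>j\<in>{1..s}. kernel N k j (x j)) \<in> borel_measurable (unit_cube {1..s})"
      by (rule measurable_prod_coordinates) (auto intro: borel_measurable_unit_lborel kernel_measurable)
    show "norm (\<Prod>j\<in>{1..s}. kernel N k j (x j)) \<le> 1" for x
      unfolding prod_norm[symmetric] norm_kernel by simp
  qed
  have key: "(\<Sum>k\<in>?K. ?e h k * (\<Prod>j\<in>{1..s}. kernel N k j (x j))) = of_real (real q ^ (N * s) * (\<Prod>j\<in>{1..s}. indicator (cell N h j) (x j)))"
    if x: "x \<in> cube {1..s}" for x h
  proof -
    let ?d = "\<lambda>p. \<phi> (digit q (snd p) (point h (fst p))) - \<phi> (digit q (snd p) (x (fst p)))"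
    have "(\<Sum>k\<in>?K. ?e h k * (\<Prod>j\<in>{1..s}. kernel N k j (x j))) = (\<Sum>k\<in>?K. \<psi> (\<Sum>p\<in>index_set N. k p * ?d p))"
      unfolding kernel_prod add[symmetric] sum.distrib[symmetric] by (simp add: algebra_simps)
    also have "\<dots> = (if \<forall>p\<in>index_set N. ?d p = 0 then of_nat CARD('a) ^ card (index_set N) else 0)"
      by (rule sum_PiE) simp
    \<comment> \<open>As \<phi> is injective on digits, the differences vanish exactly when the
      first N digits agree, that is, when x lies in the cell of the point in every
      coordinate.\<close>
    also have "(\<forall>p\<in>index_set N. ?d p = 0) \<longleftrightarrow> (\<forall>j\<in>{1..s}. x j \<in> cell N h j)"
    proof -
      have inj\<phi>: "inj_on \<phi> {0..<q}" using bij by (simp add: bij_betw_def q_def)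
      have "(\<forall>p\<in>index_set N. ?d p = 0) \<longleftrightarrow> (\<forall>j\<in>{1..s}. \<forall>i\<in>{1..N}. digit q i (point h j) = digit q i (x j))"
        using inj_on_eq_iff[OF inj\<phi>] digit_less[OF q0(2)] by (simp add: index_set_def)
      also have "\<dots> \<longleftrightarrow> (\<forall>j\<in>{1..s}. x j \<in> cell N h j)"
      proof (rule ball_cong[OF refl])
        fix j assume j: "j \<in> {1..s}"
        have b: "0 \<le> x j" "x j < 1" using cubeD[OF x j] by auto
        show "(\<forall>i\<in>{1..N}. digit q i (point h j) = digit q i (x j)) \<longleftrightarrow> x j \<in> cell N h j"
        proof
          assume "\<forall>i\<in>{1..N}. digit q i (point h j) = digit q i (x j)"
          then have "\<lfloor>real q ^ N * x j\<rfloor> = \<lfloor>real q ^ N * point h j\<rfloor>"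
            by (intro floor_eq_if_digits_eq[OF q0(2) b point_digits(1,2)[OF j]]) simp
          then show "x j \<in> cell N h j" by (simp only: mem_cell)
        next
          assume "x j \<in> cell N h j"
          then have "\<lfloor>real q ^ N * point h j\<rfloor> = \<lfloor>real q ^ N * x j\<rfloor>" by (simp only: mem_cell)
          then show "\<forall>i\<in>{1..N}. digit q i (point h j) = digit q i (x j)"
            using digit_cong_cell[OF q0(2), of _ N "point h j" "x j"] by simp
        qed
      qed
      finally show ?thesis .
    qed
    also have "card (index_set N) = N * s" by (simp add: index_set_def card_cartesian_product mult.commute)
    also have "(if \<forall>j\<in>{1..s}. x j \<in> cell N h j then of_nat CARD('a) ^ (N * s) else 0) = complex_of_real (real q ^ (N * s) * (\<Prod>j\<in>{1..s}. indicator (cell N h j) (x j)))"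
    proof (cases "\<forall>j\<in>{1..s}. x j \<in> cell N h j")
      case True
      then have "(\<Prod>j\<in>{1..s}. indicator (cell N h j) (x j)) = (1 :: real)" by (intro prod.neutral) simp
      then show ?thesis using True by (simp add: q_def)
    next
      case False
      then obtain j where "j \<in> {1..s}" "x j \<notin> cell N h j" by blast
      then have "(\<Prod>j\<in>{1..s}. indicator (cell N h j) (x j)) = (0 :: real)" by (intro prod_zero bexI[of _ j]) simp_all
      then show ?thesis using False by (simp only: if_False mult_zero_right of_real_0)
    qed
    finally show ?thesis .
  qed
  have lm: "(\<Sum>k\<in>?K. ?e h k * coef f N k) = of_real (local_mean f N h)" for h
  proof -
    have "(\<Sum>k\<in>?K. ?e h k * coef f N k) = (\<integral>x. (\<Sum>k\<in>?K. ?e h k * (of_real (f x) * (\<Prod>j\<in>{1..s}. kernel N k j (x j)))) \<partial>unit_cube {1..s})"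
      unfolding coef_def
      by (simp only: Bochner_Integration.integral_sum[OF integrable_mult_right[OF int]] integral_mult_right_zero)
    also have "\<dots> = (\<integral>x. of_real (real q ^ (N * s) * (f x * (\<Prod>j\<in>{1..s}. indicator (cell N h j) (x j)))) \<partial>unit_cube {1..s})"
    proof (rule Bochner_Integration.integral_cong[OF refl])
      fix x assume "x \<in> space (unit_cube {1..s})"
      then have x: "x \<in> cube {1..s}" by simp
      have "(\<Sum>k\<in>?K. ?e h k * (of_real (f x) * (\<Prod>j\<in>{1..s}. kernel N k j (x j)))) = of_real (f x) * (\<Sum>k\<in>?K. ?e h k * (\<Prod>j\<in>{1..s}. kernel N k j (x j)))"
        by (simp only: sum_distrib_left mult.left_commute)
      then show "(\<Sum>k\<in>?K. ?e h k * (of_real (f x) * (\<Prod>j\<in>{1..s}. kernel N k j (x j)))) = of_real (real q ^ (N * s) * (f x * (\<Prod>j\<in>{1..s}. indicator (cell N h j) (x j))))"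
        unfolding key[OF x] by (simp only: of_real_mult mult.left_commute)
    qed
    also have "\<dots> = of_real (local_mean f N h)"
      unfolding local_mean_def integral_complex_of_real by (simp only: integral_mult_right_zero)
    finally show ?thesis .
  qed
  have "of_real (\<Sum>h<q ^ m. local_mean f N h) = (\<Sum>h<q ^ m. \<Sum>k\<in>?K. ?e h k * coef f N k)" by (simp add: lm)
  also have "\<dots> = (\<Sum>k\<in>?K. (\<Sum>h<q ^ m. ?e h k) * coef f N k)"
    unfolding sum_distrib_right by (rule sum.swap)
  also have "\<dots> = (\<Sum>k\<in>?K. if in_dual k then of_nat (q ^ m) * coef f N k else 0)"
    unfolding sum_points_character[OF N] by (intro sum.cong) auto
  also have "\<dots> = (\<Sum>k\<in>{k\<in>?K. in_dual k}. of_nat (q ^ m) * coef f N k)"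
    by (rule sum.inter_filter[OF finite_indices, symmetric])
  also have "\<dots> = of_real (real q ^ m) * (\<Sum>k\<in>{k\<in>?K. in_dual k}. coef f N k)" by (simp add: sum_distrib_left)
  finally show ?thesis using q0 by simp
qed

text \<open>The cell of the point has volume q^(-N s), which the prefactor of
  \<open>local_mean\<close> normalises, and its sides shrink to 0, so continuity at the point
  applies.\<close>

lemma local_mean_tendsto:
  assumes f: "integrable (unit_cube {1..s}) f" and c: "continuous_on (cube {1..s}) f"
  shows "(\<lambda>N. local_mean f N h) \<longlonglongrightarrow> f (point h)"
proof (rule LIMSEQ_I)
  fix e :: real assume e: "0 < e"
  have q0: "0 < real q" using q_ge_2 by simp
  from continuous_on_cube_uniform_at[OF c point_in_cube q_ge_2, of "e / 2"] e
  obtain N0 where N0: "\<And>N y. N0 \<le> N \<Longrightarrow> y \<in> cube {1..s} \<Longrightarrow> (\<forall>j\<in>{1..s}. \<bar>y j - point h j\<bar> < 1 / real q ^ N) \<Longrightarrow> \<bar>f y - f (point h)\<bar> < e / 2"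
    by (metis half_gt_zero)
  have "norm (local_mean f N h - f (point h)) < e" if N: "N0 \<le> N" for N
  proof -
    let ?i = "\<lambda>x. \<Prod>j\<in>{1..s}. indicator (cell N h j) (x j) :: real"
    have im: "?i \<in> borel_measurable (unit_cube {1..s})"
    proof (rule borel_measurable_prod)
      fix j assume j: "j \<in> {1..s}"
      have "indicator (cell N h j) \<in> borel_measurable unit_lborel" by (rule borel_measurable_unit_lborel) (simp add: cell_def)
      from measurable_compose[OF measurable_component_singleton[OF j] this]
      show "(\<lambda>x. indicator (cell N h j) (x j) :: real) \<in> borel_measurable (unit_cube {1..s})" by simp
    qed
    have i01: "0 \<le> ?i x" "?i x \<le> 1" for x
      by (auto intro!: prod_nonneg prod_le_1)
    interpret prob_space "unit_cube {1..s}" by (rule prob_space_unit_cube)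
    have iint: "integrable (unit_cube {1..s}) ?i"
      by (rule integrable_const_bound[of _ 1]) (use im i01 in auto)
    have fint: "integrable (unit_cube {1..s}) (\<lambda>x. f x * ?i x)"
    proof (rule Bochner_Integration.integrable_bound[OF f])
      show "(\<lambda>x. f x * ?i x) \<in> borel_measurable (unit_cube {1..s})" using f im by auto
      show "AE x in unit_cube {1..s}. norm (f x * ?i x) \<le> norm (f x)"
        using i01 by (intro AE_I2) (simp add: abs_mult mult_left_le)
    qed
    have vol: "(\<integral>x. ?i x \<partial>unit_cube {1..s}) = (1 / real q ^ N) ^ s"
    proof -
      have "(\<integral>x. ?i x \<partial>unit_cube {1..s}) = (\<Prod>j\<in>{1..s}. \<integral>t. indicator (cell N h j) t \<partial>unit_lborel)"
        by (rule cube.product_integral_prod)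
          (auto intro!: integrable_unit_lborel_bounded[where B = 1] borel_measurable_unit_lborel simp: cell_def)
      also have "\<dots> = (\<Prod>j\<in>{1..s}. 1 / real q ^ N)"
      proof (rule prod.cong[OF refl])
        fix j assume j: "j \<in> {1..s}"
        \<comment> \<open>The cell lies inside [0,1), so passing to the restricted measure does not
          cut it.\<close>
        let ?c = "\<lfloor>real q ^ N * point h j\<rfloor>"
        have c0: "0 \<le> ?c" using point_digits(1)[OF j, of h] q0 by simp
        have c1: "?c + 1 \<le> int (q ^ N)" 
        proof -
          have "real q ^ N * point h j < real q ^ N * 1" using point_digits(2)[OF j, of h] q0 by (intro mult_strict_left_mono) auto
          then have "?c < int (q ^ N)" by (simp add: floor_less_iff)
          then show ?thesis by simp
        qed
        have "real_of_int (?c + 1) \<le> real_of_int (int (q ^ N))" using c1 by (simp only: of_int_le_iff)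
        then have "(of_int ?c + 1) / real q ^ N \<le> 1" using q0 by simp
        moreover have "0 \<le> of_int ?c / real q ^ N" using c0 q0 by simp
        ultimately have sub: "cell N h j \<subseteq> {0..<1}" unfolding cell_def by auto
        have "(\<integral>t. indicator (cell N h j) t \<partial>unit_lborel) = (\<integral>t. indicator {0..<1} t * indicator (cell N h j) t \<partial>lborel :: real)"
          unfolding integral_unit_lborel by simp
        also have "\<dots> = (\<integral>t. indicator (cell N h j) t \<partial>lborel :: real)"
          using sub by (intro arg_cong[where f = "integral\<^sup>L lborel"] ext) (auto simp: indicator_def)
        also have "\<dots> = 1 / real q ^ N" unfolding cell_def using q0 by (simp add: divide_right_mono add_divide_distrib)
        finally show "(\<integral>t. indicator (cell N h j) t \<partial>unit_lborel :: real) = 1 / real q ^ N" .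
      qed
      finally show ?thesis by simp
    qed
    have q1: "real q ^ (N * s) * (1 / real q ^ N) ^ s = 1" using q0 by (simp add: power_mult power_divide)
    have "norm ((\<integral>x. f x * ?i x \<partial>unit_cube {1..s}) - f (point h) * (\<integral>x. ?i x \<partial>unit_cube {1..s})) =
      norm (\<integral>x. f x * ?i x - f (point h) * ?i x \<partial>unit_cube {1..s})"
      using fint iint by simp
    also have "\<dots> \<le> (\<integral>x. e / 2 * ?i x \<partial>unit_cube {1..s})"
    proof (rule order_trans[OF integral_norm_bound], rule integral_mono)
      show "integrable (unit_cube {1..s}) (\<lambda>x. norm (f x * ?i x - f (point h) * ?i x))" using fint iint by auto
      show "integrable (unit_cube {1..s}) (\<lambda>x. e / 2 * ?i x)" using iint by auto
      fix x assume "x \<in> space (unit_cube {1..s})"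
      then have x: "x \<in> cube {1..s}" by simp
      show "norm (f x * ?i x - f (point h) * ?i x) \<le> e / 2 * ?i x"
      proof (cases "\<forall>j\<in>{1..s}. x j \<in> cell N h j")
        case True
        then have "\<forall>j\<in>{1..s}. \<bar>x j - point h j\<bar> < 1 / real q ^ N"
          using abs_diff_less_if_floor_eq[of "real q ^ N"] q0 by (auto simp: mem_cell)
        from N0[OF N x this] have "norm (f x - f (point h)) \<le> e / 2" by simp
        then have "norm (f x - f (point h)) * ?i x \<le> e / 2 * ?i x" by (rule mult_right_mono) (rule i01)
        then show ?thesis using i01(1)[of x] by (simp add: abs_mult flip: left_diff_distrib)
      next
        case False
        then obtain j where "j \<in> {1..s}" "x j \<notin> cell N h j" by blast
        then have "?i x = 0" by (intro prod_zero bexI[of _ j]) simp_all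
        then show ?thesis by (simp only: mult_zero_right diff_self norm_zero order_refl)
      qed
    qed
    also have "\<dots> = e / 2 * (1 / real q ^ N) ^ s" using vol by simp
    finally have "norm ((\<integral>x. f x * ?i x \<partial>unit_cube {1..s}) - f (point h) * (1 / real q ^ N) ^ s) \<le> e / 2 * (1 / real q ^ N) ^ s"
      unfolding vol .
    then have "real q ^ (N * s) * norm ((\<integral>x. f x * ?i x \<partial>unit_cube {1..s}) - f (point h) * (1 / real q ^ N) ^ s) \<le> real q ^ (N * s) * (e / 2 * (1 / real q ^ N) ^ s)"
      using q0 by (intro mult_left_mono) auto
    also have "real q ^ (N * s) * (e / 2 * (1 / real q ^ N) ^ s) = e / 2 * (real q ^ (N * s) * (1 / real q ^ N) ^ s)" by (simp only: mult_ac)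
    also have "real q ^ (N * s) * norm ((\<integral>x. f x * ?i x \<partial>unit_cube {1..s}) - f (point h) * (1 / real q ^ N) ^ s) =
       norm (real q ^ (N * s) * ((\<integral>x. f x * ?i x \<partial>unit_cube {1..s}) - f (point h) * (1 / real q ^ N) ^ s))" using q0 by (simp add: abs_mult)
    also have "real q ^ (N * s) * ((\<integral>x. f x * ?i x \<partial>unit_cube {1..s}) - f (point h) * (1 / real q ^ N) ^ s) =
       local_mean f N h - f (point h) * (real q ^ (N * s) * (1 / real q ^ N) ^ s)" unfolding local_mean_def by (simp only: right_diff_distrib mult.left_commute)
    finally show ?thesis unfolding q1 using e by simp
  qed
  then show "\<exists>N0. \<forall>N\<ge>N0. norm (local_mean f N h - f (point h)) < e" by blast
qed

text \<open>The zero frequency contributes the integral, the other dual elements at most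
  \<open>R\<close> at every level N \<ge> n. As \<open>R\<close> does not depend on N, the bound
  survives the limit in which local means become function values.\<close>

lemma quadrature_error_le:
  assumes f: "integrable (unit_cube {1..s}) f" and c: "continuous_on (cube {1..s}) f"
    and R: "\<And>N. n \<le> N \<Longrightarrow> (\<Sum>k\<in>{k\<in>index_set N \<rightarrow>\<^sub>E UNIV. in_dual k \<and> (\<exists>p\<in>index_set N. k p \<noteq> 0)}. norm (coef f N k)) \<le> R"
  shows "\<bar>I_int s f - Q_qmc \<phi> n m s C f\<bar> \<le> R"
proof -
  have q0: "0 < real q" using q_ge_2 by simp
  have I: "I_int s f = integral\<^sup>L (unit_cube {1..s}) f" unfolding I_int_def by (rule set_integral_cube_eq) simp
  have Q: "Q_qmc \<phi> n m s C f = (\<Sum>h<q ^ m. f (point h)) / real q ^ m" by (simp add: Q_qmc_def q_def)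
  have "\<bar>I_int s f - (\<Sum>h<q ^ m. local_mean f N h) / real q ^ m\<bar> \<le> R" if N: "n \<le> N" for N
  proof -
    let ?D = "{k\<in>index_set N \<rightarrow>\<^sub>E UNIV. in_dual k}"
    let ?D' = "{k\<in>index_set N \<rightarrow>\<^sub>E UNIV. in_dual k \<and> (\<exists>p\<in>index_set N. k p \<noteq> 0)}"
    let ?z = "\<lambda>p\<in>index_set N. 0 :: 'a"
    have sub: "{1..s} \<times> {1..n} \<subseteq> index_set N" using N by (auto simp: index_set_def)
    have zD: "in_dual ?z" unfolding in_dual_def
    proof (intro allI impI sum.neutral ballI)
      fix c p assume "p \<in> {1..s} \<times> {1..n}"
      with sub have "p \<in> index_set N" by blast
      then show "?z p * r p c = 0" by simp
    qed
    have "k = ?z" if "k \<in> index_set N \<rightarrow>\<^sub>E UNIV" "\<not> (\<exists>p\<in>index_set N. k p \<noteq> 0)" for k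
      by (rule PiE_ext[OF that(1)]) (use that in auto)
    then have D: "?D = insert ?z ?D'" using zD by auto
    have fD': "finite ?D'" using finite_indices by (rule rev_finite_subset) blast
    have "?z \<notin> ?D'" by auto
    then have "(\<Sum>k\<in>?D. coef f N k) = coef f N ?z + (\<Sum>k\<in>?D'. coef f N k)" unfolding D using fD' by simp
    moreover have "coef f N ?z = of_real (I_int s f)"
    proof -
      have "(\<Prod>j\<in>{1..s}. kernel N ?z j (x j)) = 1" for x
      proof -
        have "(\<Sum>p\<in>index_set N. - ?z p * \<phi> (digit q (snd p) (x (fst p)))) = 0" by (rule sum.neutral) simp
        then show ?thesis unfolding kernel_prod by (simp only: zero)
      qed
      then show ?thesis unfolding coef_def I by simp
    qed
    ultimately have "of_real ((\<Sum>h<q ^ m. local_mean f N h) / real q ^ m) = of_real (I_int s f) + (\<Sum>k\<in>?D'. coef f N k)"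
      using sum_dual_coef[OF N f] by simp
    then have "of_real ((\<Sum>h<q ^ m. local_mean f N h) / real q ^ m - I_int s f) = (\<Sum>k\<in>?D'. coef f N k)" by (simp only: of_real_diff) simp
    then have "norm (complex_of_real ((\<Sum>h<q ^ m. local_mean f N h) / real q ^ m - I_int s f)) = norm (\<Sum>k\<in>?D'. coef f N k)"
      by (rule arg_cong)
    then have "\<bar>(\<Sum>h<q ^ m. local_mean f N h) / real q ^ m - I_int s f\<bar> = norm (\<Sum>k\<in>?D'. coef f N k)"
      unfolding norm_of_real .
    also have "\<dots> \<le> (\<Sum>k\<in>?D'. norm (coef f N k))" by (rule norm_sum)
    also have "\<dots> \<le> R" by (rule R[OF N])
    finally show ?thesis by (simp only: abs_minus_commute)
  qed
  moreover have "(\<lambda>N. \<bar>I_int s f - (\<Sum>h<q ^ m. local_mean f N h) / real q ^ m\<bar>) \<longlonglongrightarrow> \<bar>I_int s f - Q_qmc \<phi> n m s C f\<bar>"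
    unfolding Q by (intro tendsto_intros local_mean_tendsto f c) (use q0 in auto)
  ultimately show ?thesis by (intro LIMSEQ_le_const2) auto
qed

end

section \<open>The error bound from a finite functional and the net condition\<close>

text \<open>One term of the functional is bounded by the whole, so H is at most \<gamma>^(1/rr)
  times it. The factor (1 + 1/\<gamma>) \<gamma> is 1 + \<gamma> for a positive weight, which
  dominates \<gamma>^(1/rr) for every rr, and 0 for a vanishing weight, where H = 0. In this form
  the weight appears as a factor, as the final sum requires.\<close>

lemma N_functionalD:
  assumes N: "N_functional \<delta> lam p r rr \<gamma> s f < \<infinity>" and rr: "1 \<le> rr" and \<tau>: "\<tau> \<in> taylor_index \<delta> s"
    and \<gamma>0: "0 \<le> \<gamma> {j\<in>{1..s}. 0 < \<tau> j}"
  defines "H \<equiv> hk_variation lam p r (top_set \<delta> s \<tau>) (anchored s (top_set \<delta> s \<tau>) (mixed_deriv s \<tau> f))"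
  shows "H < \<infinity>"
    and "enn2real H \<le> (1 + 1 / \<gamma> {j\<in>{1..s}. 0 < \<tau> j}) * \<gamma> {j\<in>{1..s}. 0 < \<tau> j} * enn2real (N_functional \<delta> lam p r rr \<gamma> s f)"
proof -
  define g where "g = \<gamma> {j\<in>{1..s}. 0 < \<tau> j}"
  define t where "t \<tau> = ennpowr (hk_variation lam p r (top_set \<delta> s \<tau>) (anchored s (top_set \<delta> s \<tau>) (mixed_deriv s \<tau> f))) rr / ennreal (\<gamma> {j\<in>{1..s}. 0 < \<tau> j})" for \<tau>
  have Neq: "N_functional \<delta> lam p r rr \<gamma> s f = ennpowr (\<Sum>\<tau>\<in>taylor_index \<delta> s. t \<tau>) (1 / rr)"
    unfolding N_functional_def t_def taylor_index_def top_set_def Let_def ..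
  have fin: "finite (taylor_index \<delta> s)" unfolding taylor_index_def by (intro finite_PiE) auto
  have "t \<tau> \<le> (\<Sum>\<tau>\<in>taylor_index \<delta> s. t \<tau>)" by (rule member_le_sum) (use \<tau> fin in auto)
  then have le: "ennpowr (t \<tau>) (1 / rr) \<le> N_functional \<delta> lam p r rr \<gamma> s f"
    unfolding Neq using rr by (intro ennpowr_mono) auto
  have tfin: "t \<tau> < \<infinity>" by (rule ennpowr_less_top[OF le_less_trans[OF le N]])
  have t: "t \<tau> = ennpowr H rr / ennreal g" unfolding t_def H_def g_def ..
  have g0: "0 \<le> g" using \<gamma>0 by (simp add: g_def)
  have goal: "H < \<infinity> \<and> enn2real H \<le> (1 + 1 / g) * g * enn2real (N_functional \<delta> lam p r rr \<gamma> s f)"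
  proof (cases "g = 0")
    case True
    have "ennpowr H rr = 0"
    proof (rule ccontr)
      assume "ennpowr H rr \<noteq> 0"
      then have "t \<tau> = \<infinity>" unfolding t True by (simp add: ennreal_divide_zero)
      then show False using tfin by simp
    qed
    then have "H = 0" by (cases H) (auto simp: ennpowr_def split: if_splits)
    then show ?thesis using True by simp
  next
    case False
    then have g: "0 < g" using g0 by simp
    have "H < \<infinity>"
    proof (rule ccontr)
      assume "\<not> H < \<infinity>"
      then have "ennpowr H rr = \<infinity>" by (cases H) (auto simp: ennpowr_def)
      then have "t \<tau> = \<infinity>" unfolding t by (simp add: ennreal_top_divide)
      then show False using tfin by simp
    qed
    then obtain a where a: "H = ennreal a" "0 \<le> a" by (cases H) auto
    have "ennpowr H rr = ennreal (a powr rr)" using a by (simp add: ennpowr_def)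
    then have "t \<tau> = ennreal (a powr rr / g)" unfolding t using g by (simp add: divide_ennreal)
    then have "ennpowr (t \<tau>) (1 / rr) = ennreal ((a powr rr / g) powr (1 / rr))" using g by (simp add: ennpowr_def)
    also have "(a powr rr / g) powr (1 / rr) = a / g powr (1 / rr)" using a g rr by (simp add: powr_divide powr_powr)
    finally have "ennreal (a / g powr (1 / rr)) \<le> N_functional \<delta> lam p r rr \<gamma> s f" using le by simp
    from enn2real_mono[OF this] have "a / g powr (1 / rr) \<le> enn2real (N_functional \<delta> lam p r rr \<gamma> s f)"
      using N a g by simp
    then have "a \<le> g powr (1 / rr) * enn2real (N_functional \<delta> lam p r rr \<gamma> s f)" using g by (simp add: divide_le_eq mult.commute)
    also have "\<dots> \<le> (1 + g) * enn2real (N_functional \<delta> lam p r rr \<gamma> s f)"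
    proof (rule mult_right_mono)
      show "g powr (1 / rr) \<le> 1 + g"
      proof (cases "g \<le> 1")
        case True
        then have "g powr (1 / rr) \<le> 1 powr (1 / rr)" using g rr by (intro powr_mono2) auto
        then show ?thesis using g by simp
      next
        case False
        then have "g powr (1 / rr) \<le> g powr 1" using rr by (intro powr_mono) auto
        then show ?thesis using g by simp
      qed
    qed simp
    also have "1 + g = (1 + 1 / g) * g" using g by (simp add: algebra_simps)
    finally show ?thesis using \<open>H < \<infinity>\<close> a by simp
  qed
  then show "H < \<infinity>"
    and "enn2real H \<le> (1 + 1 / \<gamma> {j\<in>{1..s}. 0 < \<tau> j}) * \<gamma> {j\<in>{1..s}. 0 < \<tau> j} * enn2real (N_functional \<delta> lam p r rr \<gamma> s f)"
    unfolding g_def by auto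
qed

text \<open>A relation among rows indexed by positions becomes a linear combination of the set of
  row vectors, where injectivity of the family lets each vector carry the coefficient of its own
  position.\<close>

lemma indep_rows_if_lin_indpt_family:
  fixes C :: "nat \<Rightarrow> 'a::{field,finite} mat"
  assumes C: "\<And>j. j \<in> {1..s} \<Longrightarrow> C j \<in> carrier_mat n m"
    and A: "\<And>j. j \<in> {1..s} \<Longrightarrow> A j \<subseteq> {1..n}"
    and ind: "lin_indpt_family m (SIGMA j:{1..s}. {1..card (A j)}) (\<lambda>(j, l). row (C j) (desc (A j) ! (l - 1) - 1))"
  shows "indep_rows (\<lambda>(j, i) c. C j $$ (i - 1, c)) m (SIGMA j:{1..s}. A j)"
  unfolding indep_rows_def
proof (intro allI impI)
  fix x :: "nat \<times> nat \<Rightarrow> 'a"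
  let ?B = "SIGMA j:{1..s}. A j" and ?I = "SIGMA j:{1..s}. {1..card (A j)}"
  let ?c = "\<lambda>(j, l). row (C j) (desc (A j) ! (l - 1) - 1)"
  let ?g = "\<lambda>(j, l). (j, desc (A j) ! (l - 1))"
  assume z: "\<forall>c<m. (\<Sum>p\<in>?B. x p * (\<lambda>(j, i) c. C j $$ (i - 1, c)) p c) = 0"
  have fA: "finite (A j)" if "j \<in> {1..s}" for j using A[OF that] finite_subset by blast
  have inj: "inj_on ?c ?I" and nd: "\<not> LinearCombinations.module.lin_dep class_ring (module_vec TYPE('a) m) (?c ` ?I)"
    using ind unfolding lin_indpt_family_def by auto
  have mem: "desc (A j) ! (l - 1) \<in> A j" if "j \<in> {1..s}" "l \<in> {1..card (A j)}" for j l
  proof -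
    have "l - 1 < length (desc (A j))" using fA[OF that(1)] that(2) by auto
    from nth_mem[OF this] show ?thesis unfolding set_desc[OF fA[OF that(1)]] .
  qed
  have gB: "bij_betw ?g ?I ?B"
  proof (rule bij_betwI')
    fix p p' assume p: "p \<in> ?I" "p' \<in> ?I"
    show "(?g p = ?g p') = (p = p')"
    proof
      assume e: "?g p = ?g p'"
      obtain j l l' where jl: "p = (j, l)" "p' = (j, l')" using e by (cases p; cases p') auto
      have "desc (A j) ! (l - 1) = desc (A j) ! (l' - 1)" using e jl by simp
      moreover have "distinct (desc (A j))" by (simp add: desc_def)
      ultimately have "l - 1 = l' - 1" using p jl by (subst (asm) nth_eq_iff_index_eq) auto
      moreover have "1 \<le> l" "1 \<le> l'" using p jl by auto
      ultimately have "l = l'" by linarith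
      then show "p = p'" using jl by simp
    qed simp
  next
    fix p assume "p \<in> ?I"
    then show "?g p \<in> ?B" using mem by auto
  next
    fix p assume "p \<in> ?B"
    then obtain j i where ji: "p = (j, i)" "j \<in> {1..s}" "i \<in> A j" by auto
    then have "i \<in> set (desc (A j))" using fA by simp
    then obtain l where l: "l < card (A j)" "desc (A j) ! l = i" by (auto simp: in_set_conv_nth)
    then show "\<exists>q\<in>?I. p = ?g q" using ji by (intro bexI[of _ "(j, Suc l)"]) auto
  qed
  define a where "a v = x (?g (inv_into ?I ?c v))" for v
  interpret vec_space "TYPE('a)" m .
  have fI: "finite ?I" by auto
  have carr: "?c ` ?I \<subseteq> carrier_vec m"
  proof
    fix v assume "v \<in> ?c ` ?I"
    then obtain j l where jl: "j \<in> {1..s}" "v = row (C j) (desc (A j) ! (l - 1) - 1)" by auto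
    then show "v \<in> carrier_vec m" using C[OF jl(1)] by auto
  qed
  have "lincomb a (?c ` ?I) = 0\<^sub>v m"
  proof (rule eq_vecI)
    fix i assume "i < dim_vec (0\<^sub>v m :: 'a vec)"
    then have i: "i < m" by simp
    have "lincomb a (?c ` ?I) $ i = (\<Sum>v\<in>?c ` ?I. a v * v $ i)" by (rule lincomb_index[OF i carr])
    also have "\<dots> = (\<Sum>p\<in>?I. a (?c p) * ?c p $ i)" by (rule sum.reindex[OF inj, unfolded o_def])
    also have "\<dots> = (\<Sum>p\<in>?I. x (?g p) * (\<lambda>(j, i) c. C j $$ (i - 1, c)) (?g p) i)"
    proof (rule sum.cong[OF refl])
      fix p assume p: "p \<in> ?I"
      then obtain j l where jl: "p = (j, l)" "j \<in> {1..s}" "l \<in> {1..card (A j)}" by auto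
      have "desc (A j) ! (l - 1) \<in> {1..n}" using mem[OF jl(2,3)] A[OF jl(2)] by blast
      then have "desc (A j) ! (l - 1) - 1 < dim_row (C j)" "dim_col (C j) = m" using C[OF jl(2)] by auto
      then have "?c p $ i = (\<lambda>(j, i) c. C j $$ (i - 1, c)) (?g p) i" using i by (simp add: jl)
      moreover have "a (?c p) = x (?g p)" unfolding a_def inv_into_f_f[OF inj p] ..
      ultimately show "a (?c p) * ?c p $ i = x (?g p) * (\<lambda>(j, i) c. C j $$ (i - 1, c)) (?g p) i" by simp
    qed
    also have "\<dots> = (\<Sum>p\<in>?B. x p * (\<lambda>(j, i) c. C j $$ (i - 1, c)) p i)"
      by (rule sum.reindex_bij_betw[OF gB])
    also have "\<dots> = 0" using z i by blast
    finally show "lincomb a (?c ` ?I) $ i = 0\<^sub>v m $ i" using i by simp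
  next
    show "dim_vec (lincomb a (?c ` ?I)) = dim_vec (0\<^sub>v m :: 'a vec)"
      using lincomb_dim[OF _ carr] fI by simp
  qed
  then have av: "a v = 0" if "v \<in> ?c ` ?I" for v
    using nd that fI unfolding lin_dep_def by (auto simp: module_vec_simps class_ring_simps)
  show "\<forall>p\<in>?B. x p = 0"
  proof
    fix p assume "p \<in> ?B"
    then obtain p' where p': "p' \<in> ?I" "p = ?g p'" using gB unfolding bij_betw_def by blast
    have "a (?c p') = 0" using av p'(1) by blast
    then show "x p = 0" unfolding a_def inv_into_f_f[OF inj p'(1)] p'(2) .
  qed
qed

text \<open>The l-th index of the net condition in coordinate j is taken to be the l-th largest
  element of A j; the sum of the first \<alpha> indices is then \<open>top_sum\<close>.\<close>

lemma indep_rows_digital_net: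
  fixes C :: "nat \<Rightarrow> 'a::{field,finite} mat"
  assumes net: "digital_net t \<alpha> \<beta> n m s C"
    and A: "\<And>j. j \<in> {1..s} \<Longrightarrow> A j \<subseteq> {1..n} \<and> card (A j) \<le> m"
    and sum: "real (\<Sum>j=1..s. top_sum \<alpha> (A j)) \<le> \<beta> * real n - real t"
  shows "indep_rows (\<lambda>(j, i) c. C j $$ (i - 1, c)) m (SIGMA j:{1..s}. A j)"
proof (rule indep_rows_if_lin_indpt_family)
  show "C j \<in> carrier_mat n m" if "j \<in> {1..s}" for j using net that unfolding digital_net_def by blast
  show "A j \<subseteq> {1..n}" if "j \<in> {1..s}" for j using A[OF that] by blast
  let ?\<nu> = "\<lambda>j. card (A j)" and ?i = "\<lambda>j l. desc (A j) ! (l - 1)"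
  have fA: "finite (A j)" if "j \<in> {1..s}" for j using A[OF that] finite_subset[of "A j"] by auto
  have cond: "\<forall>j\<in>{1..s}. ?\<nu> j \<le> m \<and> (\<forall>l\<in>{1..?\<nu> j}. 1 \<le> ?i j l \<and> ?i j l \<le> n) \<and> (\<forall>l\<in>{1..<?\<nu> j}. ?i j (Suc l) < ?i j l)"
  proof (intro ballI conjI)
    fix j assume j: "j \<in> {1..s}"
    show "?\<nu> j \<le> m" using A[OF j] by simp
    fix l
    show "1 \<le> ?i j l" "?i j l \<le> n" if "l \<in> {1..?\<nu> j}"
      using nth_mem[of "l - 1" "desc (A j)"] that fA[OF j] A[OF j] by force+
    show "?i j (Suc l) < ?i j l" if "l \<in> {1..<?\<nu> j}"
      using sorted_wrt_nth_less[OF sorted_wrt_desc, of "l - 1" l "A j"] that by auto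
  qed
  have "(\<Sum>l=1..min (?\<nu> j) \<alpha>. ?i j l) = top_sum \<alpha> (A j)" for j
  proof -
    have "(\<Sum>l=1..min (?\<nu> j) \<alpha>. ?i j l) = (\<Sum>l<min (?\<nu> j) \<alpha>. desc (A j) ! l)"
      by (rule sum.reindex_bij_witness[of _ Suc "\<lambda>l. l - 1"]) auto
    also have "\<dots> = (\<Sum>l<\<alpha>. head_pos (A j) l)"
      by (rule sum.mono_neutral_cong_left) (auto simp: head_pos_def)
    finally show ?thesis unfolding top_sum_eq .
  qed
  then have "real (\<Sum>j=1..s. \<Sum>l=1..min (?\<nu> j) \<alpha>. ?i j l) \<le> \<beta> * real n - real t" using sum by simp
  with cond show "lin_indpt_family m (SIGMA j:{1..s}. {1..card (A j)}) (\<lambda>(j, l). row (C j) (desc (A j) ! (l - 1) - 1))"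
    using net unfolding digital_net_def by (elim conjE allE[of _ ?\<nu>] allE[of _ ?i]) blast
qed

text \<open>Dual elements are grouped by the set v of coordinates in which they have nonzero digits.
  Only \<tau> with v contained in \<open>pos \<tau>\<close> enter the coefficient bound, each with
  the weight of \<open>pos \<tau>\<close>. As \<open>G\<close> increases with the cardinality, that
  of v may be replaced by that of \<open>pos \<tau>\<close>, which gives a summand of the final sum.
  In K, the factors 2^s and (\<delta> + 1)^s count the sets v and the indices \<tau>; 32^s
  q^(s(\<delta>+1)) comes from the Walsh coefficients and the other power of q from the sum over the
  dual net.\<close>

lemma quadrature_error_digital_net:
  fixes \<phi> :: "nat \<Rightarrow> 'a::{field,finite}" and C :: "nat \<Rightarrow> 'a mat" and \<gamma> :: "nat set \<Rightarrow> real"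
  assumes \<delta>: "1 \<le> \<delta>" and bij: "bij_betw \<phi> {0..<CARD('a)} UNIV" "\<phi> 0 = 0"
    and \<gamma>: "\<And>v. v \<subseteq> {1..s} \<Longrightarrow> 0 \<le> \<gamma> v"
    and lam: "0 < lam" "lam \<le> 1" and p: "1 \<le> p" and r: "1 \<le> r" and rr: "1 \<le> rr"
    and f: "smooth_mixed \<delta> s f" and net: "digital_net t (\<delta> + 1) \<beta> n m s C" and \<beta>: "\<beta> \<le> 1"
    and Nf: "N_functional \<delta> lam p r rr \<gamma> s f < \<infinity>"
  defines "q \<equiv> real CARD('a)" and "\<theta> \<equiv> (real \<delta> + lam) / (real \<delta> + 1)" and "T \<equiv> \<beta> * real n - real t"
  defines "\<rho> \<equiv> q powr ((1 - real \<delta> - lam) / (real \<delta> + 1))"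
  defines "G \<equiv> \<lambda>d. q powr (- \<theta> * T) * ((T + 2) ^ (d * (\<delta> + 1) - 1) / (1 - \<rho>) ^ (d * (\<delta> + 1)))"
  defines "K \<equiv> 32 ^ s * q ^ (s * (\<delta> + 1)) * q ^ (s * (\<delta> + 1) + 2 * (\<delta> + 1) * (\<delta> + 1) + 1) * 2 ^ s * (real \<delta> + 1) ^ s
     * (\<Sum>v\<in>Pow {1..s}. 1 + 1 / \<gamma> v)"
  shows "\<bar>I_int s f - Q_qmc \<phi> n m s C f\<bar> \<le> K * enn2real (N_functional \<delta> lam p r rr \<gamma> s f) * (\<Sum>u\<in>Pow {1..s} - {{}}. \<gamma> u * G (card u))"
proof -
  let ?S = "{1..s}" and ?\<alpha> = "\<delta> + 1"
  define NN where "NN = enn2real (N_functional \<delta> lam p r rr \<gamma> s f)"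
  \<comment> \<open>For a vanishing weight \<open>1 / \<gamma> v\<close> is 0, so such a set
    contributes just 1.\<close>
  define K\<gamma> where "K\<gamma> = (\<Sum>v\<in>Pow ?S. 1 + 1 / \<gamma> v)"
  define pos where "pos \<tau> = {j\<in>?S. 0 < \<tau> j}" for \<tau> :: "nat \<Rightarrow> nat"
  obtain \<psi> :: "'a \<Rightarrow> complex" where \<psi>: "additive_character \<psi>"
    using exists_additive_character[where 'a = 'a] by (auto simp: additive_character_def)
  have netD: "1 \<le> n" "1 \<le> m" "1 \<le> s" "0 < \<beta>" "\<beta> \<le> real ?\<alpha> * real m / real n" "real t \<le> \<beta> * real n"
    "\<And>j. j \<in> ?S \<Longrightarrow> C j \<in> carrier_mat n m"
    using net unfolding digital_net_def by auto
  interpret Q: digital_quadrature \<psi> \<phi> n m s C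
    using \<psi> bij netD(7) by (intro digital_quadrature.intro digital_quadrature_axioms.intro)
  have qq: "q = real Q.q" unfolding q_def Q.q_def ..
  have q1: "1 < q" using Q.q_ge_2 unfolding qq by simp
  interpret F: smooth_integrand \<delta> s f lam p r
  proof
    fix \<tau> assume \<tau>: "\<tau> \<in> taylor_index \<delta> s"
    show "hk_variation lam p r (top_set \<delta> s \<tau>) (anchored s (top_set \<delta> s \<tau>) (mixed_deriv s \<tau> f)) < \<infinity>"
      by (rule N_functionalD(1)[OF Nf rr \<tau> \<gamma>]) auto
  qed (use \<delta> f lam p r in auto)
  have NN0: "0 \<le> NN" by (simp add: NN_def)
  have K\<gamma>: "1 + 1 / \<gamma> v \<le> K\<gamma>" if "v \<subseteq> ?S" for v
    unfolding K\<gamma>_def by (rule member_le_sum) (use that \<gamma> in auto)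
  have K\<gamma>0: "0 \<le> K\<gamma>" unfolding K\<gamma>_def using \<gamma> by (intro sum_nonneg) auto
  have V: "F.V \<tau> \<le> K\<gamma> * NN * \<gamma> (pos \<tau>)" if \<tau>: "\<tau> \<in> taylor_index \<delta> s" for \<tau>
  proof -
    have pS: "pos \<tau> \<subseteq> ?S" by (auto simp: pos_def)
    have "F.V \<tau> \<le> (1 + 1 / \<gamma> (pos \<tau>)) * \<gamma> (pos \<tau>) * NN"
      unfolding F.V_def F.D_def NN_def pos_def by (rule N_functionalD(2)[OF Nf rr \<tau> \<gamma>]) auto
    also have "\<dots> \<le> K\<gamma> * \<gamma> (pos \<tau>) * NN"
      by (intro mult_right_mono K\<gamma>[OF pS] \<gamma>[OF pS] NN0)
    finally show ?thesis by (simp only: mult_ac)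
  qed
  have T0: "0 \<le> T" using netD(6) by (simp add: T_def)
  have Tn: "T \<le> real n"
  proof -
    have "\<beta> * real n \<le> 1 * real n" by (rule mult_right_mono[OF \<beta>]) simp
    then show ?thesis unfolding T_def by simp
  qed
  have Tm: "T \<le> real ?\<alpha> * real m"
  proof -
    have "\<beta> * real n \<le> real ?\<alpha> * real m" using netD(1,5) by (simp add: le_divide_eq)
    then show ?thesis unfolding T_def by simp
  qed
  have \<theta>: "1 / real ?\<alpha> < \<theta>" "\<theta> \<le> 1"
  proof -
    have "1 < real \<delta> + lam" using \<delta> lam by linarith
    then show "1 / real ?\<alpha> < \<theta>" unfolding \<theta>_def of_nat_add of_nat_1 by (intro divide_strict_right_mono) auto
    show "\<theta> \<le> 1" unfolding \<theta>_def using lam by (simp add: divide_le_eq)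
  qed
  have \<rho>eq: "\<rho> = q powr (1 / real ?\<alpha> - \<theta>)"
    unfolding \<rho>_def \<theta>_def of_nat_add of_nat_1 diff_divide_distrib[symmetric] by (simp add: diff_diff_eq)
  have \<rho>: "0 < \<rho>" "\<rho> < 1" using q1 \<theta> unfolding \<rho>eq by (auto simp: powr_less_one)
  have G0: "0 \<le> G d" for d unfolding G_def using T0 \<rho> by (intro mult_nonneg_nonneg divide_nonneg_nonneg zero_le_power) auto
  have Gmono: "G d \<le> G d'" if "d \<le> d'" for d d'
  proof -
    have le: "d * ?\<alpha> \<le> d' * ?\<alpha>" using that by (rule mult_right_mono) simp
    have "(T + 2) ^ (d * ?\<alpha> - 1) \<le> (T + 2) ^ (d' * ?\<alpha> - 1)" using le T0 by (intro power_increasing) auto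
    moreover have "(1 - \<rho>) ^ (d' * ?\<alpha>) \<le> (1 - \<rho>) ^ (d * ?\<alpha>)" using le \<rho> by (intro power_decreasing) auto
    ultimately have "(T + 2) ^ (d * ?\<alpha> - 1) / (1 - \<rho>) ^ (d * ?\<alpha>) \<le> (T + 2) ^ (d' * ?\<alpha> - 1) / (1 - \<rho>) ^ (d' * ?\<alpha>)"
      using T0 \<rho> by (intro frac_le) auto
    then show ?thesis unfolding G_def by (intro mult_left_mono) auto
  qed
  define c1 where "c1 = 32 ^ s * q ^ (s * ?\<alpha>)"
  define c0 where "c0 = q ^ (s * ?\<alpha> + 2 * ?\<alpha> * ?\<alpha> + 1)"
  define W where "W v = (\<Sum>\<tau>\<in>{\<tau>\<in>taylor_index \<delta> s. v \<subseteq> pos \<tau>}. F.V \<tau>)" for v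
  define Z where "Z = (\<Sum>u\<in>Pow ?S - {{}}. \<gamma> u * G (card u))"
  have c0: "0 \<le> c0" "0 \<le> c1" using q1 by (auto simp: c0_def c1_def)
  have V0: "0 \<le> F.V \<tau>" for \<tau> by (simp add: F.V_def)
  have W0: "0 \<le> W v" for v unfolding W_def by (intro sum_nonneg V0)
  have c: "continuous_on (cube ?S) f"
    using f unfolding smooth_mixed_def by (elim allE[of _ "[]"]) simp
  have "\<bar>I_int s f - Q_qmc \<phi> n m s C f\<bar> \<le> (\<Sum>v\<in>Pow ?S - {{}}. c1 * W v * (c0 * G (card v)))"
  proof (rule Q.quadrature_error_le[OF F.integrable_f c])
    fix N assume N: "n \<le> N"
    interpret R: net_rows Q.r s n m N ?\<alpha> T
    proof
      fix A assume "\<And>j. j \<in> ?S \<Longrightarrow> A j \<subseteq> {1..n} \<and> card (A j) \<le> m" "real (\<Sum>j=1..s. top_sum ?\<alpha> (A j)) \<le> T"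
      then show "indep_rows Q.r m (SIGMA j:?S. A j)"
        unfolding Q.r_def T_def by (intro indep_rows_digital_net[OF net]) auto
    qed (use T0 Tn Tm N in auto)
    let ?D = "{k\<in>Q.index_set N \<rightarrow>\<^sub>E UNIV. Q.in_dual k \<and> (\<exists>p\<in>Q.index_set N. k p \<noteq> 0)}"
    let ?v = "\<lambda>k. {j\<in>?S. support N k j \<noteq> {}}"
    have fD: "finite ?D" using Q.finite_indices by (rule rev_finite_subset) blast
    have coef: "norm (Q.coef f N k) \<le> c1 * W (?v k) * q powr (- \<theta> * real (\<Sum>j\<in>?v k. top_sum ?\<alpha> (support N k j)))" if k: "k \<in> ?D" for k
    proof -
      have q1': "1 \<le> Q.q" using Q.q_ge_2 by simp
      have "norm (Q.coef f N k) \<le> 32 ^ s * real Q.q ^ (s * Suc \<delta>) * real Q.q powr (- ((real \<delta> + lam) / (real \<delta> + 1)) * real (\<Sum>j=1..s. top_sum (Suc \<delta>) (support N k j)))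
        * (\<Sum>\<tau>\<in>{\<tau>\<in>taylor_index \<delta> s. \<forall>j\<in>?S. support N k j \<noteq> {} \<longrightarrow> 0 < \<tau> j}. F.V \<tau>)"
        unfolding Q.coef_def Q.kernel_def
      proof (rule F.walsh_coefficient_le[OF q1'])
        fix j assume j: "j \<in> ?S"
        show "support N k j \<subseteq> {1..N}" by (auto simp: support_def)
        fix a assume a: "a \<in> support N k j"
        then have nz: "- k (j, a) \<noteq> 0" by (simp add: support_def)
        \<comment> \<open>As d runs through the digits, \<phi> d runs through the field, so a
          nonzero k (j, a) gives a vanishing character sum. This is the condition that the digit
          weights sum to zero.\<close>
        have "(\<Sum>d<Q.q. \<psi> (- k (j, a) * \<phi> d)) = (\<Sum>x\<in>UNIV. \<psi> (- k (j, a) * x))"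
          using sum.reindex_bij_betw[OF bij(1), of "\<lambda>x. \<psi> (- k (j, a) * x)"] by (simp add: Q.q_def lessThan_atLeast0)
        also have "\<dots> = (\<Sum>x\<in>UNIV. \<psi> (x * - k (j, a)))" by (simp only: mult.commute)
        also have "\<dots> = 0" unfolding Q.sum_mult using nz by simp
        finally show "(\<Sum>d<Q.q. \<psi> (- k (j, a) * \<phi> d)) = 0" .
        show "norm (\<psi> (- k (j, a) * \<phi> d)) \<le> 1" for d by (simp only: Q.norm_eq_1 order_refl)
      qed
      also have "(\<Sum>j=1..s. top_sum (Suc \<delta>) (support N k j)) = (\<Sum>j\<in>?v k. top_sum ?\<alpha> (support N k j))"
        by (rule sum.mono_neutral_cong_right) (auto simp: top_sum_def desc_def)
      also have "{\<tau>\<in>taylor_index \<delta> s. \<forall>j\<in>?S. support N k j \<noteq> {} \<longrightarrow> 0 < \<tau> j} = {\<tau>\<in>taylor_index \<delta> s. ?v k \<subseteq> pos \<tau>}"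
        by (auto simp: pos_def)
      finally show ?thesis unfolding c1_def W_def \<theta>_def qq by (simp only: Suc_eq_plus1 mult_ac)
    qed
    have img: "?v ` ?D \<subseteq> Pow ?S - {{}}"
    proof
      fix v assume "v \<in> ?v ` ?D"
      then obtain k where k: "k \<in> ?D" "v = ?v k" by blast
      then obtain j i where "(j, i) \<in> Q.index_set N" "k (j, i) \<noteq> 0" by auto
      then have "j \<in> ?v k" by (auto simp: Q.index_set_def support_def)
      then show "v \<in> Pow ?S - {{}}" using k(2) by blast
    qed
    have "(\<Sum>k\<in>?D. norm (Q.coef f N k)) = (\<Sum>v\<in>Pow ?S - {{}}. \<Sum>k\<in>{k\<in>?D. ?v k = v}. norm (Q.coef f N k))"
      by (rule sum.group[OF fD _ img, symmetric]) simp
    also have "\<dots> \<le> (\<Sum>v\<in>Pow ?S - {{}}. c1 * W v * (c0 * G (card v)))"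
    proof (rule sum_mono)
      fix v assume v: "v \<in> Pow ?S - {{}}"
      have "(\<Sum>k\<in>{k\<in>?D. ?v k = v}. norm (Q.coef f N k)) \<le>
        (\<Sum>k\<in>{k\<in>?D. ?v k = v}. c1 * W v * q powr (- \<theta> * real (\<Sum>j\<in>v. top_sum ?\<alpha> (support N k j))))"
        by (rule sum_mono) (use coef in auto)
      also have "\<dots> = c1 * W v * (\<Sum>k\<in>{k\<in>?D. ?v k = v}. q powr (- \<theta> * real (\<Sum>j\<in>v. top_sum ?\<alpha> (support N k j))))"
        by (rule sum_distrib_left[symmetric])
      also have "\<dots> \<le> c1 * W v * (\<Sum>k\<in>{k\<in>R.dual. \<forall>j\<in>?S. support N k j \<noteq> {} \<longleftrightarrow> j \<in> v}. q powr (- \<theta> * real (\<Sum>j\<in>v. top_sum ?\<alpha> (support N k j))))"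
      proof (intro mult_left_mono sum_mono2)
        show "finite {k\<in>R.dual. \<forall>j\<in>?S. support N k j \<noteq> {} \<longleftrightarrow> j \<in> v}" using R.finite_dual by simp
        show "{k\<in>?D. ?v k = v} \<subseteq> {k\<in>R.dual. \<forall>j\<in>?S. support N k j \<noteq> {} \<longleftrightarrow> j \<in> v}"
          unfolding R.dual_def Q.in_dual_def Q.index_set_def by blast
      qed (use c0 W0 in auto)
      also have "\<dots> \<le> c1 * W v * (c0 * G (card v))"
      proof (intro mult_left_mono)
        show "(\<Sum>k\<in>{k\<in>R.dual. \<forall>j\<in>?S. support N k j \<noteq> {} \<longleftrightarrow> j \<in> v}. q powr (- \<theta> * real (\<Sum>j\<in>v. top_sum ?\<alpha> (support N k j)))) \<le> c0 * G (card v)"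
          unfolding G_def c0_def \<rho>eq q_def
          by (rule R.sum_dual_le) (use v \<theta> Q.q_ge_2 in \<open>auto simp: Q.q_def\<close>)
      qed (use c0 W0 in auto)
      finally show "(\<Sum>k\<in>{k\<in>?D. ?v k = v}. norm (Q.coef f N k)) \<le> c1 * W v * (c0 * G (card v))" .
    qed
    finally show "(\<Sum>k\<in>?D. norm (Q.coef f N k)) \<le> (\<Sum>v\<in>Pow ?S - {{}}. c1 * W v * (c0 * G (card v)))" .
  qed
  also have "\<dots> \<le> (\<Sum>v\<in>Pow ?S - {{}}. c1 * c0 * (real (card (taylor_index \<delta> s)) * (K\<gamma> * NN * Z)))"
  proof (rule sum_mono)
    fix v assume v: "v \<in> Pow ?S - {{}}"
    have "W v * G (card v) = (\<Sum>\<tau>\<in>{\<tau>\<in>taylor_index \<delta> s. v \<subseteq> pos \<tau>}. F.V \<tau> * G (card v))"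
      unfolding W_def by (rule sum_distrib_right)
    also have "\<dots> \<le> (\<Sum>\<tau>\<in>{\<tau>\<in>taylor_index \<delta> s. v \<subseteq> pos \<tau>}. K\<gamma> * NN * Z)"
    proof (rule sum_mono)
      fix \<tau> assume "\<tau> \<in> {\<tau>\<in>taylor_index \<delta> s. v \<subseteq> pos \<tau>}"
      then have \<tau>: "\<tau> \<in> taylor_index \<delta> s" "v \<subseteq> pos \<tau>" by auto
      have pS: "pos \<tau> \<in> Pow ?S - {{}}" using \<tau>(2) v by (auto simp: pos_def)
      have "card v \<le> card (pos \<tau>)" by (rule card_mono[OF _ \<tau>(2)]) (simp add: pos_def)
      then have "F.V \<tau> * G (card v) \<le> (K\<gamma> * NN * \<gamma> (pos \<tau>)) * G (card (pos \<tau>))"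
        using V0 G0 by (intro mult_mono V[OF \<tau>(1)] Gmono) (auto intro!: mult_nonneg_nonneg K\<gamma>0 NN0 \<gamma> simp: pos_def)
      also have "\<dots> = K\<gamma> * NN * (\<gamma> (pos \<tau>) * G (card (pos \<tau>)))" by (rule mult.assoc)
      also have "\<dots> \<le> K\<gamma> * NN * Z"
        unfolding Z_def by (intro mult_left_mono member_le_sum pS mult_nonneg_nonneg K\<gamma>0 NN0) (auto intro!: \<gamma> G0 mult_nonneg_nonneg)
      finally show "F.V \<tau> * G (card v) \<le> K\<gamma> * NN * Z" .
    qed
    also have "\<dots> = real (card {\<tau>\<in>taylor_index \<delta> s. v \<subseteq> pos \<tau>}) * (K\<gamma> * NN * Z)" by simp
    also have "\<dots> \<le> real (card (taylor_index \<delta> s)) * (K\<gamma> * NN * Z)"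
    proof (intro mult_right_mono of_nat_mono card_mono)
      show "finite (taylor_index \<delta> s)" by (rule F.finite_taylor_index)
      show "0 \<le> K\<gamma> * NN * Z" unfolding Z_def by (intro mult_nonneg_nonneg sum_nonneg K\<gamma>0 NN0 G0 \<gamma>) auto
    qed auto
    finally have "c1 * c0 * (W v * G (card v)) \<le> c1 * c0 * (real (card (taylor_index \<delta> s)) * (K\<gamma> * NN * Z))"
      using c0 by (intro mult_left_mono) auto
    then show "c1 * W v * (c0 * G (card v)) \<le> c1 * c0 * (real (card (taylor_index \<delta> s)) * (K\<gamma> * NN * Z))"
      by (simp only: mult_ac)
  qed
  also have "\<dots> = real (card (Pow ?S - {{}})) * (c1 * c0 * (real (card (taylor_index \<delta> s)) * (K\<gamma> * NN * Z)))" by simp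
  also have "\<dots> \<le> 2 ^ s * (c1 * c0 * (real (card (taylor_index \<delta> s)) * (K\<gamma> * NN * Z)))"
  proof (rule mult_right_mono)
    have "card (Pow ?S - {{}}) \<le> card (Pow ?S)" by (rule card_mono) auto
    then have "real (card (Pow ?S - {{}})) \<le> real (card (Pow ?S))" by (rule of_nat_mono)
    then show "real (card (Pow ?S - {{}})) \<le> 2 ^ s" by (simp add: card_Pow)
    show "0 \<le> c1 * c0 * (real (card (taylor_index \<delta> s)) * (K\<gamma> * NN * Z))"
      unfolding Z_def by (intro mult_nonneg_nonneg sum_nonneg K\<gamma>0 NN0 G0 \<gamma> c0) auto
  qed
  also have "real (card (taylor_index \<delta> s)) = (real \<delta> + 1) ^ s"
    unfolding taylor_index_def by (simp add: card_PiE add.commute)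
  also have "2 ^ s * (c1 * c0 * ((real \<delta> + 1) ^ s * (K\<gamma> * NN * Z))) = K * NN * Z"
    unfolding K_def c1_def c0_def K\<gamma>_def by (simp only: mult_ac)
  finally show ?thesis unfolding NN_def Z_def .
qed

text \<open>One estimate serves both ranges of lam. Passing to the floor only weakens q^(-\<theta>
  T), T + 2 is at most T + \<delta> + 1, and both explicit constants contain the geometric factor (1
  - \<rho>)^(-d(\<delta>+1)) as a summand. For lam = 1 one has \<theta> = 1, and the exponent of T +
  \<delta> + 1 is larger by one.\<close>

theorem corollary5p5:
  fixes \<delta> s q :: nat
    and \<phi> :: "nat \<Rightarrow> 'a::{field,finite}"
    and \<gamma> :: "nat set \<Rightarrow> real"
  assumes "1 \<le> \<delta>" and "1 \<le> s"
    and "CARD('a) = q"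
    and "bij_betw \<phi> {0..<q} UNIV" and "\<phi> 0 = 0"
    and "\<And>v. v \<subseteq> {1..} \<Longrightarrow> 0 \<le> \<gamma> v"
  shows "\<exists>K>0. \<forall>(lam::real) (\<pp>::real) (\<qq>::real) (\<rr>::real) (f :: (nat \<Rightarrow> real) \<Rightarrow> real)
           (t::nat) (\<beta>::real) (n::nat) (m::nat) (C :: nat \<Rightarrow> 'a mat).
      0 < lam \<and> lam \<le> 1 \<and> 1 \<le> \<pp> \<and> 1 \<le> \<qq> \<and> 1 \<le> \<rr> \<and>
      smooth_mixed \<delta> s f \<and>
      digital_net t (\<delta> + 1) \<beta> n m s C \<and> \<beta> \<le> 1 \<and>
      N_functional \<delta> lam \<pp> \<qq> \<rr> \<gamma> s f < \<infinity>
      \<longrightarrow>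
      (lam < 1 \<longrightarrow>
        \<bar>I_int s f - Q_qmc \<phi> n m s C f\<bar>
        \<le> real q powr (- (real \<delta> + lam) * of_int \<lfloor>(\<beta> * real n - real t) / (real \<delta> + 1)\<rfloor>)
           * K * enn2real (N_functional \<delta> lam \<pp> \<qq> \<rr> \<gamma> s f)
           * (\<Sum>u\<in>Pow {1..s} - {{}}. \<gamma> u * const_lt1 (card u) q \<delta> lam
                * (\<beta> * real n - real t + real \<delta> + 1) ^ (card u * (\<delta> + 1) - 1))) \<and>
      (lam = 1 \<longrightarrow>
        \<bar>I_int s f - Q_qmc \<phi> n m s C f\<bar>
        \<le> real q powr (- (\<beta> * real n - real t))
           * K * enn2real (N_functional \<delta> lam \<pp> \<qq> \<rr> \<gamma> s f)
           * (\<Sum>u\<in>Pow {1..s} - {{}}. \<gamma> u * const_eq1 (card u) q \<delta>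
                * (\<beta> * real n - real t + real \<delta> + 1) ^ (card u * (\<delta> + 1))))"
proof -
  note \<delta> = assms(1) and q = assms(3) and bij = assms(4) and \<phi>0 = assms(5)
  have \<gamma>: "0 \<le> \<gamma> v" if "v \<subseteq> {1..s}" for v
    by (rule assms(6)) (rule order_trans[OF that], auto)
  have q2: "2 \<le> q"
  proof -
    have "card {0, 1 :: 'a} \<le> CARD('a)" by (rule card_mono) auto
    then show ?thesis unfolding q by simp
  qed
  \<comment> \<open>Free of lam, of the three exponents, of f and of the net, as the order of the
    quantifiers demands.\<close>
  define K where "K = 32 ^ s * real q ^ (s * (\<delta> + 1)) * real q ^ (s * (\<delta> + 1) + 2 * (\<delta> + 1) * (\<delta> + 1) + 1) * 2 ^ s * (real \<delta> + 1) ^ s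
     * (\<Sum>v\<in>Pow {1..s}. 1 + 1 / \<gamma> v)"
  have "0 < (\<Sum>v\<in>Pow {1..s}. 1 + 1 / \<gamma> v)"
  proof (rule sum_pos)
    show "0 < 1 + 1 / \<gamma> v" if "v \<in> Pow {1..s}" for v
    proof -
      have "0 \<le> 1 / \<gamma> v" using \<gamma> that by simp
      then show ?thesis by linarith
    qed
  qed auto
  then have K0: "0 < K" unfolding K_def using q2 by (intro mult_pos_pos zero_less_power) auto
  have main: "(lam < 1 \<longrightarrow>
        \<bar>I_int s f - Q_qmc \<phi> n m s C f\<bar>
        \<le> real q powr (- (real \<delta> + lam) * of_int \<lfloor>(\<beta> * real n - real t) / (real \<delta> + 1)\<rfloor>)
           * K * enn2real (N_functional \<delta> lam \<pp> \<qq> \<rr> \<gamma> s f)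
           * (\<Sum>u\<in>Pow {1..s} - {{}}. \<gamma> u * const_lt1 (card u) q \<delta> lam
                * (\<beta> * real n - real t + real \<delta> + 1) ^ (card u * (\<delta> + 1) - 1))) \<and>
      (lam = 1 \<longrightarrow>
        \<bar>I_int s f - Q_qmc \<phi> n m s C f\<bar>
        \<le> real q powr (- (\<beta> * real n - real t))
           * K * enn2real (N_functional \<delta> lam \<pp> \<qq> \<rr> \<gamma> s f)
           * (\<Sum>u\<in>Pow {1..s} - {{}}. \<gamma> u * const_eq1 (card u) q \<delta>
                * (\<beta> * real n - real t + real \<delta> + 1) ^ (card u * (\<delta> + 1))))"
    if H: "0 < lam" "lam \<le> 1" "1 \<le> \<pp>" "1 \<le> \<qq>" "1 \<le> \<rr>" "smooth_mixed \<delta> s f"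
      "digital_net t (\<delta> + 1) \<beta> n m s C" "\<beta> \<le> 1" "N_functional \<delta> lam \<pp> \<qq> \<rr> \<gamma> s f < \<infinity>"
    for lam \<pp> \<qq> \<rr> :: real and f :: "(nat \<Rightarrow> real) \<Rightarrow> real" and t n m :: nat and \<beta> :: real and C :: "nat \<Rightarrow> 'a mat"
  proof -
    define T where "T = \<beta> * real n - real t"
    define NN where "NN = enn2real (N_functional \<delta> lam \<pp> \<qq> \<rr> \<gamma> s f)"
    define \<rho> where "\<rho> = real q powr ((1 - real \<delta> - lam) / (real \<delta> + 1))"
    define \<theta> where "\<theta> = (real \<delta> + lam) / (real \<delta> + 1)"
    define g where "g d = (T + 2) ^ (d * (\<delta> + 1) - 1) / (1 - \<rho>) ^ (d * (\<delta> + 1))" for d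
    have T0: "0 \<le> T" using H(7) unfolding digital_net_def T_def by auto
    have \<rho>: "0 < \<rho>" "\<rho> < 1" using q2 \<delta> H(1) unfolding \<rho>_def by (auto intro!: powr_less_one divide_neg_pos)
    have NN0: "0 \<le> NN" by (simp add: NN_def)
    have err: "\<bar>I_int s f - Q_qmc \<phi> n m s C f\<bar> \<le> K * NN * (\<Sum>u\<in>Pow {1..s} - {{}}. \<gamma> u * (real q powr (- \<theta> * T) * g (card u)))"
      using quadrature_error_digital_net[OF \<delta> bij[folded q] \<phi>0 \<gamma> H, folded T_def \<theta>_def]
      unfolding q K_def NN_def g_def \<rho>_def by simp
    have g: "g d \<le> c * (T + real \<delta> + 1) ^ e" if c: "1 / (1 - \<rho>) ^ (d * (\<delta> + 1)) \<le> c" and e: "d * (\<delta> + 1) - 1 \<le> e" for d e c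
    proof -
      have D: "0 < 1 / (1 - \<rho>) ^ (d * (\<delta> + 1))" using \<rho> by simp
      have "(T + 2) ^ (d * (\<delta> + 1) - 1) \<le> (T + real \<delta> + 1) ^ (d * (\<delta> + 1) - 1)" using T0 \<delta> by (intro power_mono) auto
      also have "\<dots> \<le> (T + real \<delta> + 1) ^ e" using T0 e by (intro power_increasing) auto
      finally have "1 / (1 - \<rho>) ^ (d * (\<delta> + 1)) * (T + 2) ^ (d * (\<delta> + 1) - 1) \<le> c * (T + real \<delta> + 1) ^ e"
        using T0 less_imp_le[OF less_le_trans[OF D c]] by (intro mult_mono c) auto
      then show ?thesis unfolding g_def by simp
    qed
    \<comment> \<open>Isolates the geometric summand of the explicit constants: the other summand is
      nonnegative and the power of q is at least 1.\<close>
    have qpow: "x \<le> real q ^ d * (y + x)" if "0 \<le> x" "0 \<le> y" for d x y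
    proof -
      have "1 * x \<le> real q ^ d * (y + x)" using q2 that by (intro mult_mono) auto
      then show ?thesis by simp
    qed
    have bound: "\<bar>I_int s f - Q_qmc \<phi> n m s C f\<bar> \<le> P * K * NN * (\<Sum>u\<in>Pow {1..s} - {{}}. \<gamma> u * c (card u) * (T + real \<delta> + 1) ^ e (card u))"
      if P: "real q powr (- \<theta> * T) \<le> P" and c: "\<And>d. 1 / (1 - \<rho>) ^ (d * (\<delta> + 1)) \<le> c d" and e: "\<And>d. d * (\<delta> + 1) - 1 \<le> e d" for P c e
    proof -
      have P0: "0 \<le> P" using order_trans[OF powr_ge_zero P] .
      have "(\<Sum>u\<in>Pow {1..s} - {{}}. \<gamma> u * (real q powr (- \<theta> * T) * g (card u))) \<le> (\<Sum>u\<in>Pow {1..s} - {{}}. \<gamma> u * (P * (c (card u) * (T + real \<delta> + 1) ^ e (card u))))"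
      proof (intro sum_mono mult_left_mono mult_mono P g c e P0)
        show "0 \<le> g (card u)" for u unfolding g_def using T0 \<rho> by (intro divide_nonneg_nonneg zero_le_power) auto
      qed (use \<gamma> in auto)
      also have "\<dots> = P * (\<Sum>u\<in>Pow {1..s} - {{}}. \<gamma> u * c (card u) * (T + real \<delta> + 1) ^ e (card u))"
        unfolding sum_distrib_left by (intro sum.cong refl) (simp only: mult_ac)
      finally have "K * NN * (\<Sum>u\<in>Pow {1..s} - {{}}. \<gamma> u * (real q powr (- \<theta> * T) * g (card u))) \<le>
        K * NN * (P * (\<Sum>u\<in>Pow {1..s} - {{}}. \<gamma> u * c (card u) * (T + real \<delta> + 1) ^ e (card u)))"
        using K0 NN0 by (intro mult_left_mono) auto
      also have "\<dots> = P * K * NN * (\<Sum>u\<in>Pow {1..s} - {{}}. \<gamma> u * c (card u) * (T + real \<delta> + 1) ^ e (card u))"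
        by (simp only: mult_ac)
      finally show ?thesis using err by (rule order_trans[rotated])
    qed
    show ?thesis
      unfolding T_def[symmetric] NN_def[symmetric]
    proof (intro conjI impI)
      assume l: "lam < 1"
      show "\<bar>I_int s f - Q_qmc \<phi> n m s C f\<bar> \<le> real q powr (- (real \<delta> + lam) * of_int \<lfloor>T / (real \<delta> + 1)\<rfloor>) * K * NN
        * (\<Sum>u\<in>Pow {1..s} - {{}}. \<gamma> u * const_lt1 (card u) q \<delta> lam * (T + real \<delta> + 1) ^ (card u * (\<delta> + 1) - 1))"
      proof (rule bound)
        have "of_int \<lfloor>T / (real \<delta> + 1)\<rfloor> \<le> T / (real \<delta> + 1)" by (rule of_int_floor_le)
        then have "(real \<delta> + lam) * of_int \<lfloor>T / (real \<delta> + 1)\<rfloor> \<le> (real \<delta> + lam) * (T / (real \<delta> + 1))"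
          using H(1) by (intro mult_left_mono) auto
        then show "real q powr (- \<theta> * T) \<le> real q powr (- (real \<delta> + lam) * of_int \<lfloor>T / (real \<delta> + 1)\<rfloor>)"
          using q2 unfolding \<theta>_def minus_mult_left[symmetric] by (intro powr_mono) auto
        have "real q powr lam < real q powr 1" using l q2 by (intro powr_less_mono) auto
        then have "0 \<le> 1 / (real q - real q powr lam)" using q2 by simp
        then show "1 / (1 - \<rho>) ^ (d * (\<delta> + 1)) \<le> const_lt1 d q \<delta> lam" for d
          unfolding const_lt1_def \<rho>_def[symmetric] using \<rho> by (intro qpow) auto
      qed simp
    next
      assume l: "lam = 1"
      show "\<bar>I_int s f - Q_qmc \<phi> n m s C f\<bar> \<le> real q powr (- T) * K * NN
        * (\<Sum>u\<in>Pow {1..s} - {{}}. \<gamma> u * const_eq1 (card u) q \<delta> * (T + real \<delta> + 1) ^ (card u * (\<delta> + 1)))"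
      proof (rule bound)
        show "real q powr (- \<theta> * T) \<le> real q powr (- T)" using l unfolding \<theta>_def by (simp add: add_eq_0_iff)
        have "(1 - real \<delta> - lam) / (real \<delta> + 1) = 1 / (real \<delta> + 1) - 1" using l by (simp add: field_simps)
        then have "\<rho> = real q powr (1 / (real \<delta> + 1) - 1)" unfolding \<rho>_def by simp
        then show "1 / (1 - \<rho>) ^ (d * (\<delta> + 1)) \<le> const_eq1 d q \<delta>" for d
          unfolding const_eq1_def using \<rho> by (simp only:) (intro qpow; simp)
      qed simp
    qed
  qed
  show ?thesis
    by (rule exI[of _ K], rule conjI[OF K0], intro allI, rule impI, elim conjE, rule main)
qed

end
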